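(* Let $p$ be a prime, $m\ge 1$ an integer, and $F_0$ a field whose characteristic is either $0$ or $\geq p$; if $\operatorname{char}(F_0)\neq p$, assume that $F_0$ contains a primitive $p$th root of unity $\rho$. Let $\alpha_1,\beta_1,\dots,\alpha_m,\beta_m$ be independent transcendental elements over $F_0$, and let $F$ be either the rational function field $F_0(\alpha_1,\beta_1,\dots,\alpha_m,\beta_m)$ or the field of iterated Laurent series $F_0(\!(\alpha_1^{-1})\!)(\!(\beta_1^{-1})\!)\dots(\!(\alpha_m^{-1})\!)(\!(\beta_m^{-1})\!)$. Let $A=(\alpha_1,\beta_1)_{p,F}\otimes_F\dots\otimes_F(\alpha_m,\beta_m)_{p,F}$ if $\operatorname{char}(F_0)\neq p$, and $A=[\alpha_1,\beta_1)_{p,F}\otimes_F\dots\otimes_F[\alpha_m,\beta_m)_{p,F}$ if $\operatorname{char}(F_0)=p$. Let $f_1,\dots,f_{p^m}$ be the characteristic coefficients of $A$. Then every $F$-subspace $V$ of $A$ satisfying $f_1(v)=\dots=f_{p-1}(v)=0$ for all $v\in V$ has dimension over $F$ at most $\frac{p^{2m}-1}{p-1}$.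
   Context: Symbol algebras of degree $p$ over a field $F$: if $\operatorname{char}(F)\neq p$ and $F$ contains a primitive $p$th root of unity $\rho$, then for $\alpha,\beta\in F^\times$, $(\alpha,\beta)_{p,F}=F\langle x,y : x^p=\alpha,\ y^p=\beta,\ yxy^{-1}=\rho x\rangle$. If $\operatorname{char}(F)=p$, then for $\alpha\in F$ and $\beta\in F^\times$, $[\alpha,\beta)_{p,F}=F\langle x,y : x^p-x=\alpha,\ y^p=\beta,\ yxy^{-1}=x+1\rangle$. These are central simple $F$-algebras of degree $p$. Characteristic coefficients: for a central simple $F$-algebra $A$ of degree $d$, embed $A$ in $A\otimes_F K\cong M_d(K)$ for a splitting field $K$; the (reduced) characteristic polynomial of $v\in A$ has coefficients in $F$ and is written $x^d+f_1(v)x^{d-1}+\dots+f_{d-1}(v)x+f_d(v)$. The maps $f_1,\dots,f_d:A\to F$, homogeneous polynomial forms of degrees $1,\dots,d$ respectively, are the characteristic coefficients of $A$. *)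

theory Defs
  imports
    "HOL-Algebra.Generated_Fields"
    "HOL-Algebra.Product_Groups"
    "HOL-Algebra.QuotRing"
    "HOL-Algebra.Algebraic_Closure_Type"
    "HOL-Library.Poly_Mapping"
    "HOL-Computational_Algebra.Formal_Laurent_Series"
    "Jordan_Normal_Form.Char_Poly"
    "Jordan_Normal_Form.VS_Connect"
begin

text \<open>
  The base field \<open>F\<close> is a type \<open>'f\<close> of class \<^class>\<open>field\<close>; as a structure it is
  \<^const>\<open>class_ring\<close>.  An associative, not necessarily commutative, \<open>F\<close>-algebra is a record of type
  \<open>('f, 'a) module\<close>, which carries both a ring structure and a scalar multiplication.  The locale
  \<^locale>\<open>algebra\<close> of the library is not used, because it demands commutativity.
\<close>

subsection \<open>Algebras by generators and relations\<close>

definition monoid_algebra ::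
    "('g, 'x) monoid_scheme \<Rightarrow> ('f::field, 'g \<Rightarrow>\<^sub>0 'f) module" where
  "monoid_algebra M =
    \<lparr>carrier = {u. Poly_Mapping.keys u \<subseteq> carrier M},
     monoid.mult = (\<lambda>u v. \<Sum>g\<in>Poly_Mapping.keys u. \<Sum>h\<in>Poly_Mapping.keys v.
        Poly_Mapping.single (g \<otimes>\<^bsub>M\<^esub> h) (Poly_Mapping.lookup u g * Poly_Mapping.lookup v h)),
     one = Poly_Mapping.single \<one>\<^bsub>M\<^esub> 1,
     ring.zero = 0,
     add = (+),
     module.smult = (\<lambda>c. Poly_Mapping.map ((*) c))\<rparr>"

definition quotient_algebra ::
    "('f, 'a) module \<Rightarrow> 'a set \<Rightarrow> ('f, 'a set) module" where
  "quotient_algebra A S =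
    ring.extend (A Quot (Idl\<^bsub>A\<^esub> S))
      (module.fields (\<lambda>c U. Idl\<^bsub>A\<^esub> S <+>\<^bsub>A\<^esub> (\<lambda>a. c \<odot>\<^bsub>A\<^esub> a) ` U))"

definition free_algebra :: "('f::field, 'g list \<Rightarrow>\<^sub>0 'f) module" where
  "free_algebra = monoid_algebra \<lparr>carrier = UNIV, monoid.mult = (@), one = []\<rparr>"

subsection \<open>Symbol algebras\<close>

datatype symbol_gen = Gen_x | Gen_y

text \<open>
  In both presentations \<open>y\<close> is invertible, since \<open>y\<^sup>p = \<beta>\<close> with \<open>\<beta> \<noteq> 0\<close>.  The relation prescribing
  \<open>yxy\<inverse>\<close> is therefore written after multiplication by \<open>y\<close> on the right: \<open>yx = \<rho> xy\<close>, respectively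
  \<open>yx = xy + y\<close>.
\<close>

definition symbol_algebra ::
    "nat \<Rightarrow> 'f::field \<Rightarrow> 'f \<Rightarrow> 'f \<Rightarrow> ('f, (symbol_gen list \<Rightarrow>\<^sub>0 'f) set) module" where
  "symbol_algebra p \<rho> \<alpha> \<beta> = quotient_algebra free_algebra
    {Poly_Mapping.single (replicate p Gen_x) 1 - Poly_Mapping.single [] \<alpha>,
     Poly_Mapping.single (replicate p Gen_y) 1 - Poly_Mapping.single [] \<beta>,
     Poly_Mapping.single [Gen_y, Gen_x] 1 - Poly_Mapping.single [Gen_x, Gen_y] \<rho>}"

definition symbol_algebra_char_p ::
    "nat \<Rightarrow> 'f::field \<Rightarrow> 'f \<Rightarrow> ('f, (symbol_gen list \<Rightarrow>\<^sub>0 'f) set) module" where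
  "symbol_algebra_char_p p \<alpha> \<beta> = quotient_algebra free_algebra
    {Poly_Mapping.single (replicate p Gen_x) 1 - Poly_Mapping.single [Gen_x] 1
       - Poly_Mapping.single [] \<alpha>,
     Poly_Mapping.single (replicate p Gen_y) 1 - Poly_Mapping.single [] \<beta>,
     Poly_Mapping.single [Gen_y, Gen_x] 1 - Poly_Mapping.single [Gen_x, Gen_y] 1
       - Poly_Mapping.single [Gen_y] 1}"

subsection \<open>Tensor products of algebras\<close>

text \<open>
  The monoid algebra of the multiplicative monoid of tuples is the free \<open>F\<close>-module on the tuples,
  with the multiplication that the tensor product induces on pure tensors.  The span of the
  multilinearity relators is already an ideal of it, so that dividing by the ideal they generate
  yields the usual tensor product over \<open>F\<close>.
\<close>

definition tensor_family_relators ::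
    "'i set \<Rightarrow> ('i \<Rightarrow> ('f::field, 'a) module) \<Rightarrow> (('i \<Rightarrow> 'a) \<Rightarrow>\<^sub>0 'f) set" where
  "tensor_family_relators I A =
    {Poly_Mapping.single (t(i := a \<oplus>\<^bsub>A i\<^esub> b)) 1
       - Poly_Mapping.single (t(i := a)) 1 - Poly_Mapping.single (t(i := b)) 1 |t i a b.
       t \<in> (\<Pi>\<^sub>E j\<in>I. carrier (A j)) \<and> i \<in> I \<and> a \<in> carrier (A i) \<and> b \<in> carrier (A i)} \<union>
    {Poly_Mapping.single (t(i := c \<odot>\<^bsub>A i\<^esub> a)) 1 - Poly_Mapping.single (t(i := a)) c |t i c a.
       t \<in> (\<Pi>\<^sub>E j\<in>I. carrier (A j)) \<and> i \<in> I \<and> a \<in> carrier (A i)}"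

definition tensor_family ::
    "'i set \<Rightarrow> ('i \<Rightarrow> ('f::field, 'a) module) \<Rightarrow> ('f, (('i \<Rightarrow> 'a) \<Rightarrow>\<^sub>0 'f) set) module" where
  "tensor_family I A =
    quotient_algebra (monoid_algebra (product_group I A)) (tensor_family_relators I A)"

definition tensor_relators ::
    "('f::field, 'a) module \<Rightarrow> ('f, 'b) module \<Rightarrow> ('a \<times> 'b \<Rightarrow>\<^sub>0 'f) set" where
  "tensor_relators A B =
    {Poly_Mapping.single (a \<oplus>\<^bsub>A\<^esub> a', b) 1
       - Poly_Mapping.single (a, b) 1 - Poly_Mapping.single (a', b) 1 |a a' b.
       a \<in> carrier A \<and> a' \<in> carrier A \<and> b \<in> carrier B} \<union>
    {Poly_Mapping.single (a, b \<oplus>\<^bsub>B\<^esub> b') 1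
       - Poly_Mapping.single (a, b) 1 - Poly_Mapping.single (a, b') 1 |a b b'.
       a \<in> carrier A \<and> b \<in> carrier B \<and> b' \<in> carrier B} \<union>
    {Poly_Mapping.single (c \<odot>\<^bsub>A\<^esub> a, b) 1 - Poly_Mapping.single (a, b) c |c a b.
       a \<in> carrier A \<and> b \<in> carrier B} \<union>
    {Poly_Mapping.single (a, c \<odot>\<^bsub>B\<^esub> b) 1 - Poly_Mapping.single (a, b) c |c a b.
       a \<in> carrier A \<and> b \<in> carrier B}"

definition tensor ::
    "('f::field, 'a) module \<Rightarrow> ('f, 'b) module \<Rightarrow> ('f, ('a \<times> 'b \<Rightarrow>\<^sub>0 'f) set) module" where
  "tensor A B = quotient_algebra (monoid_algebra (A \<times>\<times> B)) (tensor_relators A B)"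

definition pure_tensor ::
    "('f::field, 'a) module \<Rightarrow> ('f, 'b) module \<Rightarrow> 'a \<Rightarrow> 'b \<Rightarrow> ('a \<times> 'b \<Rightarrow>\<^sub>0 'f) set" where
  "pure_tensor A B a b =
    (Idl\<^bsub>monoid_algebra (A \<times>\<times> B)\<^esub> tensor_relators A B)
      +>\<^bsub>monoid_algebra (A \<times>\<times> B)\<^esub> Poly_Mapping.single (a, b) 1"

text \<open>The tensor product of \<open>m\<close> symbol algebras; \<open>\<rho>\<close> is irrelevant in characteristic \<open>p\<close>.\<close>

definition symbol_tensor ::
    "nat \<Rightarrow> 'f::field \<Rightarrow> nat \<Rightarrow> (nat \<Rightarrow> 'f) \<Rightarrow> (nat \<Rightarrow> 'f) \<Rightarrow>
      ('f, ((nat \<Rightarrow> (symbol_gen list \<Rightarrow>\<^sub>0 'f) set) \<Rightarrow>\<^sub>0 'f) set) module" where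
  "symbol_tensor p \<rho> m \<alpha> \<beta> = tensor_family {..<m}
    (\<lambda>i. if CHAR('f) = p then symbol_algebra_char_p p (\<alpha> i) (\<beta> i)
         else symbol_algebra p \<rho> (\<alpha> i) (\<beta> i))"

subsection \<open>Characteristic coefficients\<close>

text \<open>
  The splitting field is the algebraic closure \<open>K\<close> of \<open>F\<close>, which splits every central simple
  \<open>F\<close>-algebra; the reduced characteristic polynomial does not depend on the choice of the splitting
  field or of the isomorphism.
\<close>

definition closure_algebra :: "('f::field, 'f alg_closure) module" where
  "closure_algebra =
    \<lparr>carrier = UNIV, monoid.mult = (*), one = 1, ring.zero = 0, add = (+), module.smult = (\<lambda>c x. to_ac c * x)\<rparr>"

text \<open>
  The isomorphisms of \<open>K\<close>-algebras from the scalar extension of \<open>A\<close> to the algebra of \<open>d \<times> d\<close>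
  matrices; the last condition is \<open>K\<close>-linearity.
\<close>

definition splittings ::
    "nat \<Rightarrow> ('f::field, 'a) module \<Rightarrow> (('a \<times> 'f alg_closure \<Rightarrow>\<^sub>0 'f) set \<Rightarrow> 'f alg_closure mat) set"
  where
  "splittings d A =
    {h \<in> ring_iso (tensor A closure_algebra) (ring_mat TYPE('f alg_closure) d ()).
       \<forall>c. h (pure_tensor A closure_algebra \<one>\<^bsub>A\<^esub> c) = c \<cdot>\<^sub>m 1\<^sub>m d}"

definition reduced_char_poly ::
    "nat \<Rightarrow> ('f::field, 'a) module \<Rightarrow> 'a \<Rightarrow> 'f alg_closure poly" where
  "reduced_char_poly d A v =
    char_poly ((SOME h. h \<in> splittings d A) (pure_tensor A closure_algebra v 1))"

definition char_coeff :: "nat \<Rightarrow> ('f::field, 'a) module \<Rightarrow> nat \<Rightarrow> 'a \<Rightarrow> 'f" where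
  "char_coeff d A i v = (THE c. to_ac c = poly.coeff (reduced_char_poly d A v) (d - i))"

subsection \<open>The base fields\<close>

definition primitive_root_of_unity :: "nat \<Rightarrow> 'f::field \<Rightarrow> bool" where
  "primitive_root_of_unity n \<rho> \<longleftrightarrow> \<rho> ^ n = 1 \<and> (\<forall>k\<in>{1..<n}. \<rho> ^ k \<noteq> 1)"

text \<open>\<open>P\<close> is a polynomial over \<open>E\<close> in the variables \<open>I\<close>: it maps exponent vectors to coefficients.\<close>

definition algebraically_independent :: "'f::field set \<Rightarrow> ('i \<Rightarrow> 'f) \<Rightarrow> 'i set \<Rightarrow> bool" where
  "algebraically_independent E z I \<longleftrightarrow>
    (\<forall>P :: ('i \<Rightarrow>\<^sub>0 nat) \<Rightarrow>\<^sub>0 'f.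
      range (Poly_Mapping.lookup P) \<subseteq> E \<and>
      (\<forall>e\<in>Poly_Mapping.keys P. Poly_Mapping.keys e \<subseteq> I) \<and>
      (\<Sum>e\<in>Poly_Mapping.keys P.
        Poly_Mapping.lookup P e * (\<Prod>i\<in>Poly_Mapping.keys e. z i ^ Poly_Mapping.lookup e i)) = 0
      \<longrightarrow> P = 0)"

text \<open>
  Subsets \<open>E\<close> and \<open>L\<close> of the field \<open>'f\<close> with \<open>L = E((t\<inverse>))\<close>: the uniformizer \<^const>\<open>fls_X\<close>
  corresponds to \<open>t\<inverse>\<close>, so elements of \<open>L\<close> have finitely many terms of positive degree in \<open>t\<close>.
\<close>

definition laurent_extension :: "'f::field set \<Rightarrow> 'f set \<Rightarrow> 'f \<Rightarrow> bool" where
  "laurent_extension E L t \<longleftrightarrow>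
    (\<exists>\<psi> \<in> ring_iso ((class_ring :: 'f fls ring)\<lparr>carrier := {f. \<forall>n. fls_nth f n \<in> E}\<rparr>)
                   ((class_ring :: 'f ring)\<lparr>carrier := L\<rparr>).
       (\<forall>c\<in>E. \<psi> (fls_const c) = c) \<and> \<psi> fls_X = inverse t)"

text \<open>
  The whole field \<open>'f\<close> is obtained from \<open>F\<^sub>0\<close> by adjoining the Laurent series in
  \<open>\<alpha>\<^sub>0\<inverse>, \<beta>\<^sub>0\<inverse>, \<alpha>\<^sub>1\<inverse>, \<beta>\<^sub>1\<inverse>, \<dots>\<close>, in this order.
\<close>

definition iterated_laurent_field ::
    "'f::field set \<Rightarrow> nat \<Rightarrow> (nat \<Rightarrow> 'f) \<Rightarrow> (nat \<Rightarrow> 'f) \<Rightarrow> bool" where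
  "iterated_laurent_field F0 m \<alpha> \<beta> \<longleftrightarrow>
    (\<exists>E :: nat \<Rightarrow> 'f set. E 0 = F0 \<and> E (2 * m) = UNIV \<and>
      (\<forall>i<m. laurent_extension (E (2 * i)) (E (2 * i + 1)) (\<alpha> i) \<and>
             laurent_extension (E (2 * i + 1)) (E (2 * i + 2)) (\<beta> i)))"

definition rational_function_field ::
    "'f::field set \<Rightarrow> nat \<Rightarrow> (nat \<Rightarrow> 'f) \<Rightarrow> (nat \<Rightarrow> 'f) \<Rightarrow> bool" where
  "rational_function_field F0 m \<alpha> \<beta> \<longleftrightarrow>
    algebraically_independent F0 (case_sum \<alpha> \<beta>) ({..<m} <+> {..<m}) \<and>
    generate_field (class_ring :: 'f ring) (F0 \<union> \<alpha> ` {..<m} \<union> \<beta> ` {..<m}) = UNIV"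

end

theory Submission
  imports Defs "HOL-Number_Theory.Cong"
begin

text \<open>
  By Newton's identities, the vanishing of \<open>f\<^sub>1, \<dots>, f\<^sub>p\<^sub>-\<^sub>1\<close> on \<open>V\<close> means that \<open>tr (v\<^sup>k) = 0\<close> for
  \<open>1 \<le> k < p\<close> and \<open>v \<in> V\<close>, so that all symmetrized traces of at most \<open>p - 1\<close> elements of \<open>V\<close> vanish.
  Traces are computed in the matrices in which every \<open>x\<^sub>i\<close> is diagonal and every \<open>y\<^sub>i\<close> is a multiple of a
  cyclic shift.  The base field carries a degree valuation \<open>w\<close> for which the degrees \<open>w / p\<close> of the
  monomials in the \<open>x\<^sub>i, y\<^sub>i\<close> are distinct modulo the degrees of scalars; hence every nonzero \<open>v \<in> V\<close>
  has one leading monomial, and \<open>dim V\<close> is at most the number of exponent vectors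
  \<open>S \<subseteq> (\<int>/p)\<^sup>2\<^sup>m\<close> of leading monomials.
  If \<open>\<rho>\<close> is a primitive root of unity, the words with nonzero trace have exponent sum \<open>0\<close>, and \<open>S\<close>
  meets every line in at most one point, because all words with one letter \<open>b\<close> and otherwise
  letters \<open>a\<close> are cyclic rotations of each other.
  In characteristic \<open>p\<close> the leading part of a trace does not depend on the order of the letters, and
  no sum of at most \<open>p - 1\<close> elements of \<open>S\<close> is \<open>-1\<close> in the \<open>x\<close>-coordinates and \<open>0\<close> in the
  \<open>y\<close>-coordinates.  But a set of more than \<open>(p\<^sup>2\<^sup>m - 1) / (p - 1)\<close> elements has all elements among its
  \<open>(p - 1)\<close>-fold sums.
\<close>

section \<open>Sums of elements of a large subset of an elementary abelian group\<close>

text \<open>The hypothesis on the characteristic makes \<open>k\<close> and \<open>k!\<close>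
  invertible for \<open>k < p\<close>: dividing by \<open>k\<close> is needed to pass between
  coefficients and power traces, and \<open>k!\<close> must not vanish because the \<open>k!\<close>
  words of a symmetrized trace all contribute the same leading term. This limits the argument to
  words of fewer than \<open>p\<close> letters. The target \<open>-1\<close> in characteristic
  \<open>p\<close> comes from the conjugates \<open>\<xi> + j\<close> of an Artin-Schreier root:
  their power sums vanish for exponents below \<open>p - 1\<close> and equal \<open>-1\<close> for
  \<open>p - 1\<close>. The claim on sums is proved by the polynomial method. With
  \<open>N = 1 + p + ... + p^(n-1)\<close>, a polynomial of degree \<open>(p - 1) N\<close> that
  vanishes on a group of order \<open>p^n\<close> except at one point cannot vanish at all
  \<open>(p - 1)\<close>-fold sums of \<open>N + 1\<close> elements: repeated divided differences of
  order \<open>N\<close> multiply its top coefficient by the binomials \<open>jN\<close> over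
  \<open>N\<close>, \<open>j < p\<close>, which Lucas shows to be units. This needs the group inside
  a field, and powers of one transcendental element embed it into the base field. Bases, splittings
  and their uniqueness are not given by the presentations and are all read off from the explicit
  matrices.\<close>

lemma lagrange_top:
  fixes T :: "'f::field set"
  assumes "finite T" "card T = Suc N" "j \<le> N"
  shows "(\<Sum>t\<in>T. t ^ j / (\<Prod>s\<in>T-{t}. t - s)) = (if j = N then 1 else 0)"
proof -
  let ?l = "\<lambda>t. (\<Prod>s\<in>T-{t}. t - s)"
  let ?q = "\<lambda>t. (\<Prod>s\<in>T-{t}. [:-s, 1:])"
  \<comment> \<open>\<open>L\<close> is the Lagrange interpolant of \<open>X^j\<close> at the
    \<open>N + 1\<close> nodes \<open>T\<close>. As \<open>j \<le> N\<close> it is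
    \<open>X^j\<close> itself, and the sum in question is its coefficient at
    \<open>X^N\<close>.\<close>
  define L where "L = (\<Sum>t\<in>T. smult (t ^ j / ?l t) (?q t))"
  have dq: "degree (?q t) = N" "coeff (?q t) N = 1" if "t \<in> T" for t
  proof -
    have d: "degree (?q t) = N"
      using assms that by (subst degree_prod_eq_sum_degree) (auto)
    have "lead_coeff (?q t) = 1" by (simp add: lead_coeff_prod)
    then show "degree (?q t) = N" "coeff (?q t) N = 1" using d by auto
  qed
  have "degree L \<le> N" unfolding L_def
    by (rule degree_sum_le) (use assms dq in \<open>auto intro: order.trans[OF degree_smult_le]\<close>)
  moreover have "poly L x = poly (monom 1 j) x" if "x \<in> T" for x
  proof -
    have nz: "?l x \<noteq> 0" using assms by (auto simp: prod_zero_iff)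
    have "poly L x = (\<Sum>t\<in>T. if t = x then x ^ j else 0)"
      unfolding L_def poly_sum
    proof (rule sum.cong)
      fix t assume "t \<in> T"
      show "poly (smult (t ^ j / ?l t) (?q t)) x = (if t = x then x ^ j else 0)"
      proof (cases "t = x")
        case True then show ?thesis using nz by (simp add: poly_prod)
      next
        case False then show ?thesis using assms that by (auto simp: poly_prod prod_zero_iff)
      qed
    qed auto
    then show ?thesis using that assms by (simp add: poly_monom)
  qed
  ultimately have "L = monom 1 j"
    by (intro poly_eqI_degree[where A = T]) (use assms in \<open>auto simp: degree_monom_eq\<close>)
  then have "coeff L N = (if j = N then 1 else 0)" by simp
  moreover have "coeff L N = (\<Sum>t\<in>T. t ^ j / ?l t)"
    unfolding L_def coeff_sum by (rule sum.cong) (auto simp: dq)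
  ultimately show ?thesis by simp
qed

lemma coeff_linear_power:
  fixes a b :: "'a::field"
  assumes "b \<noteq> 0"
  shows "coeff ([:a, b:] ^ n) i = of_nat (n choose i) * b ^ i * a ^ (n - i)"
  using assms by (cases "i \<le> n") (auto simp: coeff_linear_poly_power coeff_eq_0 degree_power_eq binomial_eq_0)

text \<open>One digit of Lucas' theorem: compare coefficients in
  \<open>(1 + X)^(p a + r) = (1 + X^p)^a (1 + X)^r\<close>. Because \<open>r, s < p\<close>, only
  the term \<open>X^(p b)\<close> of the first factor can reach the exponent
  \<open>p b + s\<close>.\<close>

lemma prime_CHAR_of_nat_binomial_Lucas:
  assumes "Factorial_Ring.prime p" "CHAR('f::field) = p" "r < p" "s < p"
  shows "(of_nat ((p * a + r) choose (p * b + s)) :: 'f) = of_nat (a choose b) * of_nat (r choose s)"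
proof -
  let ?X = "[:0, 1::'f:]"
  have X: "[:1, 1::'f:] = 1 + ?X" by (simp add: one_pCons)
  have "[:1, 1::'f:] ^ p = 1 + ?X ^ p"
    unfolding X using assms by (subst freshmans_dream) (auto)
  then have "[:1, 1::'f:] ^ (p * a + r) = (1 + ?X ^ p) ^ a * [:1, 1:] ^ r"
    by (simp add: power_add power_mult)
  also have "(1 + ?X ^ p) ^ a = (\<Sum>k\<le>a. of_nat (a choose k) * monom 1 (p * k))"
    by (subst add.commute, subst binomial_ring) (simp add: monom_altdef power_mult)
  finally have "coeff ([:1, 1::'f:] ^ (p * a + r)) (p * b + s)
     = (\<Sum>k\<le>a. coeff (of_nat (a choose k) * monom 1 (p * k) * [:1, 1:] ^ r) (p * b + s))"
    by (simp add: sum_distrib_right coeff_sum)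
  also have "\<dots> = (\<Sum>k\<le>a. if k = b then of_nat (a choose b) * of_nat (r choose s) else 0)"
  proof (rule sum.cong)
    fix k assume "k \<in> {..a}"
    have "coeff (of_nat (a choose k) * monom 1 (p * k) * [:1, 1:] ^ r) (p * b + s)
       = of_nat (a choose k) * coeff (monom 1 (p * k) * [:1, 1::'f:] ^ r) (p * b + s)"
      by (simp add: of_nat_poly mult.assoc)
    also have "\<dots> = (if k = b then of_nat (a choose b) * of_nat (r choose s) else 0)"
    proof (cases k b rule: linorder_cases)
      case less
      then obtain c where c: "b = k + Suc c" using less_iff_Suc_add by auto
      have "p * b + s - p * k > r" using assms unfolding c by (simp add: algebra_simps)
      then show ?thesis using less by (auto simp: coeff_monom_mult coeff_linear_power binomial_eq_0)
    next
      case greater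
      then obtain c where c: "k = b + Suc c" using less_iff_Suc_add by auto
      have "p * b + s < p * k" using assms unfolding c by (simp add: algebra_simps)
      then show ?thesis using greater by (auto simp: coeff_monom_mult)
    qed (auto simp: coeff_monom_mult coeff_linear_power)
    finally show "coeff (of_nat (a choose k) * monom 1 (p * k) * [:1, 1:] ^ r) (p * b + s) =
       (if k = b then of_nat (a choose b) * of_nat (r choose s) else 0 :: 'f)" .
  qed auto
  also have "\<dots> = of_nat (a choose b) * of_nat (r choose s)"
    by (auto simp: binomial_eq_0)
  finally show ?thesis by (simp add: coeff_linear_power)
qed

text \<open>All base \<open>p\<close> digits of the repunit are \<open>1\<close> and all digits of
  its \<open>j\<close>-fold multiple are \<open>j < p\<close>, so by Lucas the binomial is a power
  of \<open>j\<close> in the field. These are the factors by which divided differences change a top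
  coefficient.\<close>

lemma binomial_repunit_nonzero:
  assumes "Factorial_Ring.prime p" "CHAR('f::field) = p" "0 < j" "j < p"
  shows "(of_nat ((j * (\<Sum>i<n. p ^ i)) choose (\<Sum>i<n. p ^ i)) :: 'f) \<noteq> 0"
proof (induction n)
  case (Suc n)
  have *: "(\<Sum>i<Suc n. p ^ i) = p * (\<Sum>i<n. p ^ i) + 1"
    by (subst sum.lessThan_Suc_shift) (simp add: sum_distrib_left)
  have "p > 1" using assms(1) prime_gt_1_nat by auto
  have "(of_nat ((j * (\<Sum>i<Suc n. p ^ i)) choose (\<Sum>i<Suc n. p ^ i)) :: 'f)
     = of_nat ((j * (\<Sum>i<n. p ^ i)) choose (\<Sum>i<n. p ^ i)) * of_nat (j choose 1)"
    unfolding * using prime_CHAR_of_nat_binomial_Lucas[OF assms(1,2), of j 1 "j * (\<Sum>i<n. p ^ i)" "\<Sum>i<n. p ^ i"] \<open>p > 1\<close> assms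
    by (simp add: algebra_simps)
  moreover have "(of_nat j :: 'f) \<noteq> 0" using assms
    by (auto simp: of_nat_eq_0_iff_char_dvd dest: dvd_imp_le)
  ultimately show ?case using Suc by simp
qed simp

text \<open>Induction on the number \<open>k\<close> of summands. A divided difference over the
  nodes \<open>T\<close> uses up one summand, lowers the degree by \<open>N\<close>, and multiplies
  the top coefficient by a binomial coefficient; after \<open>k\<close> rounds a constant that
  vanishes is left.\<close>

lemma divided_difference_vanish:
  fixes T :: "'f::field set" and q :: "'f poly"
  assumes "finite T" "card T = Suc N"
    and "degree q \<le> k * N"
    and "\<And>ts. length ts = k \<Longrightarrow> set ts \<subseteq> T \<Longrightarrow> poly q (sum_list ts) = 0"
  shows "coeff q (k * N) * (\<Prod>j\<in>{1..k}. of_nat ((j * N) choose N)) = 0"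
  using assms(3,4)
proof (induction k arbitrary: q)
  case 0
  then have "degree q = 0" by simp
  then obtain c where "q = [:c:]" by (rule degree_eq_zeroE)
  moreover have "poly q 0 = 0" using 0(2)[of "[]"] by simp
  ultimately show ?case by simp
next
  case (Suc k)
  define l where "l t = inverse (\<Prod>s\<in>T-{t}. t - s)" for t
  \<comment> \<open>The divided difference of the translates \<open>q(X + t)\<close>, with the
    Lagrange weights \<open>l t\<close>. At a sum of \<open>k\<close> nodes it combines values of
    \<open>q\<close> at sums of \<open>k + 1\<close> nodes, hence vanishes there.\<close>
  define D where "D = (\<Sum>t\<in>T. smult (l t) (q \<circ>\<^sub>p [:t, 1:]))"
  have cD: "coeff D i = (\<Sum>j\<le>degree q. coeff q j * of_nat (j choose i) * (\<Sum>t\<in>T. l t * t ^ (j - i)))" for i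
  proof -
    have "coeff (q \<circ>\<^sub>p [:t, 1:]) i = (\<Sum>j\<le>degree q. coeff q j * of_nat (j choose i) * t ^ (j - i))" for t
    proof -
      have "q \<circ>\<^sub>p [:t, 1:] = (\<Sum>j\<le>degree q. smult (coeff q j) ([:t,1:] ^ j))"
        by (simp add: pcompose_altdef poly_altdef coeff_map_poly degree_map_poly)
      then show ?thesis by (simp only: coeff_sum coeff_smult coeff_linear_power power_one mult.assoc mult_1_left one_neq_zero not_False_eq_True)
    qed
    then have "coeff D i = (\<Sum>t\<in>T. \<Sum>j\<le>degree q. coeff q j * of_nat (j choose i) * (l t * t ^ (j - i)))"
      unfolding D_def by (simp add: coeff_sum sum_distrib_left mult_ac)
    also have "\<dots> = (\<Sum>j\<le>degree q. coeff q j * of_nat (j choose i) * (\<Sum>t\<in>T. l t * t ^ (j - i)))"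
      by (subst sum.swap) (simp add: sum_distrib_left)
    finally show ?thesis .
  qed
  have lt: "(\<Sum>t\<in>T. l t * t ^ i) = (if i = N then 1 else 0)" if "i \<le> N" for i
    using lagrange_top[OF assms(1,2) that] by (simp add: l_def field_simps)
  \<comment> \<open>By \<open>lagrange_top\<close> a nonzero term has \<open>j - i = N\<close>.
    Together with \<open>j \<le> Suc k * N\<close> and \<open>i \<ge> k * N\<close> this forces
    equality in both bounds, so the degree drops by \<open>N\<close> and a single term makes up the
    new top coefficient.\<close>
  have term0: "coeff q j * of_nat (j choose i) * (\<Sum>t\<in>T. l t * t ^ (j - i))
      = (if j = Suc k * N \<and> i = k * N then coeff q (Suc k * N) * of_nat (Suc k * N choose N) else 0)"
    if "j \<le> degree q" "i \<ge> k * N" for i j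
  proof -
    have jb: "j \<le> N + k * N" using Suc.prems(1) that by simp
    have l: "(\<Sum>t\<in>T. l t * t ^ (j - i)) = (if j - i = N then 1 else 0)"
      by (rule lt) (use jb that in linarith)
    show ?thesis
    proof (cases "j = Suc k * N \<and> i = k * N")
      case True
      then show ?thesis using l binomial_symmetric[of "k * N" "N + k * N"] by simp
    next
      case False
      show ?thesis
      proof (cases "i \<le> j")
        case True
        then have "j - i \<noteq> N" using False that jb by auto
        then show ?thesis using False l by (simp only: if_False mult_zero_right)
      next
        case 2: False
        then have "j choose i = 0" by (simp add: binomial_eq_0)
        then show ?thesis using False by (simp only: if_False of_nat_0 mult_zero_right mult_zero_left)
      qed
    qed
  qed
  have "coeff D i = 0" if "i > k * N" for i
    unfolding cD by (rule sum.neutral) (use that in \<open>auto simp: term0\<close>)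
  then have dD: "degree D \<le> k * N" by (intro degree_le) auto
  have "coeff D (k * N) = (\<Sum>j\<le>degree q. if j = Suc k * N then coeff q (Suc k * N) * of_nat (Suc k * N choose N) else 0)"
    unfolding cD by (rule sum.cong) (auto simp: term0)
  also have "\<dots> = coeff q (Suc k * N) * of_nat (Suc k * N choose N)"
    by (auto simp: coeff_eq_0)
  finally have c: "coeff D (k * N) = coeff q (Suc k * N) * of_nat (Suc k * N choose N)" .
  have "poly D (sum_list ts) = 0" if "length ts = k" "set ts \<subseteq> T" for ts
    unfolding D_def poly_sum using Suc.prems(2)[of "_ # ts"] that
    by (auto intro!: sum.neutral simp: poly_pcompose add.commute)
  from Suc.IH[OF dD this] have "coeff D (k * N) * (\<Prod>j\<in>{1..k}. of_nat ((j * N) choose N)) = 0" by auto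
  then show ?case unfolding c by (simp add: mult_ac)
qed

text \<open>The threshold is the repunit \<open>N\<close>, for which
  \<open>(p - 1) * N = p ^ n - 1\<close>. This is exactly the degree of the polynomial that vanishes
  on the group away from \<open>g\<close>, so \<open>N + 1\<close> elements of \<open>T\<close>
  suffice for \<open>p - 1\<close> divided differences.\<close>

theorem sumset_covers_group:
  fixes G T :: "'f::field set"
  assumes p: "Factorial_Ring.prime p" "CHAR('f) = p"
    and G: "finite G" "card G = p ^ n" "0 \<in> G" "\<And>x y. x \<in> G \<Longrightarrow> y \<in> G \<Longrightarrow> x + y \<in> G"
    and T: "T \<subseteq> G" "card T > (p ^ n - 1) div (p - 1)"
    and g: "g \<in> G"
  shows "\<exists>ts. length ts = p - 1 \<and> set ts \<subseteq> T \<and> sum_list ts = g"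
proof (rule ccontr)
  assume neg: "\<not> ?thesis"
  have p1: "p > 1" using p prime_gt_1_nat by auto
  define N where "N = (\<Sum>i<n. p ^ i)"
  have NN: "(p - 1) * N = p ^ n - 1" unfolding N_def
    using power_diff_1_eq[of "int p" n] p1
    by (smt (verit) int_ops(2) int_ops(6) int_ops(7) less_imp_le_nat of_nat_eq_iff of_nat_power of_nat_sum one_le_power sum.cong zle_int)
  have "N = (p ^ n - 1) div (p - 1)" using NN p1
    by (metis nonzero_mult_div_cancel_left zero_less_diff less_numeral_extra(3))
  then have "card T \<ge> Suc N" using T by simp
  then obtain T' where T': "T' \<subseteq> T" "card T' = Suc N" "finite T'"
    by (metis card.infinite obtain_subset_with_card_n finite_subset nat.distinct(1))
  \<comment> \<open>If \<open>g\<close> were missed, every \<open>(p - 1)\<close>-fold sum from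
    \<open>T\<close> would lie in \<open>G - {g}\<close> and be a root of \<open>q\<close>, although
    \<open>q\<close> is monic of degree \<open>(p - 1) * N\<close>.\<close>
  define q where "q = (\<Prod>c\<in>G-{g}. [:-c, 1:])"
  have dq: "degree q = (p - 1) * N" unfolding q_def NN
    using G g by (subst degree_prod_eq_sum_degree) auto
  have lc: "coeff q ((p - 1) * N) = 1"
    unfolding dq[symmetric] by (simp add: q_def lead_coeff_prod)
  have "poly q (sum_list ts) = 0" if "length ts = p - 1" "set ts \<subseteq> T'" for ts
  proof -
    have "set xs \<subseteq> G \<Longrightarrow> sum_list xs \<in> G" for xs by (induction xs) (use G in auto)
    then have "sum_list ts \<in> G" using that T' T by blast
    moreover have "sum_list ts \<noteq> g" using neg that T' by blast
    ultimately show ?thesis using G by (auto simp: q_def poly_prod prod_zero_iff)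
  qed
  from divided_difference_vanish[OF T'(3,2) eq_refl[OF dq] this]
  have "(\<Prod>j\<in>{1..p - 1}. of_nat ((j * N) choose N) :: 'f) = 0" using lc by simp
  then obtain j where "j \<in> {1..p-1}" "(of_nat ((j * N) choose N) :: 'f) = 0" by auto
  then show False using binomial_repunit_nonzero[OF p, of j n] p1 unfolding N_def by (auto simp: le_diff_conv2)
qed

section \<open>Degree valuations of the base fields\<close>

text \<open>A valuation with values in \<open>\<int>[X]\<close>, whose order is the lexicographic one on exponent vectors.
  The sign is that of a degree: \<open>w (x + y) \<le> max (w x) (w y)\<close>.\<close>

definition degree_valuation :: "'f::field set \<Rightarrow> ('f \<Rightarrow> int poly) \<Rightarrow> bool" where
  "degree_valuation E w \<longleftrightarrow>
    (\<forall>x\<in>E. \<forall>y\<in>E. x \<noteq> 0 \<longrightarrow> y \<noteq> 0 \<longrightarrow> w (x * y) = w x + w y) \<and>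
    (\<forall>x\<in>E. \<forall>y\<in>E. x \<noteq> 0 \<longrightarrow> y \<noteq> 0 \<longrightarrow> x + y \<noteq> 0 \<longrightarrow> w (x + y) \<le> max (w x) (w y))"

text \<open>The order of \<open>int poly\<close> looks at the leading coefficient of the difference.
  Since \<open>r\<close> and \<open>s\<close> have no coefficients from \<open>X^k\<close> on, this
  is \<open>b - a\<close> at \<open>X^k\<close>.\<close>

lemma monom_add_less:
  fixes r s :: "int poly"
  assumes "\<And>i. i \<ge> k \<Longrightarrow> coeff r i = 0" "\<And>i. i \<ge> k \<Longrightarrow> coeff s i = 0" "a < b"
  shows "monom a k + r < monom b k + s"
proof -
  let ?d = "monom b k + s - (monom a k + r)"
  have k: "coeff ?d k = b - a" using assms by simp
  have "coeff ?d i = 0" if "i > k" for i using assms that by simp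
  then have "degree ?d = k" using k assms(3) by (intro antisym degree_le le_degree) auto
  then show ?thesis using k assms(3) unfolding less_poly_def pos_poly_def by simp
qed

text \<open>All degrees on \<open>E\<close> stay below \<open>X^k\<close>, so giving the new
  variable \<open>t\<close> degree \<open>X^k\<close> lets it outrank the old ones. Closure of
  \<open>E\<close> under the ring operations is carried along because
  \<open>laurent_extension\<close> speaks only of an isomorphism of structures. The condition
  \<open>w 1 = 0\<close> yields the exact degree of \<open>t\<close>.\<close>

lemma laurent_extension_valuation:
  fixes E L :: "'f::field set"
  assumes ext: "laurent_extension E L t"
    and E: "0 \<in> E" "1 \<in> E" "\<And>x y. x \<in> E \<Longrightarrow> y \<in> E \<Longrightarrow> x + y \<in> E" "\<And>x y. x \<in> E \<Longrightarrow> y \<in> E \<Longrightarrow> x * y \<in> E"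
    and w: "degree_valuation E w" "\<And>x i. x \<in> E \<Longrightarrow> x \<noteq> 0 \<Longrightarrow> i \<ge> k \<Longrightarrow> coeff (w x) i = 0" "w 1 = 0"
  obtains w' where "0 \<in> L" "1 \<in> L" "\<And>x y. x \<in> L \<Longrightarrow> y \<in> L \<Longrightarrow> x + y \<in> L" "\<And>x y. x \<in> L \<Longrightarrow> y \<in> L \<Longrightarrow> x * y \<in> L"
    "degree_valuation L w'" "\<And>x i. x \<in> L \<Longrightarrow> x \<noteq> 0 \<Longrightarrow> i \<ge> Suc k \<Longrightarrow> coeff (w' x) i = 0"
    "E \<subseteq> L" "\<And>x. x \<in> E \<Longrightarrow> x \<noteq> 0 \<Longrightarrow> w' x = w x" "t \<in> L" "t \<noteq> 0" "w' t = monom 1 k"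
proof -
  let ?C = "{f. \<forall>n. fls_nth f n \<in> E}"
  obtain \<psi> where psi: "\<psi> \<in> ring_iso ((class_ring :: 'f fls ring)\<lparr>carrier := ?C\<rparr>) ((class_ring :: 'f ring)\<lparr>carrier := L\<rparr>)"
    and c: "\<And>c. c \<in> E \<Longrightarrow> \<psi> (fls_const c) = c" and X: "\<psi> fls_X = inverse t"
    using ext unfolding laurent_extension_def by blast
  have bij: "bij_betw \<psi> ?C L" using psi by (simp add: ring_iso_def)
  have hom: "\<psi> (f * g) = \<psi> f * \<psi> g" "\<psi> (f + g) = \<psi> f + \<psi> g" if "f \<in> ?C" "g \<in> ?C" for f g
    using psi that ring_hom_mult[of \<psi> "(class_ring :: 'f fls ring)\<lparr>carrier := ?C\<rparr>" "(class_ring :: 'f ring)\<lparr>carrier := L\<rparr>" f g]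
      ring_hom_add[of \<psi> "(class_ring :: 'f fls ring)\<lparr>carrier := ?C\<rparr>" "(class_ring :: 'f ring)\<lparr>carrier := L\<rparr>" f g]
    by (auto simp: ring_iso_def)
  have Esum: "sum h A \<in> E" if "\<And>x. x \<in> A \<Longrightarrow> h x \<in> E" for h :: "int \<Rightarrow> 'f" and A
    using that by (induction A rule: infinite_finite_induct) (auto intro: E)
  have Cmult: "f * g \<in> ?C" if "f \<in> ?C" "g \<in> ?C" for f g
    using that by (auto simp: fls_times_nth(1) intro!: Esum E)
  have Cadd: "f + g \<in> ?C" if "f \<in> ?C" "g \<in> ?C" for f g using that by (auto intro: E)
  have C0: "0 \<in> ?C" using E by auto
  have Cc: "fls_const e \<in> ?C" if "e \<in> E" for e using E that by auto
  have CX: "fls_X \<in> ?C" "fls_X_inv \<in> ?C" using E by auto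
  have psi0: "\<psi> 0 = 0" using c[of 0] E by simp
  have psi1: "\<psi> 1 = 1" using c[of 1] E by simp
  define \<phi> where "\<phi> = inv_into ?C \<psi>"
  have phi: "\<phi> x \<in> ?C" "\<psi> (\<phi> x) = x" if "x \<in> L" for x
    using that bij unfolding \<phi>_def by (auto simp: bij_betw_def inv_into_into f_inv_into_f simp del: mem_Collect_eq)
  have phi': "\<phi> (\<psi> f) = f" if "f \<in> ?C" for f
    unfolding \<phi>_def using that bij by (auto simp: bij_betw_def)
  have psiL: "\<psi> f \<in> L" if "f \<in> ?C" for f using that bij by (auto simp: bij_betw_def)
  have Ladd: "x + y \<in> L" "\<phi> (x + y) = \<phi> x + \<phi> y" if "x \<in> L" "y \<in> L" for x y
    using hom(2)[OF phi(1) phi(1), of x y] phi that psiL[OF Cadd, of "\<phi> x" "\<phi> y"] phi'[OF Cadd, of "\<phi> x" "\<phi> y"] by auto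
  have Lmult: "x * y \<in> L" "\<phi> (x * y) = \<phi> x * \<phi> y" if "x \<in> L" "y \<in> L" for x y
    using hom(1)[OF phi(1) phi(1), of x y] phi that psiL[OF Cmult, of "\<phi> x" "\<phi> y"] phi'[OF Cmult, of "\<phi> x" "\<phi> y"] by auto
  have phi0: "\<phi> x \<noteq> 0" if "x \<in> L" "x \<noteq> 0" for x using phi[OF that(1)] that psi0 by auto
  \<comment> \<open>The lowest term in the uniformizer \<open>fls_X\<close>, which stands for the
    inverse of \<open>t\<close>, is the highest term in \<open>t\<close>: hence the minus sign. The
    degree of its coefficient breaks ties.\<close>
  define v where "v f = monom (- fls_subdegree f) k + w (fls_nth f (fls_subdegree f))" for f
  have lead: "fls_nth f (fls_subdegree f) \<in> E" "fls_nth f (fls_subdegree f) \<noteq> 0" if "f \<in> ?C" "f \<noteq> 0" for f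
    using that by auto
  have cv: "coeff (w (fls_nth f (fls_subdegree f))) i = 0" if "f \<in> ?C" "f \<noteq> 0" "i \<ge> k" for f i
    using lead[OF that(1,2)] w(2) that by auto
  have vmult: "v (f * g) = v f + v g" if "f \<in> ?C" "g \<in> ?C" "f \<noteq> 0" "g \<noteq> 0" for f g
  proof -
    have "fls_subdegree (f * g) = fls_subdegree f + fls_subdegree g" using that by (simp add: fls_subdegree_mult)
    moreover have "fls_nth (f * g) (fls_subdegree f + fls_subdegree g) = fls_nth f (fls_subdegree f) * fls_nth g (fls_subdegree g)"
      by simp
    ultimately show ?thesis unfolding v_def
      using w(1) lead that unfolding degree_valuation_def
      by (simp add: diff_monom[symmetric] minus_monom[symmetric])
  qed
  have vadd: "v (f + g) \<le> max (v f) (v g)" if fg: "f \<in> ?C" "g \<in> ?C" "f \<noteq> 0" "g \<noteq> 0" "f + g \<noteq> 0" for f g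
  proof -
    let ?n = "fls_subdegree (f + g)"
    \<comment> \<open>When the lowest terms of \<open>f\<close> and \<open>g\<close> cancel, the
      subdegree of the sum rises, which strictly lowers the degree whatever the coefficient
      is.\<close>
    have less: "v (f + g) < v h" if "h \<in> {f, g}" "fls_subdegree h < ?n" for h
      unfolding v_def using that fg Cadd[OF fg(1,2)] by (intro monom_add_less cv) auto
    show ?thesis
    proof (cases "fls_subdegree f < ?n \<or> fls_subdegree g < ?n")
      case True then show ?thesis using less by (fastforce simp: le_max_iff_disj)
    next
      case False
      have "min (fls_subdegree f) (fls_subdegree g) \<le> ?n" using fg by (intro fls_plus_subdegree) auto
      then consider "fls_subdegree f = ?n" "fls_subdegree g = ?n" | "fls_subdegree f = ?n" "fls_subdegree g > ?n"
        | "fls_subdegree f > ?n" "fls_subdegree g = ?n" using False by linarith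
      then show ?thesis
      proof cases
        case 1
        have "w (fls_nth f ?n + fls_nth g ?n) \<le> max (w (fls_nth f ?n)) (w (fls_nth g ?n))"
          using w(1) lead fg 1 lead(2)[OF Cadd[OF fg(1,2)] fg(5)] unfolding degree_valuation_def by (metis fls_plus_nth)
        then show ?thesis using 1 by (auto simp: v_def le_max_iff_disj)
      qed (auto simp: v_def)
    qed
  qed
  have tn: "t \<noteq> 0"
  proof
    assume "t = 0"
    then have "\<psi> fls_X = \<psi> 0" using X psi0 by simp
    then have "(fls_X :: 'f fls) = 0" using phi'[OF CX(1)] phi'[OF C0] by simp
    then show False by simp
  qed
  have tX: "\<psi> fls_X_inv = t"
  proof -
    have "\<psi> (fls_X_inv * fls_X) = 1" using psi1 by (simp add: fls_X_inv_times_conv_shift)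
    then have "\<psi> fls_X_inv * inverse t = 1" using hom(1)[OF CX(2,1)] X by simp
    then show ?thesis using tn by (simp add: field_simps)
  qed
  show thesis
  proof (rule that[of "v \<circ> \<phi>"])
    show "0 \<in> L" "1 \<in> L" using psiL[OF C0] psi0 psiL[OF Cc[of 1]] psi1 E by auto
    show "degree_valuation L (v \<circ> \<phi>)"
      unfolding degree_valuation_def
    proof (intro conjI ballI impI)
      fix x y assume xy: "x \<in> L" "y \<in> L" "x \<noteq> 0" "y \<noteq> 0"
      show "(v \<circ> \<phi>) (x * y) = (v \<circ> \<phi>) x + (v \<circ> \<phi>) y"
        using vmult[OF phi(1) phi(1) phi0 phi0] xy Lmult by simp
      show "(v \<circ> \<phi>) (x + y) \<le> max ((v \<circ> \<phi>) x) ((v \<circ> \<phi>) y)" if "x + y \<noteq> 0"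
        using vadd[OF phi(1) phi(1) phi0 phi0] phi0[OF Ladd(1)] xy Ladd that by simp
    qed
    show "coeff ((v \<circ> \<phi>) x) i = 0" if "x \<in> L" "x \<noteq> 0" "i \<ge> Suc k" for x i
      using cv[OF phi(1)[OF that(1)] phi0[OF that(1,2)], of i] that by (simp add: v_def)
    show "E \<subseteq> L" using psiL[OF Cc] c by fastforce
    show "(v \<circ> \<phi>) x = w x" if "x \<in> E" "x \<noteq> 0" for x
    proof -
      have "\<phi> x = fls_const x" using phi'[OF Cc] c that by metis
      then show ?thesis using that by (simp add: v_def)
    qed
    show "t \<in> L" using psiL[OF CX(2)] tX by simp
    show "(v \<circ> \<phi>) t = monom 1 k" using phi'[OF CX(2)] tX w(3) by (simp add: v_def)
  qed (use Ladd Lmult tn in auto)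
qed

lemma subfield_class_ring_closed:
  fixes F0 :: "'f::field set"
  assumes "subfield F0 (class_ring :: 'f ring)"
  shows "0 \<in> F0" "1 \<in> F0" "\<And>x y. x \<in> F0 \<Longrightarrow> y \<in> F0 \<Longrightarrow> x + y \<in> F0"
    "\<And>x y. x \<in> F0 \<Longrightarrow> y \<in> F0 \<Longrightarrow> x * y \<in> F0" "\<And>x. x \<in> F0 \<Longrightarrow> - x \<in> F0"
  using subringE[OF subfieldE(1)[OF assms]] by (auto simp: class_ring_simps)

text \<open>Induction along the tower of \<open>2 * m\<close> Laurent extensions. After
  \<open>k\<close> steps all degrees involve only the powers \<open>X^i\<close> with
  \<open>i < k\<close>, which leaves \<open>X^k\<close> free for the next variable.\<close>

theorem iterated_laurent_valuation:
  fixes F0 :: "'f::field set"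
  assumes F0: "subfield F0 (class_ring :: 'f ring)"
    and L: "iterated_laurent_field F0 m \<alpha> \<beta>"
  obtains w where "degree_valuation (UNIV :: 'f set) w" "\<And>x. x \<in> F0 \<Longrightarrow> x \<noteq> 0 \<Longrightarrow> w x = 0"
    "\<And>i. i < m \<Longrightarrow> \<alpha> i \<noteq> 0 \<and> \<beta> i \<noteq> 0 \<and> w (\<alpha> i) = monom 1 (2 * i) \<and> w (\<beta> i) = monom 1 (2 * i + 1)"
proof -
  obtain E where E: "E 0 = F0" "E (2 * m) = UNIV"
    "\<And>i. i < m \<Longrightarrow> laurent_extension (E (2 * i)) (E (2 * i + 1)) (\<alpha> i)"
    "\<And>i. i < m \<Longrightarrow> laurent_extension (E (2 * i + 1)) (E (2 * i + 2)) (\<beta> i)"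
    using L unfolding iterated_laurent_field_def by blast
  \<comment> \<open>The variables in the order of adjunction: \<open>\<alpha>\<close> at even and
    \<open>\<beta>\<close> at odd positions.\<close>
  define z where "z k = (if even k then \<alpha> (k div 2) else \<beta> (k div 2))" for k
  have ext: "laurent_extension (E k) (E (Suc k)) (z k)" if "k < 2 * m" for k
  proof (cases "even k")
    case True then show ?thesis using E(3)[of "k div 2"] that by (auto simp: z_def elim!: evenE)
  next
    case False then show ?thesis using E(4)[of "k div 2"] that by (auto simp: z_def elim!: oddE)
  qed
  have "\<exists>w. 0 \<in> E k \<and> 1 \<in> E k \<and> (\<forall>x\<in>E k. \<forall>y\<in>E k. x + y \<in> E k \<and> x * y \<in> E k) \<and> degree_valuation (E k) w \<and>
      (\<forall>x\<in>E k. x \<noteq> 0 \<longrightarrow> (\<forall>i\<ge>k. coeff (w x) i = 0)) \<and> F0 \<subseteq> E k \<and> (\<forall>x\<in>F0. x \<noteq> 0 \<longrightarrow> w x = 0) \<and>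
      (\<forall>i<k. z i \<in> E k \<and> z i \<noteq> 0 \<and> w (z i) = monom 1 i)" if "k \<le> 2 * m" for k
    using that
  proof (induction k)
    case 0
    show ?case
      using subfield_class_ring_closed[OF F0]
      by (intro exI[of _ "\<lambda>_. 0"]) (auto simp: E degree_valuation_def)
  next
    case (Suc k)
    then obtain w where w: "0 \<in> E k" "1 \<in> E k" "\<forall>x\<in>E k. \<forall>y\<in>E k. x + y \<in> E k \<and> x * y \<in> E k" "degree_valuation (E k) w"
      "\<forall>x\<in>E k. x \<noteq> 0 \<longrightarrow> (\<forall>i\<ge>k. coeff (w x) i = 0)" "F0 \<subseteq> E k" "\<forall>x\<in>F0. x \<noteq> 0 \<longrightarrow> w x = 0"
      "\<forall>i<k. z i \<in> E k \<and> z i \<noteq> 0 \<and> w (z i) = monom 1 i" by auto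
    have w1: "w 1 = 0" using w(7) subfield_class_ring_closed[OF F0] by auto
    from ext[of k] Suc have lext: "laurent_extension (E k) (E (Suc k)) (z k)" by simp
    obtain w' where w': "0 \<in> E (Suc k)" "1 \<in> E (Suc k)" "\<And>x y. x \<in> E (Suc k) \<Longrightarrow> y \<in> E (Suc k) \<Longrightarrow> x + y \<in> E (Suc k)"
      "\<And>x y. x \<in> E (Suc k) \<Longrightarrow> y \<in> E (Suc k) \<Longrightarrow> x * y \<in> E (Suc k)"
      "degree_valuation (E (Suc k)) w'" "\<And>x i. x \<in> E (Suc k) \<Longrightarrow> x \<noteq> 0 \<Longrightarrow> i \<ge> Suc k \<Longrightarrow> coeff (w' x) i = 0"
      "E k \<subseteq> E (Suc k)" "\<And>x. x \<in> E k \<Longrightarrow> x \<noteq> 0 \<Longrightarrow> w' x = w x" "z k \<in> E (Suc k)" "z k \<noteq> 0" "w' (z k) = monom 1 k"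
      by (rule laurent_extension_valuation[OF lext w(1,2) _ _ w(4) _ w1, of k]) (use w(3,5) in blast)+
    show ?case
      by (intro exI[of _ w']) (use w w' in \<open>auto simp: less_Suc_eq\<close>)
  qed
  from this[OF order_refl] obtain w where w: "degree_valuation (UNIV :: 'f set) w" "\<And>x. x \<in> F0 \<Longrightarrow> x \<noteq> 0 \<Longrightarrow> w x = 0"
    "\<And>i. i < 2 * m \<Longrightarrow> z i \<noteq> 0 \<and> w (z i) = monom 1 i" unfolding E by auto
  have "\<alpha> i \<noteq> 0 \<and> \<beta> i \<noteq> 0 \<and> w (\<alpha> i) = monom 1 (2 * i) \<and> w (\<beta> i) = monom 1 (2 * i + 1)" if "i < m" for i
    using w(3)[of "2 * i"] w(3)[of "2 * i + 1"] that by (auto simp: z_def)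
  then show thesis using that w by blast
qed


section \<open>Polynomials in several variables and degrees on rational function fields\<close>

lemma poly_mapping_sum_singles: "P = (\<Sum>k\<in>Poly_Mapping.keys P. Poly_Mapping.single k (Poly_Mapping.lookup P k))"
  by (rule poly_mapping_eqI) (auto simp: lookup_sum lookup_single when_def in_keys_iff)

lemma poly_mapping_times_singles:
  "P * Q = (\<Sum>k\<in>Poly_Mapping.keys P. \<Sum>l\<in>Poly_Mapping.keys Q. Poly_Mapping.single (k + l) (Poly_Mapping.lookup P k * Poly_Mapping.lookup Q l))"
proof -
  have "P * Q = (\<Sum>k\<in>Poly_Mapping.keys P. Poly_Mapping.single k (Poly_Mapping.lookup P k)) *
      (\<Sum>k\<in>Poly_Mapping.keys Q. Poly_Mapping.single k (Poly_Mapping.lookup Q k))"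
    by (simp only: poly_mapping_sum_singles[symmetric])
  then show ?thesis by (simp only: sum_product mult_single)
qed

text \<open>The sum that occurs in \<open>algebraically_independent\<close>: independence says that
  this ring homomorphism is injective on polynomials over the subfield.\<close>

definition evaluate :: "('i \<Rightarrow> 'f::field) \<Rightarrow> (('i \<Rightarrow>\<^sub>0 nat) \<Rightarrow>\<^sub>0 'f) \<Rightarrow> 'f" where
  "evaluate z P = (\<Sum>e\<in>Poly_Mapping.keys P. Poly_Mapping.lookup P e * (\<Prod>i\<in>Poly_Mapping.keys e. z i ^ Poly_Mapping.lookup e i))"

lemma evaluate_superset:
  assumes "finite A" "Poly_Mapping.keys P \<subseteq> A"
  shows "evaluate z P = (\<Sum>e\<in>A. Poly_Mapping.lookup P e * (\<Prod>i\<in>Poly_Mapping.keys e. z i ^ Poly_Mapping.lookup e i))"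
  unfolding evaluate_def using assms by (intro sum.mono_neutral_left) (auto simp: in_keys_iff)

lemma evaluate_add: "evaluate z (P + Q) = evaluate z P + evaluate z Q"
proof -
  have k: "Poly_Mapping.keys (P + Q) \<subseteq> Poly_Mapping.keys P \<union> Poly_Mapping.keys Q" by (rule Poly_Mapping.keys_add)
  show ?thesis
    by (simp add: evaluate_superset[of "Poly_Mapping.keys P \<union> Poly_Mapping.keys Q"] k lookup_add distrib_right sum.distrib)
qed

lemma evaluate_0 [simp]: "evaluate z 0 = 0"
  by (simp add: evaluate_def)

lemma evaluate_sum: "evaluate z (\<Sum>x\<in>A. f x) = (\<Sum>x\<in>A. evaluate z (f x))"
  by (induction A rule: infinite_finite_induct) (auto simp: evaluate_add)

lemma evaluate_single: "evaluate z (Poly_Mapping.single e c) = c * (\<Prod>i\<in>Poly_Mapping.keys e. z i ^ Poly_Mapping.lookup e i)"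
  by (simp add: evaluate_superset[of "{e}"])

lemma monomial_add:
  fixes z :: "'i \<Rightarrow> 'f::field"
  shows "(\<Prod>i\<in>Poly_Mapping.keys (d + e). z i ^ Poly_Mapping.lookup (d + e) i) = (\<Prod>i\<in>Poly_Mapping.keys d. z i ^ Poly_Mapping.lookup d i) * (\<Prod>i\<in>Poly_Mapping.keys e. z i ^ Poly_Mapping.lookup e i)"
proof -
  have m: "(\<Prod>i\<in>Poly_Mapping.keys d. z i ^ Poly_Mapping.lookup d i) = (\<Prod>i\<in>A. z i ^ Poly_Mapping.lookup d i)" if "finite A" "Poly_Mapping.keys d \<subseteq> A" for A and d :: "'i \<Rightarrow>\<^sub>0 nat"
    using that by (intro prod.mono_neutral_left) (auto simp: in_keys_iff)
  have k: "Poly_Mapping.keys (d + e) \<subseteq> Poly_Mapping.keys d \<union> Poly_Mapping.keys e" by (rule Poly_Mapping.keys_add)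
  show ?thesis
    by (subst (1 2 3) m[of "Poly_Mapping.keys d \<union> Poly_Mapping.keys e"])
       (use k in \<open>auto simp: lookup_add power_add prod.distrib\<close>)
qed

lemma evaluate_mult: "evaluate z (P * Q) = evaluate z P * evaluate z Q"
proof -
  have "evaluate z (P * Q) = (\<Sum>k\<in>Poly_Mapping.keys P. \<Sum>l\<in>Poly_Mapping.keys Q. (Poly_Mapping.lookup P k * (\<Prod>i\<in>Poly_Mapping.keys k. z i ^ Poly_Mapping.lookup k i)) * (Poly_Mapping.lookup Q l * (\<Prod>i\<in>Poly_Mapping.keys l. z i ^ Poly_Mapping.lookup l i)))"
    unfolding poly_mapping_times_singles[of P Q]
    by (simp add: evaluate_sum evaluate_single monomial_add mult_ac)
  also have "\<dots> = evaluate z P * evaluate z Q"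
    by (simp add: evaluate_def sum_product)
  finally show ?thesis .
qed

text \<open>The exponent of variable \<open>i\<close> becomes the coefficient at
  \<open>X^(idx i)\<close>. For injective \<open>idx\<close> the order of \<open>int poly\<close>
  thus turns into a lexicographic monomial order.\<close>

definition exponent_weight :: "('i \<Rightarrow> nat) \<Rightarrow> ('i \<Rightarrow>\<^sub>0 nat) \<Rightarrow> int poly" where
  "exponent_weight idx e = (\<Sum>i\<in>Poly_Mapping.keys e. monom (int (Poly_Mapping.lookup e i)) (idx i))"

lemma exponent_weight_add: "exponent_weight idx (d + e) = exponent_weight idx d + exponent_weight idx e"
proof -
  have m: "exponent_weight idx d = (\<Sum>i\<in>A. monom (int (Poly_Mapping.lookup d i)) (idx i))" if "finite A" "Poly_Mapping.keys d \<subseteq> A" for A d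
    unfolding exponent_weight_def using that by (intro sum.mono_neutral_left) (auto simp: in_keys_iff)
  have k: "Poly_Mapping.keys (d + e) \<subseteq> Poly_Mapping.keys d \<union> Poly_Mapping.keys e" by (rule Poly_Mapping.keys_add)
  show ?thesis
    by (simp add: m[of "Poly_Mapping.keys d \<union> Poly_Mapping.keys e"] k lookup_add add_monom[symmetric] sum.distrib)
qed

lemma coeff_exponent_weight:
  assumes "inj idx"
  shows "coeff (exponent_weight idx e) (idx i) = int (Poly_Mapping.lookup e i)"
proof -
  have "coeff (exponent_weight idx e) (idx i) = (\<Sum>j\<in>Poly_Mapping.keys e. if j = i then int (Poly_Mapping.lookup e i) else 0)"
    unfolding exponent_weight_def coeff_sum
    by (rule sum.cong) (use assms in \<open>auto simp: inj_def\<close>)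
  then show ?thesis by (auto simp: in_keys_iff)
qed

lemma exponent_weight_inj: "inj idx \<Longrightarrow> exponent_weight idx d = exponent_weight idx e \<Longrightarrow> d = e"
  by (rule poly_mapping_eqI) (metis coeff_exponent_weight of_nat_eq_iff)

text \<open>The multidegree of the leading monomial. At \<open>P = 0\<close> it is the maximum of an
  empty set, hence the hypotheses \<open>P \<noteq> 0\<close> below.\<close>

definition max_weight :: "('i \<Rightarrow> nat) \<Rightarrow> (('i \<Rightarrow>\<^sub>0 nat) \<Rightarrow>\<^sub>0 'f::field) \<Rightarrow> int poly" where
  "max_weight idx P = Max (exponent_weight idx ` Poly_Mapping.keys P)"

lemma max_weight_attained:
  assumes "P \<noteq> 0"
  obtains e where "e \<in> Poly_Mapping.keys P" "max_weight idx P = exponent_weight idx e"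
proof -
  have "Poly_Mapping.keys P \<noteq> {}" using assms by (metis poly_mapping_eqI lookup_zero in_keys_iff empty_iff)
  then have "Max (exponent_weight idx ` Poly_Mapping.keys P) \<in> exponent_weight idx ` Poly_Mapping.keys P" by (intro Max_in) auto
  then show thesis using that unfolding max_weight_def by auto
qed

lemma max_weight_ge: "e \<in> Poly_Mapping.keys P \<Longrightarrow> exponent_weight idx e \<le> max_weight idx P"
  unfolding max_weight_def by auto

text \<open>The product of the two leading monomials arises from no other pair of monomials, because
  weights add and distinguish monomials. So its coefficient is a product of nonzero coefficients and
  nothing cancels.\<close>

lemma max_weight_mult:
  fixes P Q :: "('i \<Rightarrow>\<^sub>0 nat) \<Rightarrow>\<^sub>0 'f::field"
  assumes "inj idx" "P \<noteq> 0" "Q \<noteq> 0"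
  shows "P * Q \<noteq> 0" "max_weight idx (P * Q) = max_weight idx P + max_weight idx Q"
proof -
  obtain d where d: "d \<in> Poly_Mapping.keys P" "max_weight idx P = exponent_weight idx d" using assms max_weight_attained by blast
  obtain e where e: "e \<in> Poly_Mapping.keys Q" "max_weight idx Q = exponent_weight idx e" using assms max_weight_attained by blast
  have u: "k = d \<and> l = e" if "k \<in> Poly_Mapping.keys P" "l \<in> Poly_Mapping.keys Q" "k + l = d + e" for k l
  proof -
    have "exponent_weight idx k + exponent_weight idx l = exponent_weight idx d + exponent_weight idx e"
      using that(3) exponent_weight_add by metis
    moreover have "exponent_weight idx k \<le> exponent_weight idx d" "exponent_weight idx l \<le> exponent_weight idx e"
      using max_weight_ge that d e by metis+
    ultimately show ?thesis using exponent_weight_inj[OF assms(1)] by (metis add_le_cancel_left add_le_cancel_right antisym)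
  qed
  have "Poly_Mapping.lookup (P * Q) (d + e) = (\<Sum>k\<in>Poly_Mapping.keys P. \<Sum>l\<in>Poly_Mapping.keys Q. if k = d \<and> l = e then Poly_Mapping.lookup P d * Poly_Mapping.lookup Q e else 0)"
    unfolding poly_mapping_times_singles[of P Q] lookup_sum lookup_single
    by (intro sum.cong refl) (use u in \<open>auto simp: when_def\<close>)
  also have "\<dots> = (\<Sum>k\<in>Poly_Mapping.keys P. if k = d then Poly_Mapping.lookup P d * Poly_Mapping.lookup Q e else 0)"
    using e by (intro sum.cong refl) auto
  also have "\<dots> = Poly_Mapping.lookup P d * Poly_Mapping.lookup Q e" using d by simp
  finally have nz: "Poly_Mapping.lookup (P * Q) (d + e) \<noteq> 0" using d e by (auto simp: in_keys_iff)
  then show ne: "P * Q \<noteq> 0" by auto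
  show "max_weight idx (P * Q) = max_weight idx P + max_weight idx Q"
  proof (rule antisym)
    obtain f where f: "f \<in> Poly_Mapping.keys (P * Q)" "max_weight idx (P * Q) = exponent_weight idx f"
      using ne max_weight_attained by blast
    then obtain k l where "k \<in> Poly_Mapping.keys P" "l \<in> Poly_Mapping.keys Q" "f = k + l" using keys_mult[of P Q] by blast
    then show "max_weight idx (P * Q) \<le> max_weight idx P + max_weight idx Q"
      unfolding f by (simp add: exponent_weight_add add_mono max_weight_ge)
    show "max_weight idx P + max_weight idx Q \<le> max_weight idx (P * Q)"
      using max_weight_ge[of "d + e" "P * Q" idx] nz by (simp add: d e exponent_weight_add in_keys_iff)
  qed
qed

lemma max_weight_add:
  assumes "P + Q \<noteq> 0" "P \<noteq> 0" "Q \<noteq> 0"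
  shows "max_weight idx (P + Q) \<le> max (max_weight idx P) (max_weight idx Q)"
proof -
  obtain f where f: "f \<in> Poly_Mapping.keys (P + Q)" "max_weight idx (P + Q) = exponent_weight idx f"
    using assms max_weight_attained by blast
  then have "f \<in> Poly_Mapping.keys P \<or> f \<in> Poly_Mapping.keys Q" using Poly_Mapping.keys_add[of P Q] by blast
  then show ?thesis unfolding f using max_weight_ge by (metis le_max_iff_disj)
qed

text \<open>The degree of a quotient is the difference of the degrees. Two representations of one
  element give equal polynomials after cross-multiplication, by independence, so additivity of
  \<open>max_weight\<close> makes the value independent of the representation.\<close>

lemma fraction_valuation:
  fixes R :: "(('i \<Rightarrow>\<^sub>0 nat) \<Rightarrow>\<^sub>0 'f::field) set"
  assumes idx: "inj idx"
    and R: "\<And>P Q. P \<in> R \<Longrightarrow> Q \<in> R \<Longrightarrow> P - Q \<in> R" "\<And>P Q. P \<in> R \<Longrightarrow> Q \<in> R \<Longrightarrow> P + Q \<in> R"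
      "\<And>P Q. P \<in> R \<Longrightarrow> Q \<in> R \<Longrightarrow> P * Q \<in> R"
    and indep: "\<And>P. P \<in> R \<Longrightarrow> evaluate z P = 0 \<Longrightarrow> P = 0"
    and F: "\<And>x. \<exists>P\<in>R. \<exists>Q\<in>R. Q \<noteq> 0 \<and> x = evaluate z P / evaluate z Q"
  obtains w where "degree_valuation (UNIV :: 'f set) w"
    "\<And>P Q. P \<in> R \<Longrightarrow> Q \<in> R \<Longrightarrow> P \<noteq> 0 \<Longrightarrow> Q \<noteq> 0 \<Longrightarrow> w (evaluate z P / evaluate z Q) = max_weight idx P - max_weight idx Q"
proof -
  obtain num den where nd: "\<And>x. num x \<in> R \<and> den x \<in> R \<and> den x \<noteq> 0 \<and> x = evaluate z (num x) / evaluate z (den x)"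
    using F by metis
  have ev: "evaluate z P \<noteq> 0" if "P \<in> R" "P \<noteq> 0" for P using indep that by blast
  define w where "w x = max_weight idx (num x) - max_weight idx (den x)" for x
  have w: "w (evaluate z P / evaluate z Q) = max_weight idx P - max_weight idx Q"
    if "P \<in> R" "Q \<in> R" "P \<noteq> 0" "Q \<noteq> 0" for P Q
  proof -
    define x where "x = evaluate z P / evaluate z Q"
    have "x \<noteq> 0" using ev that by (simp add: x_def)
    then have n0: "num x \<noteq> 0" using nd[of x] by (metis div_0 evaluate_0)
    have "evaluate z P / evaluate z Q = evaluate z (num x) / evaluate z (den x)" using nd x_def by metis
    then have "evaluate z (P * den x) = evaluate z (num x * Q)"
      using ev nd that by (simp add: evaluate_mult divide_simps mult.commute)
    moreover have "P * den x = P * den x - num x * Q + num x * Q" by simp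
    ultimately have "evaluate z (P * den x - num x * Q) = 0"
      by (metis add_cancel_left_left evaluate_add)
    then have "P * den x - num x * Q = 0" using nd that R by (intro indep) auto
    then have "max_weight idx (P * den x) = max_weight idx (num x * Q)" by simp
    then have "max_weight idx P + max_weight idx (den x) = max_weight idx (num x) + max_weight idx Q"
      using max_weight_mult(2)[OF idx, of P "den x"] max_weight_mult(2)[OF idx, of "num x" Q] nd[of x] n0 that by metis
    then show ?thesis unfolding w_def x_def[symmetric] by (simp add: algebra_simps)
  qed
  have "degree_valuation UNIV w" unfolding degree_valuation_def
  proof (intro conjI ballI impI)
    fix x y :: 'f assume xy: "x \<noteq> 0" "y \<noteq> 0"
    have n0: "num x \<noteq> 0" if "x \<noteq> 0" for x using nd[of x] that by (metis div_0 evaluate_0)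
    let ?P = "num x" and ?Q = "den x" and ?P' = "num y" and ?Q' = "den y"
    have x: "x = evaluate z ?P / evaluate z ?Q" and y: "y = evaluate z ?P' / evaluate z ?Q'" using nd by auto
    have nz: "?P * ?P' \<noteq> 0" "?Q * ?Q' \<noteq> 0" "?P * ?Q' \<noteq> 0" "?P' * ?Q \<noteq> 0" using max_weight_mult(1)[OF idx] n0 xy nd by auto
    have mul: "x * y = evaluate z (?P * ?P') / evaluate z (?Q * ?Q')" by (subst x, subst y) (simp add: evaluate_mult)
    show "w (x * y) = w x + w y"
      unfolding mul using nz nd n0 xy R by (subst w) (auto simp: w_def max_weight_mult(2)[OF idx])
    assume s: "x + y \<noteq> 0"
    have add: "x + y = evaluate z (?P * ?Q' + ?P' * ?Q) / evaluate z (?Q * ?Q')"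
    proof -
      have e: "evaluate z ?Q \<noteq> 0" "evaluate z ?Q' \<noteq> 0" using ev nd by auto
      have "evaluate z ?P / evaluate z ?Q + evaluate z ?P' / evaluate z ?Q'
          = evaluate z (?P * ?Q' + ?P' * ?Q) / evaluate z (?Q * ?Q')"
        using e by (simp add: evaluate_mult evaluate_add add_frac_eq)
      then show ?thesis using x y by simp
    qed
    then have a0: "?P * ?Q' + ?P' * ?Q \<noteq> 0" using s by auto
    have "max_weight idx (?P * ?Q' + ?P' * ?Q) \<le> max (max_weight idx (?P * ?Q')) (max_weight idx (?P' * ?Q))"
      by (rule max_weight_add[OF a0 nz(3,4)])
    then show "w (x + y) \<le> max (w x) (w y)"
      unfolding add using nz nd n0 xy R a0 by (subst w) (auto simp: w_def max_weight_mult(2)[OF idx] max_def split: if_splits)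
  qed
  then show thesis using that w by blast
qed

text \<open>The lexicographic degree of a quotient of polynomials over \<open>F0\<close>. It takes
  the same values on the variables as in the Laurent series case, so that the rest of the proof
  treats both fields alike.\<close>

theorem rational_function_valuation:
  fixes F0 :: "'f::field set"
  assumes F0: "subfield F0 (class_ring :: 'f ring)"
    and L: "rational_function_field F0 m \<alpha> \<beta>"
  obtains w where "degree_valuation (UNIV :: 'f set) w" "\<And>x. x \<in> F0 \<Longrightarrow> x \<noteq> 0 \<Longrightarrow> w x = 0"
    "\<And>i. i < m \<Longrightarrow> \<alpha> i \<noteq> 0 \<and> \<beta> i \<noteq> 0 \<and> w (\<alpha> i) = monom 1 (2 * i) \<and> w (\<beta> i) = monom 1 (2 * i + 1)"
proof -
  note F0c = subfield_class_ring_closed[OF F0]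
  define I :: "(nat + nat) set" where "I = {..<m} <+> {..<m}"
  define z where "z = case_sum \<alpha> \<beta>"
  define idx :: "nat + nat \<Rightarrow> nat" where "idx = case_sum (\<lambda>i. 2 * i) (\<lambda>i. 2 * i + 1)"
  \<comment> \<open>The polynomials over \<open>F0\<close> in the variables
    \<open>\<alpha> i, \<beta> i\<close> with \<open>i < m\<close>. Restricting \<open>I\<close>
    matters, since independence is given for these variables only.\<close>
  define R :: "((nat + nat \<Rightarrow>\<^sub>0 nat) \<Rightarrow>\<^sub>0 'f) set" where
    "R = {P. (\<forall>e. Poly_Mapping.lookup P e \<in> F0) \<and> (\<forall>e\<in>Poly_Mapping.keys P. Poly_Mapping.keys e \<subseteq> I)}"
  have idx: "inj idx"
  proof (rule injI)
    fix i j assume "idx i = idx j"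
    then show "i = j" by (cases i; cases j) (simp_all add: idx_def, presburger+)
  qed
  have indep: "P = 0" if "P \<in> R" "evaluate z P = 0" for P
    using L that unfolding rational_function_field_def algebraically_independent_def R_def evaluate_def z_def I_def
    by auto
  have F0sum: "sum h A \<in> F0" if "\<And>x. x \<in> A \<Longrightarrow> h x \<in> F0" for h :: "(nat + nat \<Rightarrow>\<^sub>0 nat) \<Rightarrow> 'f" and A
    using that by (induction A rule: infinite_finite_induct) (auto intro: F0c)
  have R: "P - Q \<in> R" "P + Q \<in> R" "P * Q \<in> R" if PQ: "P \<in> R" "Q \<in> R" for P Q
  proof -
    have sub: "a - b \<in> F0" if "a \<in> F0" "b \<in> F0" for a b using F0c(3)[OF that(1) F0c(5)[OF that(2)]] by simp
    have "Poly_Mapping.keys e \<subseteq> I" if "e \<in> Poly_Mapping.keys (P - Q)" for e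
    proof -
      have "e \<in> Poly_Mapping.keys P \<or> e \<in> Poly_Mapping.keys Q" using that by (auto simp: in_keys_iff lookup_minus)
      then show ?thesis using PQ by (auto simp: R_def)
    qed
    then show "P - Q \<in> R" using PQ sub by (auto simp: R_def lookup_minus)
    have "Poly_Mapping.keys e \<subseteq> I" if "e \<in> Poly_Mapping.keys (P + Q)" for e
      using that Poly_Mapping.keys_add[of P Q] PQ unfolding R_def by blast
    then show "P + Q \<in> R" using PQ F0c by (auto simp: R_def lookup_add)
    have "Poly_Mapping.lookup (P * Q) e \<in> F0" for e
      unfolding poly_mapping_times_singles[of P Q] lookup_sum lookup_single when_def
      using PQ by (intro F0sum) (auto simp: R_def intro: F0c)
    moreover have "Poly_Mapping.keys e \<subseteq> I" if e: "e \<in> Poly_Mapping.keys (P * Q)" for e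
    proof -
      obtain k l where kl: "k \<in> Poly_Mapping.keys P" "l \<in> Poly_Mapping.keys Q" "e = k + l" using e keys_mult[of P Q] by blast
      then show ?thesis using Poly_Mapping.keys_add[of k l] PQ unfolding R_def by blast
    qed
    ultimately show "P * Q \<in> R" by (auto simp: R_def)
  qed
  have Rc: "Poly_Mapping.single 0 c \<in> R" if "c \<in> F0" for c using that F0c by (auto simp: R_def lookup_single when_def)
  have Rz: "Poly_Mapping.single (Poly_Mapping.single i 1) 1 \<in> R" if "i \<in> I" for i
    using that F0c by (auto simp: R_def lookup_single when_def)
  have ev1: "evaluate z (Poly_Mapping.single 0 c) = c" for c by (simp add: evaluate_single)
  have evz: "evaluate z (Poly_Mapping.single (Poly_Mapping.single i 1) 1) = z i" for i by (simp add: evaluate_single)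
  let ?fr = "\<lambda>x. \<exists>P\<in>R. \<exists>Q\<in>R. Q \<noteq> 0 \<and> x = evaluate z P / evaluate z Q"
  have oneR: "1 \<in> R" "(1 :: (nat + nat \<Rightarrow>\<^sub>0 nat) \<Rightarrow>\<^sub>0 'f) \<noteq> 0" "evaluate z 1 = 1"
    using Rc[OF F0c(2)] ev1[of 1] by auto
  have ev: "evaluate z P \<noteq> 0" if "P \<in> R" "P \<noteq> 0" for P using indep that by blast
  have frR: "?fr (evaluate z P)" if "P \<in> R" for P
    using that oneR by (intro bexI[of _ P] bexI[of _ 1]) auto
  have gen: "generate_field (class_ring :: 'f ring) (F0 \<union> \<alpha> ` {..<m} \<union> \<beta> ` {..<m}) = UNIV"
    using L unfolding rational_function_field_def by blast
  \<comment> \<open>The quotients of values of \<open>R\<close> contain the generators and are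
    closed under the field operations, so they exhaust the generated field.\<close>
  have F: "?fr x" for x
  proof -
    have "x \<in> generate_field (class_ring :: 'f ring) (F0 \<union> \<alpha> ` {..<m} \<union> \<beta> ` {..<m})" using gen by simp
    then show ?thesis
    proof induction
      case one
      then show ?case using frR[OF oneR(1)] by (simp only: oneR(3) class_ring_simps)
    next
      case (incl h)
      then consider "h \<in> F0" | i where "i < m" "h = \<alpha> i" | i where "i < m" "h = \<beta> i" by auto
      then show ?case
      proof cases
        case 1 then show ?thesis using frR[OF Rc] ev1 by metis
      next
        case 2 then have "?fr (z (Inl i))" using frR[OF Rz[of "Inl i"]] unfolding evz by (simp add: I_def InlI InrI)
          then show ?thesis using 2(2) by (simp only: z_def sum.case)
      next
        case 3 then have "?fr (z (Inr i))" using frR[OF Rz[of "Inr i"]] unfolding evz by (simp add: I_def InlI InrI)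
          then show ?thesis using 3(2) by (simp only: z_def sum.case)
      qed
    next
      case (a_inv h)
      then obtain P Q where PQ: "P \<in> R" "Q \<in> R" "Q \<noteq> 0" "h = evaluate z P / evaluate z Q" by blast
      \<comment> \<open>This is \<open>- P\<close>, obtained from closure of \<open>R\<close> under
        differences.\<close>
      have "P - P - P \<in> R" by (rule R(1)[OF R(1)[OF PQ(1,1)] PQ(1)])
      moreover have "evaluate z (P - P - P) = - evaluate z P"
        using evaluate_add[of z "P - P - P" P] by (simp add: eq_neg_iff_add_eq_0)
      ultimately show ?case using PQ by (intro bexI[of _ "P - P - P"] bexI[of _ Q]) (auto simp: class_ring_simps)
    next
      case (m_inv h)
      then obtain P Q where PQ: "P \<in> R" "Q \<in> R" "Q \<noteq> 0" "h = evaluate z P / evaluate z Q" by blast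
      then have "P \<noteq> 0" using m_inv by auto
      then show ?case using PQ m_inv by (intro bexI[of _ Q] bexI[of _ P]) (auto simp: class_ring_simps)
    next
      case (eng_add h1 h2)
      then obtain P Q P' Q' where PQ: "P \<in> R" "Q \<in> R" "Q \<noteq> 0" "h1 = evaluate z P / evaluate z Q"
        "P' \<in> R" "Q' \<in> R" "Q' \<noteq> 0" "h2 = evaluate z P' / evaluate z Q'" by blast
      have "h1 + h2 = evaluate z (P * Q' + P' * Q) / evaluate z (Q * Q')"
        using ev PQ by (simp add: evaluate_mult evaluate_add add_frac_eq)
      moreover have "P * Q' + P' * Q \<in> R" "Q * Q' \<in> R" "Q * Q' \<noteq> 0" using R PQ max_weight_mult(1)[OF idx PQ(3,7)] by auto
      ultimately show ?case unfolding class_ring_simps by blast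
    next
      case (eng_mult h1 h2)
      then obtain P Q P' Q' where PQ: "P \<in> R" "Q \<in> R" "Q \<noteq> 0" "h1 = evaluate z P / evaluate z Q"
        "P' \<in> R" "Q' \<in> R" "Q' \<noteq> 0" "h2 = evaluate z P' / evaluate z Q'" by blast
      have "h1 * h2 = evaluate z (P * P') / evaluate z (Q * Q')"
        using PQ by (simp add: evaluate_mult)
      moreover have "P * P' \<in> R" "Q * Q' \<in> R" "Q * Q' \<noteq> 0" using R PQ max_weight_mult(1)[OF idx PQ(3,7)] by auto
      ultimately show ?case unfolding class_ring_simps by blast
    qed
  qed
  obtain w where w: "degree_valuation (UNIV :: 'f set) w"
    "\<And>P Q. P \<in> R \<Longrightarrow> Q \<in> R \<Longrightarrow> P \<noteq> 0 \<Longrightarrow> Q \<noteq> 0 \<Longrightarrow> w (evaluate z P / evaluate z Q) = max_weight idx P - max_weight idx Q"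
    by (rule fraction_valuation[OF idx R indep F]) blast+
  have wR: "w (evaluate z P) = max_weight idx P" if "P \<in> R" "P \<noteq> 0" for P
    using w(2)[OF that(1) oneR(1) that(2) oneR(2)] by (simp add: oneR max_weight_def exponent_weight_def)
  have w0: "w x = 0" if "x \<in> F0" "x \<noteq> 0" for x
  proof -
    have "Poly_Mapping.single 0 x \<noteq> (0 :: (nat + nat \<Rightarrow>\<^sub>0 nat) \<Rightarrow>\<^sub>0 'f)"
      using that by (metis lookup_single_eq lookup_zero)
    from wR[OF Rc[OF that(1)] this] show ?thesis using that by (simp add: ev1 max_weight_def exponent_weight_def)
  qed
  have wz: "z i \<noteq> 0 \<and> w (z i) = monom 1 (idx i)" if "i \<in> I" for i
  proof -
    have nz: "Poly_Mapping.single (Poly_Mapping.single i 1) (1 :: 'f) \<noteq> (0 :: (nat + nat \<Rightarrow>\<^sub>0 nat) \<Rightarrow>\<^sub>0 'f)"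
      by (metis keys_single Poly_Mapping.keys_zero insert_not_empty one_neq_zero)
    show ?thesis using wR[OF Rz[OF that] nz] ev[OF Rz[OF that] nz]
      unfolding evz by (simp add: max_weight_def exponent_weight_def)
  qed
  have "\<alpha> i \<noteq> 0 \<and> \<beta> i \<noteq> 0 \<and> w (\<alpha> i) = monom 1 (2 * i) \<and> w (\<beta> i) = monom 1 (2 * i + 1)" if "i < m" for i
    using wz[of "Inl i"] wz[of "Inr i"] that by (auto simp: z_def idx_def I_def)
  then show thesis using that w(1) w0 by blast
qed

section \<open>Kronecker products of cyclic shifts\<close>

text \<open>Matrices are indexed by natural numbers, so an index \<open>r < p ^ m\<close> encodes a
  vector in \<open>{0..<p}^m\<close> by its base \<open>p\<close> digits, the lowest digit first.
  Exponent vectors are encoded in the same way.\<close>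

definition dig :: "nat \<Rightarrow> nat \<Rightarrow> nat \<Rightarrow> nat" where
  "dig p i r = r div p ^ i mod p"

lemma dig_0: "dig p 0 r = r mod p"
  by (simp add: dig_def)

lemma dig_Suc: "dig p (Suc i) r = dig p i (r div p)"
  by (simp add: dig_def div_mult2_eq)

lemma dig_less: "p > 0 \<Longrightarrow> dig p i r < p"
  by (simp add: dig_def)

lemma dig_0_right [simp]: "dig p i 0 = 0"
  by (simp add: dig_def)

lemma sum_blocks: "(\<Sum>r<A * p. h r) = (\<Sum>i<A. \<Sum>j<p. h (i * p + j :: nat))"
proof -
  have "(\<Sum>j<p. h (i * p + j)) = sum h {i * p..<i * p + p}" for i
    using sum.shift_bounds_nat_ivl[of h 0 "i * p" p] by (simp add: atLeast0LessThan add.commute)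
  then show ?thesis using sum.nat_group[of h p A] by simp
qed

text \<open>The distributive law: \<open>r\<close> runs once through all digit vectors. It gives
  both the multiplicativity of Kronecker products and the formula for their traces.\<close>

lemma sum_prod_digits:
  fixes g :: "nat \<Rightarrow> nat \<Rightarrow> 'a::comm_semiring_1"
  assumes "p > 0"
  shows "(\<Sum>r<p ^ m. \<Prod>i<m. g i (dig p i r)) = (\<Prod>i<m. \<Sum>j<p. g i j)"
proof (induction m arbitrary: g)
  case (Suc m)
  have "(\<Sum>r<p ^ Suc m. \<Prod>i<Suc m. g i (dig p i r)) = (\<Sum>r<p ^ m * p. g 0 (dig p 0 r) * (\<Prod>i<m. g (Suc i) (dig p (Suc i) r)))"
    by (simp add: prod.lessThan_Suc_shift mult.commute del: prod.lessThan_Suc)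
  also have "\<dots> = (\<Sum>r<p ^ m. \<Sum>j<p. g 0 j * (\<Prod>i<m. g (Suc i) (dig p i r)))"
    unfolding sum_blocks using assms by (intro sum.cong) (auto simp: dig_0 dig_Suc)
  also have "\<dots> = (\<Sum>j<p. g 0 j) * (\<Sum>r<p ^ m. \<Prod>i<m. g (Suc i) (dig p i r))"
    by (subst sum_product, subst sum.swap) simp
  also have "\<dots> = (\<Prod>i<Suc m. \<Sum>j<p. g i j)"
    unfolding Suc[of "\<lambda>i. g (Suc i)"] by (simp add: prod.lessThan_Suc_shift del: prod.lessThan_Suc)
  finally show ?case .
qed simp

lemma digits_eqI:
  assumes "p > 0" "r < p ^ m" "s < p ^ m" "\<And>i. i < m \<Longrightarrow> dig p i r = dig p i s"
  shows "r = s"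
  using assms(2-)
proof (induction m arbitrary: r s)
  case (Suc m)
  have "r div p = s div p"
  proof (rule Suc.IH)
    show "r div p < p ^ m" "s div p < p ^ m"
      using Suc.prems assms(1) by (auto simp: less_mult_imp_div_less mult.commute)
    show "dig p i (r div p) = dig p i (s div p)" if "i < m" for i
      using Suc.prems(3)[of "Suc i"] that by (simp add: dig_Suc)
  qed
  moreover have "r mod p = s mod p" using Suc.prems(3)[of 0] by (simp add: dig_0)
  ultimately show ?case by (metis div_mult_mod_eq)
qed simp

lemma digits_exist:
  assumes "\<And>i. i < m \<Longrightarrow> f i < p"
  obtains r where "r < p ^ m" "\<And>i. i < m \<Longrightarrow> dig p i r = f i"
proof -
  have "\<exists>r<p ^ m. \<forall>i<m. dig p i r = f i" using assms
  proof (induction m arbitrary: f)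
    case (Suc m)
    obtain r where r: "r < p ^ m" "\<forall>i<m. dig p i r = f (Suc i)" using Suc.IH[of "\<lambda>i. f (Suc i)"] Suc.prems by auto
    have f0: "f 0 < p" using Suc.prems by auto
    have "r * p + f 0 < (r + 1) * p" using f0 by simp
    also have "\<dots> \<le> p ^ m * p" using r by (intro mult_right_mono) auto
    finally have "r * p + f 0 < p ^ Suc m" by (simp add: mult.commute)
    moreover have "dig p i (r * p + f 0) = f i" if "i < Suc m" for i
      using that r f0 by (cases i) (auto simp: dig_0 dig_Suc)
    ultimately show ?case by blast
  qed simp
  then show thesis using that by blast
qed

section \<open>Traces, products of lists of matrices, Kronecker products\<close>

definition mat_trace :: "'a::comm_ring_1 mat \<Rightarrow> 'a" where
  "mat_trace A = (\<Sum>i<dim_row A. A $$ (i, i))"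

lemma mat_trace_comm:
  assumes "A \<in> carrier_mat n n" "B \<in> carrier_mat n n"
  shows "mat_trace (A * B) = mat_trace (B * A)"
proof -
  have "mat_trace (A * B) = (\<Sum>i<n. \<Sum>j<n. A $$ (i, j) * B $$ (j, i))"
    using assms by (auto simp: mat_trace_def scalar_prod_def atLeast0LessThan intro!: sum.cong)
  also have "\<dots> = (\<Sum>j<n. \<Sum>i<n. B $$ (j, i) * A $$ (i, j))"
    by (subst sum.swap) (simp add: mult.commute)
  also have "\<dots> = mat_trace (B * A)"
    using assms by (auto simp: mat_trace_def scalar_prod_def atLeast0LessThan intro!: sum.cong)
  finally show ?thesis .
qed

definition mat_list_prod :: "nat \<Rightarrow> 'a::comm_ring_1 mat list \<Rightarrow> 'a mat" where
  "mat_list_prod n Ms = foldr (*) Ms (1\<^sub>m n)"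

lemma mat_list_prod_simps [simp]:
  "mat_list_prod n [] = 1\<^sub>m n" "mat_list_prod n (M # Ms) = M * mat_list_prod n Ms"
  by (simp_all add: mat_list_prod_def)

lemma mat_list_prod_carrier: "set Ms \<subseteq> carrier_mat n n \<Longrightarrow> mat_list_prod n Ms \<in> carrier_mat n n"
  by (induction Ms) auto

lemma mat_list_prod_append:
  "set Ms \<subseteq> carrier_mat n n \<Longrightarrow> set Ns \<subseteq> carrier_mat n n \<Longrightarrow>
    mat_list_prod n (Ms @ Ns) = mat_list_prod n Ms * mat_list_prod n Ns"
  by (induction Ms) (auto simp: mat_list_prod_carrier assoc_mult_mat[of _ n n _ n _ n] left_mult_one_mat[OF mat_list_prod_carrier])

lemma mat_list_prod_replicate: "A \<in> carrier_mat n n \<Longrightarrow> mat_list_prod n (replicate k A) = A ^\<^sub>m k"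
proof (induction k)
  case (Suc k)
  have "mat_list_prod n (replicate k A @ [A]) = mat_list_prod n (replicate k A) * A"
    using Suc by (subst mat_list_prod_append) auto
  then show ?case using Suc by (simp add: replicate_append_same[symmetric] del: replicate_append_same)
qed auto

text \<open>The \<open>m\<close>-fold Kronecker product, formed at once: factor \<open>i\<close>
  sees the \<open>i\<close>-th digits of the row and column indices.\<close>

definition kron :: "nat \<Rightarrow> nat \<Rightarrow> (nat \<Rightarrow> 'a::comm_ring_1 mat) \<Rightarrow> 'a mat" where
  "kron p m g = mat (p ^ m) (p ^ m) (\<lambda>(r, s). \<Prod>i<m. g i $$ (dig p i r, dig p i s))"

lemma kron_carrier [simp]: "kron p m g \<in> carrier_mat (p ^ m) (p ^ m)"
  by (simp add: kron_def)

lemma kron_cong: "(\<And>i. i < m \<Longrightarrow> g i = h i) \<Longrightarrow> kron p m g = kron p m h"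
  by (auto simp: kron_def)

lemma kron_mult:
  assumes "p > 0" "\<And>i. i < m \<Longrightarrow> g i \<in> carrier_mat p p" "\<And>i. i < m \<Longrightarrow> h i \<in> carrier_mat p p"
  shows "kron p m g * kron p m h = kron p m (\<lambda>i. g i * h i)"
proof (rule eq_matI)
  fix r s assume rs: "r < dim_row (kron p m (\<lambda>i. g i * h i))" "s < dim_col (kron p m (\<lambda>i. g i * h i))"
  have "(kron p m g * kron p m h) $$ (r, s) = (\<Sum>k<p ^ m. \<Prod>i<m. g i $$ (dig p i r, dig p i k) * h i $$ (dig p i k, dig p i s))"
    using rs by (simp add: kron_def scalar_prod_def prod.distrib atLeast0LessThan)
  also have "\<dots> = (\<Prod>i<m. \<Sum>j<p. g i $$ (dig p i r, j) * h i $$ (j, dig p i s))"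
    by (rule sum_prod_digits[OF assms(1)])
  also have "\<dots> = kron p m (\<lambda>i. g i * h i) $$ (r, s)"
  proof -
    have "(\<Sum>j<p. g i $$ (dig p i r, j) * h i $$ (j, dig p i s)) = (g i * h i) $$ (dig p i r, dig p i s)" if "i < m" for i
      using assms(2,3)[OF that] dig_less[OF assms(1)] by (auto simp: scalar_prod_def atLeast0LessThan)
    then show ?thesis using rs by (simp add: kron_def)
  qed
  finally show "(kron p m g * kron p m h) $$ (r, s) = kron p m (\<lambda>i. g i * h i) $$ (r, s)" .
qed (auto simp: kron_def)

lemma kron_one:
  assumes "p > 0" shows "kron p m (\<lambda>_. 1\<^sub>m p) = 1\<^sub>m (p ^ m)"
proof (rule eq_matI)
  fix r s assume "r < dim_row (1\<^sub>m (p ^ m) :: 'a mat)" "s < dim_col (1\<^sub>m (p ^ m) :: 'a mat)"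
  then have rs: "r < p ^ m" "s < p ^ m" by auto
  show "kron p m (\<lambda>_. 1\<^sub>m p) $$ (r, s) = (1\<^sub>m (p ^ m) :: 'a mat) $$ (r, s)"
  proof (cases "r = s")
    case True then show ?thesis using rs dig_less[OF assms] by (simp add: kron_def)
  next
    case False
    then obtain i where "i < m" "dig p i r \<noteq> dig p i s" using digits_eqI[OF assms rs] by blast
    then have "(\<Prod>i<m. (1\<^sub>m p :: 'a mat) $$ (dig p i r, dig p i s)) = 0"
      using dig_less[OF assms] by (intro prod_zero) auto
    then show ?thesis using False rs by (simp add: kron_def)
  qed
qed (auto simp: kron_def)

lemma kron_trace:
  assumes "p > 0" "\<And>i. i < m \<Longrightarrow> g i \<in> carrier_mat p p"
  shows "mat_trace (kron p m g) = (\<Prod>i<m. mat_trace (g i))"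
proof -
  have "mat_trace (kron p m g) = (\<Sum>r<p ^ m. \<Prod>i<m. g i $$ (dig p i r, dig p i r))"
    by (simp add: mat_trace_def kron_def)
  also have "\<dots> = (\<Prod>i<m. \<Sum>j<p. g i $$ (j, j))" by (rule sum_prod_digits[OF assms(1)])
  also have "\<dots> = (\<Prod>i<m. mat_trace (g i))" using assms(2) by (intro prod.cong) (auto simp: mat_trace_def)
  finally show ?thesis .
qed

lemma kron_list_prod:
  assumes "p > 0" "\<And>i g. i < m \<Longrightarrow> g \<in> set gs \<Longrightarrow> g i \<in> carrier_mat p p"
  shows "mat_list_prod (p ^ m) (map (kron p m) gs) = kron p m (\<lambda>i. mat_list_prod p (map (\<lambda>g. g i) gs))"
  using assms(2)
proof (induction gs)
  case (Cons g gs)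
  have "mat_list_prod p (map (\<lambda>g. g i) gs) \<in> carrier_mat p p" if "i < m" for i
    by (rule mat_list_prod_carrier) (use Cons.prems that in auto)
  then show ?case using Cons by (simp add: kron_mult[OF assms(1)])
qed (simp add: kron_one[OF assms(1)])

text \<open>The product of the diagonal matrix of \<open>f\<close> and the \<open>b\<close>-th power
  of \<open>\<eta>\<close> times the cyclic shift. The exponent \<open>b\<close> is not reduced
  modulo \<open>p\<close>, so the powers of \<open>\<eta>\<close> multiply correctly.\<close>

definition diag_shift :: "nat \<Rightarrow> 'a::comm_ring_1 \<Rightarrow> (nat \<Rightarrow> 'a) \<Rightarrow> nat \<Rightarrow> 'a mat" where
  "diag_shift p \<eta> f b = mat p p (\<lambda>(j, l). if l = (j + b) mod p then f j * \<eta> ^ b else 0)"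

lemma diag_shift_carrier [simp]: "diag_shift p \<eta> f b \<in> carrier_mat p p"
  by (simp add: diag_shift_def)

lemma periodic_mod: "(\<And>j. f (j + p) = f j) \<Longrightarrow> f (j mod p) = f (j :: nat)"
proof -
  assume f: "\<And>j. f (j + p) = f j"
  have "f (j + k * p) = f j" for j k
  proof (induction k)
    case (Suc k)
    then show ?case using f[of "j + k * p"] by (simp add: ac_simps)
  qed simp
  from this[of "j mod p" "j div p"] show ?thesis by simp
qed

text \<open>Moving a diagonal matrix past the \<open>b\<close>-th power of the shift translates its
  entries by \<open>b\<close>. Periodicity of \<open>g\<close> allows writing \<open>j + b\<close>
  without reduction modulo \<open>p\<close>.\<close>

lemma diag_shift_mult:
  assumes "p > 0" "\<And>j. g (j + p) = g j"
  shows "diag_shift p \<eta> f b * diag_shift p \<eta> g c = diag_shift p \<eta> (\<lambda>j. f j * g (j + b)) (b + c)"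
proof (rule eq_matI)
  fix j l assume "j < dim_row (diag_shift p \<eta> (\<lambda>j. f j * g (j + b)) (b + c))" "l < dim_col (diag_shift p \<eta> (\<lambda>j. f j * g (j + b)) (b + c))"
  then have jl: "j < p" "l < p" by (auto simp: diag_shift_def)
  have "(diag_shift p \<eta> f b * diag_shift p \<eta> g c) $$ (j, l) =
     (\<Sum>k<p. if k = (j + b) mod p then f j * \<eta> ^ b * (if l = (k + c) mod p then g k * \<eta> ^ c else 0) else 0)"
    using jl by (simp add: diag_shift_def scalar_prod_def atLeast0LessThan del: sum.delta sum.delta') (intro conjI impI sum.cong refl; auto)
  also have "\<dots> = diag_shift p \<eta> (\<lambda>j. f j * g (j + b)) (b + c) $$ (j, l)"
    using jl assms by (simp add: diag_shift_def mod_add_left_eq add.assoc periodic_mod[of g] power_add mult_ac)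
  finally show "(diag_shift p \<eta> f b * diag_shift p \<eta> g c) $$ (j, l) = diag_shift p \<eta> (\<lambda>j. f j * g (j + b)) (b + c) $$ (j, l)" .
qed (auto simp: diag_shift_def)

lemma diag_shift_one: "diag_shift p \<eta> (\<lambda>_. 1) 0 = 1\<^sub>m p"
  by (rule eq_matI) (auto simp: diag_shift_def)

lemma diag_shift_trace:
  assumes "p > 0"
  shows "mat_trace (diag_shift p \<eta> f b) = (if p dvd b then \<eta> ^ b * (\<Sum>j<p. f j) else 0)"
proof -
  have "j = (j + b) mod p \<longleftrightarrow> p dvd b" if "j < p" for j
    using that by (metis add.right_neutral mod_add_right_eq mod_less dvd_eq_mod_eq_0 mod_eq_0_iff_dvd
      nat_mod_eq_iff add_diff_cancel_left' mod_eq_dvd_iff_nat le_add1)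
  then have "mat_trace (diag_shift p \<eta> f b) = (\<Sum>j<p. if p dvd b then f j * \<eta> ^ b else 0)"
    by (auto simp: mat_trace_def diag_shift_def intro!: sum.cong)
  then show ?thesis by (simp add: sum_distrib_left mult.commute)
qed

text \<open>The diagonal part of the product of the monomials \<open>x\<^sup>a y\<^sup>b\<close> over a word of exponents \<open>(a, b)\<close>,
  when \<open>x\<close> acts as the diagonal matrix \<open>\<xi>\<close> and \<open>y\<close> as a multiple of the cyclic shift.\<close>

fun word_diagonal :: "(nat \<Rightarrow> 'a::comm_ring_1) \<Rightarrow> (nat \<times> nat) list \<Rightarrow> nat \<Rightarrow> 'a" where
  "word_diagonal \<xi> [] j = 1"
| "word_diagonal \<xi> ((a, b) # cs) j = \<xi> j ^ a * word_diagonal \<xi> cs (j + b)"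

lemma word_diagonal_periodic:
  assumes "\<And>j. \<xi> (j + p) = \<xi> j"
  shows "word_diagonal \<xi> cs (j + p) = word_diagonal \<xi> cs j"
proof (induction cs arbitrary: j)
  case (Cons c cs)
  have "word_diagonal \<xi> cs (j + p + b) = word_diagonal \<xi> cs (j + b)" for b
    using Cons[of "j + b"] by (simp add: ac_simps)
  then show ?case by (cases c) (simp add: assms)
qed simp

lemma word_prod:
  assumes "p > 0" "\<And>j. \<xi> (j + p) = \<xi> j"
  shows "mat_list_prod p (map (\<lambda>(a, b). diag_shift p \<eta> (\<lambda>j. \<xi> j ^ a) b) cs)
     = diag_shift p \<eta> (word_diagonal \<xi> cs) (sum_list (map snd cs))"
proof (induction cs)
  case Nil then show ?case using diag_shift_one[of p \<eta>] by (simp add: fun_eq_iff[symmetric])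
next
  case (Cons c cs)
  then show ?case
    by (cases c) (simp add: diag_shift_mult[where g = "word_diagonal \<xi> cs", OF assms(1) word_diagonal_periodic[where \<xi> = \<xi>, OF assms(2)]])
qed

section \<open>Presented algebras and their representations\<close>

locale assoc_algebra = ring A for A :: "('f::field, 'a) module" (structure) +
  assumes smult_closed [simp, intro]: "a \<in> carrier A \<Longrightarrow> c \<odot> a \<in> carrier A"
    and smult_r_distr: "a \<in> carrier A \<Longrightarrow> b \<in> carrier A \<Longrightarrow> c \<odot> (a \<oplus> b) = c \<odot> a \<oplus> c \<odot> b"
    and smult_l_distr: "a \<in> carrier A \<Longrightarrow> (c + d) \<odot> a = c \<odot> a \<oplus> d \<odot> a"
    and smult_assoc1: "a \<in> carrier A \<Longrightarrow> (c * d) \<odot> a = c \<odot> (d \<odot> a)"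
    and smult_one: "a \<in> carrier A \<Longrightarrow> 1 \<odot> a = a"
    and smult_mult_left: "a \<in> carrier A \<Longrightarrow> b \<in> carrier A \<Longrightarrow> (c \<odot> a) \<otimes> b = c \<odot> (a \<otimes> b)"
    and smult_mult_right: "a \<in> carrier A \<Longrightarrow> b \<in> carrier A \<Longrightarrow> a \<otimes> (c \<odot> b) = c \<odot> (a \<otimes> b)"
begin

lemma smult_zero_left: "a \<in> carrier A \<Longrightarrow> 0 \<odot> a = \<zero>"
  using smult_l_distr[of a 0 0] by (metis add.r_cancel_one' add_0 smult_closed)

lemma smult_zero_right: "c \<odot> \<zero> = \<zero>"
  using smult_r_distr[of \<zero> \<zero> c] by (metis add.r_cancel_one' l_zero smult_closed zero_closed)

lemma vectorspace_class_ring: "vectorspace class_ring A"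
proof -
  have "module class_ring A"
    by (rule module.intro[OF class_cring.is_cring is_abelian_group[THEN abelian_group.axioms(1), THEN abelian_group.intro]])
       (unfold_locales, auto simp: class_ring_simps smult_r_distr smult_l_distr smult_assoc1 smult_one)
  then show ?thesis
    by (intro vectorspace.intro) (auto simp: class_field)
qed

end

text \<open>An inductive form of the linear span: statements about all elements of an algebra, such
  as the existence of coordinates, then follow by induction from the generators.\<close>

inductive_set lin_span :: "('f, 'a) module \<Rightarrow> 'a set \<Rightarrow> 'a set" for A :: "('f, 'a) module" and B where
  zero: "\<zero>\<^bsub>A\<^esub> \<in> lin_span A B"
| base: "b \<in> B \<Longrightarrow> b \<in> lin_span A B"
| add: "a \<in> lin_span A B \<Longrightarrow> b \<in> lin_span A B \<Longrightarrow> a \<oplus>\<^bsub>A\<^esub> b \<in> lin_span A B"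
| smult: "a \<in> lin_span A B \<Longrightarrow> c \<odot>\<^bsub>A\<^esub> a \<in> lin_span A B"

definition monoid_convolution :: "('g, 'x) monoid_scheme \<Rightarrow> ('g \<Rightarrow>\<^sub>0 'f::field) \<Rightarrow> ('g \<Rightarrow>\<^sub>0 'f) \<Rightarrow> ('g \<Rightarrow>\<^sub>0 'f)" where
  "monoid_convolution M u v = (\<Sum>g\<in>Poly_Mapping.keys u. \<Sum>h\<in>Poly_Mapping.keys v.
        Poly_Mapping.single (g \<otimes>\<^bsub>M\<^esub> h) (Poly_Mapping.lookup u g * Poly_Mapping.lookup v h))"

lemma monoid_algebra_sel:
  "carrier (monoid_algebra M) = {u. Poly_Mapping.keys u \<subseteq> carrier M}"
  "monoid.mult (monoid_algebra M) = monoid_convolution M"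
  "one (monoid_algebra M) = Poly_Mapping.single \<one>\<^bsub>M\<^esub> 1"
  "ring.zero (monoid_algebra M) = 0" "add (monoid_algebra M) = (+)"
  "module.smult (monoid_algebra M) = (\<lambda>c. Poly_Mapping.map ((*) c))"
  by (simp_all add: monoid_algebra_def monoid_convolution_def fun_eq_iff)

lemma lookup_map_mult: "Poly_Mapping.lookup (Poly_Mapping.map ((*) c) u) g = (c :: 'f::field) * Poly_Mapping.lookup u g"
  by (transfer) (auto simp: when_def)

lemma monoid_convolution_superset:
  assumes "finite A" "Poly_Mapping.keys u \<subseteq> A" "finite B" "Poly_Mapping.keys v \<subseteq> B"
  shows "monoid_convolution M u v = (\<Sum>g\<in>A. \<Sum>h\<in>B.
        Poly_Mapping.single (g \<otimes>\<^bsub>M\<^esub> h) (Poly_Mapping.lookup u g * Poly_Mapping.lookup v h))"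
proof -
  have "monoid_convolution M u v = (\<Sum>g\<in>Poly_Mapping.keys u. \<Sum>h\<in>B.
        Poly_Mapping.single (g \<otimes>\<^bsub>M\<^esub> h) (Poly_Mapping.lookup u g * Poly_Mapping.lookup v h))"
    unfolding monoid_convolution_def using assms
    by (intro sum.cong refl sum.mono_neutral_left) (auto simp: in_keys_iff)
  also have "\<dots> = (\<Sum>g\<in>A. \<Sum>h\<in>B.
        Poly_Mapping.single (g \<otimes>\<^bsub>M\<^esub> h) (Poly_Mapping.lookup u g * Poly_Mapping.lookup v h))"
    using assms by (intro sum.mono_neutral_left) (auto simp: in_keys_iff)
  finally show ?thesis .
qed

lemma monoid_convolution_add:
  "monoid_convolution M (u + u') v = monoid_convolution M u v + monoid_convolution M u' v"
  "monoid_convolution M u (v + v') = monoid_convolution M u v + monoid_convolution M u v'"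
proof -
  note K = Poly_Mapping.keys_add
  show "monoid_convolution M (u + u') v = monoid_convolution M u v + monoid_convolution M u' v"
    using K[of u u']
    by (simp add: monoid_convolution_superset[of "Poly_Mapping.keys u \<union> Poly_Mapping.keys u'" _ "Poly_Mapping.keys v" v]
      lookup_add distrib_right single_add sum.distrib)
  show "monoid_convolution M u (v + v') = monoid_convolution M u v + monoid_convolution M u v'"
    using K[of v v']
    by (simp add: monoid_convolution_superset[of "Poly_Mapping.keys u" u "Poly_Mapping.keys v \<union> Poly_Mapping.keys v'"]
      lookup_add distrib_left single_add sum.distrib)
qed

lemma monoid_convolution_zero [simp]: "monoid_convolution M 0 v = 0" "monoid_convolution M u 0 = 0"
  by (simp_all add: monoid_convolution_def)

lemma monoid_convolution_sum:
  "monoid_convolution M (\<Sum>x\<in>B. f x) v = (\<Sum>x\<in>B. monoid_convolution M (f x) v)"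
  "monoid_convolution M u (\<Sum>x\<in>B. f x) = (\<Sum>x\<in>B. monoid_convolution M u (f x))"
  by (induction B rule: infinite_finite_induct) (auto simp: monoid_convolution_add)

lemma monoid_convolution_single:
  "monoid_convolution M (Poly_Mapping.single g a) (Poly_Mapping.single h b) = Poly_Mapping.single (g \<otimes>\<^bsub>M\<^esub> h) (a * b)"
  by (subst monoid_convolution_superset[of "{g}" _ "{h}"]) auto

lemma monoid_convolution_smult:
  "monoid_convolution M (Poly_Mapping.map ((*) c) u) v = Poly_Mapping.map ((*) c) (monoid_convolution M u v)"
  "monoid_convolution M u (Poly_Mapping.map ((*) c) v) = Poly_Mapping.map ((*) c) (monoid_convolution M u v)"
proof -
  have K: "Poly_Mapping.keys (Poly_Mapping.map ((*) c) w) \<subseteq> Poly_Mapping.keys w" for w :: "'a \<Rightarrow>\<^sub>0 'b"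
    by (auto simp: in_keys_iff lookup_map_mult)
  have S: "Poly_Mapping.map ((*) c) (\<Sum>x\<in>B. f x) = (\<Sum>x\<in>B. Poly_Mapping.map ((*) c) (f x))" for B and f :: "'c \<Rightarrow> 'a \<Rightarrow>\<^sub>0 'b"
    by (rule poly_mapping_eqI) (simp add: lookup_map_mult lookup_sum sum_distrib_left)
  have S': "Poly_Mapping.map ((*) c) (Poly_Mapping.single g a) = Poly_Mapping.single g (c * a)" for g :: 'a and a
    by (rule poly_mapping_eqI) (simp add: lookup_map_mult lookup_single when_def)
  show "monoid_convolution M (Poly_Mapping.map ((*) c) u) v = Poly_Mapping.map ((*) c) (monoid_convolution M u v)"
    by (subst (1 2) monoid_convolution_superset[of "Poly_Mapping.keys u" _ "Poly_Mapping.keys v" v])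
      (use K in \<open>auto simp: poly_mapping_eq_iff fun_eq_iff lookup_map_mult lookup_sum lookup_single when_def sum_distrib_left mult.assoc intro!: sum.cong\<close>)
  show "monoid_convolution M u (Poly_Mapping.map ((*) c) v) = Poly_Mapping.map ((*) c) (monoid_convolution M u v)"
    by (subst (1 2) monoid_convolution_superset[of "Poly_Mapping.keys u" u "Poly_Mapping.keys v"])
      (use K in \<open>auto simp: poly_mapping_eq_iff fun_eq_iff lookup_map_mult lookup_sum lookup_single when_def sum_distrib_left mult_ac intro!: sum.cong\<close>)
qed

lemma keys_sum_subset:
  assumes "\<And>x. x \<in> B \<Longrightarrow> Poly_Mapping.keys (f x) \<subseteq> C"
  shows "Poly_Mapping.keys (\<Sum>x\<in>B. f x) \<subseteq> C"
  using assms
  by (induction B rule: infinite_finite_induct) (auto dest!: subsetD[OF Poly_Mapping.keys_add])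

lemma monoid_algebra_assoc_algebra:
  assumes "monoid M"
  shows "assoc_algebra (monoid_algebra M :: ('f::field, 'g \<Rightarrow>\<^sub>0 'f) module)"
proof -
  interpret M: monoid M by (rule assms)
  let ?A = "monoid_algebra M :: ('f, 'g \<Rightarrow>\<^sub>0 'f) module"
  note [simp] = monoid_algebra_sel
  have closed: "Poly_Mapping.keys (monoid_convolution M u v) \<subseteq> carrier M"
    if "Poly_Mapping.keys u \<subseteq> carrier M" "Poly_Mapping.keys v \<subseteq> carrier M" for u v :: "'g \<Rightarrow>\<^sub>0 'f"
    unfolding monoid_convolution_def using that by (intro keys_sum_subset) auto
  have assoc: "monoid_convolution M (monoid_convolution M u v) w = monoid_convolution M u (monoid_convolution M v w)"
    if "Poly_Mapping.keys u \<subseteq> carrier M" "Poly_Mapping.keys v \<subseteq> carrier M" "Poly_Mapping.keys w \<subseteq> carrier M"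
    for u v w :: "'g \<Rightarrow>\<^sub>0 'f"
  proof -
    let ?s = "\<lambda>u g. Poly_Mapping.single g (Poly_Mapping.lookup u g)"
    let ?d = "\<lambda>u. \<Sum>g\<in>Poly_Mapping.keys u. ?s u g"
    have "monoid_convolution M (monoid_convolution M (?d u) (?d v)) (?d w) = monoid_convolution M (?d u) (monoid_convolution M (?d v) (?d w))"
      unfolding monoid_convolution_sum monoid_convolution_single
      using that by (intro sum.cong refl) (auto simp: M.m_assoc mult.assoc subset_iff)
    then show ?thesis by (simp only: poly_mapping_sum_singles[symmetric])
  qed
  have one: "monoid_convolution M (Poly_Mapping.single \<one>\<^bsub>M\<^esub> 1) u = u" "monoid_convolution M u (Poly_Mapping.single \<one>\<^bsub>M\<^esub> 1) = u"
    if "Poly_Mapping.keys u \<subseteq> carrier M" for u :: "'g \<Rightarrow>\<^sub>0 'f"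
  proof -
    let ?d = "\<Sum>g\<in>Poly_Mapping.keys u. Poly_Mapping.single g (Poly_Mapping.lookup u g)"
    have "monoid_convolution M (Poly_Mapping.single \<one>\<^bsub>M\<^esub> 1) ?d = ?d" "monoid_convolution M ?d (Poly_Mapping.single \<one>\<^bsub>M\<^esub> 1) = ?d"
      unfolding monoid_convolution_sum monoid_convolution_single
      using that by (auto intro!: sum.cong simp: subset_iff)
    then show "monoid_convolution M (Poly_Mapping.single \<one>\<^bsub>M\<^esub> 1) u = u" "monoid_convolution M u (Poly_Mapping.single \<one>\<^bsub>M\<^esub> 1) = u"
      by (simp_all only: poly_mapping_sum_singles[symmetric])
  qed
  have neg: "Poly_Mapping.keys (- u) = Poly_Mapping.keys u" for u :: "'g \<Rightarrow>\<^sub>0 'f"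
    by (auto simp: in_keys_iff)
  have "ring ?A"
  proof (rule ringI)
    show "abelian_group ?A"
    proof (rule abelian_groupI)
      fix x assume "x \<in> carrier ?A"
      then show "\<exists>y\<in>carrier ?A. y \<oplus>\<^bsub>?A\<^esub> x = \<zero>\<^bsub>?A\<^esub>" by (intro bexI[of _ "- x"]) (auto simp: neg)
    qed (auto simp: add_ac dest!: subsetD[OF Poly_Mapping.keys_add])
    show "monoid ?A"
      by (rule monoidI) (use closed assoc one in auto)
  qed (auto simp: monoid_convolution_add)
  then show ?thesis
    by (intro assoc_algebra.intro assoc_algebra_axioms.intro)
       (auto simp: monoid_convolution_smult poly_mapping_eq_iff fun_eq_iff lookup_map_mult lookup_add algebra_simps in_keys_iff subset_iff)
qed

context assoc_algebra
begin

lemma quotient_algebra_sel: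
  defines "I \<equiv> \<lambda>S. Idl S"
  shows "carrier (quotient_algebra A S) = a_rcosets (I S)"
    "monoid.mult (quotient_algebra A S) = rcoset_mult A (I S)"
    "one (quotient_algebra A S) = I S +> \<one>" "ring.zero (quotient_algebra A S) = I S"
    "add (quotient_algebra A S) = set_add A"
    "module.smult (quotient_algebra A S) = (\<lambda>c U. I S <+>\<^bsub>A\<^esub> (\<lambda>a. c \<odot> a) ` U)"
  by (simp_all add: I_def quotient_algebra_def FactRing_def ring.defs module.defs)

definition coset_proj :: "'a set \<Rightarrow> 'a \<Rightarrow> 'a set" where
  "coset_proj S a = Idl S +> a"

lemma quotient_algebra_props:
  assumes S: "S \<subseteq> carrier A"
  shows "assoc_algebra (quotient_algebra A S)"
    and "coset_proj S \<in> Ring.ring_hom A (quotient_algebra A S)"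
    and "\<And>a c. a \<in> carrier A \<Longrightarrow> coset_proj S (c \<odot> a) = c \<odot>\<^bsub>quotient_algebra A S\<^esub> coset_proj S a"
    and "coset_proj S ` carrier A = carrier (quotient_algebra A S)"
    and "\<And>a b. a \<in> carrier A \<Longrightarrow> b \<in> carrier A \<Longrightarrow> coset_proj S a = coset_proj S b \<longleftrightarrow> a \<ominus> b \<in> Idl S"
proof -
  let ?I = "Idl S" and ?Q = "quotient_algebra A S"
  interpret I: ideal ?I A by (rule genideal_ideal[OF S])
  note sel = quotient_algebra_sel[of S, simplified]
  have eq: "ring.truncate ?Q = A Quot ?I"
    by (simp add: quotient_algebra_def ring.defs module.defs FactRing_def)
  interpret Q: ring "A Quot ?I" by (rule I.quotient_is_ring)
  \<comment> \<open>\<open>A Quot ?I\<close> has the same ring operations but lives in a record type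
    without scalars, so its axioms are carried over one by one.\<close>
  have ringQ: "ring ?Q"
  proof (rule ringI)
    show "abelian_group ?Q"
    proof (rule abelian_groupI)
      note Qsel = FactRing_def sel
      fix x y z assume x: "x \<in> carrier ?Q"
      then have x': "x \<in> carrier (A Quot ?I)" by (simp add: Qsel)
      show "\<zero>\<^bsub>?Q\<^esub> \<oplus>\<^bsub>?Q\<^esub> x = x" using Q.l_zero[OF x'] by (simp add: Qsel)
      show "\<exists>y\<in>carrier ?Q. y \<oplus>\<^bsub>?Q\<^esub> x = \<zero>\<^bsub>?Q\<^esub>"
        using Q.a_inv_closed[OF x'] Q.l_neg[OF x'] unfolding Qsel by (auto intro: bexI)
      assume y: "y \<in> carrier ?Q"
      then have y': "y \<in> carrier (A Quot ?I)" by (simp add: Qsel)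
      show "x \<oplus>\<^bsub>?Q\<^esub> y \<in> carrier ?Q" "x \<oplus>\<^bsub>?Q\<^esub> y = y \<oplus>\<^bsub>?Q\<^esub> x"
        using Q.a_closed[OF x' y'] Q.a_comm[OF x' y'] by (simp_all add: Qsel)
      assume "z \<in> carrier ?Q"
      then have z': "z \<in> carrier (A Quot ?I)" by (simp add: Qsel)
      show "x \<oplus>\<^bsub>?Q\<^esub> y \<oplus>\<^bsub>?Q\<^esub> z = x \<oplus>\<^bsub>?Q\<^esub> (y \<oplus>\<^bsub>?Q\<^esub> z)"
        using Q.a_assoc[OF x' y' z'] by (simp add: Qsel)
    next
      show "\<zero>\<^bsub>?Q\<^esub> \<in> carrier ?Q" using Q.zero_closed by (simp add: FactRing_def sel)
    qed
    show "monoid ?Q" using Q.monoid_axioms unfolding monoid_def by (simp add: sel FactRing_def)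
    fix x y z assume "x \<in> carrier ?Q" "y \<in> carrier ?Q" "z \<in> carrier ?Q"
    then show "(x \<oplus>\<^bsub>?Q\<^esub> y) \<otimes>\<^bsub>?Q\<^esub> z = x \<otimes>\<^bsub>?Q\<^esub> z \<oplus>\<^bsub>?Q\<^esub> y \<otimes>\<^bsub>?Q\<^esub> z" "z \<otimes>\<^bsub>?Q\<^esub> (x \<oplus>\<^bsub>?Q\<^esub> y) = z \<otimes>\<^bsub>?Q\<^esub> x \<oplus>\<^bsub>?Q\<^esub> z \<otimes>\<^bsub>?Q\<^esub> y"
      using Q.l_distr[of x y z] Q.r_distr[of x y z] by (simp_all add: sel FactRing_def)
  qed
  show hom: "coset_proj S \<in> Ring.ring_hom A ?Q"
    using I.rcos_ring_hom unfolding Ring.ring_hom_def coset_proj_def by (simp add: sel FactRing_def)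
  have surj: "coset_proj S ` carrier A = carrier ?Q"
    by (auto simp: sel A_RCOSETS_def' coset_proj_def)
  then show "coset_proj S ` carrier A = carrier ?Q" .
  show iff: "coset_proj S a = coset_proj S b \<longleftrightarrow> a \<ominus> b \<in> ?I" if "a \<in> carrier A" "b \<in> carrier A" for a b
  proof -
    have "a \<ominus> b \<in> ?I \<longleftrightarrow> a \<in> ?I +> b"
      using I.a_rcos_module[OF that(2,1)] by (simp add: minus_eq)
    then show ?thesis unfolding coset_proj_def
      by (metis I.a_repr_independence' I.a_rcos_self that)
  qed
  \<comment> \<open>An ideal of a unital algebra is a subspace, because scaling by \<open>c\<close>
    is multiplication by \<open>c \<odot> \<one>\<close>.\<close>
  have smI: "c \<odot> i \<in> ?I" if "i \<in> ?I" for c i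
  proof -
    have "c \<odot> i = (c \<odot> \<one>) \<otimes> i" using that I.Icarr by (simp add: smult_mult_left)
    then show ?thesis using that I.I_l_closed by simp
  qed
  show sm: "coset_proj S (c \<odot> a) = c \<odot>\<^bsub>?Q\<^esub> coset_proj S a" if a: "a \<in> carrier A" for a c
  proof -
    have "?I +> (c \<odot> a) = ?I <+>\<^bsub>A\<^esub> (\<lambda>x. c \<odot> x) ` (?I +> a)"
    proof (intro equalityI subsetI)
      fix x assume "x \<in> ?I +> (c \<odot> a)"
      then obtain i where i: "i \<in> ?I" "x = i \<oplus> c \<odot> a" by (auto simp: a_r_coset_def')
      have "\<zero> \<oplus> a \<in> ?I +> a" using I.zero_closed by (auto simp: a_r_coset_def')
      then have "c \<odot> a \<in> (\<lambda>x. c \<odot> x) ` (?I +> a)" using a by auto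
      then show "x \<in> ?I <+>\<^bsub>A\<^esub> (\<lambda>x. c \<odot> x) ` (?I +> a)" using i unfolding set_add_def' by blast
    next
      fix x assume "x \<in> ?I <+>\<^bsub>A\<^esub> (\<lambda>x. c \<odot> x) ` (?I +> a)"
      then obtain i j where ij: "i \<in> ?I" "j \<in> ?I" "x = i \<oplus> c \<odot> (j \<oplus> a)" by (auto simp: set_add_def' a_r_coset_def')
      then have "x = (i \<oplus> c \<odot> j) \<oplus> c \<odot> a" using a I.Icarr by (simp add: smult_r_distr a_assoc)
      moreover have "i \<oplus> c \<odot> j \<in> ?I" using ij smI I.a_closed by auto
      ultimately show "x \<in> ?I +> (c \<odot> a)" by (auto simp: a_r_coset_def')
    qed
    then show ?thesis by (simp add: coset_proj_def sel)
  qed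
  show "assoc_algebra ?Q"
  proof (intro assoc_algebra.intro assoc_algebra_axioms.intro ringQ)
    fix a b c d assume "a \<in> carrier ?Q"
    then obtain a' where a: "a' \<in> carrier A" "a = coset_proj S a'" using surj by blast
    show "c \<odot>\<^bsub>?Q\<^esub> a \<in> carrier ?Q" using a sm[symmetric] surj by auto
    show "(c + d) \<odot>\<^bsub>?Q\<^esub> a = c \<odot>\<^bsub>?Q\<^esub> a \<oplus>\<^bsub>?Q\<^esub> d \<odot>\<^bsub>?Q\<^esub> a" "(c * d) \<odot>\<^bsub>?Q\<^esub> a = c \<odot>\<^bsub>?Q\<^esub> (d \<odot>\<^bsub>?Q\<^esub> a)" "1 \<odot>\<^bsub>?Q\<^esub> a = a"
      using a by (simp_all add: sm[symmetric] ring_hom_add[OF hom, symmetric] smult_l_distr smult_assoc1 smult_one)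
    assume "b \<in> carrier ?Q"
    then obtain b' where b: "b' \<in> carrier A" "b = coset_proj S b'" using surj by blast
    show "c \<odot>\<^bsub>?Q\<^esub> (a \<oplus>\<^bsub>?Q\<^esub> b) = c \<odot>\<^bsub>?Q\<^esub> a \<oplus>\<^bsub>?Q\<^esub> c \<odot>\<^bsub>?Q\<^esub> b"
      "c \<odot>\<^bsub>?Q\<^esub> a \<otimes>\<^bsub>?Q\<^esub> b = c \<odot>\<^bsub>?Q\<^esub> (a \<otimes>\<^bsub>?Q\<^esub> b)" "a \<otimes>\<^bsub>?Q\<^esub> (c \<odot>\<^bsub>?Q\<^esub> b) = c \<odot>\<^bsub>?Q\<^esub> (a \<otimes>\<^bsub>?Q\<^esub> b)"
      using a b by (simp_all add: sm[symmetric] ring_hom_add[OF hom, symmetric] ring_hom_mult[OF hom, symmetric] smult_r_distr smult_mult_left smult_mult_right)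
  qed
qed

end

text \<open>Representations over the algebraic closure \<open>K\<close> that are linear over the
  base field only; extending the scalars is a separate step.\<close>

definition alg_rep :: "nat \<Rightarrow> ('f::field, 'a) module \<Rightarrow> ('a \<Rightarrow> 'f alg_closure mat) \<Rightarrow> bool" where
  "alg_rep n A \<phi> \<longleftrightarrow> \<phi> \<in> Ring.ring_hom A (ring_mat TYPE('f alg_closure) n ()) \<and>
    (\<forall>a\<in>carrier A. \<forall>c. \<phi> (c \<odot>\<^bsub>A\<^esub> a) = to_ac c \<cdot>\<^sub>m \<phi> a)"

lemma alg_repD:
  assumes "alg_rep n A \<phi>"
  shows "a \<in> carrier A \<Longrightarrow> \<phi> a \<in> carrier_mat n n"
    "a \<in> carrier A \<Longrightarrow> b \<in> carrier A \<Longrightarrow> \<phi> (a \<oplus>\<^bsub>A\<^esub> b) = \<phi> a + \<phi> b"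
    "a \<in> carrier A \<Longrightarrow> b \<in> carrier A \<Longrightarrow> \<phi> (a \<otimes>\<^bsub>A\<^esub> b) = \<phi> a * \<phi> b"
    "\<phi> \<one>\<^bsub>A\<^esub> = 1\<^sub>m n"
    "a \<in> carrier A \<Longrightarrow> \<phi> (c \<odot>\<^bsub>A\<^esub> a) = to_ac c \<cdot>\<^sub>m \<phi> a"
  using assms unfolding alg_rep_def Ring.ring_hom_def by (auto simp: ring_mat_simps)

lemma alg_rep_zero: "assoc_algebra A \<Longrightarrow> alg_rep n A \<phi> \<Longrightarrow> \<phi> \<zero>\<^bsub>A\<^esub> = 0\<^sub>m n n"
proof -
  assume "assoc_algebra A" and r: "alg_rep n A \<phi>"
  then interpret assoc_algebra A by simp
  have "\<phi> \<zero>\<^bsub>A\<^esub> = 0 \<cdot>\<^sub>m \<phi> \<zero>\<^bsub>A\<^esub>"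
    using alg_repD(5)[OF r zero_closed, of 0] by (simp add: smult_zero_right)
  also have "\<dots> = 0\<^sub>m n n" using alg_repD(1)[OF r zero_closed] by auto
  finally show ?thesis .
qed

text \<open>The universal property of a monoid algebra: a multiplicative map into matrices extends
  linearly. The rule for differences serves to evaluate relators, which are differences of monoid
  elements with coefficients.\<close>

lemma monoid_algebra_rep:
  fixes M :: "('g, 'x) monoid_scheme" and f :: "'g \<Rightarrow> 'f::field alg_closure mat"
  assumes "monoid M" and f: "\<And>g. g \<in> carrier M \<Longrightarrow> f g \<in> carrier_mat n n"
    "\<And>g h. g \<in> carrier M \<Longrightarrow> h \<in> carrier M \<Longrightarrow> f (g \<otimes>\<^bsub>M\<^esub> h) = f g * f h" "f \<one>\<^bsub>M\<^esub> = 1\<^sub>m n"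
  obtains \<phi> where "alg_rep n (monoid_algebra M) \<phi>"
    "\<And>g c. g \<in> carrier M \<Longrightarrow> \<phi> (Poly_Mapping.single g c) = to_ac c \<cdot>\<^sub>m f g"
    "\<And>u v. \<phi> (u - v) = \<phi> u - \<phi> v"
proof -
  interpret M: monoid M by (rule assms(1))
  let ?A = "monoid_algebra M :: ('f, 'g \<Rightarrow>\<^sub>0 'f) module"
  note [simp] = monoid_algebra_sel
  define e where "e u ij = (\<Sum>g\<in>Poly_Mapping.keys u. to_ac (Poly_Mapping.lookup u g) * f g $$ ij)" for u ij
  have e_sup: "e u ij = (\<Sum>g\<in>A. to_ac (Poly_Mapping.lookup u g) * f g $$ ij)"
    if "finite A" "Poly_Mapping.keys u \<subseteq> A" for u A ij
    unfolding e_def using that by (intro sum.mono_neutral_left) (auto simp: in_keys_iff)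
  have e_add: "e (u + v) ij = e u ij + e v ij" for u v ij
    using Poly_Mapping.keys_add[of u v]
    by (simp add: e_sup[of "Poly_Mapping.keys u \<union> Poly_Mapping.keys v"] lookup_add distrib_right sum.distrib)
  have e_smult: "e (Poly_Mapping.map ((*) c) u) ij = to_ac c * e u ij" for c u ij
  proof -
    have "Poly_Mapping.keys (Poly_Mapping.map ((*) c) u) \<subseteq> Poly_Mapping.keys u" by (auto simp: in_keys_iff lookup_map_mult)
    then show ?thesis by (simp add: e_sup[of "Poly_Mapping.keys u"] lookup_map_mult sum_distrib_left mult.assoc)
  qed
  have e_0: "e 0 ij = 0" for ij by (simp add: e_def)
  have e_sum: "e (\<Sum>x\<in>B. h x) ij = (\<Sum>x\<in>B. e (h x) ij)" for B and h :: "'b \<Rightarrow> 'g \<Rightarrow>\<^sub>0 'f" and ij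
    by (induction B rule: infinite_finite_induct) (auto simp: e_add e_0)
  have e_single: "e (Poly_Mapping.single g c) ij = to_ac c * f g $$ ij" for g c ij
    by (subst e_sup[of "{g}"]) auto
  have e_mult: "e (monoid_convolution M u v) (i, j) = (\<Sum>k<n. e u (i, k) * e v (k, j))"
    if uv: "Poly_Mapping.keys u \<subseteq> carrier M" "Poly_Mapping.keys v \<subseteq> carrier M" "i < n" "j < n" for u v i j
  proof -
    have fm: "f (g \<otimes>\<^bsub>M\<^esub> h) $$ (i, j) = (\<Sum>k<n. f g $$ (i, k) * f h $$ (k, j))" if "g \<in> carrier M" "h \<in> carrier M" for g h
      using that uv f(1)[of g] f(1)[of h] f(2)[of g h] by (simp add: scalar_prod_def atLeast0LessThan)
    let ?c = "\<lambda>u g. to_ac (Poly_Mapping.lookup u g)"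
    have "e (monoid_convolution M u v) (i, j) = (\<Sum>g\<in>Poly_Mapping.keys u. \<Sum>h\<in>Poly_Mapping.keys v. ?c u g * ?c v h * f (g \<otimes>\<^bsub>M\<^esub> h) $$ (i, j))"
      by (simp add: monoid_convolution_def e_sum e_single)
    also have "\<dots> = (\<Sum>g\<in>Poly_Mapping.keys u. \<Sum>h\<in>Poly_Mapping.keys v. \<Sum>k<n. (?c u g * f g $$ (i, k)) * (?c v h * f h $$ (k, j)))"
      using uv by (intro sum.cong refl) (auto simp: fm subset_iff sum_distrib_left mult_ac)
    also have "\<dots> = (\<Sum>g\<in>Poly_Mapping.keys u. \<Sum>k<n. \<Sum>h\<in>Poly_Mapping.keys v. (?c u g * f g $$ (i, k)) * (?c v h * f h $$ (k, j)))"
      by (intro sum.cong refl sum.swap)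
    also have "\<dots> = (\<Sum>k<n. \<Sum>g\<in>Poly_Mapping.keys u. \<Sum>h\<in>Poly_Mapping.keys v. (?c u g * f g $$ (i, k)) * (?c v h * f h $$ (k, j)))"
      by (rule sum.swap)
    also have "\<dots> = (\<Sum>k<n. e u (i, k) * e v (k, j))"
      by (simp add: e_def sum_product)
    finally show ?thesis .
  qed
  define \<phi> where "\<phi> u = mat n n (e u)" for u
  have single: "\<phi> (Poly_Mapping.single g c) = to_ac c \<cdot>\<^sub>m f g" if "g \<in> carrier M" for g c
    by (rule eq_matI) (use f(1)[OF that] in \<open>auto simp: \<phi>_def e_single\<close>)
  have "\<phi> \<in> Ring.ring_hom ?A (ring_mat TYPE('f alg_closure) n ())"
  proof (rule ring_hom_memI)
    fix u v assume uv: "u \<in> carrier ?A" "v \<in> carrier ?A"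
    then have k: "Poly_Mapping.keys u \<subseteq> carrier M" "Poly_Mapping.keys v \<subseteq> carrier M" by auto
    have "\<phi> (monoid_convolution M u v) = \<phi> u * \<phi> v"
      by (rule eq_matI) (simp_all add: \<phi>_def e_mult[OF k] scalar_prod_def atLeast0LessThan)
    then show "\<phi> (u \<otimes>\<^bsub>?A\<^esub> v) = \<phi> u \<otimes>\<^bsub>ring_mat TYPE('f alg_closure) n ()\<^esub> \<phi> v"
      by (simp add: ring_mat_simps)
    have "\<phi> (u + v) = \<phi> u + \<phi> v"
      by (rule eq_matI) (simp_all add: \<phi>_def e_add)
    then show "\<phi> (u \<oplus>\<^bsub>?A\<^esub> v) = \<phi> u \<oplus>\<^bsub>ring_mat TYPE('f alg_closure) n ()\<^esub> \<phi> v"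
      by (simp add: ring_mat_simps)
  next
    have "\<phi> (Poly_Mapping.single \<one>\<^bsub>M\<^esub> 1) = 1\<^sub>m n"
      using single[of "\<one>\<^bsub>M\<^esub>" 1] f(3) by (auto intro!: eq_matI)
    then show "\<phi> \<one>\<^bsub>?A\<^esub> = \<one>\<^bsub>ring_mat TYPE('f alg_closure) n ()\<^esub>"
      by (simp add: ring_mat_simps)
  qed (simp add: ring_mat_simps \<phi>_def)
  moreover have "\<phi> (Poly_Mapping.map ((*) c) u) = to_ac c \<cdot>\<^sub>m \<phi> u" for c u
    by (rule eq_matI) (simp_all add: \<phi>_def e_smult)
  ultimately have "alg_rep n ?A \<phi>"
    unfolding alg_rep_def by simp
  moreover have "\<phi> (u - v) = \<phi> u - \<phi> v" for u v
  proof -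
    have e: "e (u - v) ij = e u ij - e v ij" for ij using e_add[of "u - v" v ij] by simp
    show ?thesis by (rule eq_matI) (simp_all add: \<phi>_def e)
  qed
  ultimately show thesis using that single by blast
qed

text \<open>The kernel of \<open>\<phi>\<close> is an ideal that contains \<open>S\<close>, hence
  contains the ideal generated by \<open>S\<close>; so \<open>\<phi>\<close> is constant on
  cosets.\<close>

lemma quotient_algebra_rep:
  fixes A :: "('f::field, 'a) module"
  assumes "assoc_algebra A" "S \<subseteq> carrier A" "alg_rep n A \<phi>" "\<And>s. s \<in> S \<Longrightarrow> \<phi> s = 0\<^sub>m n n"
  obtains \<psi> where "alg_rep n (quotient_algebra A S) \<psi>"
    "\<And>a. a \<in> carrier A \<Longrightarrow> \<psi> (assoc_algebra.coset_proj A S a) = \<phi> a"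
proof -
  interpret A: assoc_algebra A by (rule assms(1))
  note q = A.quotient_algebra_props[OF assms(2)]
  let ?Q = "quotient_algebra A S" and ?R = "ring_mat TYPE('f alg_closure) n ()"
  interpret R: ring ?R by (rule ring_mat)
  interpret \<phi>: ring_hom_ring A ?R \<phi>
    by (rule ring_hom_ringI2) (use assms(3) in \<open>auto simp: alg_rep_def A.ring_axioms R.ring_axioms\<close>)
  have "Idl\<^bsub>A\<^esub> S \<subseteq> a_kernel A ?R \<phi>"
  proof (rule A.genideal_minimal[OF \<phi>.kernel_is_ideal])
    show "S \<subseteq> a_kernel A ?R \<phi>"
    proof
      fix s assume "s \<in> S"
      then show "s \<in> a_kernel A ?R \<phi>" using assms(2) assms(4)[of s] unfolding a_kernel_def'
        by (simp add: ring_mat_simps subset_iff)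
    qed
  qed
  then have ker: "\<phi> s = \<zero>\<^bsub>?R\<^esub>" if "s \<in> Idl\<^bsub>A\<^esub> S" for s using that unfolding a_kernel_def' by blast
  have wd: "\<phi> a = \<phi> b" if "a \<in> carrier A" "b \<in> carrier A" "A.coset_proj S a = A.coset_proj S b" for a b
  proof -
    have "\<phi> (a \<ominus>\<^bsub>A\<^esub> b) = \<zero>\<^bsub>?R\<^esub>" using ker q(5)[OF that(1,2)] that by simp
    then have "\<phi> a \<ominus>\<^bsub>?R\<^esub> \<phi> b = \<zero>\<^bsub>?R\<^esub>" using that by (simp add: a_minus_def)
    then show ?thesis using that by (simp add: R.r_right_minus_eq)
  qed
  define \<psi> where "\<psi> U = \<phi> (SOME a. a \<in> carrier A \<and> A.coset_proj S a = U)" for U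
  have psi: "\<psi> (A.coset_proj S a) = \<phi> a" if "a \<in> carrier A" for a
  proof -
    have "(SOME b. b \<in> carrier A \<and> A.coset_proj S b = A.coset_proj S a) \<in> carrier A \<and>
      A.coset_proj S (SOME b. b \<in> carrier A \<and> A.coset_proj S b = A.coset_proj S a) = A.coset_proj S a"
      by (rule someI[of _ a]) (use that in simp)
    then show ?thesis unfolding \<psi>_def using wd that by blast
  qed
  have "alg_rep n ?Q \<psi>" unfolding alg_rep_def
  proof (intro conjI ballI allI ring_hom_memI)
    fix a c assume "a \<in> carrier ?Q"
    then obtain a' where a: "a' \<in> carrier A" "a = A.coset_proj S a'" using q(4) by blast
    show "\<psi> (c \<odot>\<^bsub>?Q\<^esub> a) = to_ac c \<cdot>\<^sub>m \<psi> a"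
      using a by (simp add: q(3)[symmetric] psi alg_repD(5)[OF assms(3)])
    show "\<psi> a \<in> carrier ?R" using a by (simp add: psi)
    fix b assume "b \<in> carrier ?Q"
    then obtain b' where b: "b' \<in> carrier A" "b = A.coset_proj S b'" using q(4) by blast
    show "\<psi> (a \<otimes>\<^bsub>?Q\<^esub> b) = \<psi> a \<otimes>\<^bsub>?R\<^esub> \<psi> b" "\<psi> (a \<oplus>\<^bsub>?Q\<^esub> b) = \<psi> a \<oplus>\<^bsub>?R\<^esub> \<psi> b"
      using a b by (simp_all add: ring_hom_mult[OF q(2), symmetric] ring_hom_add[OF q(2), symmetric] psi)
  next
    show "\<psi> \<one>\<^bsub>?Q\<^esub> = \<one>\<^bsub>?R\<^esub>" using psi[of "\<one>\<^bsub>A\<^esub>"] ring_hom_one[OF q(2)] by simp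
  qed
  then show thesis using that psi by blast
qed

lemma lin_span_mono_closed:
  assumes "B \<subseteq> lin_span A C" shows "lin_span A B \<subseteq> lin_span A C"
proof
  fix x assume "x \<in> lin_span A B"
  then show "x \<in> lin_span A C"
  proof induction
    case (base b) then show ?case using assms by blast
  qed (rule lin_span.intros; assumption)+
qed

lemma (in assoc_algebra) lin_span_carrier: "B \<subseteq> carrier A \<Longrightarrow> lin_span A B \<subseteq> carrier A"
proof
  fix x assume "B \<subseteq> carrier A" "x \<in> lin_span A B"
  from this(2,1) show "x \<in> carrier A" by induction auto
qed

lemma (in assoc_algebra) lin_span_mult_left:
  assumes B: "B \<subseteq> carrier A" and a: "a \<in> carrier A" and "\<And>b. b \<in> B \<Longrightarrow> a \<otimes> b \<in> lin_span A C" and x: "x \<in> lin_span A B"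
  shows "a \<otimes> x \<in> lin_span A C"
  using x
proof induction
  case (add x y)
  then have "x \<in> carrier A" "y \<in> carrier A" using lin_span_carrier[OF B] by auto
  then show ?case using add a by (simp add: r_distr lin_span.add)
next
  case (smult x c)
  then have "x \<in> carrier A" using lin_span_carrier[OF B] by auto
  then show ?case using smult a by (simp add: smult_mult_right lin_span.smult)
next
  case zero
  show ?case using a by (simp add: lin_span.zero)
qed (rule assms(3))

lemma monoid_algebra_quotient_span:
  fixes M :: "('g, 'x) monoid_scheme" and S :: "('g \<Rightarrow>\<^sub>0 'f::field) set"
  defines "A \<equiv> monoid_algebra M"
  assumes "monoid M" "S \<subseteq> carrier A"
  shows "carrier (quotient_algebra A S) = lin_span (quotient_algebra A S)
    {assoc_algebra.coset_proj A S (Poly_Mapping.single g 1) | g. g \<in> carrier M}"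
proof -
  interpret A: assoc_algebra A unfolding A_def by (rule monoid_algebra_assoc_algebra[OF assms(2)])
  note q = A.quotient_algebra_props[OF assms(3)]
  let ?Q = "quotient_algebra A S"
  interpret Q: assoc_algebra ?Q by (rule q(1))
  let ?W = "lin_span ?Q {A.coset_proj S (Poly_Mapping.single g 1) | g. g \<in> carrier M}"
  have sel: "carrier A = {u. Poly_Mapping.keys u \<subseteq> carrier M}" "ring.zero A = 0" "ring.add A = (+)"
    "module.smult A = (\<lambda>c. Poly_Mapping.map ((*) c))" by (simp_all add: A_def monoid_algebra_sel)
  have sing: "Poly_Mapping.single g c \<in> carrier A" if "g \<in> carrier M" for g c using that by (simp add: sel)
  have zero: "A.coset_proj S 0 = \<zero>\<^bsub>?Q\<^esub>"
    using ring_hom_zero[OF q(2) A.ring_axioms Q.ring_axioms] by (simp add: sel)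
  have main: "A.coset_proj S (\<Sum>g\<in>B. Poly_Mapping.single g (c g)) \<in> ?W" if "finite B" "B \<subseteq> carrier M" for B c
    using that
  proof (induction B)
    case empty then show ?case using zero by (simp add: lin_span.zero)
  next
    case (insert g B)
    have s: "(\<Sum>g\<in>B. Poly_Mapping.single g (c g)) \<in> carrier A" unfolding sel mem_Collect_eq by (rule keys_sum_subset) (use insert.prems in auto)
    have g: "Poly_Mapping.single g (c g) = c g \<odot>\<^bsub>A\<^esub> Poly_Mapping.single g 1"
      unfolding sel by (rule poly_mapping_eqI) (simp add: lookup_map_mult lookup_single when_def)
    have "A.coset_proj S (Poly_Mapping.single g (c g)) = c g \<odot>\<^bsub>?Q\<^esub> A.coset_proj S (Poly_Mapping.single g 1)"
      unfolding g using q(3)[OF sing] insert.prems by simp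
    moreover have "A.coset_proj S (\<Sum>g\<in>insert g B. Poly_Mapping.single g (c g)) =
       A.coset_proj S (Poly_Mapping.single g (c g)) \<oplus>\<^bsub>?Q\<^esub> A.coset_proj S (\<Sum>g\<in>B. Poly_Mapping.single g (c g))"
      using ring_hom_add[OF q(2) sing s] insert by (simp add: sel)
    moreover have "A.coset_proj S (\<Sum>g\<in>B. Poly_Mapping.single g (c g)) \<in> ?W" using insert by simp
    moreover have "A.coset_proj S (Poly_Mapping.single g 1) \<in> ?W" using insert.prems by (intro lin_span.base) blast
    ultimately show ?case by (simp only: lin_span.add lin_span.smult)
  qed
  show ?thesis
  proof
    show "?W \<subseteq> carrier ?Q"
      by (rule Q.lin_span_carrier) (use q(4) sing in blast)
    show "carrier ?Q \<subseteq> ?W"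
    proof
      fix x assume "x \<in> carrier ?Q"
      then obtain u where u: "u \<in> carrier A" "x = A.coset_proj S u" using q(4) by blast
      then have "A.coset_proj S (\<Sum>g\<in>Poly_Mapping.keys u. Poly_Mapping.single g (Poly_Mapping.lookup u g)) \<in> ?W"
        by (intro main) (auto simp: sel)
      then show "x \<in> ?W" unfolding u(2) by (simp only: poly_mapping_sum_singles[of u, symmetric])
    qed
  qed
qed

section \<open>Presentations of symbol algebras\<close>

definition word_monoid :: "'g list monoid" where
  "word_monoid = \<lparr>carrier = UNIV, monoid.mult = (@), one = []\<rparr>"

lemma word_monoid: "monoid word_monoid"
  by (rule monoidI) (auto simp: word_monoid_def)

definition symbol_relators :: "nat \<Rightarrow> 'f::field \<Rightarrow> 'f \<Rightarrow> 'f \<Rightarrow> 'f \<Rightarrow> (symbol_gen list \<Rightarrow>\<^sub>0 'f) set" where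
  "symbol_relators p \<epsilon> \<rho> \<alpha> \<beta> =
    {Poly_Mapping.single (replicate p Gen_x) 1 - Poly_Mapping.single [Gen_x] \<epsilon> - Poly_Mapping.single [] \<alpha>,
     Poly_Mapping.single (replicate p Gen_y) 1 - Poly_Mapping.single [] \<beta>,
     Poly_Mapping.single [Gen_y, Gen_x] 1 - Poly_Mapping.single [Gen_x, Gen_y] \<rho> - Poly_Mapping.single [Gen_y] \<epsilon>}"

text \<open>Both kinds of symbol algebras are given by \<open>x\<^sup>p = \<epsilon>x + \<alpha>\<close>, \<open>y\<^sup>p = \<beta>\<close>, \<open>yx = \<rho>xy + \<epsilon>y\<close>,
  with \<open>\<epsilon> = 0\<close>, respectively \<open>\<epsilon> = \<rho> = 1\<close>.\<close>

definition symbol_presentation :: "nat \<Rightarrow> 'f::field \<Rightarrow> 'f \<Rightarrow> 'f \<Rightarrow> 'f \<Rightarrow> ('f, (symbol_gen list \<Rightarrow>\<^sub>0 'f) set) module" where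
  "symbol_presentation p \<epsilon> \<rho> \<alpha> \<beta> = quotient_algebra (monoid_algebra word_monoid) (symbol_relators p \<epsilon> \<rho> \<alpha> \<beta>)"

lemma symbol_algebra_presentation:
  "symbol_algebra p \<rho> \<alpha> \<beta> = symbol_presentation p 0 \<rho> \<alpha> \<beta>"
  "symbol_algebra_char_p p \<alpha> \<beta> = symbol_presentation p 1 1 \<alpha> \<beta>"
  by (simp_all add: symbol_algebra_def symbol_algebra_char_p_def symbol_presentation_def symbol_relators_def
      free_algebra_def word_monoid_def)

definition symbol_word :: "nat \<Rightarrow> 'f::field \<Rightarrow> 'f \<Rightarrow> 'f \<Rightarrow> 'f \<Rightarrow> symbol_gen list \<Rightarrow> (symbol_gen list \<Rightarrow>\<^sub>0 'f) set" where
  "symbol_word p \<epsilon> \<rho> \<alpha> \<beta> w = assoc_algebra.coset_proj (monoid_algebra word_monoid) (symbol_relators p \<epsilon> \<rho> \<alpha> \<beta>) (Poly_Mapping.single w 1)"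

definition symbol_monomial :: "nat \<Rightarrow> 'f::field \<Rightarrow> 'f \<Rightarrow> 'f \<Rightarrow> 'f \<Rightarrow> nat \<Rightarrow> nat \<Rightarrow> (symbol_gen list \<Rightarrow>\<^sub>0 'f) set" where
  "symbol_monomial p \<epsilon> \<rho> \<alpha> \<beta> a b = symbol_word p \<epsilon> \<rho> \<alpha> \<beta> (replicate a Gen_x @ replicate b Gen_y)"

lemma single_smult: "Poly_Mapping.single g c = Poly_Mapping.map ((*) c) (Poly_Mapping.single g (1::'f::field))"
  by (rule poly_mapping_eqI) (simp add: lookup_map_mult lookup_single when_def)

context
  fixes p :: nat and \<epsilon> \<rho> \<alpha> \<beta> :: "'f::field"
begin

interpretation FA: assoc_algebra "monoid_algebra word_monoid :: ('f, symbol_gen list \<Rightarrow>\<^sub>0 'f) module"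
  by (rule monoid_algebra_assoc_algebra[OF word_monoid])

lemma symbol_relators_carrier: "symbol_relators p \<epsilon> \<rho> \<alpha> \<beta> \<subseteq> carrier (monoid_algebra word_monoid)"
  by (simp add: monoid_algebra_sel word_monoid_def)

abbreviation "Sy \<equiv> symbol_presentation p \<epsilon> \<rho> \<alpha> \<beta>"
abbreviation "sw \<equiv> symbol_word p \<epsilon> \<rho> \<alpha> \<beta>"

lemma symbol_presentation_assoc_algebra: "assoc_algebra Sy"
  unfolding symbol_presentation_def by (rule FA.quotient_algebra_props(1)[OF symbol_relators_carrier])

interpretation Sy: assoc_algebra Sy by (rule symbol_presentation_assoc_algebra)

lemma symbol_word_props:
  "sw w \<in> carrier Sy" "sw (u @ v) = sw u \<otimes>\<^bsub>Sy\<^esub> sw v" "sw [] = \<one>\<^bsub>Sy\<^esub>"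
proof -
  note q = FA.quotient_algebra_props[OF symbol_relators_carrier, folded symbol_presentation_def]
  have c: "Poly_Mapping.single w (1::'f) \<in> carrier (monoid_algebra word_monoid)" for w :: "symbol_gen list"
    by (simp add: monoid_algebra_sel word_monoid_def)
  show "sw w \<in> carrier Sy" unfolding symbol_word_def using q(4) c by blast
  have "Poly_Mapping.single (u @ v) (1::'f) = Poly_Mapping.single u 1 \<otimes>\<^bsub>monoid_algebra word_monoid\<^esub> Poly_Mapping.single v 1"
    by (simp add: monoid_algebra_sel monoid_convolution_single word_monoid_def)
  then show "sw (u @ v) = sw u \<otimes>\<^bsub>Sy\<^esub> sw v" unfolding symbol_word_def using ring_hom_mult[OF q(2) c c] by metis
  have "Poly_Mapping.single [] (1::'f) = \<one>\<^bsub>monoid_algebra (word_monoid :: symbol_gen list monoid)\<^esub>"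
    by (simp add: monoid_algebra_sel word_monoid_def)
  then show "sw [] = \<one>\<^bsub>Sy\<^esub>" unfolding symbol_word_def using ring_hom_one[OF q(2)] by metis
qed

lemma symbol_word_relations:
  "sw (replicate p Gen_x) = \<epsilon> \<odot>\<^bsub>Sy\<^esub> sw [Gen_x] \<oplus>\<^bsub>Sy\<^esub> \<alpha> \<odot>\<^bsub>Sy\<^esub> sw []"
  "sw (replicate p Gen_y) = \<beta> \<odot>\<^bsub>Sy\<^esub> sw []"
  "sw [Gen_y, Gen_x] = \<rho> \<odot>\<^bsub>Sy\<^esub> sw [Gen_x, Gen_y] \<oplus>\<^bsub>Sy\<^esub> \<epsilon> \<odot>\<^bsub>Sy\<^esub> sw [Gen_y]"
proof -
  let ?A = "monoid_algebra word_monoid :: ('f, symbol_gen list \<Rightarrow>\<^sub>0 'f) module"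
  let ?S = "symbol_relators p \<epsilon> \<rho> \<alpha> \<beta>"
  note q = FA.quotient_algebra_props[OF symbol_relators_carrier, folded symbol_presentation_def]
  have carr: "u \<in> carrier ?A" for u by (simp add: monoid_algebra_sel word_monoid_def)
  have minus: "u \<ominus>\<^bsub>?A\<^esub> v = u - v" for u v
  proof -
    have "(u - v) \<oplus>\<^bsub>?A\<^esub> v = u" by (simp add: monoid_algebra_sel)
    moreover have "(u \<ominus>\<^bsub>?A\<^esub> v) \<oplus>\<^bsub>?A\<^esub> v = u" using carr by (simp add: FA.minus_eq FA.a_assoc FA.l_neg)
    ultimately have "(u \<ominus>\<^bsub>?A\<^esub> v) + v = (u - v) + v" by (simp only: monoid_algebra_sel)
    then show ?thesis by (simp only: add_right_cancel)
  qed
  have single: "FA.coset_proj ?S (Poly_Mapping.single w c) = c \<odot>\<^bsub>Sy\<^esub> sw w" for w c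
    unfolding symbol_word_def q(3)[OF carr, symmetric] by (subst single_smult) (simp add: monoid_algebra_sel)
  have add: "FA.coset_proj ?S (u + v) = FA.coset_proj ?S u \<oplus>\<^bsub>Sy\<^esub> FA.coset_proj ?S v" for u v
    using ring_hom_add[OF q(2) carr carr] by (simp add: monoid_algebra_sel)
  have rel: "FA.coset_proj ?S u = FA.coset_proj ?S v" if "u - v \<in> ?S" for u v
    using q(5)[OF carr carr] FA.genideal_self[OF symbol_relators_carrier] that minus by (metis subsetD)
  show "sw (replicate p Gen_x) = \<epsilon> \<odot>\<^bsub>Sy\<^esub> sw [Gen_x] \<oplus>\<^bsub>Sy\<^esub> \<alpha> \<odot>\<^bsub>Sy\<^esub> sw []"
    unfolding single[symmetric] add[symmetric] unfolding symbol_word_def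
    by (rule rel) (simp add: symbol_relators_def diff_diff_eq)
  show "sw (replicate p Gen_y) = \<beta> \<odot>\<^bsub>Sy\<^esub> sw []"
    unfolding single[symmetric] unfolding symbol_word_def
    by (rule rel) (simp add: symbol_relators_def)
  show "sw [Gen_y, Gen_x] = \<rho> \<odot>\<^bsub>Sy\<^esub> sw [Gen_x, Gen_y] \<oplus>\<^bsub>Sy\<^esub> \<epsilon> \<odot>\<^bsub>Sy\<^esub> sw [Gen_y]"
    unfolding single[symmetric] add[symmetric] unfolding symbol_word_def
    by (rule rel) (simp add: symbol_relators_def diff_diff_eq)
qed

text \<open>The spanning half of the basis theorem: the relations bring every word into the form
  \<open>x^a y^b\<close> with \<open>a, b < p\<close>. Linear independence of these monomials is
  obtained later from their matrices.\<close>

lemma symbol_presentation_span: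
  assumes "p \<ge> 2"
  shows "carrier Sy = lin_span Sy {symbol_monomial p \<epsilon> \<rho> \<alpha> \<beta> a b | a b. a < p \<and> b < p}"
proof -
  let ?B = "{symbol_monomial p \<epsilon> \<rho> \<alpha> \<beta> a b | a b. a < p \<and> b < p}"
  let ?W = "lin_span Sy ?B"
  let ?x = "\<lambda>a. replicate a Gen_x" and ?y = "\<lambda>b. replicate b Gen_y"
  note w = symbol_word_props
  have Bc: "?B \<subseteq> carrier Sy" using w(1) by (auto simp: symbol_monomial_def)
  \<comment> \<open>Exponents from \<open>p\<close> on are lowered by the relations for
    \<open>x^p\<close> and \<open>y^p\<close>. Replacing \<open>x^p\<close> by
    \<open>\<epsilon> x + \<alpha>\<close> decreases the total exponent because
    \<open>p \<ge> 2\<close>.\<close>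
  have mon: "sw (?x a @ ?y b) \<in> ?W" for a b
  proof (induction "a + b" arbitrary: a b rule: less_induct)
    case less
    consider "a < p" "b < p" | "a \<ge> p" | "b \<ge> p" by linarith
    then show ?case
    proof cases
      case 1 then show ?thesis by (intro lin_span.base) (auto simp: symbol_monomial_def)
    next
      case 2
      then obtain k where k: "a = p + k" using le_Suc_ex by blast
      have "sw (?x a @ ?y b) = sw (?x p) \<otimes>\<^bsub>Sy\<^esub> sw (?x k @ ?y b)"
        unfolding k replicate_add by (simp add: w(2)[symmetric])
      also have "\<dots> = \<epsilon> \<odot>\<^bsub>Sy\<^esub> sw (?x (Suc k) @ ?y b) \<oplus>\<^bsub>Sy\<^esub> \<alpha> \<odot>\<^bsub>Sy\<^esub> sw (?x k @ ?y b)"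
        using w(2)[of "[Gen_x]" "?x k @ ?y b"] w(2)[of "[]" "?x k @ ?y b"]
        by (simp add: symbol_word_relations w(1) Sy.l_distr Sy.smult_mult_left)
      also have "\<dots> \<in> ?W" using assms k by (intro lin_span.add lin_span.smult less) auto
      finally show ?thesis .
    next
      case 3
      then obtain k where k: "b = p + k" using le_Suc_ex by blast
      have "sw (?x a @ ?y b) = sw (?x a) \<otimes>\<^bsub>Sy\<^esub> sw (?y p @ ?y k)"
        unfolding k replicate_add by (simp add: w(2)[symmetric])
      also have "\<dots> = sw (?x a) \<otimes>\<^bsub>Sy\<^esub> (\<beta> \<odot>\<^bsub>Sy\<^esub> (sw [] \<otimes>\<^bsub>Sy\<^esub> sw (?y k)))"
        by (simp add: w(2)[of "?y p"] symbol_word_relations w(1) Sy.smult_mult_left)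
      also have "\<dots> = \<beta> \<odot>\<^bsub>Sy\<^esub> sw (?x a @ ?y k)"
        by (simp add: w(1) w(2)[symmetric] Sy.smult_mult_right)
      also have "\<dots> \<in> ?W" using assms k by (intro lin_span.smult less) auto
      finally show ?thesis .
    qed
  qed
  have xW: "sw [Gen_x] \<otimes>\<^bsub>Sy\<^esub> z \<in> ?W" if "z \<in> ?W" for z
  proof (rule Sy.lin_span_mult_left[OF Bc w(1) _ that])
    fix z assume "z \<in> ?B"
    then obtain a b where "z = sw (?x a @ ?y b)" by (auto simp: symbol_monomial_def)
    then show "sw [Gen_x] \<otimes>\<^bsub>Sy\<^esub> z \<in> ?W" using mon[of "Suc a" b] by (simp add: w(2)[symmetric])
  qed
  \<comment> \<open>By induction on \<open>a\<close>, the letter \<open>y\<close> moves past one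
    \<open>x\<close> at a time: \<open>yx = \<rho> xy + \<epsilon> y\<close> leaves two terms in
    which it stands before fewer letters \<open>x\<close>.\<close>
  have ymon: "sw [Gen_y] \<otimes>\<^bsub>Sy\<^esub> sw (?x a @ ?y b) \<in> ?W" for a b
  proof (induction a)
    case 0 then show ?case using mon[of 0 "Suc b"] by (simp add: w(2)[symmetric])
  next
    case (Suc a)
    have "sw [Gen_y] \<otimes>\<^bsub>Sy\<^esub> sw (?x (Suc a) @ ?y b) = sw [Gen_y, Gen_x] \<otimes>\<^bsub>Sy\<^esub> sw (?x a @ ?y b)"
      by (simp add: w(2)[symmetric])
    also have "\<dots> = \<rho> \<odot>\<^bsub>Sy\<^esub> (sw [Gen_x, Gen_y] \<otimes>\<^bsub>Sy\<^esub> sw (?x a @ ?y b)) \<oplus>\<^bsub>Sy\<^esub> \<epsilon> \<odot>\<^bsub>Sy\<^esub> (sw [Gen_y] \<otimes>\<^bsub>Sy\<^esub> sw (?x a @ ?y b))"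
      by (simp add: symbol_word_relations(3) w(1) Sy.l_distr Sy.smult_mult_left)
    also have "sw [Gen_x, Gen_y] = sw [Gen_x] \<otimes>\<^bsub>Sy\<^esub> sw [Gen_y]" by (simp add: w(2)[symmetric])
    also have "sw [Gen_x] \<otimes>\<^bsub>Sy\<^esub> sw [Gen_y] \<otimes>\<^bsub>Sy\<^esub> sw (?x a @ ?y b) = sw [Gen_x] \<otimes>\<^bsub>Sy\<^esub> (sw [Gen_y] \<otimes>\<^bsub>Sy\<^esub> sw (?x a @ ?y b))"
      by (rule Sy.m_assoc[OF w(1) w(1) w(1)])
    finally show ?case using Suc xW by (simp add: lin_span.add lin_span.smult)
  qed
  have yW: "sw [Gen_y] \<otimes>\<^bsub>Sy\<^esub> z \<in> ?W" if "z \<in> ?W" for z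
  proof (rule Sy.lin_span_mult_left[OF Bc w(1) _ that])
    fix z assume "z \<in> ?B"
    then obtain a b where "z = sw (?x a @ ?y b)" by (auto simp: symbol_monomial_def)
    then show "sw [Gen_y] \<otimes>\<^bsub>Sy\<^esub> z \<in> ?W" using ymon by simp
  qed
  have words: "sw u \<in> ?W" for u
  proof (induction u)
    case Nil then show ?case using mon[of 0 0] by simp
  next
    case (Cons c u)
    have "sw (c # u) = sw [c] \<otimes>\<^bsub>Sy\<^esub> sw u" by (simp add: w(2)[symmetric])
    then show ?case using Cons xW yW by (cases c) auto
  qed
  show ?thesis
  proof
    show "?W \<subseteq> carrier Sy" by (rule Sy.lin_span_carrier[OF Bc])
    have "carrier Sy = lin_span Sy {sw g | g. g \<in> carrier (word_monoid :: symbol_gen list monoid)}"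
      unfolding symbol_presentation_def symbol_word_def
      by (rule monoid_algebra_quotient_span[OF word_monoid symbol_relators_carrier])
    also have "\<dots> \<subseteq> ?W" by (rule lin_span_mono_closed) (use words in blast)
    finally show "carrier Sy \<subseteq> ?W" .
  qed
qed

definition letter_exponents :: "symbol_gen \<Rightarrow> nat \<times> nat" where
  "letter_exponents c = (case c of Gen_x \<Rightarrow> (1, 0) | Gen_y \<Rightarrow> (0, 1))"

lemma word_diagonal_replicate:
  "word_diagonal \<xi> (replicate a (1, 0) @ replicate b (0, 1)) j = \<xi> j ^ a"
proof (induction a)
  case 0
  show ?case by (simp, induction b arbitrary: j) auto
qed simp

text \<open>The generator \<open>x\<close> acts as the diagonal matrix with entries
  \<open>\<xi> j\<close>, and \<open>y\<close> as \<open>\<eta>\<close> times the cyclic shift. In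
  position \<open>(j, j + 1)\<close> the product \<open>yx\<close> has
  \<open>\<eta> \<xi> (j + 1)\<close> and \<open>xy\<close> has \<open>\<eta> \<xi> j\<close>, so
  the commutation relation amounts to the recursion for \<open>\<xi>\<close>.\<close>

lemma symbol_presentation_rep:
  fixes \<xi> :: "nat \<Rightarrow> 'f alg_closure"
  assumes p: "p \<ge> 2"
    and xi: "\<And>j. \<xi> (j + p) = \<xi> j" "\<And>j. \<xi> j ^ p = to_ac \<epsilon> * \<xi> j + to_ac \<alpha>" "\<And>j. \<xi> (Suc j) = to_ac \<rho> * \<xi> j + to_ac \<epsilon>"
    and eta: "\<eta> ^ p = to_ac \<beta>"
  obtains \<psi> where "alg_rep p Sy \<psi>"
    "\<And>a b. \<psi> (symbol_monomial p \<epsilon> \<rho> \<alpha> \<beta> a b) = diag_shift p \<eta> (\<lambda>j. \<xi> j ^ a) b"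
proof -
  let ?d = "\<lambda>(a, b). diag_shift p \<eta> (\<lambda>j. \<xi> j ^ a) b"
  define f where "f w = mat_list_prod p (map ?d (map letter_exponents w))" for w
  have set: "set (map ?d cs) \<subseteq> carrier_mat p p" for cs by auto
  have f_carr: "f w \<in> carrier_mat p p" for w unfolding f_def by (rule mat_list_prod_carrier[OF set])
  have f_app: "f (u @ v) = f u * f v" for u v
    unfolding f_def map_append by (rule mat_list_prod_append[OF set set])
  have f_diag: "f w = diag_shift p \<eta> (word_diagonal \<xi> (map letter_exponents w)) (sum_list (map snd (map letter_exponents w)))" for w
    unfolding f_def by (rule word_prod) (use p xi(1) in auto)
  have f_mon: "f (replicate a Gen_x @ replicate b Gen_y) = diag_shift p \<eta> (\<lambda>j. \<xi> j ^ a) b" for a b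
  proof -
    have "word_diagonal \<xi> (map letter_exponents (replicate a Gen_x @ replicate b Gen_y)) = (\<lambda>j. \<xi> j ^ a)"
      by (rule ext) (simp add: letter_exponents_def word_diagonal_replicate[unfolded One_nat_def])
    moreover have "sum_list (map snd (map letter_exponents (replicate a Gen_x @ replicate b Gen_y))) = b"
      by (simp add: letter_exponents_def sum_list_replicate)
    ultimately show ?thesis by (simp only: f_diag)
  qed
  obtain \<phi> where phi: "alg_rep p (monoid_algebra word_monoid) \<phi>"
    "\<And>g c. \<phi> (Poly_Mapping.single g c) = to_ac c \<cdot>\<^sub>m f g" "\<And>u v. \<phi> (u - v) = \<phi> u - \<phi> v"
  proof (rule monoid_algebra_rep[OF word_monoid, of f p])
    show "f \<one>\<^bsub>word_monoid\<^esub> = 1\<^sub>m p" by (simp add: f_def word_monoid_def)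
  qed (auto simp: word_monoid_def f_carr f_app)
  have r1: "f (replicate p Gen_x) = to_ac \<epsilon> \<cdot>\<^sub>m f [Gen_x] + to_ac \<alpha> \<cdot>\<^sub>m f []"
    using f_mon[of p 0] f_mon[of 1 0] f_mon[of 0 0]
    by (intro eq_matI) (auto simp: diag_shift_def xi(2))
  have r2: "f (replicate p Gen_y) = to_ac \<beta> \<cdot>\<^sub>m f []"
    using f_mon[of 0 p] f_mon[of 0 0]
    by (intro eq_matI) (auto simp: diag_shift_def eta)
  have r3: "f [Gen_y, Gen_x] = to_ac \<rho> \<cdot>\<^sub>m f [Gen_x, Gen_y] + to_ac \<epsilon> \<cdot>\<^sub>m f [Gen_y]"
    using f_diag[of "[Gen_y, Gen_x]"] f_mon[of 1 1] f_mon[of 0 1]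
    by (intro eq_matI) (auto simp: diag_shift_def letter_exponents_def xi(3) algebra_simps)
  have "\<phi> s = 0\<^sub>m p p" if "s \<in> symbol_relators p \<epsilon> \<rho> \<alpha> \<beta>" for s
    using that f_carr[of "[Gen_x]"] f_carr[of "[]"] f_carr[of "[Gen_y]"] f_carr[of "[Gen_x, Gen_y]"]
    unfolding symbol_relators_def by (auto simp: phi(2,3) r1 r2 r3 intro!: eq_matI)
  from quotient_algebra_rep[OF FA.assoc_algebra_axioms symbol_relators_carrier phi(1) this]
  obtain \<psi> where psi: "alg_rep p Sy \<psi>"
    "\<And>a. a \<in> carrier (monoid_algebra word_monoid) \<Longrightarrow> \<psi> (FA.coset_proj (symbol_relators p \<epsilon> \<rho> \<alpha> \<beta>) a) = \<phi> a"
    unfolding symbol_presentation_def by blast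
  have "\<psi> (symbol_monomial p \<epsilon> \<rho> \<alpha> \<beta> a b) = diag_shift p \<eta> (\<lambda>j. \<xi> j ^ a) b" for a b
    unfolding symbol_monomial_def symbol_word_def
    by (subst psi(2)) (auto simp: monoid_algebra_sel word_monoid_def phi(2) f_mon intro!: eq_matI)
  then show thesis using that psi(1) by blast
qed

end

section \<open>Tensor products\<close>

text \<open>Both the tensor product of a family and that of two algebras are quotients of monoid
  algebras by relators of two shapes, for sums and for scalars. Each shape yields one linearity rule
  for pure tensors.\<close>

lemma monoid_quotient_props:
  fixes M :: "('g, 'x) monoid_scheme" and S :: "('g \<Rightarrow>\<^sub>0 'f::field) set"
  defines "Q \<equiv> quotient_algebra (monoid_algebra M) S"
    and "\<pi> \<equiv> assoc_algebra.coset_proj (monoid_algebra M) S"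
  assumes M: "monoid M" and S: "S \<subseteq> carrier (monoid_algebra M)"
  shows "assoc_algebra Q"
    and "\<And>g c. g \<in> carrier M \<Longrightarrow> \<pi> (Poly_Mapping.single g c) \<in> carrier Q"
    and "\<And>g c. g \<in> carrier M \<Longrightarrow> \<pi> (Poly_Mapping.single g c) = c \<odot>\<^bsub>Q\<^esub> \<pi> (Poly_Mapping.single g 1)"
    and "\<pi> (Poly_Mapping.single \<one>\<^bsub>M\<^esub> 1) = \<one>\<^bsub>Q\<^esub>"
    and "\<And>u g h. g \<in> carrier M \<Longrightarrow> h \<in> carrier M \<Longrightarrow> u \<in> carrier M \<Longrightarrow>
      Poly_Mapping.single u 1 - Poly_Mapping.single g 1 - Poly_Mapping.single h 1 \<in> S \<Longrightarrow>
      \<pi> (Poly_Mapping.single u 1) = \<pi> (Poly_Mapping.single g 1) \<oplus>\<^bsub>Q\<^esub> \<pi> (Poly_Mapping.single h 1)"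
    and "\<And>u g c. g \<in> carrier M \<Longrightarrow> u \<in> carrier M \<Longrightarrow>
      Poly_Mapping.single u 1 - Poly_Mapping.single g c \<in> S \<Longrightarrow>
      \<pi> (Poly_Mapping.single u 1) = c \<odot>\<^bsub>Q\<^esub> \<pi> (Poly_Mapping.single g 1)"
proof -
  let ?A = "monoid_algebra M :: ('f, 'g \<Rightarrow>\<^sub>0 'f) module"
  interpret A: assoc_algebra ?A by (rule monoid_algebra_assoc_algebra[OF M])
  note q = A.quotient_algebra_props[OF S, folded Q_def \<pi>_def]
  have sing: "Poly_Mapping.single g (c :: 'f) \<in> carrier ?A" if "g \<in> carrier M" for g c
    using that by (simp add: monoid_algebra_sel)
  have minus: "u \<ominus>\<^bsub>?A\<^esub> v = u - v" if "u \<in> carrier ?A" "v \<in> carrier ?A" for u v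
  proof -
    have "(u \<ominus>\<^bsub>?A\<^esub> v) \<oplus>\<^bsub>?A\<^esub> v = u" using that by (simp add: A.minus_eq A.a_assoc A.l_neg)
    then have "(u \<ominus>\<^bsub>?A\<^esub> v) + v = (u - v) + v" by (simp add: monoid_algebra_sel)
    then show ?thesis by (simp only: add_right_cancel)
  qed
  have rel: "\<pi> u = \<pi> v" if "u - v \<in> S" "u \<in> carrier ?A" "v \<in> carrier ?A" for u v
    using q(5)[OF that(2,3)] A.genideal_self[OF S] that(1) minus[OF that(2,3)] by (metis subsetD)
  show "assoc_algebra Q" by (rule q(1))
  show "\<pi> (Poly_Mapping.single g c) \<in> carrier Q" if "g \<in> carrier M" for g c
    using q(4) sing[OF that] by blast
  show smult: "\<pi> (Poly_Mapping.single g c) = c \<odot>\<^bsub>Q\<^esub> \<pi> (Poly_Mapping.single g 1)" if "g \<in> carrier M" for g c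
    unfolding q(3)[OF sing[OF that], symmetric] by (subst single_smult) (simp add: monoid_algebra_sel)
  show "\<pi> (Poly_Mapping.single \<one>\<^bsub>M\<^esub> 1) = \<one>\<^bsub>Q\<^esub>"
    using ring_hom_one[OF q(2)] by (simp add: monoid_algebra_sel)
  show "\<pi> (Poly_Mapping.single u 1) = \<pi> (Poly_Mapping.single g 1) \<oplus>\<^bsub>Q\<^esub> \<pi> (Poly_Mapping.single h 1)"
    if g: "g \<in> carrier M" "h \<in> carrier M" "u \<in> carrier M"
      and r: "Poly_Mapping.single u 1 - Poly_Mapping.single g 1 - Poly_Mapping.single h 1 \<in> S" for u g h
  proof -
    have "Poly_Mapping.single g (1::'f) + Poly_Mapping.single h 1 \<in> carrier ?A"
      using A.a_closed[OF sing[OF g(1), of 1] sing[OF g(2), of 1]] by (simp add: monoid_algebra_sel(5))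
    then have "\<pi> (Poly_Mapping.single u 1) = \<pi> (Poly_Mapping.single g 1 + Poly_Mapping.single h 1)"
      using r sing[OF g(3)] by (intro rel) (simp_all add: diff_diff_eq)
    then show ?thesis using ring_hom_add[OF q(2) sing[OF g(1)] sing[OF g(2)], of 1 1] by (simp add: monoid_algebra_sel(5))
  qed
  show "\<pi> (Poly_Mapping.single u 1) = c \<odot>\<^bsub>Q\<^esub> \<pi> (Poly_Mapping.single g 1)"
    if g: "g \<in> carrier M" "u \<in> carrier M" and r: "Poly_Mapping.single u 1 - Poly_Mapping.single g c \<in> S" for u g c
    using rel[OF r sing[OF g(2)] sing[OF g(1)]] smult[OF g(1), of c] by (simp only:)
qed

lemma product_monoid:
  assumes "\<And>i. i \<in> I \<Longrightarrow> monoid (G i)"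
  shows "monoid (product_group I G)"
proof (rule monoidI)
  fix x y z
  assume x: "x \<in> carrier (product_group I G)"
  then show "\<one>\<^bsub>product_group I G\<^esub> \<otimes>\<^bsub>product_group I G\<^esub> x = x" "x \<otimes>\<^bsub>product_group I G\<^esub> \<one>\<^bsub>product_group I G\<^esub> = x"
    using assms by (auto simp: fun_eq_iff PiE_def Pi_def extensional_def monoid.l_one monoid.r_one)
  assume y: "y \<in> carrier (product_group I G)"
  with x show "x \<otimes>\<^bsub>product_group I G\<^esub> y \<in> carrier (product_group I G)"
    using assms by (auto simp: PiE_def Pi_def monoid.m_closed)
  assume z: "z \<in> carrier (product_group I G)"
  with x y show "x \<otimes>\<^bsub>product_group I G\<^esub> y \<otimes>\<^bsub>product_group I G\<^esub> z = x \<otimes>\<^bsub>product_group I G\<^esub> (y \<otimes>\<^bsub>product_group I G\<^esub> z)"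
    using assms by (auto simp: fun_eq_iff PiE_def Pi_def monoid.m_assoc)
qed (use assms in \<open>auto simp: monoid.one_closed\<close>)

definition family_tensor ::
    "'i set \<Rightarrow> ('i \<Rightarrow> ('f::field, 'a) module) \<Rightarrow> ('i \<Rightarrow> 'a) \<Rightarrow> (('i \<Rightarrow> 'a) \<Rightarrow>\<^sub>0 'f) set" where
  "family_tensor I A t = assoc_algebra.coset_proj (monoid_algebra (product_group I A)) (tensor_family_relators I A) (Poly_Mapping.single t 1)"

context
  fixes I :: "'i set" and A :: "'i \<Rightarrow> ('f::field, 'a) module"
  assumes A: "\<And>i. i \<in> I \<Longrightarrow> assoc_algebra (A i)"
begin

lemma tensor_family_monoid: "monoid (product_group I A)"
  by (rule product_monoid) (meson A assoc_algebra.axioms(1) ring.is_monoid)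

lemma tensor_family_upd: "t \<in> (\<Pi>\<^sub>E j\<in>I. carrier (A j)) \<Longrightarrow> i \<in> I \<Longrightarrow> a \<in> carrier (A i) \<Longrightarrow> t(i := a) \<in> carrier (product_group I A)"
  by (auto simp: PiE_def Pi_def extensional_def)

lemma tensor_family_relators_carrier: "tensor_family_relators I A \<subseteq> carrier (monoid_algebra (product_group I A))"
proof -
  interpret P: assoc_algebra "monoid_algebra (product_group I A) :: ('f, ('i \<Rightarrow> 'a) \<Rightarrow>\<^sub>0 'f) module"
    by (rule monoid_algebra_assoc_algebra[OF tensor_family_monoid])
  have sub: "u - v \<in> carrier (monoid_algebra (product_group I A))"
    if "u \<in> carrier (monoid_algebra (product_group I A))" "v \<in> carrier (monoid_algebra (product_group I A))" for u v :: "('i \<Rightarrow> 'a) \<Rightarrow>\<^sub>0 'f"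
  proof -
    have "Poly_Mapping.keys (u - v) \<subseteq> Poly_Mapping.keys u \<union> Poly_Mapping.keys v" by (auto simp: in_keys_iff lookup_minus)
    then show ?thesis using that by (auto simp: monoid_algebra_sel)
  qed
  have s: "Poly_Mapping.single g (c::'f) \<in> carrier (monoid_algebra (product_group I A))" if "g \<in> carrier (product_group I A)" for g c
    using that by (simp add: monoid_algebra_sel)
  have cl: "a \<oplus>\<^bsub>A i\<^esub> b \<in> carrier (A i)" "c \<odot>\<^bsub>A i\<^esub> a \<in> carrier (A i)"
    if "i \<in> I" "a \<in> carrier (A i)" "b \<in> carrier (A i)" for i a b c
    using A[OF that(1)] that by (auto intro: assoc_algebra.smult_closed ring.ring_simprules(1)[OF assoc_algebra.axioms(1)])
  show ?thesis
  proof
    fix s assume "s \<in> tensor_family_relators I A"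
    then show "s \<in> carrier (monoid_algebra (product_group I A))"
      unfolding tensor_family_relators_def
    proof (elim UnE CollectE exE conjE)
      fix t i a b
      assume "t \<in> (\<Pi>\<^sub>E j\<in>I. carrier (A j))" "i \<in> I" "a \<in> carrier (A i)" "b \<in> carrier (A i)"
        "s = Poly_Mapping.single (t(i := a \<oplus>\<^bsub>A i\<^esub> b)) 1 - Poly_Mapping.single (t(i := a)) 1 - Poly_Mapping.single (t(i := b)) 1"
      then show ?thesis using cl by (simp only:) (intro sub s tensor_family_upd)
    next
      fix t i c a
      assume "t \<in> (\<Pi>\<^sub>E j\<in>I. carrier (A j))" "i \<in> I" "a \<in> carrier (A i)"
        "s = Poly_Mapping.single (t(i := c \<odot>\<^bsub>A i\<^esub> a)) 1 - Poly_Mapping.single (t(i := a)) c"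
      then show ?thesis using cl by (simp only:) (intro sub s tensor_family_upd)
    qed
  qed
qed

lemmas family_props = monoid_quotient_props[OF tensor_family_monoid tensor_family_relators_carrier,
  folded tensor_family_def family_tensor_def]

lemma tensor_family_assoc_algebra: "assoc_algebra (tensor_family I A)"
  by (rule family_props(1))

lemma family_tensor_carrier: "t \<in> (\<Pi>\<^sub>E j\<in>I. carrier (A j)) \<Longrightarrow> family_tensor I A t \<in> carrier (tensor_family I A)"
  using family_props(2)[of t 1] by (simp add: family_tensor_def)

lemma family_tensor_add:
  assumes "t \<in> (\<Pi>\<^sub>E j\<in>I. carrier (A j))" "i \<in> I" "a \<in> carrier (A i)" "b \<in> carrier (A i)"
  shows "family_tensor I A (t(i := a \<oplus>\<^bsub>A i\<^esub> b)) = family_tensor I A (t(i := a)) \<oplus>\<^bsub>tensor_family I A\<^esub> family_tensor I A (t(i := b))"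
proof (rule family_props(5))
  have "a \<oplus>\<^bsub>A i\<^esub> b \<in> carrier (A i)" using A[OF assms(2)] assms by (auto intro: ring.ring_simprules(1)[OF assoc_algebra.axioms(1)])
  then show "t(i := a \<oplus>\<^bsub>A i\<^esub> b) \<in> carrier (product_group I A)" using assms by (intro tensor_family_upd)
  show "Poly_Mapping.single (t(i := a \<oplus>\<^bsub>A i\<^esub> b)) 1 - Poly_Mapping.single (t(i := a)) 1 - Poly_Mapping.single (t(i := b)) 1 \<in> tensor_family_relators I A"
    unfolding tensor_family_relators_def using assms by blast
qed (use assms in \<open>auto intro!: tensor_family_upd simp del: carrier_product_group\<close>)

lemma family_tensor_smult:
  assumes "t \<in> (\<Pi>\<^sub>E j\<in>I. carrier (A j))" "i \<in> I" "a \<in> carrier (A i)"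
  shows "family_tensor I A (t(i := c \<odot>\<^bsub>A i\<^esub> a)) = c \<odot>\<^bsub>tensor_family I A\<^esub> family_tensor I A (t(i := a))"
proof (rule family_props(6))
  have "c \<odot>\<^bsub>A i\<^esub> a \<in> carrier (A i)" using A[OF assms(2)] assms by (auto intro: assoc_algebra.smult_closed)
  then show "t(i := c \<odot>\<^bsub>A i\<^esub> a) \<in> carrier (product_group I A)" using assms by (intro tensor_family_upd)
  show "Poly_Mapping.single (t(i := c \<odot>\<^bsub>A i\<^esub> a)) 1 - Poly_Mapping.single (t(i := a)) c \<in> tensor_family_relators I A"
    unfolding tensor_family_relators_def using assms by blast
qed (use assms in \<open>auto intro!: tensor_family_upd simp del: carrier_product_group\<close>)

text \<open>Multilinearity allows replacing the entries of a pure tensor by generators, one position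
  after the other.\<close>

lemma tensor_family_span:
  assumes "finite I" and B: "\<And>i. i \<in> I \<Longrightarrow> B i \<subseteq> carrier (A i)" "\<And>i. i \<in> I \<Longrightarrow> carrier (A i) = lin_span (A i) (B i)"
  shows "carrier (tensor_family I A) = lin_span (tensor_family I A) (family_tensor I A ` (\<Pi>\<^sub>E i\<in>I. B i))"
proof -
  let ?T = "tensor_family I A"
  let ?W = "lin_span ?T (family_tensor I A ` (\<Pi>\<^sub>E i\<in>I. B i))"
  interpret T: assoc_algebra ?T by (rule tensor_family_assoc_algebra)
  have PB: "(\<Pi>\<^sub>E i\<in>I. B i) \<subseteq> (\<Pi>\<^sub>E i\<in>I. carrier (A i))" using B(1) by (intro PiE_mono) auto
  \<comment> \<open>\<open>J\<close> is the set of positions whose entries are still arbitrary. The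
    induction over \<open>J\<close> expands one such entry along \<open>lin_span\<close> and moves
    its position out of \<open>J\<close>.\<close>
  have main: "family_tensor I A t \<in> ?W"
    if "finite J" "J \<subseteq> I" "t \<in> (\<Pi>\<^sub>E i\<in>I. carrier (A i))" "\<And>i. i \<in> I - J \<Longrightarrow> t i \<in> B i" for J t
    using that
  proof (induction J arbitrary: t)
    case empty
    then have "t \<in> (\<Pi>\<^sub>E i\<in>I. B i)" by (auto simp: PiE_def Pi_def)
    then show ?case by (intro lin_span.base) auto
  next
    case (insert i J)
    then have i: "i \<in> I" by auto
    interpret Ai: assoc_algebra "A i" by (rule A[OF i])
    have "family_tensor I A (t(i := a)) \<in> ?W" if "a \<in> lin_span (A i) (B i)" for a
      using that
    proof induction
      case zero
      have "family_tensor I A (t(i := 0 \<odot>\<^bsub>A i\<^esub> \<zero>\<^bsub>A i\<^esub>)) = 0 \<odot>\<^bsub>?T\<^esub> family_tensor I A (t(i := \<zero>\<^bsub>A i\<^esub>))"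
        using insert.prems i by (intro family_tensor_smult) auto
      also have "\<dots> = \<zero>\<^bsub>?T\<^esub>"
        using tensor_family_upd[OF insert.prems(2) i Ai.zero_closed]
        by (intro T.smult_zero_left family_tensor_carrier) simp
      finally show ?case by (simp only: Ai.smult_zero_right lin_span.zero)
    next
      case (base b)
      show ?case
      proof (rule insert.IH)
        show "t(i := b) \<in> (\<Pi>\<^sub>E i\<in>I. carrier (A i))"
          using tensor_family_upd[OF insert.prems(2) i, of b] B(1)[OF i] base by auto
        show "(t(i := b)) j \<in> B j" if "j \<in> I - J" for j using that insert.prems(3)[of j] base by auto
      qed (use insert.prems in auto)
    next
      case (add a b)
      then have "a \<in> carrier (A i)" "b \<in> carrier (A i)" using B(2)[OF i] by auto
      then show ?case using add insert.prems i by (simp only: family_tensor_add lin_span.add)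
    next
      case (smult a c)
      then have "a \<in> carrier (A i)" using B(2)[OF i] by auto
      then show ?case using smult insert.prems i by (simp only: family_tensor_smult lin_span.smult)
    qed
    moreover have "t i \<in> lin_span (A i) (B i)" using insert.prems(2) i B(2)[OF i] by auto
    ultimately show ?case using fun_upd_triv[of t i] by metis
  qed
  show ?thesis
  proof
    show "?W \<subseteq> carrier ?T"
      using PB family_tensor_carrier by (intro T.lin_span_carrier) blast
    have "carrier ?T = lin_span ?T {family_tensor I A g | g. g \<in> carrier (product_group I A)}"
      unfolding tensor_family_def family_tensor_def
      by (rule monoid_algebra_quotient_span[OF tensor_family_monoid tensor_family_relators_carrier])
    also have "\<dots> \<subseteq> ?W"
    proof (rule lin_span_mono_closed, safe)
      fix g assume "g \<in> carrier (product_group I A)"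
      then show "family_tensor I A g \<in> ?W" by (intro main[OF \<open>finite I\<close> subset_refl]) auto
    qed
    finally show "carrier ?T \<subseteq> ?W" .
  qed
qed

end

section \<open>Multilinearity of Kronecker products and representations of tensor products\<close>

lemma mat_prod_upd:
  assumes "i < (m::nat)"
  shows "(\<Prod>j<m. h j (if j = i then x else y j)) = h i x * (\<Prod>j\<in>{..<m}-{i}. h j (y j) :: 'a::comm_monoid_mult)"
proof -
  have "(\<Prod>j<m. h j (if j = i then x else y j)) = h i x * (\<Prod>j\<in>{..<m}-{i}. h j (if j = i then x else y j))"
    using assms by (subst prod.remove[of _ i]) auto
  also have "(\<Prod>j\<in>{..<m}-{i}. h j (if j = i then x else y j)) = (\<Prod>j\<in>{..<m}-{i}. h j (y j))"
    by (rule prod.cong) auto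
  finally show ?thesis .
qed

lemma kron_add:
  assumes "p > 0" "i < m" "U \<in> carrier_mat p p" "N \<in> carrier_mat p p"
  shows "kron p m (\<lambda>j. if j = i then U + N else g j) = kron p m (\<lambda>j. if j = i then U else g j) + kron p m (\<lambda>j. if j = i then N else g j)"
proof (rule eq_matI)
  fix r s assume "r < dim_row (kron p m (\<lambda>j. if j = i then U else g j) + kron p m (\<lambda>j. if j = i then N else g j))"
    "s < dim_col (kron p m (\<lambda>j. if j = i then U else g j) + kron p m (\<lambda>j. if j = i then N else g j))"
  then have rs: "r < p ^ m" "s < p ^ m" by (auto simp: kron_def)
  have d: "dig p i r < p" "dig p i s < p" using assms dig_less by auto
  show "kron p m (\<lambda>j. if j = i then U + N else g j) $$ (r, s) = (kron p m (\<lambda>j. if j = i then U else g j) + kron p m (\<lambda>j. if j = i then N else g j)) $$ (r, s)"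
    using rs assms d by (simp add: kron_def mat_prod_upd[of i m "\<lambda>j M. M $$ (dig p j r, dig p j s)"] distrib_right)
qed (auto simp: kron_def)

lemma kron_smult:
  assumes "p > 0" "i < m" "U \<in> carrier_mat p p"
  shows "kron p m (\<lambda>j. if j = i then c \<cdot>\<^sub>m U else g j) = c \<cdot>\<^sub>m kron p m (\<lambda>j. if j = i then U else g j)"
proof (rule eq_matI)
  fix r s assume "r < dim_row (c \<cdot>\<^sub>m kron p m (\<lambda>j. if j = i then U else g j))" "s < dim_col (c \<cdot>\<^sub>m kron p m (\<lambda>j. if j = i then U else g j))"
  then have rs: "r < p ^ m" "s < p ^ m" by (auto simp: kron_def)
  have d: "dig p i r < p" "dig p i s < p" using assms dig_less by auto
  show "kron p m (\<lambda>j. if j = i then c \<cdot>\<^sub>m U else g j) $$ (r, s) = (c \<cdot>\<^sub>m kron p m (\<lambda>j. if j = i then U else g j)) $$ (r, s)"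
    using rs assms d by (simp add: kron_def mat_prod_upd[of i m "\<lambda>j M. M $$ (dig p j r, dig p j s)"] mult.assoc)
qed (auto simp: kron_def)

lemma smult_one_mat: "(1 :: 'a::comm_ring_1) \<cdot>\<^sub>m M = M"
  by (rule eq_matI) auto

lemma smult_smult_mat: "(c :: 'a::comm_ring_1) \<cdot>\<^sub>m (e \<cdot>\<^sub>m M) = (c * e) \<cdot>\<^sub>m M"
  by (rule eq_matI) (auto simp: mult.assoc)

text \<open>The Kronecker product of the given representations is multiplicative on tuples and
  linear in each entry, so its linear extension kills the relators of the tensor product.\<close>

lemma tensor_family_rep:
  fixes A :: "nat \<Rightarrow> ('f::field, 'a) module"
  assumes p: "p > 0" and A: "\<And>i. i < m \<Longrightarrow> assoc_algebra (A i)" and psi: "\<And>i. i < m \<Longrightarrow> alg_rep p (A i) (\<psi> i)"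
  obtains \<Phi> where "alg_rep (p ^ m) (tensor_family {..<m} A) \<Phi>"
    "\<And>t. t \<in> (\<Pi>\<^sub>E i\<in>{..<m}. carrier (A i)) \<Longrightarrow> \<Phi> (family_tensor {..<m} A t) = kron p m (\<lambda>i. \<psi> i (t i))"
proof -
  let ?I = "{..<m}"
  have A': "\<And>i. i \<in> ?I \<Longrightarrow> assoc_algebra (A i)" using A by auto
  let ?P = "product_group ?I A"
  let ?M = "monoid_algebra ?P :: ('f, (nat \<Rightarrow> 'a) \<Rightarrow>\<^sub>0 'f) module"
  have mon: "monoid ?P" by (rule tensor_family_monoid[OF A'])
  define f where "f t = kron p m (\<lambda>i. \<psi> i (t i))" for t
  have f_mult: "f (s \<otimes>\<^bsub>?P\<^esub> t) = f s * f t" if "s \<in> carrier ?P" "t \<in> carrier ?P" for s t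
  proof -
    have c: "s i \<in> carrier (A i)" "t i \<in> carrier (A i)" if "i < m" for i
      using that \<open>s \<in> carrier ?P\<close> \<open>t \<in> carrier ?P\<close> by auto
    have "f s * f t = kron p m (\<lambda>i. \<psi> i (s i) * \<psi> i (t i))"
      unfolding f_def using c alg_repD(1)[OF psi] by (intro kron_mult[OF p]) auto
    also have "\<dots> = f (s \<otimes>\<^bsub>?P\<^esub> t)"
      unfolding f_def by (rule kron_cong) (simp add: alg_repD(3)[OF psi] c)
    finally show ?thesis ..
  qed
  have f_one: "f \<one>\<^bsub>?P\<^esub> = 1\<^sub>m (p ^ m)"
    unfolding f_def kron_one[OF p, of m, symmetric] by (rule kron_cong) (simp add: alg_repD(4)[OF psi])
  have f_carr: "f t \<in> carrier_mat (p ^ m) (p ^ m)" for t by (simp add: f_def)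
  obtain \<phi> where phi: "alg_rep (p ^ m) ?M \<phi>"
    "\<And>g c. g \<in> carrier ?P \<Longrightarrow> \<phi> (Poly_Mapping.single g c) = to_ac c \<cdot>\<^sub>m f g"
    "\<And>u v. \<phi> (u - v) = \<phi> u - \<phi> v"
    by (rule monoid_algebra_rep[where f = f, OF mon _ f_mult f_one]) (use f_carr in blast)+
  have fupd: "f (t(i := a)) = kron p m (\<lambda>j. if j = i then \<psi> i a else \<psi> j (t j))" for t i a
    unfolding f_def by (rule kron_cong) auto
  have kill: "\<phi> s = 0\<^sub>m (p ^ m) (p ^ m)" if "s \<in> tensor_family_relators ?I A" for s
    using that unfolding tensor_family_relators_def
  proof (elim UnE CollectE exE conjE)
    fix t i a b
    assume h: "t \<in> (\<Pi>\<^sub>E j\<in>?I. carrier (A j))" "i \<in> ?I" "a \<in> carrier (A i)" "b \<in> carrier (A i)"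
      and s: "s = Poly_Mapping.single (t(i := a \<oplus>\<^bsub>A i\<^esub> b)) 1 - Poly_Mapping.single (t(i := a)) 1 - Poly_Mapping.single (t(i := b)) 1"
    have i: "i < m" using h by simp
    have ab: "a \<oplus>\<^bsub>A i\<^esub> b \<in> carrier (A i)" using A[OF i] h by (auto intro: ring.ring_simprules(1)[OF assoc_algebra.axioms(1)])
    have "f (t(i := a \<oplus>\<^bsub>A i\<^esub> b)) = f (t(i := a)) + f (t(i := b))"
      unfolding fupd alg_repD(2)[OF psi[OF i] h(3,4)]
      by (rule kron_add[OF p i alg_repD(1)[OF psi[OF i] h(3)] alg_repD(1)[OF psi[OF i] h(4)]])
    then show ?thesis
      unfolding s phi(3) using f_carr[of "t(i := a)"] f_carr[of "t(i := b)"]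
        tensor_family_upd[OF A' h(1,2) h(3)] tensor_family_upd[OF A' h(1,2) h(4)] tensor_family_upd[OF A' h(1,2) ab]
      by (simp add: phi(2) del: carrier_product_group fun_upd_apply) (rule eq_matI; simp)
  next
    fix t i c a
    assume h: "t \<in> (\<Pi>\<^sub>E j\<in>?I. carrier (A j))" "i \<in> ?I" "a \<in> carrier (A i)"
      and s: "s = Poly_Mapping.single (t(i := c \<odot>\<^bsub>A i\<^esub> a)) 1 - Poly_Mapping.single (t(i := a)) c"
    have i: "i < m" using h by simp
    have ca: "c \<odot>\<^bsub>A i\<^esub> a \<in> carrier (A i)" using A[OF i] h by (auto intro: assoc_algebra.smult_closed)
    have "f (t(i := c \<odot>\<^bsub>A i\<^esub> a)) = to_ac c \<cdot>\<^sub>m f (t(i := a))"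
      unfolding fupd alg_repD(5)[OF psi[OF i] h(3)]
      by (rule kron_smult[OF p i alg_repD(1)[OF psi[OF i] h(3)]])
    then show ?thesis
      unfolding s phi(3) using f_carr[of "t(i := a)"]
        tensor_family_upd[OF A' h(1,2) h(3)] tensor_family_upd[OF A' h(1,2) ca]
      by (simp add: phi(2) del: carrier_product_group fun_upd_apply) (rule eq_matI; simp)
  qed
  from quotient_algebra_rep[OF monoid_algebra_assoc_algebra[OF mon] tensor_family_relators_carrier[OF A'] phi(1) kill]
  obtain \<Phi> where Phi: "alg_rep (p ^ m) (tensor_family ?I A) \<Phi>"
    "\<And>a. a \<in> carrier ?M \<Longrightarrow> \<Phi> (assoc_algebra.coset_proj ?M (tensor_family_relators ?I A) a) = \<phi> a"
    unfolding tensor_family_def by blast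
  have "\<Phi> (family_tensor ?I A t) = f t" if "t \<in> (\<Pi>\<^sub>E i\<in>?I. carrier (A i))" for t
    unfolding family_tensor_def using that f_carr[of t]
    by (subst Phi(2)) (simp_all add: monoid_algebra_sel phi(2) smult_one_mat)
  then show thesis using that Phi(1) unfolding f_def by blast
qed

section \<open>Extension of scalars to the algebraic closure\<close>

lemma closure_algebra_sel:
  "carrier closure_algebra = UNIV" "monoid.mult closure_algebra = (*)" "one closure_algebra = 1"
  "ring.zero closure_algebra = 0" "ring.add closure_algebra = (+)" "module.smult closure_algebra = (\<lambda>c x. to_ac c * x)"
  by (simp_all add: closure_algebra_def)

lemma closure_algebra_assoc_algebra: "assoc_algebra (closure_algebra :: ('f::field, 'f alg_closure) module)"
proof -
  have "ring (closure_algebra :: ('f, 'f alg_closure) module)"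
  proof (rule ringI)
    show "abelian_group (closure_algebra :: ('f, 'f alg_closure) module)"
    proof (rule abelian_groupI)
      fix x :: "'f alg_closure"
      show "\<exists>y\<in>carrier closure_algebra. y \<oplus>\<^bsub>(closure_algebra :: ('f, 'f alg_closure) module)\<^esub> x = \<zero>\<^bsub>closure_algebra\<^esub>"
        by (intro bexI[of _ "- x"]) (simp_all add: closure_algebra_sel)
    qed (simp_all add: closure_algebra_sel add_ac)
    show "monoid (closure_algebra :: ('f, 'f alg_closure) module)"
      by (rule monoidI) (simp_all add: closure_algebra_sel)
  qed (simp_all add: closure_algebra_sel algebra_simps)
  then show ?thesis
    by (intro assoc_algebra.intro assoc_algebra_axioms.intro) (simp_all add: closure_algebra_sel algebra_simps)
qed

context
  fixes A :: "('f::field, 'a) module" and B :: "('f, 'b) module"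
  assumes A: "assoc_algebra A" and B: "assoc_algebra B"
begin

interpretation A: assoc_algebra A by (rule A)
interpretation B: assoc_algebra B by (rule B)

lemma tensor_monoid: "monoid (A \<times>\<times> B)"
  by (rule DirProd_monoid[OF A.monoid_axioms B.monoid_axioms])

lemma DirProd_carrier: "a \<in> carrier A \<Longrightarrow> b \<in> carrier B \<Longrightarrow> (a, b) \<in> carrier (A \<times>\<times> B)"
  by (simp add: DirProd_def)

lemma tensor_relators_carrier: "tensor_relators A B \<subseteq> carrier (monoid_algebra (A \<times>\<times> B))"
proof -
  have sub: "u - v \<in> carrier (monoid_algebra (A \<times>\<times> B))"
    if "u \<in> carrier (monoid_algebra (A \<times>\<times> B))" "v \<in> carrier (monoid_algebra (A \<times>\<times> B))" for u v :: "'a \<times> 'b \<Rightarrow>\<^sub>0 'f"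
  proof -
    have "Poly_Mapping.keys (u - v) \<subseteq> Poly_Mapping.keys u \<union> Poly_Mapping.keys v" by (auto simp: in_keys_iff lookup_minus)
    then show ?thesis using that by (auto simp: monoid_algebra_sel)
  qed
  have s: "Poly_Mapping.single (a, b) (c::'f) \<in> carrier (monoid_algebra (A \<times>\<times> B))" if "a \<in> carrier A" "b \<in> carrier B" for a b c
    using that by (simp add: monoid_algebra_sel DirProd_carrier)
  show ?thesis
  proof
    fix s assume "s \<in> tensor_relators A B"
    then show "s \<in> carrier (monoid_algebra (A \<times>\<times> B))"
      unfolding tensor_relators_def
      by (elim UnE CollectE exE conjE) (simp only:, intro sub s A.a_closed B.a_closed A.smult_closed B.smult_closed; assumption)+
  qed
qed

lemmas pair_props = monoid_quotient_props[OF tensor_monoid tensor_relators_carrier, folded tensor_def]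

lemma pure_tensor_eq: "pure_tensor A B a b = assoc_algebra.coset_proj (monoid_algebra (A \<times>\<times> B)) (tensor_relators A B) (Poly_Mapping.single (a, b) 1)"
  unfolding pure_tensor_def assoc_algebra.coset_proj_def[OF monoid_algebra_assoc_algebra[OF tensor_monoid]] ..

lemma tensor_assoc_algebra: "assoc_algebra (tensor A B)"
  by (rule pair_props(1))

lemma pure_tensor_carrier: "a \<in> carrier A \<Longrightarrow> b \<in> carrier B \<Longrightarrow> pure_tensor A B a b \<in> carrier (tensor A B)"
  unfolding pure_tensor_eq by (rule pair_props(2)[OF DirProd_carrier])

lemma pure_tensor_add_left:
  assumes "a \<in> carrier A" "a' \<in> carrier A" "b \<in> carrier B"
  shows "pure_tensor A B (a \<oplus>\<^bsub>A\<^esub> a') b = pure_tensor A B a b \<oplus>\<^bsub>tensor A B\<^esub> pure_tensor A B a' b"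
proof -
  have "Poly_Mapping.single (a \<oplus>\<^bsub>A\<^esub> a', b) 1 - Poly_Mapping.single (a, b) 1 - Poly_Mapping.single (a', b) 1 \<in> tensor_relators A B"
    unfolding tensor_relators_def using assms by blast
  then show ?thesis unfolding pure_tensor_eq
    using assms by (intro pair_props(5) DirProd_carrier A.a_closed B.a_closed A.smult_closed B.smult_closed)
qed

lemma pure_tensor_add_right:
  assumes "a \<in> carrier A" "b \<in> carrier B" "b' \<in> carrier B"
  shows "pure_tensor A B a (b \<oplus>\<^bsub>B\<^esub> b') = pure_tensor A B a b \<oplus>\<^bsub>tensor A B\<^esub> pure_tensor A B a b'"
proof -
  have "Poly_Mapping.single (a, b \<oplus>\<^bsub>B\<^esub> b') 1 - Poly_Mapping.single (a, b) 1 - Poly_Mapping.single (a, b') 1 \<in> tensor_relators A B"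
    unfolding tensor_relators_def using assms by blast
  then show ?thesis unfolding pure_tensor_eq
    using assms by (intro pair_props(5) DirProd_carrier A.a_closed B.a_closed A.smult_closed B.smult_closed)
qed

lemma pure_tensor_smult_left:
  assumes "a \<in> carrier A" "b \<in> carrier B"
  shows "pure_tensor A B (c \<odot>\<^bsub>A\<^esub> a) b = c \<odot>\<^bsub>tensor A B\<^esub> pure_tensor A B a b"
proof -
  have "Poly_Mapping.single (c \<odot>\<^bsub>A\<^esub> a, b) 1 - Poly_Mapping.single (a, b) c \<in> tensor_relators A B"
    unfolding tensor_relators_def using assms by blast
  then show ?thesis unfolding pure_tensor_eq
    using assms by (intro pair_props(6) DirProd_carrier A.a_closed B.a_closed A.smult_closed B.smult_closed)
qed

lemma pure_tensor_smult_right: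
  assumes "a \<in> carrier A" "b \<in> carrier B"
  shows "pure_tensor A B a (c \<odot>\<^bsub>B\<^esub> b) = c \<odot>\<^bsub>tensor A B\<^esub> pure_tensor A B a b"
proof -
  have "Poly_Mapping.single (a, c \<odot>\<^bsub>B\<^esub> b) 1 - Poly_Mapping.single (a, b) c \<in> tensor_relators A B"
    unfolding tensor_relators_def using assms by blast
  then show ?thesis unfolding pure_tensor_eq
    using assms by (intro pair_props(6) DirProd_carrier A.a_closed B.a_closed A.smult_closed B.smult_closed)
qed

text \<open>Only the first factor is expanded over generators. With \<open>B\<close> the algebraic
  closure, all its elements are kept and act as coefficients.\<close>

lemma tensor_span:
  assumes S: "S \<subseteq> carrier A" "carrier A = lin_span A S"
  shows "carrier (tensor A B) = lin_span (tensor A B) {pure_tensor A B s b | s b. s \<in> S \<and> b \<in> carrier B}"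
proof -
  let ?T = "tensor A B"
  let ?W = "lin_span ?T {pure_tensor A B s b | s b. s \<in> S \<and> b \<in> carrier B}"
  interpret T: assoc_algebra ?T by (rule tensor_assoc_algebra)
  have main: "pure_tensor A B a b \<in> ?W" if "a \<in> lin_span A S" "b \<in> carrier B" for a b
    using that(1)
  proof induction
    case zero
    have "pure_tensor A B \<zero>\<^bsub>A\<^esub> b = 0 \<odot>\<^bsub>?T\<^esub> pure_tensor A B \<zero>\<^bsub>A\<^esub> b"
      using pure_tensor_smult_left[OF A.zero_closed that(2), of 0] by (simp only: A.smult_zero_right)
    also have "\<dots> = \<zero>\<^bsub>?T\<^esub>" by (rule T.smult_zero_left[OF pure_tensor_carrier[OF A.zero_closed that(2)]])
    finally show ?case by (simp add: lin_span.zero)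
  next
    case (base s) then show ?case using that(2) by (intro lin_span.base) blast
  next
    case (add a a')
    then show ?case using S that(2) by (simp add: pure_tensor_add_left lin_span.add)
  next
    case (smult a c)
    then show ?case using S that(2) by (simp add: pure_tensor_smult_left lin_span.smult)
  qed
  show ?thesis
  proof
    show "?W \<subseteq> carrier ?T"
      using S(1) pure_tensor_carrier by (intro T.lin_span_carrier) blast
    have "carrier ?T = lin_span ?T {assoc_algebra.coset_proj (monoid_algebra (A \<times>\<times> B)) (tensor_relators A B) (Poly_Mapping.single g 1) | g. g \<in> carrier (A \<times>\<times> B)}"
      unfolding tensor_def by (rule monoid_algebra_quotient_span[OF tensor_monoid tensor_relators_carrier])
    also have "\<dots> \<subseteq> ?W"
    proof (rule lin_span_mono_closed, safe)
      fix g assume "g \<in> carrier (A \<times>\<times> B)"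
      then obtain a b where "g = (a, b)" "a \<in> carrier A" "b \<in> carrier B" by (auto simp: DirProd_def)
      then show "assoc_algebra.coset_proj (monoid_algebra (A \<times>\<times> B)) (tensor_relators A B) (Poly_Mapping.single g 1) \<in> ?W"
        using main[of a b] S(2) unfolding pure_tensor_eq by blast
    qed
    finally show "carrier ?T \<subseteq> ?W" .
  qed
qed

end

text \<open>The extension of \<open>\<Phi>\<close> to scalars in the closure. Applied to a basis of
  \<open>A\<close> whose matrices form a basis of the matrix algebra, it becomes a
  splitting.\<close>

lemma tensor_closure_rep:
  fixes A :: "('f::field, 'a) module"
  assumes A: "assoc_algebra A" and Phi: "alg_rep n A \<Phi>"
  obtains \<Psi> where "alg_rep n (tensor A closure_algebra) \<Psi>"
    "\<And>a c. a \<in> carrier A \<Longrightarrow> \<Psi> (pure_tensor A closure_algebra a c) = c \<cdot>\<^sub>m \<Phi> a"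
proof -
  let ?K = "closure_algebra :: ('f, 'f alg_closure) module"
  note K = closure_algebra_assoc_algebra
  interpret A: assoc_algebra A by (rule A)
  let ?P = "A \<times>\<times> ?K"
  have mon: "monoid ?P" by (rule tensor_monoid[OF A K])
  define f where "f = (\<lambda>(a, c). c \<cdot>\<^sub>m \<Phi> a)"
  have f_carr: "f g \<in> carrier_mat n n" if "g \<in> carrier ?P" for g
    using that alg_repD(1)[OF Phi] by (auto simp: f_def DirProd_def)
  have f_mult: "f (g \<otimes>\<^bsub>?P\<^esub> h) = f g * f h" if "g \<in> carrier ?P" "h \<in> carrier ?P" for g h
  proof -
    obtain a c where g': "g = (a, c)" by (cases g)
    obtain b e where h': "h = (b, e)" by (cases h)
    have g: "g = (a, c)" "a \<in> carrier A" "h = (b, e)" "b \<in> carrier A"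
      using that by (simp_all add: g' h' DirProd_def)
    have "c \<cdot>\<^sub>m \<Phi> a * (e \<cdot>\<^sub>m \<Phi> b) = (c * e) \<cdot>\<^sub>m (\<Phi> a * \<Phi> b)"
      using alg_repD(1)[OF Phi g(2)] alg_repD(1)[OF Phi g(4)]
      by (simp add: mult_smult_assoc_mat[of _ n n _ n] mult_smult_distrib[of _ n n _ n] smult_smult_mat mult.commute)
    then show ?thesis using g by (simp add: f_def DirProd_def closure_algebra_sel alg_repD(3)[OF Phi])
  qed
  have f_one: "f \<one>\<^bsub>?P\<^esub> = 1\<^sub>m n"
    by (simp add: f_def DirProd_def closure_algebra_sel alg_repD(4)[OF Phi]) (rule eq_matI; simp)
  obtain \<phi> where phi: "alg_rep n (monoid_algebra ?P) \<phi>"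
    "\<And>g c. g \<in> carrier ?P \<Longrightarrow> \<phi> (Poly_Mapping.single g c) = to_ac c \<cdot>\<^sub>m f g"
    "\<And>u v. \<phi> (u - v) = \<phi> u - \<phi> v"
    by (rule monoid_algebra_rep[OF mon f_carr f_mult f_one]) blast+
  have sing: "\<phi> (Poly_Mapping.single (a, c) e) = (to_ac e * c) \<cdot>\<^sub>m \<Phi> a" if "a \<in> carrier A" for a c e
    using phi(2)[of "(a, c)"] that by (simp add: f_def DirProd_def closure_algebra_sel smult_smult_mat)
  have kill: "\<phi> s = 0\<^sub>m n n" if "s \<in> tensor_relators A ?K" for s
    using that unfolding tensor_relators_def
  proof (elim UnE CollectE exE conjE)
    fix a a' b assume h: "a \<in> carrier A" "a' \<in> carrier A"
      "s = Poly_Mapping.single (a \<oplus>\<^bsub>A\<^esub> a', b) 1 - Poly_Mapping.single (a, b) 1 - Poly_Mapping.single (a', b) 1"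
    show ?thesis
      unfolding h(3) phi(3) sing[OF A.a_closed[OF h(1,2)]] sing[OF h(1)] sing[OF h(2)] alg_repD(2)[OF Phi h(1,2)]
      by (rule eq_matI) (use alg_repD(1)[OF Phi h(1)] alg_repD(1)[OF Phi h(2)] in \<open>simp_all add: algebra_simps\<close>)
  next
    fix a b b' assume h: "a \<in> carrier A"
      "s = Poly_Mapping.single (a, b \<oplus>\<^bsub>?K\<^esub> b') 1 - Poly_Mapping.single (a, b) 1 - Poly_Mapping.single (a, b') 1"
    show ?thesis
      unfolding h(2) phi(3) sing[OF h(1)] closure_algebra_sel
      by (rule eq_matI) (use alg_repD(1)[OF Phi h(1)] in \<open>simp_all add: algebra_simps\<close>)
  next
    fix c a b assume h: "a \<in> carrier A"
      "s = Poly_Mapping.single (c \<odot>\<^bsub>A\<^esub> a, b) 1 - Poly_Mapping.single (a, b) c"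
    show ?thesis
      unfolding h(2) phi(3) sing[OF h(1)] sing[OF A.smult_closed[OF h(1)]] alg_repD(5)[OF Phi h(1)]
      by (rule eq_matI) (use alg_repD(1)[OF Phi h(1)] in \<open>simp_all add: algebra_simps\<close>)
  next
    fix c a b assume h: "a \<in> carrier A"
      "s = Poly_Mapping.single (a, c \<odot>\<^bsub>?K\<^esub> b) 1 - Poly_Mapping.single (a, b) c"
    show ?thesis
      unfolding h(2) phi(3) sing[OF h(1)] closure_algebra_sel
      by (rule eq_matI) (use alg_repD(1)[OF Phi h(1)] in \<open>simp_all add: algebra_simps\<close>)
  qed
  from quotient_algebra_rep[OF monoid_algebra_assoc_algebra[OF mon] tensor_relators_carrier[OF A K] phi(1) kill]
  obtain \<Psi> where Psi: "alg_rep n (tensor A ?K) \<Psi>"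
    "\<And>a. a \<in> carrier (monoid_algebra ?P) \<Longrightarrow> \<Psi> (assoc_algebra.coset_proj (monoid_algebra ?P) (tensor_relators A ?K) a) = \<phi> a"
    unfolding tensor_def by blast
  have "\<Psi> (pure_tensor A ?K a c) = c \<cdot>\<^sub>m \<Phi> a" if "a \<in> carrier A" for a c
    unfolding pure_tensor_eq[OF A K] using that
    by (subst Psi(2)) (simp_all add: monoid_algebra_sel DirProd_def closure_algebra_sel sing)
  then show thesis using that Psi(1) by blast
qed

lemma alg_rep_finsum:
  assumes T: "assoc_algebra T" and Psi: "alg_rep n T \<Psi>" and S: "finite S" "\<And>x. x \<in> S \<Longrightarrow> f x \<in> carrier T"
  shows "\<Psi> (finsum T f S) = mat n n (\<lambda>ij. \<Sum>x\<in>S. \<Psi> (f x) $$ ij)"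
proof -
  interpret T: assoc_algebra T by (rule T)
  show ?thesis using S
  proof (induction S)
    case empty
    show ?case by (simp add: alg_rep_zero[OF T Psi]) (rule eq_matI; simp)
  next
    case (insert x S)
    have "\<Psi> (finsum T f (insert x S)) = \<Psi> (f x) + \<Psi> (finsum T f S)"
    proof -
      have "finsum T f (insert x S) = f x \<oplus>\<^bsub>T\<^esub> finsum T f S" using insert by (intro T.finsum_insert) auto
      then show ?thesis using insert.prems by (simp only:) (intro alg_repD(2)[OF Psi] T.finsum_closed; auto)
    qed
    then show ?case using insert alg_repD(1)[OF Psi, of "f x"] by (simp, intro eq_matI) auto
  qed
qed

lemma (in assoc_algebra) finsum_smult:
  assumes "finite S" "\<And>x. x \<in> S \<Longrightarrow> f x \<in> carrier A"
  shows "finsum A (\<lambda>x. c \<odot> f x) S = c \<odot> finsum A f S"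
  using assms
proof (induction S)
  case (insert x S)
  then have "finsum A (\<lambda>x. c \<odot> f x) (insert x S) = c \<odot> f x \<oplus> finsum A (\<lambda>x. c \<odot> f x) S"
    by (intro finsum_insert) auto
  also have "\<dots> = c \<odot> (f x \<oplus> finsum A f S)"
    using insert by (simp add: smult_r_distr Pi_def)
  also have "f x \<oplus> finsum A f S = finsum A f (insert x S)"
    using insert by (intro finsum_insert[symmetric]) auto
  finally show ?case .
qed (simp add: smult_zero_right)

section \<open>The matrix model of the tensor product\<close>

text \<open>One model for both kinds of symbols: \<open>\<xi> i\<close> lists the eigenvalues of the
  \<open>i\<close>-th \<open>x\<close>, and \<open>\<eta> i\<close> is a \<open>p\<close>-th root of
  \<open>\<beta> i\<close>. Distinct eigenvalues make Vandermonde matrices invertible, and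
  \<open>\<eta> i \<noteq> 0\<close> keeps every cyclic diagonal nonzero; both are behind the
  splitting property.\<close>

locale symbol_model =
  fixes p m :: nat and \<epsilon> \<rho> :: "'f::field" and \<alpha> \<beta> :: "nat \<Rightarrow> 'f"
    and \<xi> :: "nat \<Rightarrow> nat \<Rightarrow> 'f alg_closure" and \<eta> :: "nat \<Rightarrow> 'f alg_closure"
  assumes p: "p \<ge> 2"
    and xi_periodic: "\<And>i j. i < m \<Longrightarrow> \<xi> i (j + p) = \<xi> i j"
    and xi_root: "\<And>i j. i < m \<Longrightarrow> \<xi> i j ^ p = to_ac \<epsilon> * \<xi> i j + to_ac (\<alpha> i)"
    and xi_Suc: "\<And>i j. i < m \<Longrightarrow> \<xi> i (Suc j) = to_ac \<rho> * \<xi> i j + to_ac \<epsilon>"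
    and xi_inj: "\<And>i. i < m \<Longrightarrow> inj_on (\<xi> i) {..<p}"
    and eta: "\<And>i. i < m \<Longrightarrow> \<eta> i ^ p = to_ac (\<beta> i)" "\<And>i. i < m \<Longrightarrow> \<eta> i \<noteq> 0"
begin

abbreviation d :: nat where "d \<equiv> p ^ m"

definition factor :: "nat \<Rightarrow> ('f, (symbol_gen list \<Rightarrow>\<^sub>0 'f) set) module" where
  "factor i = symbol_presentation p \<epsilon> \<rho> (\<alpha> i) (\<beta> i)"

definition TA :: "('f, ((nat \<Rightarrow> (symbol_gen list \<Rightarrow>\<^sub>0 'f) set) \<Rightarrow>\<^sub>0 'f) set) module" where
  "TA = tensor_family {..<m} factor"

text \<open>The indices of the \<open>p ^ (2 * m)\<close> monomials: the digits of the first
  component are the \<open>x\<close>-exponents, those of the second the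
  \<open>y\<close>-exponents.\<close>

definition Idx :: "(nat \<times> nat) set" where "Idx = {..<d} \<times> {..<d}"

lemma finite_Idx [simp]: "finite Idx" by (simp add: Idx_def)

definition monomial :: "nat \<times> nat \<Rightarrow> ((nat \<Rightarrow> (symbol_gen list \<Rightarrow>\<^sub>0 'f) set) \<Rightarrow>\<^sub>0 'f) set" where
  "monomial x = family_tensor {..<m} factor
    (\<lambda>i\<in>{..<m}. symbol_monomial p \<epsilon> \<rho> (\<alpha> i) (\<beta> i) (dig p i (fst x)) (dig p i (snd x)))"

definition monomial_mat :: "nat \<times> nat \<Rightarrow> 'f alg_closure mat" where
  "monomial_mat x = kron p m (\<lambda>i. diag_shift p (\<eta> i) (\<lambda>j. \<xi> i j ^ dig p i (fst x)) (dig p i (snd x)))"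

text \<open>Coefficients are taken from the closure, so these are the matrices of elements of the
  scalar extension; elements of the algebra itself have coefficients of the form
  \<open>to_ac c\<close>.\<close>

definition comb_mat :: "(nat \<times> nat \<Rightarrow> 'f alg_closure) \<Rightarrow> 'f alg_closure mat" where
  "comb_mat C = mat d d (\<lambda>ij. \<Sum>x\<in>Idx. C x * monomial_mat x $$ ij)"

lemma comb_mat_carrier [simp]: "comb_mat C \<in> carrier_mat d d"
  by (simp add: comb_mat_def)

lemma p0: "p > 0" using p by simp

lemma factor_assoc_algebra: "assoc_algebra (factor i)"
  unfolding factor_def by (rule symbol_presentation_assoc_algebra)

lemma TA_assoc_algebra: "assoc_algebra TA"
  unfolding TA_def by (rule tensor_family_assoc_algebra) (rule factor_assoc_algebra)

sublocale TA: assoc_algebra TA by (rule TA_assoc_algebra)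

lemma symbol_monomial_factor: "symbol_monomial p \<epsilon> \<rho> (\<alpha> i) (\<beta> i) a b \<in> carrier (factor i)"
  unfolding factor_def symbol_monomial_def by (rule symbol_word_props(1))

lemma monomial_carrier [simp]: "monomial x \<in> carrier TA"
  unfolding monomial_def TA_def
  by (rule family_tensor_carrier) (auto simp: factor_assoc_algebra symbol_monomial_factor)

lemma TA_span: "carrier TA = lin_span TA (monomial ` Idx)"
proof -
  let ?B = "\<lambda>i. {symbol_monomial p \<epsilon> \<rho> (\<alpha> i) (\<beta> i) a b | a b. a < p \<and> b < p}"
  have "carrier TA = lin_span TA (family_tensor {..<m} factor ` (\<Pi>\<^sub>E i\<in>{..<m}. ?B i))"
    unfolding TA_def
  proof (rule tensor_family_span)
    show "carrier (factor i) = lin_span (factor i) (?B i)" for i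
      unfolding factor_def by (rule symbol_presentation_span[OF p])
    show "?B i \<subseteq> carrier (factor i)" for i using symbol_monomial_factor by blast
  qed (auto simp: factor_assoc_algebra)
  also have "family_tensor {..<m} factor ` (\<Pi>\<^sub>E i\<in>{..<m}. ?B i) = monomial ` Idx"
  proof (intro equalityI subsetI)
    fix z assume "z \<in> family_tensor {..<m} factor ` (\<Pi>\<^sub>E i\<in>{..<m}. ?B i)"
    then obtain t where t: "t \<in> (\<Pi>\<^sub>E i\<in>{..<m}. ?B i)" "z = family_tensor {..<m} factor t" by blast
    have "\<forall>i\<in>{..<m}. \<exists>a b. t i = symbol_monomial p \<epsilon> \<rho> (\<alpha> i) (\<beta> i) a b \<and> a < p \<and> b < p"
      using t(1) by (fastforce simp: PiE_iff)
    then obtain a b where ab: "\<And>i. i < m \<Longrightarrow> t i = symbol_monomial p \<epsilon> \<rho> (\<alpha> i) (\<beta> i) (a i) (b i) \<and> a i < p \<and> b i < p"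
      by (metis lessThan_iff)
    obtain A where A: "A < p ^ m" "\<And>i. i < m \<Longrightarrow> dig p i A = a i" using digits_exist[of m a p] ab by blast
    obtain B where B: "B < p ^ m" "\<And>i. i < m \<Longrightarrow> dig p i B = b i" using digits_exist[of m b p] ab by blast
    have "t = (\<lambda>i\<in>{..<m}. symbol_monomial p \<epsilon> \<rho> (\<alpha> i) (\<beta> i) (dig p i A) (dig p i B))"
      using t(1) ab A(2) B(2) by (intro ext) (auto simp: PiE_iff extensional_def)
    then have "z = monomial (A, B)" using t(2) by (simp add: monomial_def)
    then show "z \<in> monomial ` Idx" using A B by (auto simp: Idx_def)
  next
    fix z assume "z \<in> monomial ` Idx"
    then obtain x where x: "z = monomial x" by blast
    have "(\<lambda>i\<in>{..<m}. symbol_monomial p \<epsilon> \<rho> (\<alpha> i) (\<beta> i) (dig p i (fst x)) (dig p i (snd x))) \<in> (\<Pi>\<^sub>E i\<in>{..<m}. ?B i)"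
      using dig_less[OF p0] by auto
    then show "z \<in> family_tensor {..<m} factor ` (\<Pi>\<^sub>E i\<in>{..<m}. ?B i)" unfolding x monomial_def by blast
  qed
  finally show ?thesis .
qed

lemma TA_rep:
  obtains \<Phi> where "alg_rep d TA \<Phi>" "\<And>x. \<Phi> (monomial x) = monomial_mat x"
proof -
  have "\<exists>\<psi>. alg_rep p (factor i) \<psi> \<and> (\<forall>a b. \<psi> (symbol_monomial p \<epsilon> \<rho> (\<alpha> i) (\<beta> i) a b) = diag_shift p (\<eta> i) (\<lambda>j. \<xi> i j ^ a) b)"
    if i: "i < m" for i
    unfolding factor_def
    by (rule symbol_presentation_rep[OF p xi_periodic[OF i] xi_root[OF i] xi_Suc[OF i] eta(1)[OF i]]) blast
  then obtain \<psi> where psi: "\<And>i. i < m \<Longrightarrow> alg_rep p (factor i) (\<psi> i)"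
    "\<And>i a b. i < m \<Longrightarrow> \<psi> i (symbol_monomial p \<epsilon> \<rho> (\<alpha> i) (\<beta> i) a b) = diag_shift p (\<eta> i) (\<lambda>j. \<xi> i j ^ a) b"
    by metis
  obtain \<Phi> where Phi: "alg_rep d TA \<Phi>"
    "\<And>t. t \<in> (\<Pi>\<^sub>E i\<in>{..<m}. carrier (factor i)) \<Longrightarrow> \<Phi> (family_tensor {..<m} factor t) = kron p m (\<lambda>i. \<psi> i (t i))"
    unfolding TA_def by (rule tensor_family_rep[OF p0 factor_assoc_algebra psi(1)]) blast+
  have "\<Phi> (monomial x) = monomial_mat x" for x
  proof -
    have "\<Phi> (monomial x) = kron p m (\<lambda>i. \<psi> i ((\<lambda>i\<in>{..<m}. symbol_monomial p \<epsilon> \<rho> (\<alpha> i) (\<beta> i) (dig p i (fst x)) (dig p i (snd x))) i))"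
      unfolding monomial_def by (rule Phi(2)) (auto simp: symbol_monomial_factor)
    also have "\<dots> = monomial_mat x"
      unfolding monomial_mat_def by (rule kron_cong) (simp add: psi(2))
    finally show ?thesis .
  qed
  then show thesis using that Phi(1) by blast
qed

text \<open>The inverse has as its columns the coefficients of the Lagrange basis polynomials at the
  distinct nodes \<open>\<xi> i j\<close>.\<close>

lemma vandermonde_inverse:
  assumes "i < m"
  obtains L where "L \<in> carrier_mat p p" "mat p p (\<lambda>(j, a). \<xi> i j ^ a) * L = 1\<^sub>m p" "L * mat p p (\<lambda>(j, a). \<xi> i j ^ a) = 1\<^sub>m p"
proof -
  let ?V = "mat p p (\<lambda>(j, a). \<xi> i j ^ a)"
  define l where "l j = smult (\<Prod>k\<in>{..<p}-{j}. inverse (\<xi> i j - \<xi> i k)) (\<Prod>k\<in>{..<p}-{j}. [:- \<xi> i k, 1:])" for j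
  have deg: "degree (l j) < p" if "j < p" for j
  proof -
    have "degree (\<Prod>k\<in>{..<p}-{j}. [:- \<xi> i k, 1:]) = p - 1"
      using that by (subst degree_prod_eq_sum_degree) auto
    then show ?thesis unfolding l_def using p0 by (intro le_less_trans[OF degree_smult_le]) simp
  qed
  have val: "poly (l j) (\<xi> i k) = (if k = j then 1 else 0)" if jk: "j < p" "k < p" for j k
  proof (cases "k = j")
    case True
    have "inverse (\<xi> i j - \<xi> i k) * (\<xi> i j - \<xi> i k) = 1" if "k \<in> {..<p} - {j}" for k
      using xi_inj[OF assms] that jk by (intro left_inverse) (auto simp: inj_on_def)
    then have "(\<Prod>k\<in>{..<p}-{j}. inverse (\<xi> i j - \<xi> i k) * (\<xi> i j - \<xi> i k)) = 1" by (intro prod.neutral) blast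
    then show ?thesis using True by (simp add: l_def poly_prod prod.distrib del: right_inverse left_inverse)
  next
    case False
    then have "poly (\<Prod>k\<in>{..<p}-{j}. [:- \<xi> i k, 1:]) (\<xi> i k) = 0" unfolding poly_prod using jk by (intro prod_zero) auto
    then show ?thesis using False by (simp add: l_def)
  qed
  define L where "L = mat p p (\<lambda>(a, j). coeff (l j) a)"
  have "?V * L = 1\<^sub>m p"
  proof (rule eq_matI)
    fix k j assume "k < dim_row (1\<^sub>m p :: 'f alg_closure mat)" "j < dim_col (1\<^sub>m p :: 'f alg_closure mat)"
    then have kj: "k < p" "j < p" by auto
    have "(?V * L) $$ (k, j) = (\<Sum>a<p. coeff (l j) a * \<xi> i k ^ a)"
      using kj by (simp add: L_def scalar_prod_def atLeast0LessThan mult.commute)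
    also have "\<dots> = poly (l j) (\<xi> i k)"
      unfolding poly_altdef using deg[OF kj(2)] by (intro sum.mono_neutral_right) (auto simp: coeff_eq_0)
    finally show "(?V * L) $$ (k, j) = (1\<^sub>m p :: 'f alg_closure mat) $$ (k, j)" using val kj by simp
  qed (auto simp: L_def)
  moreover have "L \<in> carrier_mat p p" by (simp add: L_def)
  ultimately show thesis using that mat_mult_left_right_inverse[of ?V p L] by auto
qed

text \<open>Column \<open>b\<close> of the following array of coefficients collects the entries of a matrix on the
  \<open>b\<close>-th cyclic diagonal, on which only the monomials \<open>x\<^sup>a y\<^sup>b\<close> live; there they form a
  tensor product of Vandermonde matrices.\<close>

lemma comb_mat_entry:
  obtains sh H where "\<And>r b. r < d \<Longrightarrow> b < d \<Longrightarrow> sh r b < d"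
    "\<And>r s. r < d \<Longrightarrow> s < d \<Longrightarrow> \<exists>b<d. sh r b = s" "\<And>r b b'. r < d \<Longrightarrow> b < d \<Longrightarrow> b' < d \<Longrightarrow> sh r b = sh r b' \<Longrightarrow> b = b'"
    "\<And>b. H b \<noteq> 0"
    "\<And>C r b. r < d \<Longrightarrow> b < d \<Longrightarrow> comb_mat C $$ (r, sh r b) =
      H b * (kron p m (\<lambda>i. mat p p (\<lambda>(j, a). \<xi> i j ^ a)) * mat d d C) $$ (r, b)"
proof -
  \<comment> \<open>The column in which row \<open>r\<close> meets the \<open>b\<close>-th cyclic
    diagonal: digitwise addition of \<open>r\<close> and \<open>b\<close> modulo
    \<open>p\<close>.\<close>
  define sh where "sh r b = (SOME s. s < d \<and> (\<forall>i<m. dig p i s = (dig p i r + dig p i b) mod p))" for r b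
  have sh: "sh r b < d" "\<And>i. i < m \<Longrightarrow> dig p i (sh r b) = (dig p i r + dig p i b) mod p" for r b
  proof -
    have "\<exists>s. s < d \<and> (\<forall>i<m. dig p i s = (dig p i r + dig p i b) mod p)"
      using digits_exist[of m "\<lambda>i. (dig p i r + dig p i b) mod p" p] p0 by (metis mod_less_divisor)
    from someI_ex[OF this] show "sh r b < d" "\<And>i. i < m \<Longrightarrow> dig p i (sh r b) = (dig p i r + dig p i b) mod p"
      unfolding sh_def by auto
  qed
  have cancel: "x = y" if "(k + x) mod p = (k + y) mod p" "x < p" "y < p" for k x y :: nat
  proof -
    have e: "z = ((k + z) mod p + (p - k mod p)) mod p" if "z < p" for z
    proof -
      have "k mod p < p" using p0 by simp
      then have "k + z + (p - k mod p) = z + p * (k div p + 1)"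
        using mult_div_mod_eq[of p k] unfolding distrib_left mult_1_right by linarith
      then have "(k + z + (p - k mod p)) mod p = z" using that by (metis mod_mult_self2 mod_less)
      then show ?thesis by (simp add: mod_add_left_eq)
    qed
    show ?thesis using e[OF that(2)] e[OF that(3)] that(1) by metis
  qed
  \<comment> \<open>The scalar by which all entries on the \<open>b\<close>-th diagonal are
    multiplied, coming from the \<open>\<eta> i\<close> in the cyclic shifts.\<close>
  define H where "H b = (\<Prod>i<m. \<eta> i ^ dig p i b)" for b
  show thesis
  proof (rule that)
    show "sh r b < d" for r b by (rule sh)
    show "\<exists>b<d. sh r b = s" if "r < d" "s < d" for r s
    proof -
      define f where "f i = (dig p i s + (p - dig p i r)) mod p" for i
      obtain b where b: "b < d" "\<And>i. i < m \<Longrightarrow> dig p i b = f i"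
        using digits_exist[of m f p] p0 by (auto simp: f_def)
      have "sh r b = s"
      proof (rule digits_eqI[OF p0 sh(1) that(2)])
        fix i assume i: "i < m"
        have "dig p i r < p" "dig p i s < p" using dig_less[OF p0] by auto
        then have "(dig p i r + (dig p i s + (p - dig p i r)) mod p) mod p = dig p i s"
          by (simp add: mod_add_right_eq)
        then show "dig p i (sh r b) = dig p i s" by (simp add: sh(2)[OF i] b(2)[OF i] f_def)
      qed
      then show ?thesis using b by blast
    qed
    show "b = b'" if "r < d" "b < d" "b' < d" "sh r b = sh r b'" for r b b'
    proof (rule digits_eqI[OF p0 that(2,3)])
      fix i assume "i < m"
      then have "(dig p i r + dig p i b) mod p = (dig p i r + dig p i b') mod p" using sh(2)[of i r] that(4) by metis
      then show "dig p i b = dig p i b'" by (rule cancel) (auto simp: dig_less[OF p0])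
    qed
    show "H b \<noteq> 0" for b using eta(2) by (simp add: H_def)
    fix C :: "nat \<times> nat \<Rightarrow> 'f alg_closure" and r b assume rb: "r < d" "b < d"
    have entry: "monomial_mat (a, b') $$ (r, sh r b) = (if b' = b then H b * (\<Prod>i<m. \<xi> i (dig p i r) ^ dig p i a) else 0)"
      if b': "b' < d" for a b'
    proof (cases "b' = b")
      case True
      then show ?thesis using rb sh dig_less[OF p0]
        by (simp add: monomial_mat_def kron_def diag_shift_def H_def prod.distrib mult.commute)
    next
      case False
      then obtain i where i: "i < m" "dig p i b' \<noteq> dig p i b" using digits_eqI[OF p0 b' rb(2)] by blast
      then have "dig p i (sh r b) \<noteq> (dig p i r + dig p i b') mod p"
        using sh(2)[OF i(1)] cancel dig_less[OF p0] by metis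
      then have "(\<Prod>i<m. diag_shift p (\<eta> i) (\<lambda>j. \<xi> i j ^ dig p i a) (dig p i b') $$ (dig p i r, dig p i (sh r b))) = 0"
        using i(1) dig_less[OF p0] by (intro prod_zero) (auto simp: diag_shift_def)
      then show ?thesis using False rb sh by (simp add: monomial_mat_def kron_def)
    qed
    have "comb_mat C $$ (r, sh r b) = (\<Sum>a<d. \<Sum>b'<d. C (a, b') * monomial_mat (a, b') $$ (r, sh r b))"
      using rb sh(1) by (simp add: comb_mat_def Idx_def sum.cartesian_product case_prod_beta)
    also have "\<dots> = (\<Sum>a<d. \<Sum>b'<d. if b' = b then C (a, b) * (H b * (\<Prod>i<m. \<xi> i (dig p i r) ^ dig p i a)) else 0)"
      by (intro sum.cong refl) (auto simp: entry)
    also have "\<dots> = H b * (\<Sum>a<d. (\<Prod>i<m. \<xi> i (dig p i r) ^ dig p i a) * C (a, b))"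
      using rb by (simp add: sum_distrib_left mult_ac)
    also have "\<dots> = H b * (kron p m (\<lambda>i. mat p p (\<lambda>(j, a). \<xi> i j ^ a)) * mat d d C) $$ (r, b)"
      using rb dig_less[OF p0] by (simp add: kron_def scalar_prod_def atLeast0LessThan)
    finally show "comb_mat C $$ (r, sh r b) = H b * (kron p m (\<lambda>i. mat p p (\<lambda>(j, a). \<xi> i j ^ a)) * mat d d C) $$ (r, b)" .
  qed
qed

text \<open>The monomial matrices form a basis of all \<open>d \<times> d\<close> matrices: by
  \<open>comb_mat_entry\<close> the coefficients solve a linear system whose matrix is a Kronecker
  product of invertible Vandermonde matrices.\<close>

lemma comb_mat_bij:
  "comb_mat C = comb_mat C' \<Longrightarrow> x \<in> Idx \<Longrightarrow> C x = C' x"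
  "M \<in> carrier_mat d d \<Longrightarrow> \<exists>C. comb_mat C = M"
proof -
  obtain sh H where sh: "\<And>r b. r < d \<Longrightarrow> b < d \<Longrightarrow> sh r b < d"
    "\<And>r s. r < d \<Longrightarrow> s < d \<Longrightarrow> \<exists>b<d. sh r b = s" "\<And>r b b'. r < d \<Longrightarrow> b < d \<Longrightarrow> b' < d \<Longrightarrow> sh r b = sh r b' \<Longrightarrow> b = b'"
    "\<And>b. H b \<noteq> 0"
    "\<And>C r b. r < d \<Longrightarrow> b < d \<Longrightarrow> comb_mat C $$ (r, sh r b) =
      H b * (kron p m (\<lambda>i. mat p p (\<lambda>(j, a). \<xi> i j ^ a)) * mat d d C) $$ (r, b)"
    by (rule comb_mat_entry) blast
  let ?V = "kron p m (\<lambda>i. mat p p (\<lambda>(j, a). \<xi> i j ^ a))"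
  have "\<exists>L. L \<in> carrier_mat p p \<and> mat p p (\<lambda>(j, a). \<xi> i j ^ a) * L = 1\<^sub>m p \<and> L * mat p p (\<lambda>(j, a). \<xi> i j ^ a) = 1\<^sub>m p" if "i < m" for i
    by (rule vandermonde_inverse[OF that]) (intro exI conjI)
  then obtain L where L: "\<And>i. i < m \<Longrightarrow> L i \<in> carrier_mat p p"
    "\<And>i. i < m \<Longrightarrow> mat p p (\<lambda>(j, a). \<xi> i j ^ a) * L i = 1\<^sub>m p" "\<And>i. i < m \<Longrightarrow> L i * mat p p (\<lambda>(j, a). \<xi> i j ^ a) = 1\<^sub>m p"
    by metis
  let ?L = "kron p m L"
  have VL: "?V * ?L = 1\<^sub>m d"
    using L by (subst kron_mult[OF p0]) (auto simp: kron_one[OF p0, symmetric] intro!: kron_cong)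
  have LV: "?L * ?V = 1\<^sub>m d"
    using L by (subst kron_mult[OF p0]) (auto simp: kron_one[OF p0, symmetric] intro!: kron_cong)
  have cV: "?V \<in> carrier_mat d d" and cL: "?L \<in> carrier_mat d d" by simp_all
  show "C x = C' x" if eq: "comb_mat C = comb_mat C'" and x: "x \<in> Idx" for C C' x
  proof -
    have "?V * mat d d C = ?V * mat d d C'"
    proof (rule eq_matI)
      fix r b assume "r < dim_row (?V * mat d d C')" "b < dim_col (?V * mat d d C')"
      then have rb: "r < d" "b < d" by (auto simp: kron_def)
      show "(?V * mat d d C) $$ (r, b) = (?V * mat d d C') $$ (r, b)"
        using sh(5)[OF rb, of C] sh(5)[OF rb, of C'] sh(4)[of b] eq by simp
    qed auto
    then have "?L * (?V * mat d d C) = ?L * (?V * mat d d C')" by simp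
    then have "mat d d C = mat d d C'"
      by (simp add: assoc_mult_mat[OF cL cV mat_carrier, symmetric] LV)
    then have "mat d d C $$ x = mat d d C' $$ x" by simp
    then show ?thesis using x by (auto simp: Idx_def)
  qed
  show "\<exists>C. comb_mat C = M" if M: "M \<in> carrier_mat d d" for M
  proof -
    define G where "G = mat d d (\<lambda>(r, b). M $$ (r, sh r b) / H b)"
    define C where "C = (\<lambda>x. (?L * G) $$ x)"
    have G: "G \<in> carrier_mat d d" by (simp add: G_def)
    have LG: "?L * G \<in> carrier_mat d d" using cL G by (rule mult_carrier_mat)
    have "mat d d C = ?L * G" by (rule eq_matI) (use carrier_matD[OF LG] in \<open>simp_all add: C_def\<close>)
    then have VC: "?V * mat d d C = G"
      using left_mult_one_mat[OF G] by (simp add: assoc_mult_mat[OF cV cL G, symmetric] VL)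
    have "comb_mat C = M"
    proof (rule eq_matI)
      fix r s assume "r < dim_row M" "s < dim_col M"
      then have rs: "r < d" "s < d" using M by auto
      then obtain b where b: "b < d" "sh r b = s" using sh(2) by blast
      show "comb_mat C $$ (r, s) = M $$ (r, s)"
        using sh(5)[OF rs(1) b(1), of C] sh(4)[of b] rs b by (simp add: VC G_def)
    qed (use M in \<open>simp_all add: comb_mat_def\<close>)
    then show ?thesis by blast
  qed
qed

text \<open>Only the values of \<open>C\<close> on \<open>Idx\<close> enter, so coordinates are
  unique on \<open>Idx\<close> and arbitrary elsewhere.\<close>

definition from_coords :: "(nat \<times> nat \<Rightarrow> 'f) \<Rightarrow> ((nat \<Rightarrow> (symbol_gen list \<Rightarrow>\<^sub>0 'f) set) \<Rightarrow>\<^sub>0 'f) set" where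
  "from_coords C = finsum TA (\<lambda>x. C x \<odot>\<^bsub>TA\<^esub> monomial x) Idx"

lemma from_coords_carrier [simp]: "from_coords C \<in> carrier TA"
  unfolding from_coords_def by (rule TA.finsum_closed) auto

lemma from_coords_add: "from_coords (\<lambda>x. C x + C' x) = from_coords C \<oplus>\<^bsub>TA\<^esub> from_coords C'"
  unfolding from_coords_def
  by (subst TA.finsum_addf[symmetric]) (auto simp: TA.smult_l_distr intro!: TA.finsum_cong')

lemma from_coords_smult: "from_coords (\<lambda>x. c * C x) = c \<odot>\<^bsub>TA\<^esub> from_coords C"
  unfolding from_coords_def
  by (subst TA.finsum_smult[symmetric]) (auto simp: TA.smult_assoc1 intro!: TA.finsum_cong')

lemma from_coords_zero: "from_coords (\<lambda>x. 0) = \<zero>\<^bsub>TA\<^esub>"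
  using from_coords_smult[of 0 "\<lambda>x. 0"] by (simp add: TA.smult_zero_left)

lemma from_coords_unit: "x \<in> Idx \<Longrightarrow> from_coords (\<lambda>y. if y = x then 1 else 0) = monomial x"
proof -
  assume x: "x \<in> Idx"
  have "from_coords (\<lambda>y. if y = x then 1 else 0) = finsum TA (\<lambda>y. if x = y then monomial y else \<zero>\<^bsub>TA\<^esub>) Idx"
    unfolding from_coords_def by (rule TA.finsum_cong') (auto simp: TA.smult_one TA.smult_zero_left)
  also have "\<dots> = monomial x" by (rule TA.finsum_singleton[OF x finite_Idx]) auto
  finally show ?thesis .
qed

lemma from_coords_surj: "v \<in> carrier TA \<Longrightarrow> \<exists>C. v = from_coords C"
proof -
  assume "v \<in> carrier TA"
  then have "v \<in> lin_span TA (monomial ` Idx)" using TA_span by simp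
  then show ?thesis
  proof induction
    case zero show ?case by (rule exI) (rule from_coords_zero[symmetric])
  next
    case (base b) then show ?case using from_coords_unit by fastforce
  next
    case (add a b)
    then obtain C C' where "a = from_coords C" "b = from_coords C'" by blast
    then show ?case by (intro exI[of _ "\<lambda>x. C x + C' x"]) (simp only: from_coords_add)
  next
    case (smult a c)
    then obtain C where "a = from_coords C" by blast
    then show ?case by (intro exI[of _ "\<lambda>x. c * C x"]) (simp only: from_coords_smult)
  qed
qed

abbreviation TK where "TK \<equiv> tensor TA closure_algebra"
abbreviation pure where "pure \<equiv> pure_tensor TA closure_algebra"

text \<open>The scalar extension is spanned by at most \<open>d^2\<close> elements whose matrices
  form a basis of the matrix algebra, which makes the representation bijective. This exhibits the
  algebra as split over the closure without structure theory, and supplies the witness for the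
  choice in \<open>reduced_char_poly\<close>.\<close>

lemma splitting_exists:
  obtains \<Psi> where "\<Psi> \<in> splittings d TA"
    "\<And>C. \<Psi> (pure (from_coords C) 1) = comb_mat (\<lambda>x. to_ac (C x))"
proof -
  obtain \<Phi> where Phi: "alg_rep d TA \<Phi>" "\<And>x. \<Phi> (monomial x) = monomial_mat x" using TA_rep by blast
  let ?K = "closure_algebra :: ('f, 'f alg_closure) module"
  note KA = closure_algebra_assoc_algebra
  obtain \<Psi> where Psi: "alg_rep d TK \<Psi>" "\<And>a c. a \<in> carrier TA \<Longrightarrow> \<Psi> (pure a c) = c \<cdot>\<^sub>m \<Phi> a"
    by (rule tensor_closure_rep[OF TA_assoc_algebra Phi(1)]) blast
  interpret TK: assoc_algebra TK by (rule tensor_assoc_algebra[OF TA_assoc_algebra KA])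
  have pc: "pure a c \<in> carrier TK" if "a \<in> carrier TA" for a c
    by (rule pure_tensor_carrier[OF TA_assoc_algebra KA that]) (simp add: closure_algebra_sel)
  \<comment> \<open>A normal form for elements of the scalar extension. Every element has one, and
    its matrix \<open>comb_mat C\<close> determines the coefficients, so the representation is
    injective.\<close>
  define N where "N C = finsum TK (\<lambda>x. pure (monomial x) (C x)) Idx" for C
  have N_add: "N (\<lambda>x. C x + C' x) = N C \<oplus>\<^bsub>TK\<^esub> N C'" for C C'
  proof -
    have "pure (monomial x) (C x + C' x) = pure (monomial x) (C x) \<oplus>\<^bsub>TK\<^esub> pure (monomial x) (C' x)" for x
      using pure_tensor_add_right[OF TA_assoc_algebra KA monomial_carrier, of "C x" "C' x" x] by (simp add: closure_algebra_sel)
    then show ?thesis unfolding N_def by (simp add: TK.finsum_addf pc)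
  qed
  have N_smult: "N (\<lambda>x. to_ac c * C x) = c \<odot>\<^bsub>TK\<^esub> N C" for c C
  proof -
    have "pure (monomial x) (to_ac c * C x) = c \<odot>\<^bsub>TK\<^esub> pure (monomial x) (C x)" for x
      using pure_tensor_smult_right[OF TA_assoc_algebra KA monomial_carrier, of "C x" x c] by (simp add: closure_algebra_sel)
    then show ?thesis unfolding N_def by (simp add: TK.finsum_smult pc)
  qed
  have p0': "pure a 0 = \<zero>\<^bsub>TK\<^esub>" if "a \<in> carrier TA" for a
    using pure_tensor_smult_right[OF TA_assoc_algebra KA that, of 0 0] pc[OF that, of 0]
    by (simp add: closure_algebra_sel TK.smult_zero_left)
  have N_surj: "\<exists>C. z = N C" if "z \<in> carrier TK" for z
  proof -
    have "carrier TK = lin_span TK {pure s b | s b. s \<in> monomial ` Idx \<and> b \<in> carrier ?K}"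
      by (rule tensor_span[OF TA_assoc_algebra KA _ TA_span]) auto
    then have "z \<in> lin_span TK {pure s b | s b. s \<in> monomial ` Idx \<and> b \<in> carrier ?K}" using that by simp
    then show ?thesis
    proof induction
      case zero
      have "N (\<lambda>_. 0) = \<zero>\<^bsub>TK\<^esub>" unfolding N_def by (simp add: p0')
      then show ?case by metis
    next
      case (base z)
      then obtain x c where x: "x \<in> Idx" "z = pure (monomial x) c" by blast
      have "N (\<lambda>y. if y = x then c else 0) = finsum TK (\<lambda>y. if x = y then pure (monomial y) c else \<zero>\<^bsub>TK\<^esub>) Idx"
        unfolding N_def by (rule TK.finsum_cong') (auto simp: p0' pc)
      also have "\<dots> = z" unfolding x(2) by (rule TK.finsum_singleton[OF x(1) finite_Idx]) (auto simp: pc)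
      finally show ?case by metis
    next
      case (add a b)
      then obtain C C' where "a = N C" "b = N C'" by blast
      then show ?case by (intro exI[of _ "\<lambda>x. C x + C' x"]) (simp only: N_add)
    next
      case (smult a c)
      then obtain C where "a = N C" by blast
      then show ?case by (intro exI[of _ "\<lambda>x. to_ac c * C x"]) (simp only: N_smult)
    qed
  qed
  have mm: "monomial_mat x \<in> carrier_mat d d" for x by (simp add: monomial_mat_def)
  have Psi_N: "\<Psi> (N C) = comb_mat C" for C
  proof -
    have "\<Psi> (N C) = mat d d (\<lambda>ij. \<Sum>x\<in>Idx. \<Psi> (pure (monomial x) (C x)) $$ ij)"
      unfolding N_def by (rule alg_rep_finsum[OF TK.assoc_algebra_axioms Psi(1) finite_Idx pc[OF monomial_carrier]])
    also have "\<dots> = comb_mat C"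
      unfolding comb_mat_def by (rule eq_matI) (simp_all add: Psi(2) Phi(2) carrier_matD[OF mm])
    finally show ?thesis .
  qed
  have "bij_betw \<Psi> (carrier TK) (carrier_mat d d)"
    unfolding bij_betw_def
  proof
    show "inj_on \<Psi> (carrier TK)"
    proof (rule inj_onI)
      fix z z' assume z: "z \<in> carrier TK" "z' \<in> carrier TK" "\<Psi> z = \<Psi> z'"
      obtain C where C: "z = N C" using N_surj[OF z(1)] by blast
      obtain C' where C': "z' = N C'" using N_surj[OF z(2)] by blast
      have "comb_mat C = comb_mat C'" using z(3) unfolding C C' Psi_N .
      then have "C x = C' x" if "x \<in> Idx" for x using comb_mat_bij(1) that by blast
      then have "N C = N C'" unfolding N_def by (intro TK.finsum_cong') (auto simp: pc)
      then show "z = z'" using C C' by simp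
    qed
    show "\<Psi> ` carrier TK = carrier_mat d d"
    proof
      show "\<Psi> ` carrier TK \<subseteq> carrier_mat d d" using alg_repD(1)[OF Psi(1)] by blast
      show "carrier_mat d d \<subseteq> \<Psi> ` carrier TK"
      proof
        fix M :: "'f alg_closure mat" assume "M \<in> carrier_mat d d"
        then obtain C where C: "comb_mat C = M" using comb_mat_bij(2) by blast
        have "N C \<in> carrier TK" unfolding N_def by (rule TK.finsum_closed) (simp add: pc)
        then show "M \<in> \<Psi> ` carrier TK" using Psi_N[of C] C by (intro image_eqI[of _ _ "N C"]) simp_all
      qed
    qed
  qed
  then have "\<Psi> \<in> ring_iso TK (ring_mat TYPE('f alg_closure) d ())"
    using Psi(1) unfolding alg_rep_def ring_iso_def by (simp add: ring_mat_simps)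
  moreover have "\<Psi> (pure \<one>\<^bsub>TA\<^esub> c) = c \<cdot>\<^sub>m 1\<^sub>m d" for c
    by (simp add: Psi(2) alg_repD(4)[OF Phi(1)])
  ultimately have spl: "\<Psi> \<in> splittings d TA" unfolding splittings_def by simp
  have "\<Psi> (pure (from_coords C) 1) = comb_mat (\<lambda>x. to_ac (C x))" for C
  proof -
    have "\<Phi> (from_coords C) = mat d d (\<lambda>ij. \<Sum>x\<in>Idx. \<Phi> (C x \<odot>\<^bsub>TA\<^esub> monomial x) $$ ij)"
      unfolding from_coords_def by (rule alg_rep_finsum[OF TA_assoc_algebra Phi(1) finite_Idx]) simp
    also have "\<dots> = comb_mat (\<lambda>x. to_ac (C x))"
      unfolding comb_mat_def by (rule eq_matI) (simp_all add: alg_repD(5)[OF Phi(1)] Phi(2) carrier_matD[OF mm])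
    finally show ?thesis by (simp add: Psi(2) smult_one_mat)
  qed
  then show thesis using that spl by blast
qed

text \<open>The independence of the monomials over the base field, inherited from the independence
  of their matrices.\<close>

lemma from_coords_inj: "from_coords C = from_coords C' \<Longrightarrow> x \<in> Idx \<Longrightarrow> C x = C' x"
proof -
  assume "from_coords C = from_coords C'" "x \<in> Idx"
  moreover obtain \<Psi> where "\<And>C. \<Psi> (pure (from_coords C) 1) = comb_mat (\<lambda>x. to_ac (C x))"
    using splitting_exists by blast
  ultimately have "to_ac (C x) = to_ac (C' x)" using comb_mat_bij(1) by metis
  then show ?thesis by simp
qed

end

section \<open>Power traces and characteristic coefficients\<close>

lemma mat_trace_add:
  "A \<in> carrier_mat n n \<Longrightarrow> B \<in> carrier_mat n n \<Longrightarrow> mat_trace (A + B) = mat_trace A + mat_trace B"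
  by (simp add: mat_trace_def sum.distrib)

lemma mat_trace_smult: "A \<in> carrier_mat n n \<Longrightarrow> mat_trace (c \<cdot>\<^sub>m A) = c * mat_trace A"
  by (simp add: mat_trace_def sum_distrib_left)

text \<open>Comparing coefficients in \<open>(x - A) adj (x - A) = \<chi> (x)\<close>, where \<open>\<chi>\<close> is the characteristic
  polynomial, expresses the coefficients of the adjoint by powers of \<open>A\<close>; its trace is the
  derivative of \<open>\<chi>\<close>.\<close>

lemma char_poly_newton:
  fixes A :: "'a::idom mat"
  assumes A: "A \<in> carrier_mat n n"
  shows "of_nat (Suc j) * coeff (char_poly A) (Suc j) = (\<Sum>i\<le>n. coeff (char_poly A) (j + 1 + i) * mat_trace (A ^\<^sub>m i))"
proof -
  let ?M = "char_poly_matrix A"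
  let ?c = "coeff (char_poly A)"
  have M: "?M \<in> carrier_mat n n" using A by simp
  note adj = adj_mat[OF M]
  define B where "B j = mat n n (\<lambda>(r, s). coeff (adj_mat ?M $$ (r, s)) j)" for j
  have B: "B j \<in> carrier_mat n n" for j by (simp add: B_def)
  have step: "B j = A * B (Suc j) + ?c (Suc j) \<cdot>\<^sub>m 1\<^sub>m n" for j
  proof (rule eq_matI)
    fix r s assume "r < dim_row (A * B (Suc j) + ?c (Suc j) \<cdot>\<^sub>m 1\<^sub>m n)" "s < dim_col (A * B (Suc j) + ?c (Suc j) \<cdot>\<^sub>m 1\<^sub>m n)"
    then have rs: "r < n" "s < n" by (auto simp: B_def)
    have "(?M * adj_mat ?M) $$ (r, s) = (\<Sum>k<n. ?M $$ (r, k) * adj_mat ?M $$ (k, s))"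
      using rs M adj(1) by (simp add: scalar_prod_def atLeast0LessThan)
    also have "\<dots> = (\<Sum>k<n. (if k = r then [:0, 1:] * adj_mat ?M $$ (r, s) else 0) - smult (A $$ (r, k)) (adj_mat ?M $$ (k, s)))"
      using rs A by (intro sum.cong refl) (auto simp: char_poly_matrix_def algebra_simps)
    also have "\<dots> = [:0, 1:] * adj_mat ?M $$ (r, s) - (\<Sum>k<n. smult (A $$ (r, k)) (adj_mat ?M $$ (k, s)))"
      using rs by (simp add: sum_subtractf)
    finally have "(det ?M \<cdot>\<^sub>m 1\<^sub>m n) $$ (r, s) = pCons 0 (adj_mat ?M $$ (r, s)) - (\<Sum>k<n. smult (A $$ (r, k)) (adj_mat ?M $$ (k, s)))"
      by (simp add: adj(2))
    then have "coeff ((det ?M \<cdot>\<^sub>m 1\<^sub>m n) $$ (r, s)) (Suc j) = coeff (adj_mat ?M $$ (r, s)) j - (\<Sum>k<n. A $$ (r, k) * coeff (adj_mat ?M $$ (k, s)) (Suc j))"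
      by (simp add: coeff_sum)
    moreover have "coeff ((det ?M \<cdot>\<^sub>m 1\<^sub>m n) $$ (r, s)) (Suc j) = (if r = s then ?c (Suc j) else 0)"
      using rs by (simp add: char_poly_def)
    ultimately show "B j $$ (r, s) = (A * B (Suc j) + ?c (Suc j) \<cdot>\<^sub>m 1\<^sub>m n) $$ (r, s)"
      using rs A by (auto simp: B_def scalar_prod_def atLeast0LessThan algebra_simps)
  qed (use A in \<open>auto simp: B_def\<close>)
  have pow: "A ^\<^sub>m k \<in> carrier_mat n n" for k using A by (rule pow_carrier_mat)
  have tr_step: "mat_trace (A ^\<^sub>m k * B j) = mat_trace (A ^\<^sub>m Suc k * B (Suc j)) + ?c (Suc j) * mat_trace (A ^\<^sub>m k)" for k j
  proof -
    have "A ^\<^sub>m k * B j = A ^\<^sub>m k * (A * B (Suc j)) + A ^\<^sub>m k * (?c (Suc j) \<cdot>\<^sub>m 1\<^sub>m n)"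
      by (subst step) (rule mult_add_distrib_mat[OF pow mult_carrier_mat[OF A B]], simp)
    also have "A ^\<^sub>m k * (A * B (Suc j)) = A ^\<^sub>m Suc k * B (Suc j)"
      by (simp add: assoc_mult_mat[OF pow A B])
    also have "A ^\<^sub>m k * (?c (Suc j) \<cdot>\<^sub>m 1\<^sub>m n) = ?c (Suc j) \<cdot>\<^sub>m A ^\<^sub>m k"
      using pow[of k] by (simp add: mult_smult_distrib[OF pow one_carrier_mat] right_mult_one_mat[OF pow])
    finally have e: "A ^\<^sub>m k * B j = A ^\<^sub>m Suc k * B (Suc j) + ?c (Suc j) \<cdot>\<^sub>m A ^\<^sub>m k" .
    show ?thesis unfolding e
      by (subst mat_trace_add[where n = n]) (use pow B mat_trace_smult[OF pow] mult_carrier_mat[OF pow B] in \<open>auto simp del: pow_mat.simps\<close>)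
  qed
  have iter: "mat_trace (B j) = (\<Sum>i<k. ?c (j + 1 + i) * mat_trace (A ^\<^sub>m i)) + mat_trace (A ^\<^sub>m k * B (j + k))" for k j
  proof (induction k)
    case 0 then show ?case using A left_mult_one_mat[OF B] by simp
  next
    case (Suc k)
    then show ?case using tr_step[of k "j + k"] by (simp add: algebra_simps del: pow_mat.simps)
  qed
  \<comment> \<open>Larger than the degrees of all entries of the adjoint, so that the remainder
    after \<open>D\<close> iterations is zero, and larger than \<open>n\<close>, so that the sum can
    be cut off at the degree of the characteristic polynomial.\<close>
  define D where "D = Suc (Max ((\<lambda>(r, s). degree (adj_mat ?M $$ (r, s))) ` ({..<n} \<times> {..<n}) \<union> {n}))"
  have D: "degree (adj_mat ?M $$ (r, s)) < D" if "r < n" "s < n" for r s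
    unfolding D_def less_Suc_eq_le using that by (intro Max_ge) auto
  have Dn: "n < D" unfolding D_def less_Suc_eq_le by (intro Max_ge) auto
  have "B (j + D) = 0\<^sub>m n n"
    by (rule eq_matI) (auto simp: B_def intro!: coeff_eq_0 dest: D)
  then have "mat_trace (A ^\<^sub>m D * B (j + D)) = 0"
    using right_mult_zero_mat[OF pow] by (simp add: mat_trace_def)
  then have "mat_trace (B j) = (\<Sum>i<D. ?c (j + 1 + i) * mat_trace (A ^\<^sub>m i))" using iter[of j D] by simp
  also have "\<dots> = (\<Sum>i\<le>n. ?c (j + 1 + i) * mat_trace (A ^\<^sub>m i))"
    using Dn degree_monic_char_poly[OF A] by (intro sum.mono_neutral_right) (auto intro!: coeff_eq_0)
  finally have 1: "mat_trace (B j) = (\<Sum>i\<le>n. ?c (j + 1 + i) * mat_trace (A ^\<^sub>m i))" .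
  have "adj_mat ?M $$ (i, i) = char_poly (mat_delete A i i)" if "i < n" for i
  proof -
    have "mat_delete ?M i i = char_poly_matrix (mat_delete A i i)"
      by (rule eq_matI) (use A that in \<open>auto simp: mat_delete_def char_poly_matrix_def\<close>)
    then show ?thesis using that M by (simp add: adj_mat_def cofactor_def char_poly_def)
  qed
  then have "mat_trace (B j) = coeff (\<Sum>i<n. char_poly (mat_delete A i i)) j"
    by (simp add: mat_trace_def B_def coeff_sum)
  also have "\<dots> = of_nat (Suc j) * ?c (Suc j)"
    unfolding pderiv_char_poly[OF A, symmetric] by (simp add: coeff_pderiv)
  finally show ?thesis using 1 by simp
qed

text \<open>With the earlier coefficients zero, Newton's identity retains only the terms with
  \<open>A ^\<^sub>m 0\<close> and \<open>A ^\<^sub>m k\<close>. The former turns the factor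
  \<open>n - k\<close> on the left into \<open>- k\<close>.\<close>

corollary char_poly_first_power_trace:
  fixes A :: "'a::idom mat"
  assumes A: "A \<in> carrier_mat n n" and k: "1 \<le> k" "k < n"
    and zero: "\<And>i. 1 \<le> i \<Longrightarrow> i < k \<Longrightarrow> coeff (char_poly A) (n - i) = 0"
  shows "mat_trace (A ^\<^sub>m k) = - of_nat k * coeff (char_poly A) (n - k)"
proof -
  let ?c = "coeff (char_poly A)"
  have cn: "?c n = 1" using degree_monic_char_poly[OF A] by auto
  have big: "?c i = 0" if "i > n" for i using degree_monic_char_poly[OF A] that by (auto intro: coeff_eq_0)
  have tr0: "mat_trace (A ^\<^sub>m 0) = of_nat n" using A by (simp add: mat_trace_def)
  obtain j where j: "n - k = Suc j" using k by (cases "n - k") auto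
    have "of_nat (Suc j) * ?c (Suc j) = (\<Sum>i\<le>n. ?c (j + 1 + i) * mat_trace (A ^\<^sub>m i))"
      by (rule char_poly_newton[OF A])
    \<comment> \<open>The index of the coefficient is \<open>n - k + i\<close>. For
      \<open>0 < i < k\<close> the coefficient vanishes by assumption, and for \<open>i > k\<close>
      the index exceeds the degree.\<close>
    also have "\<dots> = (\<Sum>i\<in>{0, k}. ?c (j + 1 + i) * mat_trace (A ^\<^sub>m i))"
    proof (rule sum.mono_neutral_right)
      show "\<forall>i\<in>{..n} - {0, k}. ?c (j + 1 + i) * mat_trace (A ^\<^sub>m i) = 0"
      proof
        fix i assume i: "i \<in> {..n} - {0, k}"
        have "?c (j + 1 + i) = 0"
        proof (cases "i < k")
          case True
          have "j + 1 + i = n - (k - i)" using j k True by simp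
          then show ?thesis using zero[of "k - i"] True i by auto
        next
          case False then show ?thesis using i j k by (intro big) auto
        qed
        then show "?c (j + 1 + i) * mat_trace (A ^\<^sub>m i) = 0" by simp
      qed
    qed (use k in auto)
    also have "\<dots> = ?c (Suc j) * of_nat n + mat_trace (A ^\<^sub>m k)"
    proof -
      have "j + 1 + k = n" using j k by simp
      then show ?thesis using k cn tr0 by simp
    qed
    finally have "mat_trace (A ^\<^sub>m k) = (of_nat (Suc j) - of_nat n) * ?c (Suc j)" by (simp add: algebra_simps)
    also have "of_nat (Suc j) - of_nat n = (- of_nat k :: 'a)"
    proof -
      have "n = Suc j + k" using j k by simp
      then show ?thesis by simp
    qed
    finally show ?thesis using j by simp
qed

text \<open>Skolem-Noether for matrix algebras, by an explicit conjugating matrix. It makes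
  characteristic polynomials independent of the splitting that the definition chooses.\<close>

lemma matrix_automorphism_inner:
  fixes g :: "'k::field mat \<Rightarrow> 'k mat"
  assumes n: "n > 0"
    and g: "\<And>M. M \<in> carrier_mat n n \<Longrightarrow> g M \<in> carrier_mat n n"
      "\<And>M N. M \<in> carrier_mat n n \<Longrightarrow> N \<in> carrier_mat n n \<Longrightarrow> g (M + N) = g M + g N"
      "\<And>M N. M \<in> carrier_mat n n \<Longrightarrow> N \<in> carrier_mat n n \<Longrightarrow> g (M * N) = g M * g N"
      "\<And>M c. M \<in> carrier_mat n n \<Longrightarrow> g (c \<cdot>\<^sub>m M) = c \<cdot>\<^sub>m g M"
    and inj: "\<And>M. M \<in> carrier_mat n n \<Longrightarrow> g M = 0\<^sub>m n n \<Longrightarrow> M = 0\<^sub>m n n"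
    and M: "M \<in> carrier_mat n n"
  shows "similar_mat (g M) M"
proof -
  define E where "E i j = mat n n (\<lambda>rs. if rs = (i, j) then 1 else 0 :: 'k)" for i j
  have E: "E i j \<in> carrier_mat n n" for i j by (simp add: E_def)
  have EE: "E i j * E k l = (if j = k then E i l else 0\<^sub>m n n)" if "i < n" "j < n" "k < n" "l < n" for i j k l
    by (rule eq_matI) (use that in \<open>auto simp: E_def scalar_prod_def if_distrib[of "\<lambda>x. x * _"] sum.delta cong: if_cong\<close>)
  have g0: "g (0\<^sub>m n n) = 0\<^sub>m n n" 
  proof -
    have "g (0\<^sub>m n n) = g (0 \<cdot>\<^sub>m 0\<^sub>m n n)" by (rule arg_cong[of _ _ g], rule eq_matI) auto
    also have "\<dots> = 0 \<cdot>\<^sub>m g (0\<^sub>m n n)" by (rule g(4)) simp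
    also have "\<dots> = 0\<^sub>m n n" by (rule eq_matI) (simp_all add: carrier_matD[OF g(1)[OF zero_carrier_mat]])
    finally show ?thesis .
  qed
  have "E 0 0 \<noteq> 0\<^sub>m n n"
  proof
    assume "E 0 0 = 0\<^sub>m n n"
    then have "E 0 0 $$ (0, 0) = 0\<^sub>m n n $$ (0, 0)" by simp
    then show False using n by (simp add: E_def)
  qed
  then have "g (E 0 0) \<noteq> 0\<^sub>m n n" using inj[OF E] by blast
  then obtain q0 c0 where q0: "q0 < n" "c0 < n" "g (E 0 0) $$ (q0, c0) \<noteq> 0"
    using g(1)[OF E, of 0 0] by (metis carrier_matD eq_matI index_zero_mat)
  \<comment> \<open>Column \<open>j\<close> of \<open>S\<close> is column \<open>c0\<close> of the
    image of the matrix unit \<open>E j 0\<close>. Since \<open>N * E j 0\<close> is the combination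
    of the \<open>E i 0\<close> with coefficients from column \<open>j\<close> of \<open>N\<close>,
    this gives \<open>g N * S = S * N\<close>.\<close>
  define S where "S = mat n n (\<lambda>(r, j). g (E j 0) $$ (r, c0))"
  have S: "S \<in> carrier_mat n n" by (simp add: S_def)
  have lin: "g (mat n n (\<lambda>(r, s). if s = 0 \<and> r \<in> R then v r else 0)) $$ (q, c0) = (\<Sum>i\<in>R. v i * g (E i 0) $$ (q, c0))"
    if R: "finite R" "R \<subseteq> {..<n}" and q: "q < n" for R v q
    using R
  proof (induction R)
    case empty
    have "mat n n (\<lambda>(r, s). if s = 0 \<and> r \<in> {} then v r else 0) = 0\<^sub>m n n" by (rule eq_matI) auto
    then show ?case using q q0 by (simp only: g0) simp
  next
    case (insert i R)
    let ?N = "\<lambda>R. mat n n (\<lambda>(r, s). if s = 0 \<and> r \<in> R then v r else 0)"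
    have "?N (insert i R) = v i \<cdot>\<^sub>m E i 0 + ?N R" by (rule eq_matI) (use insert in \<open>auto simp: E_def\<close>)
    then have "g (?N (insert i R)) = v i \<cdot>\<^sub>m g (E i 0) + g (?N R)"
      using g(2)[of "v i \<cdot>\<^sub>m E i 0" "?N R"] g(4)[OF E] E by simp
    then show ?case using insert g(1)[OF E, of i 0] g(1)[of "?N R"] q q0 by simp
  qed
  have gS: "g N * S = S * N" if N: "N \<in> carrier_mat n n" for N
  proof (rule eq_matI)
    fix r j assume "r < dim_row (S * N)" "j < dim_col (S * N)"
    then have rj: "r < n" "j < n" using N by (auto simp: S_def)
    have "(g N * S) $$ (r, j) = (g N * g (E j 0)) $$ (r, c0)"
      using rj g(1)[OF N] g(1)[OF E, of j 0] q0 by (simp add: S_def scalar_prod_def)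
    also have "g N * g (E j 0) = g (N * E j 0)" using g(3)[OF N E] by simp
    also have "N * E j 0 = mat n n (\<lambda>(r, s). if s = 0 \<and> r \<in> {..<n} then N $$ (r, j) else 0)"
      by (rule eq_matI) (use N rj in \<open>auto simp: E_def scalar_prod_def if_distrib[of "\<lambda>x. _ * x"] sum.delta cong: if_cong\<close>)
    also have "g \<dots> $$ (r, c0) = (\<Sum>i<n. N $$ (i, j) * g (E i 0) $$ (r, c0))"
      using lin[of "{..<n}" r "\<lambda>r. N $$ (r, j)"] rj by simp
    also have "\<dots> = (S * N) $$ (r, j)"
      using rj N by (simp add: S_def scalar_prod_def atLeast0LessThan mult.commute)
    finally show "(g N * S) $$ (r, j) = (S * N) $$ (r, j)" .
  qed (use g(1)[OF N] N S in auto)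
  \<comment> \<open>For \<open>v\<close> in the kernel of \<open>S\<close>, row \<open>q0\<close> of
    the image of \<open>E 0 k\<close> extracts the entry \<open>k\<close> of \<open>v\<close>,
    multiplied by the entry of the image of \<open>E 0 0\<close> that was chosen to be
    nonzero.\<close>
  have "det S \<noteq> 0"
  proof
    assume "det S = 0"
    then obtain v where v: "v \<in> carrier_vec n" "v \<noteq> 0\<^sub>v n" "S *\<^sub>v v = 0\<^sub>v n"
      using det_0_iff_vec_prod_zero_field[OF S] by blast
    have row: "(\<Sum>j<n. v $ j * g (E j 0) $$ (r, c0)) = 0" if "r < n" for r
    proof -
      have "(S *\<^sub>v v) $ r = 0" using v that by simp
      then show ?thesis using that v(1) by (simp add: S_def scalar_prod_def atLeast0LessThan mult.commute)
    qed
    have "v $ k = 0" if k: "k < n" for k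
    proof -
      have pr: "(\<Sum>r<n. g (E 0 k) $$ (q0, r) * g (E j 0) $$ (r, c0)) = (if j = k then g (E 0 0) $$ (q0, c0) else 0)" if "j < n" for j
      proof -
        have "(\<Sum>r<n. g (E 0 k) $$ (q0, r) * g (E j 0) $$ (r, c0)) = (g (E 0 k) * g (E j 0)) $$ (q0, c0)"
          using g(1)[OF E, of 0 k] g(1)[OF E, of j 0] q0 by (simp add: scalar_prod_def atLeast0LessThan)
        also have "\<dots> = g (E 0 k * E j 0) $$ (q0, c0)" using g(3)[OF E E] by simp
        also have "\<dots> = (if j = k then g (E 0 0) $$ (q0, c0) else 0)"
          using EE[of 0 k j 0] n k that g0 q0 by auto
        finally show ?thesis .
      qed
      have "0 = (\<Sum>r<n. g (E 0 k) $$ (q0, r) * (\<Sum>j<n. v $ j * g (E j 0) $$ (r, c0)))"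
        by (simp add: row)
      also have "\<dots> = (\<Sum>j<n. v $ j * (\<Sum>r<n. g (E 0 k) $$ (q0, r) * g (E j 0) $$ (r, c0)))"
        by (simp add: sum_distrib_left) (subst sum.swap, simp add: mult_ac)
      also have "\<dots> = v $ k * g (E 0 0) $$ (q0, c0)" using k by (simp add: pr if_distrib[of "\<lambda>x. _ * x"] cong: if_cong)
      finally show ?thesis using q0 by simp
    qed
    then have "v = 0\<^sub>v n" using v(1) by (intro eq_vecI) auto
    then show False using v(2) by simp
  qed
  then obtain S' where S': "S' \<in> carrier_mat n n" "S * S' = 1\<^sub>m n" "S' * S = 1\<^sub>m n"
    using det_non_zero_imp_unit[OF S, of "()"] unfolding Units_def by (auto simp: ring_mat_simps)
  have "g M = g M * (S * S')" using S'(2) g(1)[OF M] by simp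
  also have "\<dots> = S * M * S'" using gS[OF M] assoc_mult_mat[OF g(1)[OF M] S S'(1)] by simp
  finally have "similar_mat_wit (g M) M S S'"
    unfolding similar_mat_wit_def Let_def using g(1)[OF M] M S S' by auto
  then show ?thesis unfolding similar_mat_def by blast
qed

context symbol_model
begin

text \<open>Two splittings differ by a linear automorphism \<open>g\<close> of the matrix algebra,
  which is inner; so an arbitrary splitting may be replaced by the explicit matrices.\<close>

lemma char_poly_splitting:
  assumes h: "h \<in> splittings d TA"
  shows "char_poly (h (pure (from_coords C) 1)) = char_poly (comb_mat (\<lambda>x. to_ac (C x)))"
    and "h (pure (from_coords C) 1) \<in> carrier_mat d d"
proof -
  obtain \<Psi> where Psi: "\<Psi> \<in> splittings d TA" "\<And>C. \<Psi> (pure (from_coords C) 1) = comb_mat (\<lambda>x. to_ac (C x))"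
    by (rule splitting_exists) blast
  let ?R = "ring_mat TYPE('f alg_closure) d ()"
  note KA = closure_algebra_assoc_algebra
  interpret TK: assoc_algebra TK by (rule tensor_assoc_algebra[OF TA_assoc_algebra KA])
  have pc: "pure a c \<in> carrier TK" if "a \<in> carrier TA" for a c
    by (rule pure_tensor_carrier[OF TA_assoc_algebra KA that]) (simp add: closure_algebra_sel)
  have props: "f z \<in> carrier_mat d d" "f (z \<otimes>\<^bsub>TK\<^esub> z') = f z * f z'" "f (z \<oplus>\<^bsub>TK\<^esub> z') = f z + f z'"
    "f (pure \<one>\<^bsub>TA\<^esub> c) = c \<cdot>\<^sub>m 1\<^sub>m d"
    if "f \<in> splittings d TA" "z \<in> carrier TK" "z' \<in> carrier TK" for f z z' c
  proof -
    have f: "f \<in> Ring.ring_hom TK ?R" using that(1) by (simp add: splittings_def ring_iso_def)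
    show "f z \<in> carrier_mat d d" using ring_hom_closed[OF f that(2)] by (simp add: ring_mat_simps)
    show "f (z \<otimes>\<^bsub>TK\<^esub> z') = f z * f z'" using ring_hom_mult[OF f that(2,3)] by (simp add: ring_mat_simps)
    show "f (z \<oplus>\<^bsub>TK\<^esub> z') = f z + f z'" using ring_hom_add[OF f that(2,3)] by (simp add: ring_mat_simps)
    show "f (pure \<one>\<^bsub>TA\<^esub> c) = c \<cdot>\<^sub>m 1\<^sub>m d" using that(1) by (simp add: splittings_def)
  qed
  have bij: "bij_betw f (carrier TK) (carrier_mat d d)" if "f \<in> splittings d TA" for f
    using that by (simp add: splittings_def ring_iso_def ring_mat_simps)
  define g where "g M = h (inv_into (carrier TK) \<Psi> M)" for M
  define u where "u M = inv_into (carrier TK) \<Psi> M" for M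
  have u: "u M \<in> carrier TK" "\<Psi> (u M) = M" if "M \<in> carrier_mat d d" for M
    unfolding u_def using bij[OF Psi(1)] that by (auto simp: bij_betw_def inv_into_into f_inv_into_f)
  have u': "u (\<Psi> z) = z" if "z \<in> carrier TK" for z
    unfolding u_def using bij[OF Psi(1)] that by (auto simp: bij_betw_def)
  have g: "g M = h (u M)" for M by (simp add: g_def u_def)
  have u_add: "u (M + N) = u M \<oplus>\<^bsub>TK\<^esub> u N" and u_mult: "u (M * N) = u M \<otimes>\<^bsub>TK\<^esub> u N"
    if "M \<in> carrier_mat d d" "N \<in> carrier_mat d d" for M N
  proof -
    have "\<Psi> (u M \<oplus>\<^bsub>TK\<^esub> u N) = M + N" "\<Psi> (u M \<otimes>\<^bsub>TK\<^esub> u N) = M * N"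
      using props(2,3)[OF Psi(1) u(1) u(1)] u(2) that by auto
    then show "u (M + N) = u M \<oplus>\<^bsub>TK\<^esub> u N" "u (M * N) = u M \<otimes>\<^bsub>TK\<^esub> u N"
      using u'[OF TK.a_closed[OF u(1)[OF that(1)] u(1)[OF that(2)]]] u'[OF TK.m_closed[OF u(1)[OF that(1)] u(1)[OF that(2)]]] by auto
  qed
  \<comment> \<open>A splitting is known to respect scalars only on the elements
    \<open>pure \<one> c\<close>. Scaling is therefore written as multiplication by a scalar
    matrix.\<close>
  have scal: "c \<cdot>\<^sub>m M = (c \<cdot>\<^sub>m 1\<^sub>m d) * M" if "M \<in> carrier_mat d d" for c :: "'f alg_closure" and M
    using that by (simp add: mult_smult_assoc_mat[of _ d d _ d])
  have one: "\<one>\<^bsub>TA\<^esub> \<in> carrier TA" by simp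
  have u_scal: "u (c \<cdot>\<^sub>m 1\<^sub>m d) = pure \<one>\<^bsub>TA\<^esub> c" for c
    using u'[OF pc[OF one, of c]] props(4)[OF Psi(1) pc[OF one] pc[OF one], of c] by simp
  have sim: "similar_mat (g M) M" if M: "M \<in> carrier_mat d d" for M
  proof (rule matrix_automorphism_inner[OF _ _ _ _ _ _ M])
    show "d > 0" using p0 by simp
    show "g M \<in> carrier_mat d d" if "M \<in> carrier_mat d d" for M
      unfolding g using props(1)[OF h u(1)[OF that] u(1)[OF that]] .
    show "g (M + N) = g M + g N" if "M \<in> carrier_mat d d" "N \<in> carrier_mat d d" for M N
      unfolding g u_add[OF that] by (rule props(3)[OF h u(1)[OF that(1)] u(1)[OF that(2)]])
    show gm: "g (M * N) = g M * g N" if "M \<in> carrier_mat d d" "N \<in> carrier_mat d d" for M N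
      unfolding g u_mult[OF that] by (rule props(2)[OF h u(1)[OF that(1)] u(1)[OF that(2)]])
    show "g (c \<cdot>\<^sub>m M) = c \<cdot>\<^sub>m g M" if M: "M \<in> carrier_mat d d" for M c
    proof -
      have "g (c \<cdot>\<^sub>m M) = g (c \<cdot>\<^sub>m 1\<^sub>m d) * g M"
        unfolding scal[OF M] by (rule gm) (use M in simp_all)
      also have "g (c \<cdot>\<^sub>m 1\<^sub>m d) = c \<cdot>\<^sub>m 1\<^sub>m d"
        unfolding g u_scal by (rule props(4)[OF h pc[OF one] pc[OF one]])
      also have "(c \<cdot>\<^sub>m 1\<^sub>m d) * g M = c \<cdot>\<^sub>m g M"
        using scal[of "g M" c] props(1)[OF h u(1)[OF M] u(1)[OF M]] by (simp add: g)
      finally show ?thesis .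
    qed
    show "M = 0\<^sub>m d d" if M: "M \<in> carrier_mat d d" "g M = 0\<^sub>m d d" for M
    proof -
      have z: "u (0\<^sub>m d d) \<in> carrier TK" by (rule u(1)) simp
      have "h (u (0\<^sub>m d d)) = 0\<^sub>m d d"
      proof -
        have "0\<^sub>m d d = (0 :: 'f alg_closure) \<cdot>\<^sub>m 1\<^sub>m d" by (rule eq_matI) auto
        then have "u (0\<^sub>m d d) = pure \<one>\<^bsub>TA\<^esub> 0" using u_scal[of 0] by simp
        then have "h (u (0\<^sub>m d d)) = 0 \<cdot>\<^sub>m 1\<^sub>m d" using props(4)[OF h pc[OF one] pc[OF one], of 0] by simp
        also have "\<dots> = 0\<^sub>m d d" by (rule eq_matI) auto
        finally show ?thesis .
      qed
      then have "h (u M) = h (u (0\<^sub>m d d))" using M(2) by (simp add: g)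
      then have "u M = u (0\<^sub>m d d)" using bij[OF h] u(1)[OF M(1)] z by (auto simp: bij_betw_def inj_on_def)
      then have "\<Psi> (u M) = \<Psi> (u (0\<^sub>m d d))" by simp
      then show ?thesis unfolding u(2)[OF M(1)] u(2)[OF zero_carrier_mat] .
    qed
  qed
  let ?z = "pure (from_coords C) 1"
  have z: "?z \<in> carrier TK" by (rule pc) simp
  have "h ?z = g (\<Psi> ?z)" unfolding g u'[OF z] ..
  then show "char_poly (h ?z) = char_poly (comb_mat (\<lambda>x. to_ac (C x)))"
    using char_poly_similar[OF sim[OF comb_mat_carrier]] by (simp add: Psi(2))
  show "h ?z \<in> carrier_mat d d" by (rule props(1)[OF h z z])
qed

text \<open>\<open>char_coeff\<close> is a definite description of a preimage in the base field, so
  its vanishing is informative only once the coefficient is known to lie there. This follows by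
  strong induction: when the earlier coefficients vanish, the \<open>k\<close>-th is the power trace
  divided by \<open>- k\<close>, and the power traces lie in the base field.\<close>

lemma power_trace_zero:
  assumes coeffs: "\<And>i. 1 \<le> i \<Longrightarrow> i < p \<Longrightarrow> char_coeff d TA i (from_coords C) = 0"
    and traces: "\<And>k. mat_trace (comb_mat (\<lambda>x. to_ac (C x)) ^\<^sub>m k) \<in> range to_ac"
    and char: "\<And>k. 1 \<le> k \<Longrightarrow> k < p \<Longrightarrow> of_nat k \<noteq> (0 :: 'f)"
    and "m \<ge> 1" and k: "1 \<le> k" "k < p"
  shows "mat_trace (comb_mat (\<lambda>x. to_ac (C x)) ^\<^sub>m k) = 0"
proof -
  let ?M = "comb_mat (\<lambda>x. to_ac (C x))"
  let ?h = "SOME h. h \<in> splittings d TA"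
  obtain \<Psi> where "\<Psi> \<in> splittings d TA" using splitting_exists by metis
  then have "?h \<in> splittings d TA" using someI[of "\<lambda>h. h \<in> splittings d TA" \<Psi>] by simp
  then have cp: "reduced_char_poly d TA (from_coords C) = char_poly ?M"
    unfolding reduced_char_poly_def by (rule char_poly_splitting(1))
  have pd: "p \<le> d" using \<open>m \<ge> 1\<close> p by (cases m) auto
  have zero: "coeff (char_poly ?M) (d - k) = 0" if "1 \<le> k" "k < p" for k
    using that
  proof (induction k rule: less_induct)
    case (less k)
    obtain x where x: "mat_trace (?M ^\<^sub>m k) = to_ac x" using traces by blast
    have "mat_trace (?M ^\<^sub>m k) = - of_nat k * coeff (char_poly ?M) (d - k)"
      by (rule char_poly_first_power_trace[OF comb_mat_carrier]) (use less pd in auto)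
    then have "coeff (char_poly ?M) (d - k) = to_ac (- x / of_nat k)"
      using x char[OF less.prems] by (simp add: field_simps flip: to_ac_of_nat)
    then have c: "\<exists>c. to_ac c = coeff (char_poly ?M) (d - k)" by metis
    have "char_coeff d TA k (from_coords C) = 0" using coeffs less.prems by blast
    then have "to_ac 0 = coeff (char_poly ?M) (d - k)"
      unfolding char_coeff_def cp using theI'[of "\<lambda>c. to_ac c = coeff (char_poly ?M) (d - k)"] c
      by (metis to_ac_eq_iff)
    then show ?case by simp
  qed
  have "mat_trace (?M ^\<^sub>m k) = - of_nat k * coeff (char_poly ?M) (d - k)"
    by (rule char_poly_first_power_trace[OF comb_mat_carrier]) (use k zero pd in auto)
  then show ?thesis using zero k by simp
qed

definition word_trace :: "(nat \<times> nat) list \<Rightarrow> 'f alg_closure" where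
  "word_trace xs = mat_trace (mat_list_prod d (map monomial_mat xs))"

definition digits :: "nat \<Rightarrow> (nat \<times> nat) list \<Rightarrow> (nat \<times> nat) list" where
  "digits i xs = map (\<lambda>x. (dig p i (fst x), dig p i (snd x))) xs"

lemma monomial_mat_carrier: "monomial_mat x \<in> carrier_mat d d"
  by (simp add: monomial_mat_def)

lemma word_trace_eq:
  "word_trace xs = (\<Prod>i<m. if p dvd sum_list (map snd (digits i xs))
    then \<eta> i ^ sum_list (map snd (digits i xs)) * (\<Sum>j<p. word_diagonal (\<xi> i) (digits i xs) j) else 0)"
proof -
  let ?g = "\<lambda>x i. diag_shift p (\<eta> i) (\<lambda>j. \<xi> i j ^ dig p i (fst x)) (dig p i (snd x))"
  have c: "mat_list_prod p (map (\<lambda>x. ?g x i) xs) = diag_shift p (\<eta> i) (word_diagonal (\<xi> i) (digits i xs)) (sum_list (map snd (digits i xs)))"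
    if i: "i < m" for i
    using word_prod[OF p0, of "\<xi> i" "\<eta> i" "digits i xs"] xi_periodic[OF i]
    by (simp add: digits_def comp_def case_prod_beta)
  have "map monomial_mat xs = map (kron p m) (map ?g xs)"
    by (simp add: monomial_mat_def)
  then have "mat_list_prod d (map monomial_mat xs) = mat_list_prod d (map (kron p m) (map ?g xs))"
    by (rule arg_cong)
  also have "\<dots> = kron p m (\<lambda>i. mat_list_prod p (map (\<lambda>g. g i) (map ?g xs)))"
    by (rule kron_list_prod[OF p0]) auto
  also have "\<dots> = kron p m (\<lambda>i. diag_shift p (\<eta> i) (word_diagonal (\<xi> i) (digits i xs)) (sum_list (map snd (digits i xs))))"
    by (rule kron_cong) (simp add: comp_def c)
  finally have "word_trace xs = mat_trace (kron p m (\<lambda>i. diag_shift p (\<eta> i) (word_diagonal (\<xi> i) (digits i xs)) (sum_list (map snd (digits i xs)))))"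
    by (simp add: word_trace_def)
  also have "\<dots> = (\<Prod>i<m. mat_trace (diag_shift p (\<eta> i) (word_diagonal (\<xi> i) (digits i xs)) (sum_list (map snd (digits i xs)))))"
    by (rule kron_trace[OF p0]) simp
  also have "\<dots> = (\<Prod>i<m. if p dvd sum_list (map snd (digits i xs))
    then \<eta> i ^ sum_list (map snd (digits i xs)) * (\<Sum>j<p. word_diagonal (\<xi> i) (digits i xs) j) else 0)"
    by (intro prod.cong refl diag_shift_trace[OF p0])
  finally show ?thesis .
qed

lemma word_trace_rotate: "word_trace (xs @ ys) = word_trace (ys @ xs)"
proof -
  have c: "set (map monomial_mat zs) \<subseteq> carrier_mat d d" for zs using monomial_mat_carrier by auto
  show ?thesis unfolding word_trace_def map_append mat_list_prod_append[OF c c]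
    by (rule mat_trace_comm[OF mat_list_prod_carrier[OF c] mat_list_prod_carrier[OF c]])
qed

lemma comb_mat_list_prod:
  assumes "i < d" "j < d"
  shows "mat_list_prod d (map comb_mat Cs) $$ (i, j) =
    (\<Sum>xs | set xs \<subseteq> Idx \<and> length xs = length Cs. (\<Prod>s<length Cs. (Cs ! s) (xs ! s)) * mat_list_prod d (map monomial_mat xs) $$ (i, j))"
  using assms
proof (induction Cs arbitrary: i j)
  case Nil
  have "{xs. set xs \<subseteq> Idx \<and> length xs = length []} = {[]}" by auto
  then show ?case by simp
next
  case (Cons C Cs)
  let ?L = "\<lambda>k. {xs. set xs \<subseteq> Idx \<and> length xs = k}"
  have fin: "finite (?L k)" for k using finite_lists_length_eq[OF finite_Idx] by simp
  have L: "?L (Suc k) = (\<lambda>(x, xs). x # xs) ` (Idx \<times> ?L k)" for k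
    by (auto simp: length_Suc_conv image_iff)
  have inj: "inj_on (\<lambda>(x, xs). x # xs) (Idx \<times> ?L k)" for k by (auto simp: inj_on_def)
  have cc: "mat_list_prod d (map comb_mat Cs) \<in> carrier_mat d d" by (rule mat_list_prod_carrier) auto
  have cm: "mat_list_prod d (map monomial_mat xs) \<in> carrier_mat d d" for xs
    by (rule mat_list_prod_carrier) (use monomial_mat_carrier in auto)
  let ?P = "\<lambda>xs. \<Prod>s<length Cs. (Cs ! s) (xs ! s)"
  have "mat_list_prod d (map comb_mat (C # Cs)) $$ (i, j) = (\<Sum>k<d. comb_mat C $$ (i, k) * mat_list_prod d (map comb_mat Cs) $$ (k, j))"
    using Cons.prems carrier_matD[OF cc] by (simp add: scalar_prod_def atLeast0LessThan comb_mat_def)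
  also have "\<dots> = (\<Sum>k<d. (\<Sum>x\<in>Idx. C x * monomial_mat x $$ (i, k)) * (\<Sum>xs\<in>?L (length Cs). ?P xs * mat_list_prod d (map monomial_mat xs) $$ (k, j)))"
    using Cons.prems by (intro sum.cong refl arg_cong2[of _ _ _ _ "(*)"] Cons.IH) (simp_all add: comb_mat_def)
  also have "\<dots> = (\<Sum>k<d. \<Sum>(x, xs)\<in>Idx \<times> ?L (length Cs). C x * ?P xs * (monomial_mat x $$ (i, k) * mat_list_prod d (map monomial_mat xs) $$ (k, j)))"
    by (simp add: sum_product sum.cartesian_product mult_ac)
  also have "\<dots> = (\<Sum>(x, xs)\<in>Idx \<times> ?L (length Cs). C x * ?P xs * (\<Sum>k<d. monomial_mat x $$ (i, k) * mat_list_prod d (map monomial_mat xs) $$ (k, j)))"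
    by (subst sum.swap) (simp add: sum_distrib_left case_prod_beta)
  also have "\<dots> = (\<Sum>(x, xs)\<in>Idx \<times> ?L (length Cs). (\<Prod>s<Suc (length Cs). ((C # Cs) ! s) ((x # xs) ! s)) * mat_list_prod d (map monomial_mat (x # xs)) $$ (i, j))"
  proof (intro sum.cong refl, clarify)
    fix a b xs
    have "(\<Sum>k<d. monomial_mat (a, b) $$ (i, k) * mat_list_prod d (map monomial_mat xs) $$ (k, j)) = mat_list_prod d (map monomial_mat ((a, b) # xs)) $$ (i, j)"
      using Cons.prems carrier_matD[OF cm[of xs]] carrier_matD[OF monomial_mat_carrier[of "(a, b)"]] by (simp add: scalar_prod_def atLeast0LessThan)
    then show "C (a, b) * ?P xs * (\<Sum>k<d. monomial_mat (a, b) $$ (i, k) * mat_list_prod d (map monomial_mat xs) $$ (k, j))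
       = (\<Prod>s<Suc (length Cs). ((C # Cs) ! s) (((a, b) # xs) ! s)) * mat_list_prod d (map monomial_mat ((a, b) # xs)) $$ (i, j)"
      by (simp add: prod.lessThan_Suc_shift del: prod.lessThan_Suc)
  qed
  also have "\<dots> = (\<Sum>xs\<in>?L (Suc (length Cs)). (\<Prod>s<Suc (length Cs). ((C # Cs) ! s) (xs ! s)) * mat_list_prod d (map monomial_mat xs) $$ (i, j))"
    unfolding L by (subst sum.reindex[OF inj]) (simp add: case_prod_beta comp_def)
  finally show ?case by simp
qed

lemma comb_mat_power_trace:
  "mat_trace (comb_mat C ^\<^sub>m k) = (\<Sum>xs | set xs \<subseteq> Idx \<and> length xs = k. (\<Prod>s<k. C (xs ! s)) * word_trace xs)"
proof -
  have e: "comb_mat C ^\<^sub>m k = mat_list_prod d (map comb_mat (replicate k C))"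
    using mat_list_prod_replicate[OF comb_mat_carrier, of k C] by simp
  have cc: "mat_list_prod d (map comb_mat (replicate k C)) \<in> carrier_mat d d" by (rule mat_list_prod_carrier) auto
  have cm: "mat_list_prod d (map monomial_mat xs) \<in> carrier_mat d d" for xs
    by (rule mat_list_prod_carrier) (use monomial_mat_carrier in auto)
  have "mat_trace (comb_mat C ^\<^sub>m k) = (\<Sum>i<d. mat_list_prod d (map comb_mat (replicate k C)) $$ (i, i))"
    unfolding e mat_trace_def using carrier_matD[OF cc] by simp
  also have "\<dots> = (\<Sum>i<d. \<Sum>xs | set xs \<subseteq> Idx \<and> length xs = k. (\<Prod>s<k. C (xs ! s)) * mat_list_prod d (map monomial_mat xs) $$ (i, i))"
    by (intro sum.cong refl, subst comb_mat_list_prod) (auto intro!: sum.cong prod.cong)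
  also have "\<dots> = (\<Sum>xs | set xs \<subseteq> Idx \<and> length xs = k. (\<Prod>s<k. C (xs ! s)) * word_trace xs)"
    by (subst sum.swap) (simp add: word_trace_def mat_trace_def sum_distrib_left carrier_matD[OF cm])
  finally show ?thesis .
qed

end

section \<open>Leading terms of word traces\<close>

text \<open>The model together with a degree on the base field only; all comparisons of degrees are
  made for coefficients and traces, which lie there. Integers and \<open>\<rho>\<close> have degree
  zero because they belong to \<open>F0\<close>.\<close>

locale valued_symbol_model = symbol_model p m \<epsilon> \<rho> \<alpha> \<beta> \<xi> \<eta>
  for p m :: nat and \<epsilon> \<rho> :: "'f::field" and \<alpha> \<beta> \<xi> \<eta> +
  fixes w :: "'f \<Rightarrow> int poly"
  assumes prime: "Factorial_Ring.prime p"
    and w_mult: "\<And>x y. x \<noteq> 0 \<Longrightarrow> y \<noteq> 0 \<Longrightarrow> w (x * y) = w x + w y"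
    and w_add: "\<And>x y. x \<noteq> 0 \<Longrightarrow> y \<noteq> 0 \<Longrightarrow> x + y \<noteq> 0 \<Longrightarrow> w (x + y) \<le> max (w x) (w y)"
    and w_of_nat: "\<And>n. of_nat n \<noteq> (0 :: 'f) \<Longrightarrow> w (of_nat n) = 0"
    and w_alpha: "\<And>i. i < m \<Longrightarrow> \<alpha> i \<noteq> 0 \<and> w (\<alpha> i) = monom 1 (2 * i)"
    and w_beta: "\<And>i. i < m \<Longrightarrow> \<beta> i \<noteq> 0 \<and> w (\<beta> i) = monom 1 (2 * i + 1)"
    and w_rho: "\<rho> \<noteq> 0" "w \<rho> = 0"
    and small: "\<And>k. 1 \<le> k \<Longrightarrow> k < p \<Longrightarrow> of_nat k \<noteq> (0 :: 'f)"
    and kinds: "CHAR('f) = p \<and> \<epsilon> = 1 \<and> \<rho> = 1 \<or> of_nat p \<noteq> (0 :: 'f) \<and> \<epsilon> = 0 \<and> primitive_root_of_unity p \<rho>"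
begin

text \<open>Degrees are scaled by \<open>p\<close> so that the generators get integral ones:
  \<open>x^p\<close> behaves like \<open>\<alpha>\<close> and \<open>y^p\<close> is
  \<open>\<beta>\<close>. Zero counts as having degree minus infinity, so that sums need no case
  distinctions.\<close>

definition deg_le :: "int poly \<Rightarrow> 'f \<Rightarrow> bool" where "deg_le \<gamma> x \<longleftrightarrow> x = 0 \<or> of_nat p * w x \<le> \<gamma>"
definition deg_less :: "int poly \<Rightarrow> 'f \<Rightarrow> bool" where "deg_less \<gamma> x \<longleftrightarrow> x = 0 \<or> of_nat p * w x < \<gamma>"
definition deg_eq :: "int poly \<Rightarrow> 'f \<Rightarrow> bool" where "deg_eq \<gamma> x \<longleftrightarrow> x \<noteq> 0 \<and> of_nat p * w x = \<gamma>"

lemma p_mult_le: "of_nat p * x \<le> of_nat p * y \<longleftrightarrow> x \<le> (y :: int poly)"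
  using p by (simp add: mult_le_cancel_left_pos)

lemma w_one: "w 1 = 0"
  using w_of_nat[of 1] by simp

lemma w_minus: "x \<noteq> 0 \<Longrightarrow> w (- x) = w x"
proof -
  assume x: "x \<noteq> 0"
  have "w (-1) + w (-1) = 0" using w_mult[of "-1" "-1"] w_one by simp
  then have "2 * w (-1) = 0" by simp
  then have "w (-1) = 0" by (simp only: mult_eq_0_iff) simp
  then show ?thesis using w_mult[of "-1" x] x by simp
qed

lemma deg_zero [simp]: "deg_le \<gamma> 0" "deg_less \<gamma> 0"
  by (simp_all add: deg_le_def deg_less_def)

lemma deg_le_add: "deg_le \<gamma> x \<Longrightarrow> deg_le \<gamma> y \<Longrightarrow> deg_le \<gamma> (x + y)"
proof -
  assume a: "deg_le \<gamma> x" "deg_le \<gamma> y"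
  show ?thesis
  proof (cases "x = 0 \<or> y = 0 \<or> x + y = 0")
    case False
    then have "w (x + y) \<le> w x \<or> w (x + y) \<le> w y" using w_add[of x y] by (simp add: le_max_iff_disj)
    then have "of_nat p * w (x + y) \<le> of_nat p * w x \<or> of_nat p * w (x + y) \<le> of_nat p * w y" by (simp only: p_mult_le)
    then show ?thesis using a False unfolding deg_le_def by (meson order_trans)
  qed (use a in \<open>auto simp: deg_le_def\<close>)
qed

lemma deg_less_add: "deg_less \<gamma> x \<Longrightarrow> deg_less \<gamma> y \<Longrightarrow> deg_less \<gamma> (x + y)"
proof -
  assume a: "deg_less \<gamma> x" "deg_less \<gamma> y"
  show ?thesis
  proof (cases "x = 0 \<or> y = 0 \<or> x + y = 0")
    case False
    then have "w (x + y) \<le> w x \<or> w (x + y) \<le> w y" using w_add[of x y] by (simp add: le_max_iff_disj)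
    then have "of_nat p * w (x + y) \<le> of_nat p * w x \<or> of_nat p * w (x + y) \<le> of_nat p * w y" by (simp only: p_mult_le)
    then show ?thesis using a False unfolding deg_less_def by (meson le_less_trans)
  qed (use a in \<open>auto simp: deg_less_def\<close>)
qed

lemma deg_le_mult: "deg_le \<gamma> x \<Longrightarrow> deg_le \<delta> y \<Longrightarrow> deg_le (\<gamma> + \<delta>) (x * y)"
  by (cases "x = 0 \<or> y = 0") (auto simp: deg_le_def w_mult distrib_left intro: add_mono)

lemma deg_less_le_mult: "deg_less \<gamma> x \<Longrightarrow> deg_le \<delta> y \<Longrightarrow> deg_less (\<gamma> + \<delta>) (x * y)"
  by (cases "x = 0 \<or> y = 0") (auto simp: deg_less_def deg_le_def w_mult distrib_left intro: add_less_le_mono)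

lemma deg_eq_mult: "deg_eq \<gamma> x \<Longrightarrow> deg_eq \<delta> y \<Longrightarrow> deg_eq (\<gamma> + \<delta>) (x * y)"
  by (auto simp: deg_eq_def w_mult distrib_left)

lemma deg_less_imp_le: "deg_less \<gamma> x \<Longrightarrow> deg_le \<gamma> x"
  by (auto simp: deg_less_def deg_le_def)

lemma deg_eq_imp_le: "deg_eq \<gamma> x \<Longrightarrow> deg_le \<gamma> x"
  by (auto simp: deg_eq_def deg_le_def)

lemma deg_le_less: "deg_le \<gamma> x \<Longrightarrow> \<gamma> < \<delta> \<Longrightarrow> deg_less \<delta> x"
  by (auto simp: deg_less_def deg_le_def)

lemma deg_eq_add_less: "deg_eq \<gamma> x \<Longrightarrow> deg_less \<gamma> y \<Longrightarrow> deg_eq \<gamma> (x + y)"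
proof -
  assume a: "deg_eq \<gamma> x" "deg_less \<gamma> y"
  show ?thesis
  proof (cases "y = 0")
    case False
    have x: "x \<noteq> 0" and less: "of_nat p * w y < of_nat p * w x" using a False by (auto simp: deg_eq_def deg_less_def)
    then have yx: "w y < w x" using p_mult_le[of "w x" "w y"] by (meson not_le)
    have ne: "x + y \<noteq> 0"
    proof
      assume "x + y = 0"
      then have "y = - x" by (simp add: eq_neg_iff_add_eq_0 add.commute)
      then show False using yx w_minus[OF x] by simp
    qed
    have "w (x + y) \<le> w x" using w_add[OF x False ne] yx by simp
    moreover have "w x \<le> w (x + y)"
    proof -
      have "w ((x + y) + (- y)) \<le> max (w (x + y)) (w (- y))" using ne False x by (intro w_add) auto
      then have "w x \<le> max (w (x + y)) (w y)" using w_minus[OF False] by simp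
      then show ?thesis using yx by (simp add: le_max_iff_disj)
    qed
    ultimately show ?thesis using a ne by (simp add: deg_eq_def)
  qed (use a in simp)
qed

lemma deg_le_of_nat: "deg_le 0 (of_nat n)"
  by (cases "of_nat n = (0 :: 'f)") (auto simp: deg_le_def w_of_nat)

lemma deg_eq_of_nat: "of_nat n \<noteq> (0 :: 'f) \<Longrightarrow> deg_eq 0 (of_nat n)"
  by (auto simp: deg_eq_def w_of_nat)

lemma w_power: "x \<noteq> 0 \<Longrightarrow> w (x ^ k) = of_nat k * w x"
  by (induction k) (auto simp: w_one w_mult distrib_right)

lemma of_nat_times_monom: "of_nat k * monom (c :: int) n = monom (int k * c) n"
proof -
  have "(of_nat k :: int poly) = [:int k:]" by (simp add: of_nat_poly)
  then show ?thesis by (simp add: smult_monom)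
qed

lemma deg_eq_alpha: "i < m \<Longrightarrow> deg_eq (monom (int (k * p)) (2 * i)) (\<alpha> i ^ k)"
  using w_alpha[of i] by (simp add: deg_eq_def w_power of_nat_times_monom mult.commute)

lemma deg_eq_beta: "i < m \<Longrightarrow> deg_eq (monom (int (k * p)) (2 * i + 1)) (\<beta> i ^ k)"
  using w_beta[of i] by (simp add: deg_eq_def w_power of_nat_times_monom mult.commute)

lemma deg_eq_rho: "deg_eq 0 (\<rho> ^ k)"
  using w_rho by (simp add: deg_eq_def w_power)

text \<open>Leading terms multiply: the error of a product is telescoped as
  \<open>(\<tau> - r) T + r (T - R)\<close>. This passes from the \<open>m\<close> factors of a
  trace to the trace itself.\<close>

lemma deg_approx_prod:
  assumes "finite S" "\<And>i. i \<in> S \<Longrightarrow> deg_less (\<gamma> i) (\<tau> i - r i)" "\<And>i. i \<in> S \<Longrightarrow> deg_le (\<gamma> i) (r i)"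
  shows "deg_less (\<Sum>i\<in>S. \<gamma> i) ((\<Prod>i\<in>S. \<tau> i) - (\<Prod>i\<in>S. r i)) \<and> deg_le (\<Sum>i\<in>S. \<gamma> i) (\<Prod>i\<in>S. r i)"
  using assms
proof (induction S)
  case empty
  then show ?case using deg_le_of_nat[of 1] by simp
next
  case (insert i S)
  let ?T = "\<Prod>i\<in>S. \<tau> i" and ?R = "\<Prod>i\<in>S. r i" and ?g = "\<Sum>i\<in>S. \<gamma> i"
  have IH: "deg_less ?g (?T - ?R)" "deg_le ?g ?R" using insert by auto
  have T: "deg_le ?g ?T" using deg_le_add[OF deg_less_imp_le[OF IH(1)] IH(2)] by simp
  have i: "deg_less (\<gamma> i) (\<tau> i - r i)" "deg_le (\<gamma> i) (r i)" using insert by auto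
  have "deg_less (\<gamma> i + ?g) ((\<tau> i - r i) * ?T + r i * (?T - ?R))"
    using deg_less_le_mult[OF i(1) T] deg_less_le_mult[OF IH(1) i(2)]
    by (intro deg_less_add) (simp_all add: ac_simps)
  also have "(\<tau> i - r i) * ?T + r i * (?T - ?R) = \<tau> i * ?T - r i * ?R" by (simp add: algebra_simps)
  finally show ?case using insert deg_le_mult[OF i(2) IH(2)] by simp
qed

abbreviation fst_sum :: "(nat \<times> nat) list \<Rightarrow> nat" where "fst_sum cs \<equiv> sum_list (map fst cs)"
abbreviation snd_sum :: "(nat \<times> nat) list \<Rightarrow> nat" where "snd_sum cs \<equiv> sum_list (map snd cs)"

definition factor_trace :: "nat \<Rightarrow> (nat \<times> nat) list \<Rightarrow> 'f alg_closure" where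
  "factor_trace i cs = (if p dvd snd_sum cs then \<eta> i ^ snd_sum cs * (\<Sum>j<p. word_diagonal (\<xi> i) cs j) else 0)"

lemma word_trace_factors: "word_trace xs = (\<Prod>i<m. factor_trace i (digits i xs))"
  unfolding word_trace_eq factor_trace_def ..

lemma eta_power: "i < m \<Longrightarrow> p dvd n \<Longrightarrow> \<eta> i ^ n = to_ac (\<beta> i ^ (n div p))"
  using eta(1)[of i] by (auto elim!: dvdE simp: power_mult p0)

text \<open>The power of \<open>\<rho>\<close> produced by sorting a word: a letter with
  \<open>y\<close>-exponent \<open>b\<close> moves past all later letters \<open>x\<close>. It is
  the only way in which the order of the letters enters when \<open>\<epsilon> = 0\<close>.\<close>

fun commutation_exponent :: "(nat \<times> nat) list \<Rightarrow> nat" where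
  "commutation_exponent [] = 0"
| "commutation_exponent ((a, b) # cs) = b * fst_sum cs + commutation_exponent cs"

text \<open>Here \<open>\<xi> i j\<close> is \<open>\<rho>^j\<close> times \<open>\<xi> i 0\<close>,
  so the sum over \<open>j\<close> is geometric with ratio \<open>\<rho>^n\<close>, where
  \<open>n\<close> is the total \<open>x\<close>-exponent. It vanishes unless \<open>p\<close>
  divides \<open>n\<close>, and then \<open>n / p\<close> powers of \<open>\<alpha> i\<close> come
  out.\<close>

lemma factor_trace_0:
  assumes i: "i < m" and eps: "\<epsilon> = 0" and prim: "primitive_root_of_unity p \<rho>"
  shows "factor_trace i cs = to_ac (if p dvd snd_sum cs \<and> p dvd fst_sum cs
    then \<beta> i ^ (snd_sum cs div p) * (\<alpha> i ^ (fst_sum cs div p) * (\<rho> ^ commutation_exponent cs * of_nat p)) else 0)"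
proof -
  let ?r = "to_ac \<rho>" and ?n = "fst_sum cs"
  have xi: "\<xi> i j = ?r ^ j * \<xi> i 0" for j
    by (induction j) (auto simp: xi_Suc[OF i] eps)
  have wd: "word_diagonal (\<xi> i) cs j = ?r ^ (j * fst_sum cs + commutation_exponent cs) * \<xi> i 0 ^ fst_sum cs" for cs j
  proof (induction cs arbitrary: j)
    case (Cons c cs)
    obtain a b where c: "c = (a, b)" by (cases c)
    show ?case unfolding c word_diagonal.simps Cons
      by (subst xi) (simp add: power_add power_mult_distrib power_mult[symmetric] algebra_simps)
  qed simp
  have rp: "\<rho> ^ p = 1" using prim by (simp add: primitive_root_of_unity_def)
  have geo: "(\<Sum>j<p. (?r ^ ?n) ^ j) = (if p dvd ?n then of_nat p else 0)"
  proof (cases "p dvd ?n")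
    case True
    then obtain k where "?n = p * k" by blast
    then have "\<rho> ^ ?n = 1" using rp by (simp add: power_mult)
    then have "?r ^ ?n = 1" by (metis to_ac_1 to_ac_power)
    then show ?thesis using True by simp
  next
    case False
    then have "?n mod p \<in> {1..<p}" using p0 by (auto simp: dvd_eq_mod_eq_0)
    then have "\<rho> ^ (?n mod p) \<noteq> 1" using prim by (simp add: primitive_root_of_unity_def)
    moreover have "\<rho> ^ ?n = \<rho> ^ (?n mod p)"
    proof -
      have "\<rho> ^ ?n = \<rho> ^ (p * (?n div p) + ?n mod p)" by simp
      also have "\<dots> = \<rho> ^ (?n mod p)" unfolding power_add power_mult rp by simp
      finally show ?thesis .
    qed
    ultimately have "?r ^ ?n \<noteq> 1" by (metis to_ac_1 to_ac_eq_iff to_ac_power)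
    moreover have "(?r ^ ?n) ^ p = 1"
    proof -
      have "(\<rho> ^ ?n) ^ p = 1" using rp by (simp add: power_mult[symmetric] mult.commute[of ?n]) (simp add: power_mult rp)
      then show ?thesis by (metis to_ac_1 to_ac_power)
    qed
    ultimately show ?thesis using False by (simp add: sum_gp_strict)
  qed
  have "(\<Sum>j<p. word_diagonal (\<xi> i) cs j) = (\<Sum>j<p. (?r ^ ?n) ^ j) * (?r ^ commutation_exponent cs * \<xi> i 0 ^ ?n)"
    by (simp add: wd sum_distrib_right sum_distrib_left power_add power_mult[symmetric] mult_ac)
  moreover have "\<xi> i 0 ^ ?n = to_ac (\<alpha> i ^ (?n div p))" if "p dvd ?n"
    using xi_root[OF i, of 0] that eps by (auto elim!: dvdE simp: power_mult p0)
  ultimately show ?thesis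
    by (auto simp: factor_trace_def eta_power[OF i] geo mult_ac)
qed

text \<open>By Fermat this number is \<open>-1\<close> modulo \<open>p\<close>; it is the trace of
  \<open>x^(p-1)\<close> in the Artin-Schreier case. Keeping it as a natural number shows at once
  that its degree is zero.\<close>

definition wilson :: nat where "wilson = (\<Sum>j<p. j ^ (p - 1))"

text \<open>The differences of consecutive powers \<open>f j ^ Suc l\<close> telescope to zero.
  Expanding them, induction removes all lower power sums and leaves \<open>l + 1\<close> times the
  desired one, with \<open>l + 1 < p\<close> invertible.\<close>

lemma shifted_power_sum_low:
  fixes f :: "nat \<Rightarrow> 'f alg_closure"
  assumes f: "\<And>j. f (Suc j) = f j + 1" "f p = f 0" and l: "l < p - 1"
  shows "(\<Sum>j<p. f j ^ l) = 0"
  using l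
proof (induction l rule: less_induct)
  case (less l)
  have tel: "(\<Sum>j<p. f (Suc j) ^ Suc l - f j ^ Suc l) = 0"
    using sum_lessThan_telescope[of "\<lambda>j. f j ^ Suc l" p] f(2) by simp
  have "f (Suc j) ^ Suc l - f j ^ Suc l = (\<Sum>k\<le>l. of_nat (Suc l choose k) * f j ^ k)" for j
    unfolding f(1) by (subst binomial_ring) simp
  then have "0 = (\<Sum>j<p. \<Sum>k\<le>l. of_nat (Suc l choose k) * f j ^ k)" using tel by (simp del: power_Suc)
  also have "\<dots> = (\<Sum>k\<le>l. of_nat (Suc l choose k) * (\<Sum>j<p. f j ^ k))"
    by (subst sum.swap) (simp add: sum_distrib_left)
  also have "\<dots> = (\<Sum>k\<in>{l}. of_nat (Suc l choose k) * (\<Sum>j<p. f j ^ k))"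
    by (rule sum.mono_neutral_right) (use less in auto)
  finally have "of_nat (Suc l) * (\<Sum>j<p. f j ^ l) = 0" by simp
  moreover have "of_nat (Suc l) \<noteq> (0 :: 'f alg_closure)"
    using small[of "Suc l"] less.prems by (metis One_nat_def Suc_le_mono less_diff_conv Suc_eq_plus1 to_ac_eq_0_iff to_ac_of_nat zero_le)
  ultimately show ?case by (metis mult_eq_0_iff)
qed

context
  assumes char_p: "CHAR('f) = p" "\<epsilon> = 1" "\<rho> = 1"
begin

lemma of_nat_p_zero: "of_nat p = (0 :: 'f alg_closure)"
  using of_nat_CHAR[where 'a = 'f] char_p by (metis to_ac_0 to_ac_of_nat)

lemma xi_add: "i < m \<Longrightarrow> \<xi> i (j + b) = \<xi> i j + of_nat b"
  by (induction b) (auto simp: xi_Suc char_p algebra_simps)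

lemma xi_power_sum_low: "i < m \<Longrightarrow> l < p - 1 \<Longrightarrow> (\<Sum>j<p. \<xi> i j ^ l) = 0"
  by (rule shifted_power_sum_low) (use xi_Suc xi_periodic[of i 0] char_p in auto)

lemma xi_power_sum_wilson: "i < m \<Longrightarrow> (\<Sum>j<p. \<xi> i j ^ (p - 1)) = of_nat wilson"
proof -
  assume i: "i < m"
  have low: "(\<Sum>j<p. (of_nat j :: 'f alg_closure) ^ l) = 0" if "l < p - 1" for l
    by (rule shifted_power_sum_low[OF _ _ that]) (simp_all add: of_nat_p_zero)
  have "(\<Sum>j<p. \<xi> i j ^ (p - 1)) = (\<Sum>j<p. \<Sum>k\<le>p - 1. of_nat (p - 1 choose k) * of_nat j ^ k * \<xi> i 0 ^ (p - 1 - k))"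
  proof (rule sum.cong[OF refl])
    fix j
    have "\<xi> i j = of_nat j + \<xi> i 0" using xi_add[OF i, of 0 j] by simp
    then show "\<xi> i j ^ (p - 1) = (\<Sum>k\<le>p - 1. of_nat (p - 1 choose k) * of_nat j ^ k * \<xi> i 0 ^ (p - 1 - k))"
      by (simp only: binomial_ring)
  qed
  also have "\<dots> = (\<Sum>k\<le>p - 1. of_nat (p - 1 choose k) * \<xi> i 0 ^ (p - 1 - k) * (\<Sum>j<p. of_nat j ^ k))"
    by (subst sum.swap) (simp add: sum_distrib_left sum_distrib_right mult_ac)
  also have "\<dots> = (\<Sum>k\<in>{p - 1}. of_nat (p - 1 choose k) * \<xi> i 0 ^ (p - 1 - k) * (\<Sum>j<p. of_nat j ^ k))"
    by (rule sum.mono_neutral_right) (use low in auto)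
  also have "\<dots> = of_nat wilson" by (simp add: wilson_def)
  finally show ?thesis .
qed

text \<open>Otherwise all power sums with exponent below \<open>p\<close> would vanish, that is, the
  row vector of ones would annihilate the invertible Vandermonde matrix.\<close>

lemma wilson_nonzero: "m > 0 \<Longrightarrow> of_nat wilson \<noteq> (0 :: 'f)"
proof
  assume m: "m > 0" and "of_nat wilson = (0 :: 'f)"
  then have W: "of_nat wilson = (0 :: 'f alg_closure)" by (metis to_ac_0 to_ac_of_nat)
  have s: "(\<Sum>j<p. \<xi> 0 j ^ a) = 0" if "a < p" for a
    using xi_power_sum_low[OF m, of a] xi_power_sum_wilson[OF m] W that by (cases "a = p - 1") auto
  let ?V = "mat p p (\<lambda>(j, a). \<xi> 0 j ^ a)"
  obtain L where L: "L \<in> carrier_mat p p" "?V * L = 1\<^sub>m p" by (rule vandermonde_inverse[OF m]) blast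
  have "1 = (\<Sum>j<p. (?V * L) $$ (j, 0))" unfolding L(2) using p0 by simp
  also have "\<dots> = (\<Sum>j<p. \<Sum>a<p. \<xi> 0 j ^ a * L $$ (a, 0))"
    using L(1) p0 by (simp add: scalar_prod_def atLeast0LessThan del: index_one_mat)
  also have "\<dots> = (\<Sum>a<p. (\<Sum>j<p. \<xi> 0 j ^ a) * L $$ (a, 0))"
    by (subst sum.swap) (simp add: sum_distrib_right)
  also have "\<dots> = 0" by (simp add: s)
  finally show False by simp
qed

text \<open>The leading term of the \<open>l\<close>-th power sum of the roots. For
  \<open>l = q p + (p - 1)\<close> the power \<open>x^(q p)\<close> contributes
  \<open>\<alpha>^q\<close> and \<open>x^(p-1)\<close> its trace; here
  \<open>q = Suc l div p - 1\<close>. Other exponents have no term of that degree.\<close>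

definition lead_sum :: "nat \<Rightarrow> nat \<Rightarrow> 'f" where
  "lead_sum i l = (if p dvd Suc l then of_nat wilson * \<alpha> i ^ (Suc l div p - 1) else 0)"

lemma lead_sum_deg: "i < m \<Longrightarrow> deg_le (monom (int l - int (p - 1)) (2 * i)) (lead_sum i l)"
proof (cases "p dvd Suc l")
  case True
  assume i: "i < m"
  from True obtain k where k: "Suc l = p * k" by blast
  then have "k > 0" by (cases k) auto
  then obtain k' where k': "k = Suc k'" by (cases k) auto
  have l: "int l - int (p - 1) = int (k' * p)"
  proof -
    have "l = k' * p + (p - 1)" using k k' p0 by (simp add: algebra_simps)
    then show ?thesis by simp
  qed
  have "deg_le (0 + monom (int (k' * p)) (2 * i)) (of_nat wilson * \<alpha> i ^ k')"
    by (rule deg_le_mult[OF deg_le_of_nat deg_eq_imp_le[OF deg_eq_alpha[OF i]]])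
  then show ?thesis using True k k' p0 l by (simp add: lead_sum_def)
qed (simp add: lead_sum_def)

text \<open>Recursion through \<open>\<xi>^(k+p) = \<xi>^(k+1) + \<alpha> \<xi>^k\<close>. The first
  summand has strictly smaller degree because \<open>p \<ge> 2\<close>, and the second carries the
  leading term along.\<close>

lemma xi_power_sum:
  assumes i: "i < m"
  shows "\<exists>\<sigma>. to_ac \<sigma> = (\<Sum>j<p. \<xi> i j ^ l) \<and> deg_less (monom (int l - int (p - 1)) (2 * i)) (\<sigma> - lead_sum i l)"
proof (induction l rule: less_induct)
  case (less l)
  have mono: "monom a (2 * i) < monom b (2 * i)" if "a < b" for a b :: int
    using monom_add_less[of "2 * i" 0 0 a b] that by simp
  consider "l < p - 1" | "l = p - 1" | "l \<ge> p" using p by linarith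
  then show ?case
  proof cases
    case 1
    then have "\<not> p dvd Suc l" by (auto dest: dvd_imp_le)
    then show ?thesis using xi_power_sum_low[OF i 1] by (intro exI[of _ 0]) (simp add: lead_sum_def)
  next
    case 2
    have e: "Suc (p - 1) = p" using p0 by simp
    show ?thesis unfolding 2 lead_sum_def e using xi_power_sum_wilson[OF i] p0 by (intro exI[of _ "of_nat wilson"]) simp
  next
    case 3
    then obtain k where k: "l = k + p" using le_Suc_ex by (metis add.commute)
    obtain s where s: "to_ac s = (\<Sum>j<p. \<xi> i j ^ k)" "deg_less (monom (int k - int (p - 1)) (2 * i)) (s - lead_sum i k)"
      using less[of k] k p0 by auto
    obtain s' where s': "to_ac s' = (\<Sum>j<p. \<xi> i j ^ Suc k)" "deg_less (monom (int (Suc k) - int (p - 1)) (2 * i)) (s' - lead_sum i (Suc k))"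
      using less[of "Suc k"] k p by auto
    have "(\<Sum>j<p. \<xi> i j ^ l) = to_ac (s' + \<alpha> i * s)"
    proof -
      have "\<xi> i j ^ l = \<xi> i j ^ Suc k + to_ac (\<alpha> i) * \<xi> i j ^ k" for j
        unfolding k power_add xi_root[OF i] by (simp add: char_p algebra_simps)
      then show ?thesis by (simp add: sum.distrib sum_distrib_left s s')
    qed
    moreover have "deg_less (monom (int l - int (p - 1)) (2 * i)) (s' + \<alpha> i * s - lead_sum i l)"
    proof -
      have "deg_le (monom (int (Suc k) - int (p - 1)) (2 * i)) s'"
        using deg_le_add[OF deg_less_imp_le[OF s'(2)] lead_sum_deg[OF i]] by simp
      then have 1: "deg_less (monom (int l - int (p - 1)) (2 * i)) s'"
        by (rule deg_le_less) (rule mono, use k p in simp)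
      have "deg_less (monom (int k - int (p - 1)) (2 * i) + monom (int (1 * p)) (2 * i)) ((s - lead_sum i k) * \<alpha> i ^ 1)"
        by (rule deg_less_le_mult[OF s(2) deg_eq_imp_le[OF deg_eq_alpha[OF i]]])
      then have 2: "deg_less (monom (int l - int (p - 1)) (2 * i)) ((s - lead_sum i k) * \<alpha> i)"
        unfolding k by (simp add: add_monom algebra_simps)
      have "lead_sum i l = lead_sum i k * \<alpha> i"
      proof (cases "p dvd Suc k")
        case True
        then obtain q where q: "Suc k = p * q" by blast
        then obtain q' where q': "q = Suc q'" by (cases q) auto
        have "Suc l = p * Suc q" using q k by simp
        then show ?thesis using q q' p0 by (simp add: lead_sum_def)
      next
        case False
        then have "\<not> p dvd Suc l" unfolding k using dvd_add_left_iff[of p p "Suc k"] by simp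
        then show ?thesis using False by (simp add: lead_sum_def)
      qed
      then have "s' + \<alpha> i * s - lead_sum i l = s' + (s - lead_sum i k) * \<alpha> i" by (simp only:) (simp add: algebra_simps)
      then show ?thesis by (simp only: deg_less_add[OF 1 2])
    qed
    ultimately show ?thesis by metis
  qed
qed

text \<open>Every letter contributes a power of some \<open>\<xi> i j + b\<close>, so a word gives a
  monic polynomial in \<open>\<xi> i j\<close> with integer coefficients. The order of the letters
  affects only lower coefficients, which is why leading parts are order-free in characteristic
  \<open>p\<close>.\<close>

lemma word_diagonal_poly:
  assumes i: "i < m"
  shows "\<exists>q :: 'f alg_closure poly. degree q = fst_sum cs \<and> coeff q (fst_sum cs) = 1 \<and> (\<forall>l. coeff q l \<in> range of_nat) \<and>
    (\<forall>j. word_diagonal (\<xi> i) cs (j + b) = poly q (\<xi> i j))"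
proof (induction cs arbitrary: b)
  case Nil
  show ?case by (rule exI[of _ 1]) (auto intro: range_eqI[of _ _ 1] range_eqI[of _ _ 0])
next
  case (Cons c cs)
  obtain a b' where c: "c = (a, b')" by (cases c)
  obtain q where q: "degree q = fst_sum cs" "coeff q (fst_sum cs) = 1" "\<forall>l. coeff q l \<in> range of_nat"
    "\<forall>j. word_diagonal (\<xi> i) cs (j + (b + b')) = poly q (\<xi> i j)" using Cons by metis
  have add: "x + y \<in> range of_nat" and mult: "x * y \<in> range of_nat" if "x \<in> range of_nat" "y \<in> range of_nat" for x y :: "'f alg_closure"
    using that by (metis (mono_tags, lifting) image_iff of_nat_add rangeI, metis (mono_tags, lifting) image_iff of_nat_mult rangeI)
  have sum: "(\<Sum>l\<in>L. h l) \<in> range of_nat" if "\<And>l. l \<in> L \<Longrightarrow> h l \<in> range of_nat" for L :: "nat set" and h :: "nat \<Rightarrow> 'f alg_closure"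
    using that by (induction L rule: infinite_finite_induct) (auto intro: add range_eqI[of _ _ 0])
  let ?l = "[:of_nat b, 1 :: 'f alg_closure:] ^ a"
  have lin: "coeff ?l l \<in> range of_nat" for l
    by (cases "l \<le> a") (auto simp: coeff_linear_power coeff_linear_poly_power simp flip: of_nat_power of_nat_mult)
  have lc: "lead_coeff (?l * q) = 1" using q by (simp add: lead_coeff_mult lead_coeff_power)
  have "q \<noteq> 0" using q(2) by auto
  then have dg: "degree (?l * q) = fst_sum (c # cs)" using q by (simp add: degree_mult_eq degree_power_eq c)
  show ?case
  proof (intro exI[of _ "?l * q"] conjI allI)
    show "coeff (?l * q) (fst_sum (c # cs)) = 1" using lc unfolding dg .
    show "coeff (?l * q) l \<in> range of_nat" for l unfolding coeff_mult using lin q(3) by (intro sum mult) auto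
    show "word_diagonal (\<xi> i) (c # cs) (j + b) = poly (?l * q) (\<xi> i j)" for j
      using q(4) by (simp add: c xi_add[OF i] add.assoc add.commute[of "of_nat b"])
  qed (rule dg)
qed

text \<open>The monic polynomial of the word turns the trace into a combination of power sums with
  coefficients of degree at most zero. The lower power sums have smaller degree, so the leading term
  is that of the top one.\<close>

lemma factor_trace_p:
  assumes i: "i < m"
  shows "\<exists>\<tau>. to_ac \<tau> = factor_trace i cs \<and>
    deg_less (monom (int (fst_sum cs) - int (p - 1)) (2 * i) + monom (int (snd_sum cs)) (2 * i + 1))
      (\<tau> - (if p dvd snd_sum cs then \<beta> i ^ (snd_sum cs div p) * lead_sum i (fst_sum cs) else 0))"
proof (cases "p dvd snd_sum cs")
  case False
  then show ?thesis by (intro exI[of _ 0]) (simp add: factor_trace_def)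
next
  case True
  let ?n = "fst_sum cs"
  have mono: "monom a (2 * i) < monom b (2 * i)" if "a < b" for a b :: int
    using monom_add_less[of "2 * i" 0 0 a b] that by simp
  obtain q where q: "degree q = ?n" "coeff q ?n = 1" "\<forall>l. coeff q l \<in> range of_nat"
    "\<forall>j. word_diagonal (\<xi> i) cs (j + 0) = poly q (\<xi> i j)" using word_diagonal_poly[OF i] by blast
  have "\<forall>l. \<exists>a. coeff q l = of_nat a" using q(3) by (auto simp: image_iff)
  from choice[OF this] obtain c where c: "\<And>l. coeff q l = of_nat (c l)" by (elim exE) simp
  obtain \<sigma> where s: "\<And>l. to_ac (\<sigma> l) = (\<Sum>j<p. \<xi> i j ^ l)"
    "\<And>l. deg_less (monom (int l - int (p - 1)) (2 * i)) (\<sigma> l - lead_sum i l)"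
    using xi_power_sum[OF i] by metis
  define \<tau> where "\<tau> = \<sigma> ?n + (\<Sum>l<?n. of_nat (c l) * \<sigma> l)"
  have "(\<Sum>j<p. word_diagonal (\<xi> i) cs j) = (\<Sum>j<p. \<Sum>l\<le>?n. of_nat (c l) * \<xi> i j ^ l)"
    using q(4) by (simp add: poly_altdef q(1) c)
  also have "\<dots> = (\<Sum>l\<le>?n. of_nat (c l) * to_ac (\<sigma> l))"
    by (subst sum.swap) (simp add: sum_distrib_left s)
  also have "\<dots> = to_ac \<tau>"
    using q(2) c[of ?n] by (simp add: \<tau>_def to_ac_sum lessThan_Suc_atMost[symmetric])
  finally have tau: "(\<Sum>j<p. word_diagonal (\<xi> i) cs j) = to_ac \<tau>" .
  have "deg_less (monom (int ?n - int (p - 1)) (2 * i)) (\<Sum>l\<in>L. of_nat (c l) * \<sigma> l)" if "finite L" "L \<subseteq> {..<?n}" for L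
    using that
  proof (induction L)
    case (insert l L)
    have "deg_le (monom (int l - int (p - 1)) (2 * i)) (\<sigma> l)"
      using deg_le_add[OF deg_less_imp_le[OF s(2)] lead_sum_deg[OF i]] by simp
    then have "deg_less (monom (int ?n - int (p - 1)) (2 * i)) (\<sigma> l)"
      by (rule deg_le_less) (rule mono, use insert in simp)
    then have "deg_less (monom (int ?n - int (p - 1)) (2 * i)) (of_nat (c l) * \<sigma> l)"
      using deg_less_le_mult[OF _ deg_le_of_nat] by (metis add.right_neutral mult.commute)
    then show ?case using insert by (simp add: deg_less_add)
  qed simp
  from this[of "{..<?n}"] have "deg_less (monom (int ?n - int (p - 1)) (2 * i)) (\<tau> - lead_sum i ?n)"
    using deg_less_add[OF s(2)[of ?n], of "\<Sum>l<?n. of_nat (c l) * \<sigma> l"] unfolding \<tau>_def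
    by (simp add: diff_add_eq)
  from deg_less_le_mult[OF this deg_eq_imp_le[OF deg_eq_beta[OF i, of "snd_sum cs div p"]]]
  have "deg_less (monom (int ?n - int (p - 1)) (2 * i) + monom (int (snd_sum cs)) (2 * i + 1))
      (\<beta> i ^ (snd_sum cs div p) * \<tau> - \<beta> i ^ (snd_sum cs div p) * lead_sum i ?n)"
    using True by (simp add: algebra_simps)
  then show ?thesis
    using True eta_power[OF i True] tau by (intro exI[of _ "\<beta> i ^ (snd_sum cs div p) * \<tau>"]) (simp add: factor_trace_def)
qed

end

end

text \<open>Inclusion-exclusion without signs: functions into \<open>S\<close> are grouped by their
  image, and by induction every proper subset of \<open>S\<close> contributes zero.\<close>

lemma sum_surj_functions_zero:
  fixes Q :: "(nat \<Rightarrow> nat) \<Rightarrow> 'a::ab_group_add"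
  assumes A: "finite A" and zero: "\<And>S. S \<subseteq> A \<Longrightarrow> (\<Sum>g\<in>A \<rightarrow>\<^sub>E S. Q g) = 0" and S: "S \<subseteq> A"
  shows "(\<Sum>g | g \<in> A \<rightarrow>\<^sub>E S \<and> g ` A = S. Q g) = 0"
proof -
  have "finite S" using A S finite_subset by blast
  then show ?thesis using S
  proof (induction S rule: finite_psubset_induct)
    case (psubset S)
    have fin: "finite (A \<rightarrow>\<^sub>E S)" using A psubset by (intro finite_PiE) auto
    have e: "{g \<in> A \<rightarrow>\<^sub>E S. g ` A = T} = {g. g \<in> A \<rightarrow>\<^sub>E T \<and> g ` A = T}" if "T \<subseteq> S" for T
      using that by (auto simp: PiE_iff)
    have "(\<Sum>g\<in>A \<rightarrow>\<^sub>E S. Q g) = (\<Sum>T\<in>Pow S. \<Sum>g\<in>{g \<in> A \<rightarrow>\<^sub>E S. g ` A = T}. Q g)"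
      by (rule sum.group[symmetric]) (use fin psubset in \<open>auto simp: PiE_iff\<close>)
    also have "\<dots> = (\<Sum>T\<in>Pow S. \<Sum>g | g \<in> A \<rightarrow>\<^sub>E T \<and> g ` A = T. Q g)"
      by (intro sum.cong refl) (use e in auto)
    also have "\<dots> = (\<Sum>T\<in>{S}. \<Sum>g | g \<in> A \<rightarrow>\<^sub>E T \<and> g ` A = T. Q g)"
    proof (rule sum.mono_neutral_right)
      show "\<forall>T\<in>Pow S - {S}. (\<Sum>g | g \<in> A \<rightarrow>\<^sub>E T \<and> g ` A = T. Q g) = 0"
      proof
        fix T assume "T \<in> Pow S - {S}"
        then show "(\<Sum>g | g \<in> A \<rightarrow>\<^sub>E T \<and> g ` A = T. Q g) = 0" using psubset.prems by (intro psubset.IH) auto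
      qed
    qed (use psubset in auto)
    finally show ?case using zero[OF psubset.prems] by simp
  qed
qed

text \<open>A form of degree \<open>k\<close> that vanishes on all partial sums of
  \<open>Cs 0, ..., Cs (k - 1)\<close> has vanishing multilinear part. Since \<open>t\<close> need
  not be symmetric, this part is the symmetrization of \<open>t\<close>.\<close>

lemma polarization:
  fixes t :: "(nat \<Rightarrow> 'i) \<Rightarrow> 'a::comm_ring_1" and Cs :: "nat \<Rightarrow> 'i \<Rightarrow> 'a"
  assumes Idx: "finite I"
    and zero: "\<And>S. S \<subseteq> {..<k} \<Longrightarrow> (\<Sum>f\<in>{..<k} \<rightarrow>\<^sub>E I. (\<Prod>s<k. \<Sum>j\<in>S. Cs j (f s)) * t f) = 0"
  shows "(\<Sum>f\<in>{..<k} \<rightarrow>\<^sub>E I. (\<Prod>s<k. Cs s (f s)) * (\<Sum>\<sigma> | \<sigma> permutes {..<k}. t (\<lambda>s\<in>{..<k}. f (\<sigma> s)))) = 0"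
proof -
  let ?A = "{..<k}"
  let ?F = "?A \<rightarrow>\<^sub>E I"
  \<comment> \<open>The contribution in which slot \<open>s\<close> is filled with
    \<open>Cs (g s)\<close>. Surjective choices \<open>g\<close> of \<open>k\<close> slots are
    permutations, and they make up the multilinear part.\<close>
  define Q where "Q g = (\<Sum>f\<in>?F. (\<Prod>s<k. Cs (g s) (f s)) * t f)" for g
  have z: "(\<Sum>g\<in>?A \<rightarrow>\<^sub>E S. Q g) = 0" if "S \<subseteq> ?A" for S
  proof -
    have finS: "finite S" using that finite_subset by blast
    have "(\<Sum>f\<in>?F. (\<Prod>s<k. \<Sum>j\<in>S. Cs j (f s)) * t f) = (\<Sum>f\<in>?F. \<Sum>g\<in>?A \<rightarrow>\<^sub>E S. (\<Prod>s<k. Cs (g s) (f s)) * t f)"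
      using finS by (intro sum.cong refl, subst prod_sum_PiE) (auto simp: sum_distrib_right)
    also have "\<dots> = (\<Sum>g\<in>?A \<rightarrow>\<^sub>E S. Q g)" unfolding Q_def by (rule sum.swap)
    finally show ?thesis using zero[OF that] by simp
  qed
  have "0 = (\<Sum>g | g \<in> ?A \<rightarrow>\<^sub>E ?A \<and> g ` ?A = ?A. Q g)"
    using sum_surj_functions_zero[of ?A Q ?A] z by simp
  also have "\<dots> = (\<Sum>\<sigma> | \<sigma> permutes ?A. Q \<sigma>)"
  proof (rule sum.reindex_bij_witness[of _ "\<lambda>\<sigma>. restrict \<sigma> ?A" "\<lambda>g x. if x \<in> ?A then g x else x"])
    fix g assume g: "g \<in> {g. g \<in> ?A \<rightarrow>\<^sub>E ?A \<and> g ` ?A = ?A}"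
    show "restrict (\<lambda>x. if x \<in> ?A then g x else x) ?A = g"
      using g by (intro ext) (auto simp: PiE_iff extensional_def)
    have "bij_betw g ?A ?A" using g by (simp add: bij_betw_def eq_card_imp_inj_on)
    then have "bij_betw (\<lambda>x. if x \<in> ?A then g x else x) ?A ?A" by (rule bij_betw_cong[THEN iffD1, rotated]) auto
    then show "(\<lambda>x. if x \<in> ?A then g x else x) \<in> {\<sigma>. \<sigma> permutes ?A}"
      by (simp, intro bij_imp_permutes) auto
    show "Q (\<lambda>x. if x \<in> ?A then g x else x) = Q g" unfolding Q_def by (intro sum.cong refl) simp
  next
    fix \<sigma> assume "\<sigma> \<in> {\<sigma>. \<sigma> permutes ?A}"
    then have s: "\<sigma> permutes ?A" by simp
    show "(\<lambda>x. if x \<in> ?A then restrict \<sigma> ?A x else x) = \<sigma>"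
      using permutes_not_in[OF s] by auto
    have "restrict \<sigma> ?A ` ?A = \<sigma> ` ?A" by (rule image_cong) auto
    then show "restrict \<sigma> ?A \<in> {g. g \<in> ?A \<rightarrow>\<^sub>E ?A \<and> g ` ?A = ?A}"
      using permutes_image[OF s] by auto
  qed
  also have "\<dots> = (\<Sum>\<sigma> | \<sigma> permutes ?A. \<Sum>f\<in>?F. (\<Prod>s<k. Cs s (f s)) * t (\<lambda>s\<in>?A. f (\<sigma> s)))"
  proof (rule sum.cong[OF refl])
    fix \<sigma> assume "\<sigma> \<in> {\<sigma>. \<sigma> permutes ?A}"
    then have s: "\<sigma> permutes ?A" by simp
    have s': "inv_into UNIV \<sigma> permutes ?A" by (rule permutes_inv[OF s])
    have m: "\<tau> x < k" if "\<tau> permutes ?A" "x < k" for \<tau> x using permutes_in_image[OF that(1), of x] that(2) by simp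
    \<comment> \<open>Reindexing \<open>f\<close> by \<open>\<sigma>\<close> shifts the permutation
      from the coefficients to the letters of the word.\<close>
    show "Q \<sigma> = (\<Sum>f\<in>?F. (\<Prod>s<k. Cs s (f s)) * t (\<lambda>s\<in>?A. f (\<sigma> s)))"
      unfolding Q_def
    proof (rule sum.reindex_bij_witness[of _ "\<lambda>f. \<lambda>s\<in>?A. f (\<sigma> s)" "\<lambda>f. \<lambda>s\<in>?A. f (inv_into UNIV \<sigma> s)"])
      fix f assume f: "f \<in> ?F"
      show "(\<lambda>s\<in>?A. (\<lambda>s\<in>?A. f (inv_into UNIV \<sigma> s)) (\<sigma> s)) = f"
        using f m[OF s] permutes_inverses[OF s] by (intro ext) (auto simp: PiE_iff extensional_def)
      show "(\<lambda>s\<in>?A. f (inv_into UNIV \<sigma> s)) \<in> ?F" using f m[OF s'] by (auto simp: PiE_iff)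
      show "(\<lambda>s\<in>?A. (\<lambda>s\<in>?A. f (\<sigma> s)) (inv_into UNIV \<sigma> s)) = f"
        using f m[OF s'] permutes_inverses[OF s] by (intro ext) (auto simp: PiE_iff extensional_def)
      show "(\<lambda>s\<in>?A. f (\<sigma> s)) \<in> ?F" using f m[OF s] by (auto simp: PiE_iff)
      have "(\<lambda>x\<in>?A. restrict (\<lambda>s. f (inv_into UNIV \<sigma> s)) ?A (\<sigma> x)) = f"
        using f m[OF s] permutes_inverses[OF s] by (intro ext) (auto simp: PiE_iff extensional_def)
      moreover have "(\<Prod>x<k. Cs x (restrict (\<lambda>s. f (inv_into UNIV \<sigma> s)) ?A x)) = (\<Prod>x<k. Cs (\<sigma> x) (f x))"
      proof -
        have "(\<Prod>x<k. Cs x (restrict (\<lambda>s. f (inv_into UNIV \<sigma> s)) ?A x)) = (\<Prod>x<k. Cs x (f (inv_into UNIV \<sigma> x)))" by (rule prod.cong) auto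
        also have "\<dots> = (\<Prod>x<k. Cs (\<sigma> x) (f (inv_into UNIV \<sigma> (\<sigma> x))))"
          by (rule prod.permute[OF s, unfolded comp_def])
        also have "\<dots> = (\<Prod>x<k. Cs (\<sigma> x) (f x))" by (simp only: permutes_inverses[OF s])
        finally show ?thesis .
      qed
      ultimately show "(\<Prod>x<k. Cs x (restrict (\<lambda>s. f (inv_into UNIV \<sigma> s)) ?A x)) * t (\<lambda>x\<in>?A. restrict (\<lambda>s. f (inv_into UNIV \<sigma> s)) ?A (\<sigma> x)) = (\<Prod>x<k. Cs (\<sigma> x) (f x)) * t f"
        by simp
    qed
  qed
  also have "\<dots> = (\<Sum>f\<in>?F. (\<Prod>s<k. Cs s (f s)) * (\<Sum>\<sigma> | \<sigma> permutes ?A. t (\<lambda>s\<in>?A. f (\<sigma> s))))"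
    by (subst sum.swap) (simp add: sum_distrib_left)
  finally show ?thesis by simp
qed

lemma sum_lists_functions:
  fixes h :: "'i list \<Rightarrow> 'a::comm_monoid_add"
  shows "(\<Sum>xs | set xs \<subseteq> I \<and> length xs = k. h xs) = (\<Sum>f\<in>{..<k} \<rightarrow>\<^sub>E I. h (map f [0..<k]))"
proof (rule sum.reindex_bij_witness[of _ "\<lambda>f. map f [0..<k]" "\<lambda>xs. \<lambda>s\<in>{..<k}. xs ! s"])
  fix xs assume xs: "xs \<in> {xs. set xs \<subseteq> I \<and> length xs = k}"
  show e: "map (\<lambda>s\<in>{..<k}. xs ! s) [0..<k] = xs" using xs by (intro nth_equalityI) auto
  show "(\<lambda>s\<in>{..<k}. xs ! s) \<in> {..<k} \<rightarrow>\<^sub>E I" using xs by (auto simp: subset_iff)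
  show "h (map (\<lambda>s\<in>{..<k}. xs ! s) [0..<k]) = h xs" unfolding e ..
next
  fix f assume f: "f \<in> {..<k} \<rightarrow>\<^sub>E I"
  show "(\<lambda>s\<in>{..<k}. map f [0..<k] ! s) = f" using f by (intro ext) (auto simp: PiE_iff extensional_def)
  show "map f [0..<k] \<in> {xs. set xs \<subseteq> I \<and> length xs = k}" using f by (auto simp: PiE_iff)
qed

context valued_symbol_model
begin

text \<open>A trace has its full leading term exactly for \<open>x\<close>-exponent sums congruent
  to \<open>- \<delta>\<close> modulo \<open>p\<close>. Through this number both kinds of symbols
  are treated together.\<close>

definition \<delta> :: nat where "\<delta> = (if \<epsilon> = 0 then 0 else 1)"

definition weight :: "nat \<times> nat \<Rightarrow> int poly" where
  "weight x = (\<Sum>i<m. monom (int (dig p i (fst x))) (2 * i) + monom (int (dig p i (snd x))) (2 * i + 1))"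

text \<open>The degree lost on taking traces: in the Artin-Schreier case
  \<open>x^(q p + p - 1)\<close> has a trace of the degree of \<open>\<alpha>^q\<close>, which is
  \<open>p - 1\<close> less, for each of the \<open>m\<close> factors.\<close>

definition offset :: "int poly" where
  "offset = (\<Sum>i<m. monom (int (\<delta> * (p - 1))) (2 * i))"

definition hits :: "(nat \<times> nat) list \<Rightarrow> bool" where
  "hits xs \<longleftrightarrow> (\<forall>i<m. p dvd snd_sum (digits i xs) \<and> p dvd fst_sum (digits i xs) + \<delta>)"

text \<open>The top term of a word trace, up to the power of \<open>\<rho>\<close> that depends on
  the order of the letters. The constant is the trace of \<open>x^(p-1)\<close> or of the identity,
  according to the kind.\<close>

definition leading :: "(nat \<times> nat) list \<Rightarrow> 'f" where
  "leading xs = (\<Prod>i<m. if p dvd snd_sum (digits i xs) then \<beta> i ^ (snd_sum (digits i xs) div p) *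
     (if p dvd fst_sum (digits i xs) + \<delta> then of_nat (if \<delta> = 1 then wilson else p) * \<alpha> i ^ ((fst_sum (digits i xs) + \<delta>) div p - \<delta>) else 0) else 0)"

lemma sum_weight:
  "sum_list (map weight xs) = (\<Sum>i<m. monom (int (fst_sum (digits i xs))) (2 * i) + monom (int (snd_sum (digits i xs))) (2 * i + 1))"
  by (induction xs) (simp_all add: weight_def digits_def add_monom[symmetric] sum.distrib ac_simps)

lemma two_kinds:
  obtains "CHAR('f) = p" "\<epsilon> = 1" "\<rho> = 1" "\<delta> = 1" | "\<epsilon> = 0" "primitive_root_of_unity p \<rho>" "of_nat p \<noteq> (0 :: 'f)" "\<delta> = 0"
  using kinds unfolding \<delta>_def by auto

lemma delta_char: "\<delta> = (if CHAR('f) = p then 1 else 0)"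
proof (rule two_kinds)
  assume "of_nat p \<noteq> (0 :: 'f)" "\<delta> = 0"
  then show ?thesis by (metis of_nat_CHAR)
qed simp

abbreviation word_degree :: "(nat \<times> nat) list \<Rightarrow> int poly" where
  "word_degree xs \<equiv> sum_list (map weight xs) - offset"

abbreviation factor_degree :: "nat \<Rightarrow> (nat \<times> nat) list \<Rightarrow> int poly" where
  "factor_degree i cs \<equiv> monom (int (fst_sum cs) - int (\<delta> * (p - 1))) (2 * i) + monom (int (snd_sum cs)) (2 * i + 1)"

lemma total_eq: "word_degree xs = (\<Sum>i<m. factor_degree i (digits i xs))"
  unfolding sum_weight offset_def sum_subtractf[symmetric] by (simp add: diff_monom[symmetric] algebra_simps)

lemma leading_factor_deg:
  assumes i: "i < m"
  shows "p dvd snd_sum cs \<Longrightarrow> p dvd fst_sum cs + \<delta> \<Longrightarrow>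
      deg_eq (factor_degree i cs) (\<beta> i ^ (snd_sum cs div p) * (of_nat (if \<delta> = 1 then wilson else p) * \<alpha> i ^ ((fst_sum cs + \<delta>) div p - \<delta>)))"
proof -
  assume d: "p dvd snd_sum cs" "p dvd fst_sum cs + \<delta>"
  have nz: "of_nat (if \<delta> = 1 then wilson else p) \<noteq> (0 :: 'f)"
    by (rule two_kinds) (use wilson_nonzero i in auto)
  \<comment> \<open>For \<open>\<delta> = 1\<close> write \<open>n + 1 = p k\<close>: then
    \<open>(k - 1) p = n - (p - 1)\<close>, and \<open>k \<ge> 1\<close> keeps the subtraction of
    naturals exact.\<close>
  have e: "int (((fst_sum cs + \<delta>) div p - \<delta>) * p) = int (fst_sum cs) - int (\<delta> * (p - 1))"
  proof (rule two_kinds)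
    assume \<delta>: "\<delta> = 1"
    obtain k where k: "fst_sum cs + 1 = p * k" using d \<delta> by auto
    then obtain k' where k': "k = Suc k'" by (cases k) auto
    have "(p * k) div p = k" using p0 by simp
    moreover have "int (fst_sum cs) + 1 = int p * int k" using k by (metis of_nat_1 of_nat_add of_nat_mult)
    ultimately show ?thesis using k k' p0 \<delta> by (simp add: algebra_simps of_nat_diff)
  qed (use d in auto)
  have "deg_eq (monom (int (snd_sum cs div p * p)) (2 * i + 1) + (0 + monom (int (((fst_sum cs + \<delta>) div p - \<delta>) * p)) (2 * i)))
      (\<beta> i ^ (snd_sum cs div p) * (of_nat (if \<delta> = 1 then wilson else p) * \<alpha> i ^ ((fst_sum cs + \<delta>) div p - \<delta>)))"
    by (intro deg_eq_mult deg_eq_beta deg_eq_alpha deg_eq_of_nat i nz)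
  moreover have "snd_sum cs div p * p = snd_sum cs" using d(1) by simp
  ultimately show ?thesis unfolding e by (simp only: add_0_left add.commute)
qed

lemma leading_deg: "hits xs \<Longrightarrow> deg_eq (word_degree xs) (leading xs)"
proof -
  assume h: "hits xs"
  have "deg_eq (\<Sum>i\<in>S. factor_degree i (digits i xs)) (\<Prod>i\<in>S. \<beta> i ^ (snd_sum (digits i xs) div p) * (of_nat (if \<delta> = 1 then wilson else p) * \<alpha> i ^ ((fst_sum (digits i xs) + \<delta>) div p - \<delta>)))"
    if "finite S" "S \<subseteq> {..<m}" for S
    using that
  proof (induction S)
    case empty
    then show ?case using deg_eq_of_nat[of 1] by simp
  next
    case (insert i S)
    then have "deg_eq (factor_degree i (digits i xs)) (\<beta> i ^ (snd_sum (digits i xs) div p) * (of_nat (if \<delta> = 1 then wilson else p) * \<alpha> i ^ ((fst_sum (digits i xs) + \<delta>) div p - \<delta>)))"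
      using h unfolding hits_def by (intro leading_factor_deg) auto
    from deg_eq_mult[OF this insert.IH] show ?case
      unfolding sum.insert[OF insert.hyps] prod.insert[OF insert.hyps] using insert.prems by simp
  qed
  from this[of "{..<m}"] show ?thesis
    unfolding total_eq leading_def using h unfolding hits_def by simp
qed

text \<open>The comparison with \<open>leading\<close> is restricted to characteristic
  \<open>p\<close>. For a root of unity \<open>\<rho>\<close> the order of the letters changes the
  top term by a power of \<open>\<rho>\<close>, which only leaves the degree intact.\<close>

lemma word_trace_leading:
  "\<exists>x. to_ac x = word_trace xs \<and> deg_le (word_degree xs) x \<and>
    (CHAR('f) = p \<longrightarrow> deg_less (word_degree xs) (x - leading xs))"
proof -
  let ?lead = "\<lambda>i. if p dvd snd_sum (digits i xs) then \<beta> i ^ (snd_sum (digits i xs) div p) *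
     (if p dvd fst_sum (digits i xs) + \<delta> then of_nat (if \<delta> = 1 then wilson else p) * \<alpha> i ^ ((fst_sum (digits i xs) + \<delta>) div p - \<delta>) else 0) else 0"
  have lead_le: "deg_le (factor_degree i (digits i xs)) (?lead i)" if "i < m" for i
  proof (cases "p dvd snd_sum (digits i xs) \<and> p dvd fst_sum (digits i xs) + \<delta>")
    case True
    then have "p dvd snd_sum (digits i xs)" "p dvd fst_sum (digits i xs) + \<delta>" by blast+
    from deg_eq_imp_le[OF leading_factor_deg[OF that this]] show ?thesis by (simp only: True if_True)
  next
    case False
    then have "?lead i = 0" by (auto simp only: if_False if_True mult_zero_right split: if_split)
    then show ?thesis by (simp only: deg_zero)
  qed
  show ?thesis
  proof (rule two_kinds)
    assume c: "CHAR('f) = p" "\<epsilon> = 1" "\<rho> = 1" and \<delta>: "\<delta> = 1"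
    have ex: "\<exists>\<tau>. to_ac \<tau> = factor_trace i (digits i xs) \<and> deg_less (factor_degree i (digits i xs)) (\<tau> - ?lead i)" if i: "i < m" for i
    proof -
      have e: "?lead i = (if p dvd snd_sum (digits i xs) then \<beta> i ^ (snd_sum (digits i xs) div p) * lead_sum i (fst_sum (digits i xs)) else 0)"
        by (simp add: \<delta> lead_sum_def[OF c])
      show ?thesis unfolding e using factor_trace_p[OF c i, of "digits i xs"] by (simp only: \<delta> mult_1)
    qed
    define \<tau> where "\<tau> i = (SOME \<tau>. to_ac \<tau> = factor_trace i (digits i xs) \<and>
      deg_less (factor_degree i (digits i xs)) (\<tau> - ?lead i))" for i
    have t: "to_ac (\<tau> i) = factor_trace i (digits i xs)" "deg_less (factor_degree i (digits i xs)) (\<tau> i - ?lead i)"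
      if "i < m" for i
      unfolding \<tau>_def
      by (rule conjunct1[OF someI_ex[OF ex[OF that]]], rule conjunct2[OF someI_ex[OF ex[OF that]]])
    have "deg_less (word_degree xs) ((\<Prod>i<m. \<tau> i) - leading xs) \<and> deg_le (word_degree xs) (leading xs)"
      unfolding total_eq leading_def by (rule deg_approx_prod[OF finite_lessThan]) (simp_all only: lessThan_iff t(2) lead_le)
    moreover have "to_ac (\<Prod>i<m. \<tau> i) = word_trace xs"
      unfolding word_trace_factors to_ac_prod by (rule prod.cong) (simp_all only: lessThan_iff t(1))
    ultimately show ?thesis
      using deg_le_add[of "word_degree xs" "(\<Prod>i<m. \<tau> i) - leading xs" "leading xs"] deg_less_imp_le
      by (intro exI[of _ "\<Prod>i<m. \<tau> i"]) simp
  next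
    assume c: "\<epsilon> = 0" "primitive_root_of_unity p \<rho>" "of_nat p \<noteq> (0 :: 'f)" and \<delta>: "\<delta> = 0"
    define \<tau> where "\<tau> i = \<rho> ^ commutation_exponent (digits i xs) * ?lead i" for i
    have t: "to_ac (\<tau> i) = factor_trace i (digits i xs)" if i: "i < m" for i
      unfolding factor_trace_0[OF i c(1,2)] \<tau>_def by (simp add: \<delta> mult_ac)
    have le: "deg_le (factor_degree i (digits i xs)) (\<tau> i)" if "i < m" for i
      using deg_le_mult[OF deg_eq_imp_le[OF deg_eq_rho] lead_le[OF that]] unfolding \<tau>_def by simp
    have "deg_le (word_degree xs) (\<Prod>i<m. \<tau> i)"
      unfolding total_eq using deg_approx_prod[of "{..<m}" "\<lambda>i. factor_degree i (digits i xs)" \<tau> \<tau>] le by simp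
    moreover have "to_ac (\<Prod>i<m. \<tau> i) = word_trace xs"
      unfolding word_trace_factors to_ac_prod by (rule prod.cong) (use t in auto)
    moreover have "CHAR('f) \<noteq> p" using c(3) by (metis of_nat_CHAR)
    ultimately show ?thesis by metis
  qed
qed

definition tr :: "(nat \<times> nat) list \<Rightarrow> 'f" where "tr xs = of_ac (word_trace xs)"

lemma tr: "to_ac (tr xs) = word_trace xs" "deg_le (word_degree xs) (tr xs)" "CHAR('f) = p \<Longrightarrow> deg_less (word_degree xs) (tr xs - leading xs)"
proof -
  obtain x where x: "to_ac x = word_trace xs" "deg_le (word_degree xs) x" "CHAR('f) = p \<longrightarrow> deg_less (word_degree xs) (x - leading xs)"
    using word_trace_leading by blast
  have "tr xs = x" unfolding tr_def x(1)[symmetric] by simp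
  then show "to_ac (tr xs) = word_trace xs" "deg_le (word_degree xs) (tr xs)" "CHAR('f) = p \<Longrightarrow> deg_less (word_degree xs) (tr xs - leading xs)"
    using x by auto
qed

lemma tr_deg_eq: "hits xs \<Longrightarrow> deg_eq (word_degree xs) (tr xs)"
proof (rule two_kinds)
  assume h: "hits xs" and "CHAR('f) = p"
  then show ?thesis using deg_eq_add_less[OF leading_deg tr(3)] by simp
next
  assume h: "hits xs" and c: "\<epsilon> = 0" "primitive_root_of_unity p \<rho>" "of_nat p \<noteq> (0 :: 'f)" and \<delta>: "\<delta> = 0"
  have "to_ac (tr xs) = to_ac ((\<Prod>i<m. \<rho> ^ commutation_exponent (digits i xs)) * leading xs)"
    unfolding tr(1) word_trace_factors leading_def to_ac_mult to_ac_prod prod.distrib[symmetric]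
    using h unfolding hits_def by (intro prod.cong refl) (simp add: factor_trace_0[OF _ c(1,2)] \<delta> mult_ac)
  then have e: "tr xs = (\<Prod>i<m. \<rho> ^ commutation_exponent (digits i xs)) * leading xs" by (simp only: to_ac_eq_iff)
  have "(\<Prod>i<m. \<rho> ^ commutation_exponent (digits i xs)) = \<rho> ^ (\<Sum>i<m. commutation_exponent (digits i xs))"
    by (simp add: power_sum)
  then show ?thesis unfolding e using deg_eq_mult[OF deg_eq_rho leading_deg[OF h]] by simp
qed

definition sym_tr :: "nat \<Rightarrow> (nat \<Rightarrow> nat \<times> nat) \<Rightarrow> 'f" where
  "sym_tr k f = (\<Sum>\<sigma> | \<sigma> permutes {..<k}. tr (map (\<lambda>s. f (\<sigma> s)) [0..<k]))"

lemma sum_list_permute: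
  assumes "\<sigma> permutes {..<k}"
  shows "sum_list (map (\<lambda>s. h (\<sigma> s)) [0..<k]) = (sum_list (map h [0..<k]) :: 'c::comm_monoid_add)"
  using sum.permute[OF assms, of h]
  by (simp add: interv_sum_list_conv_sum_set_nat atLeast0LessThan comp_def)

lemma perm_invariant:
  assumes s: "\<sigma> permutes {..<k}"
  shows "word_degree (map (\<lambda>s. f (\<sigma> s)) [0..<k]) = word_degree (map f [0..<k])"
    and "leading (map (\<lambda>s. f (\<sigma> s)) [0..<k]) = leading (map f [0..<k])"
proof -
  show "word_degree (map (\<lambda>s. f (\<sigma> s)) [0..<k]) = word_degree (map f [0..<k])"
    using sum_list_permute[OF s, of "\<lambda>s. weight (f s)"] by (simp add: comp_def)
  have "fst_sum (digits i (map (\<lambda>s. f (\<sigma> s)) [0..<k])) = fst_sum (digits i (map f [0..<k]))"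
    "snd_sum (digits i (map (\<lambda>s. f (\<sigma> s)) [0..<k])) = snd_sum (digits i (map f [0..<k]))" for i
    using sum_list_permute[OF s, of "\<lambda>s. dig p i (fst (f s))"] sum_list_permute[OF s, of "\<lambda>s. dig p i (snd (f s))"]
    by (simp_all add: digits_def comp_def)
  then show "leading (map (\<lambda>s. f (\<sigma> s)) [0..<k]) = leading (map f [0..<k])"
    unfolding leading_def by (simp only:)
qed

lemma finite_perms: "finite {\<sigma>. \<sigma> permutes {..<k :: nat}}"
  by (rule finite_permutations) simp

lemma sym_tr_deg_le: "deg_le (word_degree (map f [0..<k])) (sym_tr k f)"
proof -
  have "deg_le (word_degree (map f [0..<k])) (\<Sum>\<sigma>\<in>P. tr (map (\<lambda>s. f (\<sigma> s)) [0..<k]))" if "finite P" "P \<subseteq> {\<sigma>. \<sigma> permutes {..<k}}" for P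
    using that
  proof (induction P)
    case (insert \<sigma> P)
    then have "deg_le (word_degree (map f [0..<k])) (tr (map (\<lambda>s. f (\<sigma> s)) [0..<k]))"
      using tr(2)[of "map (\<lambda>s. f (\<sigma> s)) [0..<k]"] perm_invariant(1)[of \<sigma> k f] by simp
    then show ?case using insert by (simp add: deg_le_add)
  qed simp
  from this[OF finite_perms order_refl] show ?thesis unfolding sym_tr_def .
qed

lemma fact_nonzero: "k < p \<Longrightarrow> of_nat (fact k) \<noteq> (0 :: 'f)"
proof (induction k)
  case (Suc k)
  moreover have "of_nat (fact (Suc k)) = (of_nat (Suc k) * of_nat (fact k) :: 'f)"
    by (simp only: fact_Suc of_nat_mult of_nat_id)
  ultimately show ?case using small[of "Suc k"] by (simp del: of_nat_Suc fact_Suc)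
qed simp

text \<open>Up to cyclic rotation there is only one word with all letters but one equal to \<open>a\<close>.\<close>

lemma rotate_single:
  assumes s: "\<sigma> permutes {..<k}" and k: "k > 0"
  shows "tr (map (\<lambda>s. if \<sigma> s = 0 then b else a) [0..<k]) = tr (b # replicate (k - 1) a)"
proof -
  define j where "j = inv_into UNIV \<sigma> 0"
  have j: "j < k" using permutes_in_image[OF permutes_inv[OF s], of 0] k by (simp add: j_def)
  have sj: "\<sigma> x = 0 \<longleftrightarrow> x = j" for x unfolding j_def using permutes_inverses[OF s] by metis
  have "map (\<lambda>s. if \<sigma> s = 0 then b else a) [0..<k] = replicate j a @ b # replicate (k - 1 - j) a"
    by (rule nth_equalityI) (use j in \<open>auto simp: sj nth_append nth_Cons'\<close>)
  moreover have "word_trace (replicate j a @ b # replicate (k - 1 - j) a) = word_trace (b # replicate (k - 1) a)"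
    using word_trace_rotate[of "replicate j a" "b # replicate (k - 1 - j) a"] j by (simp add: replicate_add[symmetric])
  ultimately show ?thesis unfolding tr_def by simp
qed

text \<open>The \<open>k!\<close> words must not cancel. In characteristic \<open>p\<close> they
  share their leading term; otherwise, for the special words allowed, they are rotations of each
  other and have equal traces. In both cases the factor \<open>k!\<close> is a unit as
  \<open>k < p\<close>.\<close>

lemma sym_tr_deg_eq:
  assumes h: "hits (map f [0..<k])" and k: "0 < k" "k < p"
    and comm: "CHAR('f) = p \<or> (\<exists>a b. f = (\<lambda>s. if s = 0 then b else a))"
  shows "deg_eq (word_degree (map f [0..<k])) (sym_tr k f)"
proof -
  let ?g = "word_degree (map f [0..<k])"
  have card: "card {\<sigma>. \<sigma> permutes {..<k}} = fact k" by (rule card_permutations) auto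
  show ?thesis using comm
  proof
    assume c: "CHAR('f) = p"
    have "deg_less ?g (\<Sum>\<sigma>\<in>P. tr (map (\<lambda>s. f (\<sigma> s)) [0..<k]) - leading (map f [0..<k]))" if "finite P" "P \<subseteq> {\<sigma>. \<sigma> permutes {..<k}}" for P
      using that
    proof (induction P)
      case (insert \<sigma> P)
      then have "deg_less ?g (tr (map (\<lambda>s. f (\<sigma> s)) [0..<k]) - leading (map f [0..<k]))"
        using tr(3)[OF c, of "map (\<lambda>s. f (\<sigma> s)) [0..<k]"] perm_invariant[of \<sigma> k f] by simp
      then show ?case using insert by (simp add: deg_less_add)
    qed simp
    from this[OF finite_perms order_refl]
    have "deg_less ?g (sym_tr k f - of_nat (fact k) * leading (map f [0..<k]))"
      by (simp add: sum_subtractf sym_tr_def card)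
    moreover have "deg_eq ?g (of_nat (fact k) * leading (map f [0..<k]))"
      using deg_eq_mult[OF deg_eq_of_nat[OF fact_nonzero[OF k(2)]] leading_deg[OF h]] by simp
    ultimately show ?thesis using deg_eq_add_less by fastforce
  next
    assume "\<exists>a b. f = (\<lambda>s. if s = 0 then b else a)"
    then obtain a b where f: "f = (\<lambda>s. if s = 0 then b else a)" by blast
    have "sym_tr k f = (\<Sum>\<sigma> | \<sigma> permutes {..<k}. tr (b # replicate (k - 1) a))"
      unfolding sym_tr_def f by (intro sum.cong refl rotate_single) (use k in auto)
    also have "\<dots> = of_nat (fact k) * tr (b # replicate (k - 1) a)" by (simp add: card)
    also have "tr (b # replicate (k - 1) a) = tr (map f [0..<k])"
      unfolding f using rotate_single[OF permutes_id, of k b a] k by simp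
    finally show ?thesis
      using deg_eq_mult[OF deg_eq_of_nat[OF fact_nonzero[OF k(2)]] tr_deg_eq[OF h]] by simp
  qed
qed

text \<open>The term at \<open>x\<close> has total degree \<open>g\<close>, counting
  \<open>weight x\<close> for the monomial, and every other term has strictly smaller
  degree.\<close>

definition is_lead :: "(nat \<times> nat \<Rightarrow> 'f) \<Rightarrow> nat \<times> nat \<Rightarrow> int poly \<Rightarrow> bool" where
  "is_lead C x g \<longleftrightarrow> x \<in> Idx \<and> deg_eq (g - weight x) (C x) \<and> (\<forall>y\<in>Idx - {x}. deg_less (g - weight y) (C y))"

lemma coeff_weight: "i < m \<Longrightarrow> coeff (weight x) (2 * i) = int (dig p i (fst x))"
  "i < m \<Longrightarrow> coeff (weight x) (2 * i + 1) = int (dig p i (snd x))"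
proof -
  assume i: "i < m"
  have "coeff (weight x) (2 * i) = (\<Sum>j<m. if j = i then int (dig p i (fst x)) else 0)"
    unfolding weight_def coeff_sum by (intro sum.cong refl) (auto simp: Suc_double_not_eq_double double_not_eq_Suc_double)
  then show "coeff (weight x) (2 * i) = int (dig p i (fst x))" using i by simp
  have "coeff (weight x) (2 * i + 1) = (\<Sum>j<m. if j = i then int (dig p i (snd x)) else 0)"
    unfolding weight_def coeff_sum by (intro sum.cong refl) (auto simp: Suc_double_not_eq_double double_not_eq_Suc_double)
  then show "coeff (weight x) (2 * i + 1) = int (dig p i (snd x))" using i by simp
qed

text \<open>The coefficients of a weight are digits below \<open>p\<close>, hence determined modulo
  \<open>p\<close>, and scaled degrees of scalars are divisible by \<open>p\<close>. So terms at
  different monomials never have the same degree, and leading monomials are unique.\<close>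

lemma weight_separates:
  assumes xy: "x \<in> Idx" "y \<in> Idx" and e: "of_nat p * u + weight x = of_nat p * v + weight y"
  shows "x = y"
proof -
  have pc: "coeff (of_nat p * u) n = int p * coeff u n" for u :: "int poly" and n
    unfolding of_nat_poly[of p] by (simp only: mult_pCons_left mult_zero_left pCons_0_0 add_0_right coeff_smult)
  have dd: "a = b" if "int p * c + int a = int p * c' + int b" "a < p" "b < p" for a b c c'
  proof -
    have "int a mod int p = int b mod int p"
      using arg_cong[OF that(1), of "\<lambda>z. z mod int p"] by (simp only: mod_mult_self4)
    then show ?thesis using that(2,3) by (simp only: zmod_int[symmetric] of_nat_eq_iff mod_less)
  qed
  have "dig p i (fst x) = dig p i (fst y)" "dig p i (snd x) = dig p i (snd y)" if i: "i < m" for i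
  proof -
    have "coeff (of_nat p * u + weight x) n = coeff (of_nat p * v + weight y) n" for n using e by simp
    from this[of "2 * i"] this[of "2 * i + 1"]
    have 1: "int p * coeff u (2 * i) + int (dig p i (fst x)) = int p * coeff v (2 * i) + int (dig p i (fst y))"
      and 2: "int p * coeff u (2 * i + 1) + int (dig p i (snd x)) = int p * coeff v (2 * i + 1) + int (dig p i (snd y))"
      by (simp_all only: coeff_add pc coeff_weight[OF i])
    show "dig p i (fst x) = dig p i (fst y)" by (rule dd[OF 1 dig_less[OF p0] dig_less[OF p0]])
    show "dig p i (snd x) = dig p i (snd y)" by (rule dd[OF 2 dig_less[OF p0] dig_less[OF p0]])
  qed
  then have "fst x = fst y" "snd x = snd y"
    using digits_eqI[OF p0, of "fst x" m "fst y"] digits_eqI[OF p0, of "snd x" m "snd y"] xy by (auto simp: Idx_def)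
  then show ?thesis by (rule prod_eqI)
qed

lemma lead_exists:
  assumes "x0 \<in> Idx" "C x0 \<noteq> 0"
  obtains x g where "is_lead C x g" "C x \<noteq> 0"
proof -
  define N where "N = {x \<in> Idx. C x \<noteq> 0}"
  define h where "h x = of_nat p * w (C x) + weight x" for x
  have "x0 \<in> N" using assms by (simp add: N_def)
  then have N: "N \<noteq> {}" "finite N" by (blast, simp add: N_def)
  have "Max (h ` N) \<in> h ` N" using N by (intro Max_in) auto
  then obtain x where x: "x \<in> N" "h x = Max (h ` N)" by auto
  have le: "h y \<le> h x" if "y \<in> N" for y unfolding x(2) using that N by (intro Max_ge) auto
  have "deg_less (h x - weight y) (C y)" if y: "y \<in> Idx - {x}" for y
  proof (cases "C y = 0")
    case False
    then have yN: "y \<in> N" using y by (simp add: N_def)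
    have "h y \<noteq> h x" using weight_separates[of y x] y x(1) by (auto simp: h_def N_def)
    then have "h y < h x" using le[OF yN] by simp
    then show ?thesis unfolding deg_less_def h_def by (simp add: less_diff_eq)
  qed simp
  then have "is_lead C x (h x)" using x(1) unfolding is_lead_def by (auto simp: N_def deg_eq_def h_def)
  then show thesis using that x(1) by (auto simp: N_def)
qed

text \<open>In the polarized trace identity the choice of all leading monomials gives a term of
  exact degree, because its word hits, while every other choice gives a smaller degree. Such a sum
  cannot vanish. Closure of \<open>W\<close> under addition supplies the vanishing traces at partial
  sums that polarization needs.\<close>

theorem leads_no_hit:
  assumes W: "\<And>C C'. C \<in> W \<Longrightarrow> C' \<in> W \<Longrightarrow> (\<lambda>x. C x + C' x) \<in> W" "(\<lambda>_. 0) \<in> W"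
    and zero: "\<And>C. C \<in> W \<Longrightarrow> mat_trace (comb_mat (\<lambda>x. to_ac (C x)) ^\<^sub>m k) = 0"
    and Cs: "\<And>s. s < k \<Longrightarrow> Cs s \<in> W" "\<And>s. s < k \<Longrightarrow> is_lead (Cs s) (l s) (g s)"
    and k: "0 < k" "k < p" and h: "hits (map l [0..<k])"
    and comm: "CHAR('f) = p \<or> (\<exists>a b. l = (\<lambda>s. if s = 0 then b else a))"
  shows False
proof -
  let ?F = "{..<k} \<rightarrow>\<^sub>E Idx"
  have WS: "(\<lambda>x. \<Sum>j\<in>S. Cs j x) \<in> W" if "finite S" "S \<subseteq> {..<k}" for S
    using that
  proof (induction S)
    case (insert j S)
    then have "(\<lambda>x. Cs j x + (\<Sum>j\<in>S. Cs j x)) \<in> W" using Cs(1) by (intro W(1)) auto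
    then show ?case using insert by simp
  qed (simp add: W(2))
  have pol: "(\<Sum>f\<in>?F. (\<Prod>s<k. Cs s (f s)) * (\<Sum>\<sigma> | \<sigma> permutes {..<k}. tr (map (\<lambda>s\<in>{..<k}. f (\<sigma> s)) [0..<k]))) = 0"
  proof (rule polarization[OF finite_Idx, where t = "\<lambda>f. tr (map f [0..<k])"])
    fix S assume S: "S \<subseteq> {..<k}"
    let ?C = "\<lambda>x. \<Sum>j\<in>S. Cs j x"
    have "0 = mat_trace (comb_mat (\<lambda>x. to_ac (?C x)) ^\<^sub>m k)"
      using zero[OF WS[OF finite_subset[OF S finite_lessThan] S]] by simp
    also have "\<dots> = (\<Sum>xs | set xs \<subseteq> Idx \<and> length xs = k. to_ac ((\<Prod>s<k. ?C (xs ! s)) * tr xs))"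
      unfolding comb_mat_power_trace by (simp add: tr(1) to_ac_prod)
    also have "\<dots> = (\<Sum>f\<in>?F. to_ac ((\<Prod>s<k. ?C (map f [0..<k] ! s)) * tr (map f [0..<k])))"
      by (rule sum_lists_functions)
    also have "\<dots> = to_ac (\<Sum>f\<in>?F. (\<Prod>s<k. ?C (f s)) * tr (map f [0..<k]))"
      unfolding to_ac_sum by (intro sum.cong refl arg_cong[of _ _ to_ac] arg_cong2[of _ _ _ _ "(*)"] prod.cong) auto
    finally show "(\<Sum>f\<in>?F. (\<Prod>s<k. ?C (f s)) * tr (map f [0..<k])) = 0" by (rule to_ac_eq_0_iff[THEN iffD1, OF sym])
  qed
  have symtr: "(\<Sum>\<sigma> | \<sigma> permutes {..<k}. tr (map (\<lambda>s\<in>{..<k}. f (\<sigma> s)) [0..<k])) = sym_tr k f" for f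
    unfolding sym_tr_def by (intro sum.cong refl arg_cong[of _ _ tr] map_cong) auto
  let ?T = "\<lambda>f. (\<Prod>s<k. Cs s (f s)) * sym_tr k f"
  \<comment> \<open>The common degree bound for all choices \<open>f\<close>: the weights subtracted
    from the coefficients reappear in the degree of the word.\<close>
  let ?g = "(\<Sum>s<k. g s) - offset"
  have tot: "(\<Sum>s<k. g s - weight (f s)) + word_degree (map f [0..<k]) = ?g" for f
    by (simp add: sum_subtractf interv_sum_list_conv_sum_set_nat atLeast0LessThan comp_def)
  have prod_le: "deg_le (\<Sum>s\<in>S. g s - weight (f s)) (\<Prod>s\<in>S. Cs s (f s))"
    if "f \<in> ?F" "finite S" "S \<subseteq> {..<k}" for f S
    using that(2,3)
  proof (induction S)
    case empty then show ?case using deg_le_of_nat[of 1] by simp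
  next
    case (insert s S)
    have "f s \<in> Idx" using that(1) insert.prems by auto
    moreover have "is_lead (Cs s) (l s) (g s)" using insert.prems by (intro Cs(2)) simp
    ultimately have "deg_le (g s - weight (f s)) (Cs s (f s))"
      unfolding is_lead_def by (cases "f s = l s") (simp_all add: deg_eq_imp_le deg_less_imp_le)
    then show ?case using insert by (simp add: deg_le_mult)
  qed
  have less: "deg_less ?g (?T f)" if f: "f \<in> ?F" "s < k" "f s \<noteq> l s" for f s
  proof -
    have "f s \<in> Idx - {l s}" using f by auto
    then have "deg_less (g s - weight (f s)) (Cs s (f s))" using Cs(2)[of s] f unfolding is_lead_def by blast
    from deg_less_le_mult[OF this prod_le[OF f(1), of "{..<k} - {s}"]]
    have "deg_less (\<Sum>s<k. g s - weight (f s)) (\<Prod>s<k. Cs s (f s))"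
      using f(2) by (simp add: sum.remove[of "{..<k}" s] prod.remove[of "{..<k}" s])
    from deg_less_le_mult[OF this sym_tr_deg_le[of f k]] show ?thesis unfolding tot .
  qed
  \<comment> \<open>The sum runs over extensional functions, so the leading choice \<open>l\<close>
    has to be restricted to its domain.\<close>
  define l' where "l' = (\<lambda>s\<in>{..<k}. l s)"
  have l'F: "l' \<in> ?F" using Cs(2) by (auto simp: l'_def is_lead_def)
  have ml: "map l' [0..<k] = map l [0..<k]" by (auto simp: l'_def)
  have "deg_eq (\<Sum>s\<in>S. g s - weight (l s)) (\<Prod>s\<in>S. Cs s (l s))" if "finite S" "S \<subseteq> {..<k}" for S
    using that
  proof (induction S)
    case empty then show ?case using deg_eq_of_nat[of 1] by simp
  next
    case (insert s S)
    then have "deg_eq (g s - weight (l s)) (Cs s (l s))" using Cs(2)[of s] unfolding is_lead_def by auto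
    then show ?case using insert by (simp add: deg_eq_mult)
  qed
  from this[of "{..<k}"] have "deg_eq (\<Sum>s<k. g s - weight (l s)) (\<Prod>s<k. Cs s (l s))" by simp
  from deg_eq_mult[OF this sym_tr_deg_eq[OF h k comm]] have "deg_eq ?g (?T l)" unfolding tot .
  moreover have "?T l' = ?T l"
  proof -
    have "\<sigma> s < k" if "\<sigma> permutes {..<k}" "s < k" for \<sigma> s
      using permutes_in_image[OF that(1), of s] that(2) by simp
    then have "sym_tr k l' = sym_tr k l" unfolding sym_tr_def
      by (intro sum.cong refl arg_cong[of _ _ tr] map_cong) (simp_all add: l'_def)
    moreover have "(\<Prod>s<k. Cs s (l' s)) = (\<Prod>s<k. Cs s (l s))" by (rule prod.cong) (auto simp: l'_def)
    ultimately show ?thesis by simp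
  qed
  ultimately have eq: "deg_eq ?g (?T l')" by simp
  have finF: "finite ?F" by (intro finite_PiE) auto
  have "deg_less ?g (\<Sum>f\<in>S. ?T f)" if "finite S" "S \<subseteq> ?F - {l'}" for S
    using that
  proof (induction S)
    case (insert f S)
    then have "f \<in> ?F" "f \<noteq> l'" by auto
    have "\<exists>s<k. f s \<noteq> l s"
    proof (rule ccontr)
      assume "\<not> ?thesis"
      then have "f s = l' s" if "s \<in> {..<k}" for s using that by (simp add: l'_def)
      from PiE_ext[OF \<open>f \<in> ?F\<close> l'F this] show False using \<open>f \<noteq> l'\<close> by contradiction
    qed
    then obtain s where "s < k" "f s \<noteq> l s" by (elim exE conjE)
    then have "deg_less ?g (?T f)" using less \<open>f \<in> ?F\<close> by blast
    then show ?case using insert by (simp add: deg_less_add)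
  qed simp
  from this[of "?F - {l'}"] have "deg_less ?g (\<Sum>f\<in>?F - {l'}. ?T f)" using finF by simp
  from deg_eq_add_less[OF eq this] have "deg_eq ?g (\<Sum>f\<in>?F. ?T f)"
    using finF l'F by (simp add: sum.remove[of ?F l'])
  then show False using pol unfolding symtr deg_eq_def by simp
qed

end

section \<open>Counting leading monomials\<close>

context valued_symbol_model
begin

definition coord :: "nat \<times> nat \<Rightarrow> nat \<Rightarrow> nat" where
  "coord x j = (if j < m then dig p j (fst x) else dig p (j - m) (snd x))"

lemma coord_less: "coord x j < p"
  using dig_less[OF p0] by (simp add: coord_def)

lemma coord_exists:
  assumes "\<And>j. j < 2 * m \<Longrightarrow> f j < p"
  obtains x where "x \<in> Idx" "\<And>j. j < 2 * m \<Longrightarrow> coord x j = f j"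
proof -
  obtain a where a: "a < p ^ m" "\<And>i. i < m \<Longrightarrow> dig p i a = f i" using digits_exist[of m f p] assms by auto
  obtain b where b: "b < p ^ m" "\<And>i. i < m \<Longrightarrow> dig p i b = f (m + i)" using digits_exist[of m "\<lambda>i. f (m + i)" p] assms by auto
  show thesis
    by (rule that[of "(a, b)"]) (use a b in \<open>auto simp: Idx_def coord_def\<close>)
qed

lemma coord_inj:
  assumes "x \<in> Idx" "y \<in> Idx" "\<And>j. j < 2 * m \<Longrightarrow> coord x j = coord y j"
  shows "x = y"
proof (rule prod_eqI)
  show "fst x = fst y"
  proof (rule digits_eqI[OF p0, of _ m])
    show "dig p i (fst x) = dig p i (fst y)" if "i < m" for i
      using assms(3)[of i] that by (simp add: coord_def)
  qed (use assms(1,2) in \<open>auto simp: Idx_def\<close>)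
  show "snd x = snd y"
  proof (rule digits_eqI[OF p0, of _ m])
    show "dig p i (snd x) = dig p i (snd y)" if "i < m" for i
      using assms(3)[of "m + i"] that by (simp add: coord_def)
  qed (use assms(1,2) in \<open>auto simp: Idx_def\<close>)
qed

lemma hits_coord: "hits xs \<longleftrightarrow> (\<forall>j<2 * m. p dvd (\<Sum>x\<leftarrow>xs. coord x j) + (if j < m then \<delta> else 0))"
proof
  assume h: "hits xs"
  show "\<forall>j<2 * m. p dvd (\<Sum>x\<leftarrow>xs. coord x j) + (if j < m then \<delta> else 0)"
  proof (intro allI impI)
    fix j assume j: "j < 2 * m"
    show "p dvd (\<Sum>x\<leftarrow>xs. coord x j) + (if j < m then \<delta> else 0)"
    proof (cases "j < m")
      case True
      then show ?thesis using h by (auto simp: hits_def digits_def coord_def comp_def)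
    next
      case False
      then have "p dvd snd_sum (digits (j - m) xs)" using h j unfolding hits_def by auto
      then show ?thesis using False by (simp add: digits_def coord_def comp_def)
    qed
  qed
next
  assume h: "\<forall>j<2 * m. p dvd (\<Sum>x\<leftarrow>xs. coord x j) + (if j < m then \<delta> else 0)"
  show "hits xs" unfolding hits_def
  proof (intro allI impI conjI)
    fix i assume i: "i < m"
    show "p dvd snd_sum (digits i xs)"
      using h[rule_format, of "m + i"] i by (simp add: digits_def coord_def comp_def)
    show "p dvd fst_sum (digits i xs) + \<delta>"
      using h[rule_format, of i] i by (simp add: digits_def coord_def comp_def)
  qed
qed

lemma card_Idx: "card Idx = p ^ (2 * m)"
  by (simp add: Idx_def power_add[symmetric] mult_2)

lemma zero_Idx: "(0, 0) \<in> Idx" "coord (0, 0) j = 0"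
  using p0 by (auto simp: Idx_def coord_def)

context
  fixes S :: "(nat \<times> nat) set"
  assumes S: "S \<subseteq> Idx"
    and no_hit: "\<And>l k. (\<And>s. s < k \<Longrightarrow> l s \<in> S) \<Longrightarrow> 0 < k \<Longrightarrow> k < p \<Longrightarrow> hits (map l [0..<k]) \<Longrightarrow>
      CHAR('f) = p \<or> (\<exists>a b. l = (\<lambda>s. if s = 0 then b else a)) \<Longrightarrow> False"
    and m1: "m \<ge> 1"
begin

text \<open>Away from characteristic \<open>p\<close>, every line of \<open>(\<int>/p)\<^sup>2\<^sup>m\<close> contains at most one element
  of \<open>S\<close>: \<open>S \<ni> y = t x\<close> with \<open>2 \<le> t < p\<close> would give the forbidden sum \<open>(p - t) x + y = 0\<close>.\<close>

lemma card_le_lines: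
  assumes \<delta>: "\<delta> = 0"
  shows "card S * (p - 1) \<le> p ^ (2 * m) - 1"
proof -
  \<comment> \<open>The zero vector stands for the monomial \<open>1\<close>, whose trace is nonzero
    when \<open>\<delta> = 0\<close>; it is excluded by words with a single letter.\<close>
  have nz: "\<exists>j<2 * m. coord x j \<noteq> 0" if "x \<in> S" for x
  proof (rule ccontr)
    assume "\<not> ?thesis"
    then have "x = (0, 0)" using coord_inj[of x "(0, 0)"] zero_Idx S that by auto
    then have h: "hits (map (\<lambda>_. x) [0..<1])"
      unfolding hits_coord \<delta> by (simp add: zero_Idx)
    have "\<exists>a b. (\<lambda>_ :: nat. x) = (\<lambda>s. if s = 0 then b else a)" by (intro exI[of _ x]) simp
    then show False by (intro no_hit[of 1 "\<lambda>_. x", OF _ _ _ h] disjI2) (use that p in simp_all)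
  qed
  have ex: "\<exists>y\<in>Idx. \<forall>j<2 * m. coord y j = (c * coord x j) mod p" for c x
    by (rule coord_exists[of "\<lambda>j. (c * coord x j) mod p"]) (use p0 in auto)
  define mult where "mult c x = (SOME y. y \<in> Idx \<and> (\<forall>j<2 * m. coord y j = (c * coord x j) mod p))" for c x
  have mult: "mult c x \<in> Idx" "j < 2 * m \<Longrightarrow> coord (mult c x) j = (c * coord x j) mod p" for c x j
    using someI_ex[OF ex[of c x, unfolded Bex_def], folded mult_def] by simp_all
  \<comment> \<open>The multiples \<open>c x\<close> with \<open>1 \<le> c < p\<close> and
    \<open>x\<close> in \<open>S\<close> are pairwise distinct nonzero vectors, which gives the
    count.\<close>
  have unique: "c = c' \<and> x = y"
    if c: "c \<in> {1..<p}" "c' \<in> {1..<p}" and x: "x \<in> S" and y: "y \<in> S" and e: "mult c x = mult c' y" for c c' x y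
  proof -
    have cong: "[c * coord x j = c' * coord y j] (mod p)" if "j < 2 * m" for j
      using mult(2)[OF that, of c x] mult(2)[OF that, of c' y] e by (simp add: cong_def)
    have cop: "coprime a p" if "0 < a" "a < p" for a
    proof -
      have "\<not> p dvd a" using that by (simp add: nat_dvd_not_less)
      from prime_imp_coprime[OF prime this] show ?thesis by (simp only: coprime_commute)
    qed
    have "coprime c' p" using cop c(2) by simp
    from cong_solve_coprime_nat[OF this] obtain u where u: "[c' * u = Suc 0] (mod p)" by (rule exE)
    \<comment> \<open>The quotient \<open>c / c'\<close> modulo \<open>p\<close>, so that
      \<open>y = t x\<close>. The case \<open>t = 0\<close> would make \<open>y\<close> zero, and
      \<open>t = 1\<close> gives equality.\<close>
    define t where "t = (u * c) mod p"
    have ty: "[t * coord x j = coord y j] (mod p)" if "j < 2 * m" for j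
    proof -
      have "[t * coord x j = u * (c * coord x j)] (mod p)" unfolding t_def cong_def by (simp add: mod_mult_left_eq mult.assoc)
      also have "[u * (c * coord x j) = u * (c' * coord y j)] (mod p)" using cong[OF that] by (rule cong_scalar_left)
      also have "u * (c' * coord y j) = (c' * u) * coord y j" by simp
      also have "[(c' * u) * coord y j = Suc 0 * coord y j] (mod p)" using u by (rule cong_scalar_right)
      finally show ?thesis by simp
    qed
    have "t < p" using p0 by (simp add: t_def)
    consider "t = 0" | "t = 1" | "t \<ge> 2" by linarith
    then show "c = c' \<and> x = y"
    proof cases
      case 1
      then have "coord y j = 0" if "j < 2 * m" for j
        using ty[OF that] coord_less[of y j] by (simp add: cong_def)
      moreover obtain j where "j < 2 * m" "coord y j \<noteq> 0" using nz[OF y] by (elim exE conjE)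
      ultimately show ?thesis by (simp only:)
    next
      case 2
      have "coord x j = coord y j" if "j < 2 * m" for j
        using ty[OF that] coord_less[of x j] coord_less[of y j] 2 by (simp add: cong_def)
      then have xy: "x = y" using coord_inj S x y by blast
      obtain j where j: "j < 2 * m" "coord x j \<noteq> 0" using nz[OF x] by blast
      have "coprime (coord x j) p" using j coord_less[of x j] by (intro cop) auto
      then have "[c = c'] (mod p)" using cong[OF j(1)] xy by (simp add: cong_mult_rcancel_nat)
      then show ?thesis using c xy by (simp add: cong_def)
    next
      case 3
      \<comment> \<open>One \<open>y\<close> followed by \<open>p - t\<close> copies of
        \<open>x\<close>, with sum \<open>(t + p - t) x = 0\<close>. Its length
        \<open>p - t + 1\<close> is below \<open>p\<close> because \<open>t \<ge> 2\<close>.\<close>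
      define l where "l s = (if s = (0::nat) then y else x)" for s
      have k: "p - t + 1 = Suc (p - t)" by simp
      have sum: "(\<Sum>z\<leftarrow>map l [0..<p - t + 1]. coord z j) = coord y j + (p - t) * coord x j" for j
      proof -
        have "map l [1..<Suc (p - t)] = replicate (p - t) x"
          by (rule nth_equalityI) (simp_all add: l_def del: upt_Suc)
        then have "map l [0..<p - t + 1] = y # replicate (p - t) x"
          unfolding k upt_conv_Cons[OF zero_less_Suc] by (simp add: l_def del: upt_Suc)
        then show ?thesis by (simp add: sum_list_replicate)
      qed
      have h: "hits (map l [0..<p - t + 1])"
        unfolding hits_coord \<delta>
      proof (intro allI impI)
        fix j assume j: "j < 2 * m"
        have "[coord y j + (p - t) * coord x j = t * coord x j + (p - t) * coord x j] (mod p)"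
          using ty[OF j] by (intro cong_add cong_sym[OF ty[OF j]] cong_refl)
        also have "t * coord x j + (p - t) * coord x j = p * coord x j"
          using \<open>t < p\<close> by (simp add: distrib_right[symmetric])
        finally have "p dvd coord y j + (p - t) * coord x j" by (simp add: cong_dvd_iff)
        then show "p dvd (\<Sum>z\<leftarrow>map l [0..<p - t + 1]. coord z j) + (if j < m then 0 else 0)" unfolding sum by simp
      qed
      have "\<exists>a b. l = (\<lambda>s. if s = 0 then b else a)"
        by (intro exI[of _ x] exI[of _ y]) (simp add: l_def fun_eq_iff)
      then have False
        by (intro no_hit[OF _ _ _ h] disjI2) (use x y 3 \<open>t < p\<close> in \<open>simp_all add: l_def\<close>)
      then show ?thesis ..
    qed
  qed
  have inj: "inj_on (\<lambda>(c, x). mult c x) ({1..<p} \<times> S)"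
  proof (rule inj_onI)
    fix u v assume "u \<in> {1..<p} \<times> S" "v \<in> {1..<p} \<times> S" "(\<lambda>(c, x). mult c x) u = (\<lambda>(c, x). mult c x) v"
    then show "u = v" using unique[of "fst u" "fst v" "snd u" "snd v"] by (auto simp: case_prod_beta prod_eq_iff mem_Times_iff)
  qed
  have "(\<lambda>(c, x). mult c x) ` ({1..<p} \<times> S) \<subseteq> Idx - {(0, 0)}"
  proof (rule image_subsetI)
    fix u assume "u \<in> {1..<p} \<times> S"
    then obtain c x where u: "u = (c, x)" and c: "c \<in> {1..<p}" and x: "x \<in> S" by (rule SigmaE)
    obtain j where j: "j < 2 * m" "coord x j \<noteq> 0" using nz[OF x] by blast
    have "\<not> p dvd c" "\<not> p dvd coord x j" using c j coord_less[of "x" j] by (auto dest: dvd_imp_le)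
    then have "\<not> p dvd c * coord x j" using prime_dvd_mult_iff[OF prime] by blast
    then have "coord (mult c x) j \<noteq> 0" using mult(2)[OF j(1), of c "x"] by (simp add: dvd_eq_mod_eq_0)
    then have "mult c x \<noteq> (0, 0)" using zero_Idx(2) by metis
    then show "(\<lambda>(c, x). mult c x) u \<in> Idx - {(0, 0)}" unfolding u using mult(1) by simp
  qed
  then have "card ({1..<p} \<times> S) \<le> card (Idx - {(0, 0)})"
    by (rule card_inj_on_le[OF inj]) simp
  also have "card (Idx - {(0, 0)}) = p ^ (2 * m) - 1" using zero_Idx(1) by (simp add: card_Idx)
  finally show ?thesis by (simp add: card_cartesian_product mult.commute)
qed

text \<open>The sumset theorem concerns subgroups of a field. The exponent vectors are placed there
  as polynomials of degree below \<open>2 * m\<close> in \<open>\<alpha> 0\<close> over the prime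
  field.\<close>

definition embed :: "nat \<times> nat \<Rightarrow> 'f" where
  "embed x = (\<Sum>j<2 * m. of_nat (coord x j) * \<alpha> 0 ^ j)"

text \<open>Distinct powers of \<open>\<alpha> 0\<close> have distinct degrees while integers have
  degree zero, so the top nonzero coefficient cannot cancel.\<close>

lemma alpha_powers_independent:
  assumes "(\<Sum>j<n. of_nat (e j) * \<alpha> 0 ^ j) = 0" "j < n"
  shows "of_nat (e j) = (0 :: 'f)"
proof -
  have a: "0 < m" using m1 by simp
  have mono: "monom (int (x * p)) 0 < monom (int (y * p)) 0" if "x < y" for x y :: nat
    using monom_add_less[of 0 0 0 "int (x * p)" "int (y * p)"] that p0 by (simp add: monom_0)
  have low: "deg_less (monom (int (n * p)) 0) (\<Sum>j<n'. of_nat (e j) * \<alpha> 0 ^ j)" if "n' \<le> n" for n n'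
    using that
  proof (induction n')
    case (Suc n')
    have "deg_le (0 + monom (int (n' * p)) (2 * 0)) (of_nat (e n') * \<alpha> 0 ^ n')"
      by (intro deg_le_mult deg_le_of_nat deg_eq_imp_le deg_eq_alpha a)
    then have "deg_less (monom (int (n * p)) 0) (of_nat (e n') * \<alpha> 0 ^ n')"
      using mono[of n' n] Suc.prems by (intro deg_le_less) auto
    then show ?case using Suc by (simp add: deg_less_add)
  qed simp
  show ?thesis using assms
  proof (induction n)
    case (Suc n)
    have top: "of_nat (e n) = (0 :: 'f)"
    proof (rule ccontr)
      assume "of_nat (e n) \<noteq> (0 :: 'f)"
      then have "deg_eq (0 + monom (int (n * p)) (2 * 0)) (of_nat (e n) * \<alpha> 0 ^ n)"
        by (intro deg_eq_mult deg_eq_of_nat deg_eq_alpha a)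
      then have "deg_eq (monom (int (n * p)) 0) (of_nat (e n) * \<alpha> 0 ^ n + (\<Sum>j<n. of_nat (e j) * \<alpha> 0 ^ j))"
        using low[of n n] by (intro deg_eq_add_less) auto
      then show False using Suc.prems by (simp add: deg_eq_def add.commute)
    qed
    then show ?case using Suc by (cases "j = n") auto
  qed simp
qed

text \<open>If \<open>S\<close> were larger, the vector with \<open>-1\<close> in the
  \<open>x\<close>-coordinates and \<open>0\<close> in the \<open>y\<close>-coordinates would be a
  sum of fewer than \<open>p\<close> elements of \<open>S\<close>, that is, a word that
  hits.\<close>

lemma card_le_sumset:
  assumes char_p: "CHAR('f) = p"
  shows "card S \<le> (p ^ (2 * m) - 1) div (p - 1)"
proof (rule ccontr)
  assume neg: "\<not> ?thesis"
  have \<delta>: "\<delta> = 1" by (simp add: delta_char char_p)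
  have of_nat_mod: "of_nat (n mod p) = (of_nat n :: 'f)" for n
    using char_p by (simp add: of_nat_eq_iff_cong_CHAR cong_def)
  have of_nat_dvd: "p dvd n \<longleftrightarrow> of_nat n = (0 :: 'f)" for n
    using char_p by (simp add: of_nat_eq_0_iff_char_dvd)
  have sum_embed: "sum_list (map embed xs) = (\<Sum>j<2 * m. of_nat (\<Sum>x\<leftarrow>xs. coord x j) * \<alpha> 0 ^ j)" for xs
    by (induction xs) (simp_all add: embed_def sum.distrib distrib_right)
  \<comment> \<open>Equality in the field is brought back to coordinates modulo \<open>p\<close>;
    the number \<open>p - coord z j\<close> replaces \<open>- coord z j\<close> to stay within the
    naturals.\<close>
  have compare: "p dvd (\<Sum>x\<leftarrow>xs. coord x j) + (p - coord z j)" if e: "sum_list (map embed xs) = embed z" and j: "j < 2 * m" for xs z j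
  proof -
    have le: "coord z j \<le> p" for j using coord_less[of z j] by simp
    have "(\<Sum>j<2 * m. of_nat ((\<Sum>x\<leftarrow>xs. coord x j) + (p - coord z j)) * \<alpha> 0 ^ j)
      = sum_list (map embed xs) + (\<Sum>j<2 * m. of_nat (p - coord z j) * \<alpha> 0 ^ j)"
      by (simp add: sum_embed sum.distrib distrib_right)
    also have "\<dots> = (\<Sum>j<2 * m. of_nat (coord z j + (p - coord z j)) * \<alpha> 0 ^ j)"
      unfolding e by (simp add: embed_def sum.distrib distrib_right)
    also have "\<dots> = 0" using le of_nat_dvd[of p] by simp
    finally show ?thesis unfolding of_nat_dvd using j by (rule alpha_powers_independent)
  qed
  have inj: "inj_on embed Idx"
  proof (rule inj_onI)
    fix x y assume xy: "x \<in> Idx" "y \<in> Idx" "embed x = embed y"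
    have "coord x j = coord y j" if j: "j < 2 * m" for j
    proof -
      have "p dvd coord x j + (p - coord y j)" using compare[of "[x]" y j] xy j by simp
      then have "(coord x j + (p - coord y j)) mod p = 0" by simp
      then have "[coord x j + (p - coord y j) + coord y j = 0 + coord y j] (mod p)" by (intro cong_add) (auto simp: cong_def)
      then have "[coord x j = coord y j] (mod p)" using coord_less[of y j] by (simp add: cong_def)
      then show ?thesis using coord_less[of x j] coord_less[of y j] by (simp add: cong_def)
    qed
    then show "x = y" using coord_inj xy by blast
  qed
  let ?G = "embed ` Idx"
  \<comment> \<open>Adding \<open>0\<close> turns sums of exactly \<open>p - 1\<close> elements into
    sums of at most \<open>p - 1\<close> elements; the zeros are filtered out below.\<close>
  let ?T = "insert 0 (embed ` S)"
  have e0: "embed (0, 0) = 0" by (simp add: embed_def zero_Idx)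
  have G_add: "x + y \<in> ?G" if xy: "x \<in> ?G" "y \<in> ?G" for x y
  proof -
    obtain a where a: "x = embed a" "a \<in> Idx" using xy(1) by (rule imageE)
    obtain b where b: "y = embed b" "b \<in> Idx" using xy(2) by (rule imageE)
    obtain c where c: "c \<in> Idx" "\<And>j. j < 2 * m \<Longrightarrow> coord c j = (coord a j + coord b j) mod p"
      by (rule coord_exists[of "\<lambda>j. (coord a j + coord b j) mod p"]) (use p0 in auto)
    have e: "embed c = x + y"
      unfolding a(1) b(1) embed_def sum.distrib[symmetric] by (rule sum.cong) (simp_all add: c of_nat_mod distrib_right)
    show ?thesis unfolding e[symmetric] by (rule imageI[OF c(1)])
  qed
  \<comment> \<open>The target vector, with \<open>p - 1\<close> standing for \<open>-1\<close> in
    the \<open>x\<close>-coordinates.\<close>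
  obtain z where z: "z \<in> Idx" "\<And>j. j < 2 * m \<Longrightarrow> coord z j = (if j < m then p - 1 else 0)"
    by (rule coord_exists[of "\<lambda>j. if j < m then p - 1 else 0"]) (use p0 in auto)
  have "card (embed ` S) = card S" using inj S by (intro card_image) (auto intro: inj_on_subset)
  moreover have "finite (embed ` S)" using S finite_Idx finite_subset by blast
  ultimately have cT: "card ?T \<ge> card S" using card_insert_le[of "embed ` S" 0] by simp
  have "\<exists>ts. length ts = p - 1 \<and> set ts \<subseteq> ?T \<and> sum_list ts = embed z"
  proof (rule sumset_covers_group[OF prime char_p, of ?G "2 * m"])
    show "finite ?G" by simp
    show "card ?G = p ^ (2 * m)" using card_image[OF inj] card_Idx by simp
    show "0 \<in> ?G" using e0 zero_Idx(1) by (metis image_eqI)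
    show "?T \<subseteq> ?G" using S e0 zero_Idx(1) by (auto intro: image_eqI[of _ _ "(0, 0)"])
    show "card ?T > (p ^ (2 * m) - 1) div (p - 1)" using neg cT by linarith
  qed (use G_add z in auto)
  then obtain ts where ts: "length ts = p - 1" "set ts \<subseteq> ?T" "sum_list ts = embed z" by blast
  define us where "us = filter (\<lambda>u. u \<noteq> 0) ts"
  have us: "set us \<subseteq> embed ` S" "sum_list us = embed z" "length us \<le> p - 1"
  proof -
    show "set us \<subseteq> embed ` S" using ts(2) by (auto simp: us_def)
    show "sum_list us = embed z" using ts(3) sum_list_map_filter[of ts "\<lambda>u. u \<noteq> 0" "\<lambda>u. u"] by (simp add: us_def)
    show "length us \<le> p - 1" using ts(1) length_filter_le[of "\<lambda>u. u \<noteq> 0" ts] by (simp add: us_def)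
  qed
  have "\<exists>xs. set xs \<subseteq> S \<and> map embed xs = us" using us(1)
  proof (induction us)
    case (Cons u us)
    then obtain xs x where "set xs \<subseteq> S" "map embed xs = us" "x \<in> S" "u = embed x" by auto
    then show ?case by (intro exI[of _ "x # xs"]) auto
  qed simp
  then obtain xs where xs: "set xs \<subseteq> S" "map embed xs = us" by blast
  have len: "length xs < p" using us(3) p0 arg_cong[OF xs(2), of length] by simp
  have dv: "p dvd (\<Sum>x\<leftarrow>xs. coord x j) + (p - coord z j)" if "j < 2 * m" for j
    by (rule compare[OF _ that]) (simp add: xs us)
  \<comment> \<open>The empty sum misses the target, since its coordinate \<open>0\<close> is
    \<open>-1\<close>; this uses \<open>m \<ge> 1\<close>.\<close>
  have "xs \<noteq> []"
  proof
    assume "xs = []"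
    then have "p dvd 1" using dv[of 0] z(2)[of 0] m1 p0 by simp
    then show False using p by simp
  qed
  have "hits xs" unfolding hits_coord
  proof (intro allI impI)
    fix j assume j: "j < 2 * m"
    show "p dvd (\<Sum>x\<leftarrow>xs. coord x j) + (if j < m then \<delta> else 0)"
    proof (cases "j < m")
      case True
      then show ?thesis using dv[OF j] z(2)[OF j] p0 \<delta> by simp
    next
      case False
      then have "p dvd (\<Sum>x\<leftarrow>xs. coord x j) + p" using dv[OF j] z(2)[OF j] by simp
      then show ?thesis using False dvd_add_left_iff[of p p] by simp
    qed
  qed
  moreover have "map (\<lambda>s. xs ! s) [0..<length xs] = xs" by (rule map_nth)
  ultimately have h: "hits (map (\<lambda>s. xs ! s) [0..<length xs])" by simp
  then show False
    by (intro no_hit[OF _ _ _ h] disjI1 char_p) (use len \<open>xs \<noteq> []\<close> in \<open>simp_all add: subsetD[OF xs(1)]\<close>)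
qed

lemma card_leads_le: "card S \<le> (p ^ (2 * m) - 1) div (p - 1)"
proof (cases "CHAR('f) = p")
  case False
  then have "card S * (p - 1) \<le> p ^ (2 * m) - 1" by (intro card_le_lines) (simp add: delta_char)
  then show ?thesis using p by (simp add: less_eq_div_iff_mult_less_eq)
qed (rule card_le_sumset)

end

end

section \<open>The dimension bound\<close>

text \<open>Functionals that separate the points of \<open>V\<close> embed it into a space of
  dimension \<open>card S\<close>. Finite dimension is part of the conclusion, so a spanning set is
  built by passing to the kernel of one functional at a time.\<close>

lemma dim_le_card_functionals:
  fixes V :: "('f::field, 'a, 'x) module_scheme" and L :: "'s \<Rightarrow> 'a \<Rightarrow> 'f"
  assumes vs: "vectorspace class_ring V" and S: "finite S"
    and add: "\<And>s u v. s \<in> S \<Longrightarrow> u \<in> carrier V \<Longrightarrow> v \<in> carrier V \<Longrightarrow> L s (u \<oplus>\<^bsub>V\<^esub> v) = L s u + L s v"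
    and smult: "\<And>s c v. s \<in> S \<Longrightarrow> v \<in> carrier V \<Longrightarrow> L s (c \<odot>\<^bsub>V\<^esub> v) = c * L s v"
    and inj: "\<And>v. v \<in> carrier V \<Longrightarrow> (\<And>s. s \<in> S \<Longrightarrow> L s v = 0) \<Longrightarrow> v = \<zero>\<^bsub>V\<^esub>"
  shows "vectorspace.fin_dim class_ring V \<and> vectorspace.dim class_ring V \<le> card S"
proof -
  interpret V: vectorspace class_ring V by (rule vs)
  have c: "c \<in> carrier (class_ring :: 'f ring)" for c by (simp add: class_ring_simps)
  have "\<exists>G\<subseteq>U. finite G \<and> card G \<le> card T \<and> U \<subseteq> V.span G"
    if "finite T" "T \<subseteq> S" and "U \<subseteq> carrier V" "\<And>u v. u \<in> U \<Longrightarrow> v \<in> U \<Longrightarrow> u \<oplus>\<^bsub>V\<^esub> v \<in> U"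
      "\<And>c v. v \<in> U \<Longrightarrow> c \<odot>\<^bsub>V\<^esub> v \<in> U" "\<And>v. v \<in> U \<Longrightarrow> (\<And>s. s \<in> T \<Longrightarrow> L s v = 0) \<Longrightarrow> v = \<zero>\<^bsub>V\<^esub>" for T U
    using that
  proof (induction T arbitrary: U)
    case (empty U)
    then have "U \<subseteq> {\<zero>\<^bsub>V\<^esub>}" by blast
    then have "U \<subseteq> V.span {}" by (simp add: V.span_empty)
    then show ?case by (intro exI[of _ "{}"] conjI) simp_all
  next
    case (insert s T U)
    define U0 where "U0 = {v \<in> U. L s v = 0}"
    have sS: "s \<in> S" using insert.prems(1) by simp
    have "\<exists>G\<subseteq>U0. finite G \<and> card G \<le> card T \<and> U0 \<subseteq> V.span G"
    proof (rule insert.IH)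
      show "T \<subseteq> S" "U0 \<subseteq> carrier V" using insert.prems(1,2) by (auto simp: U0_def)
      show "u \<oplus>\<^bsub>V\<^esub> v \<in> U0" if "u \<in> U0" "v \<in> U0" for u v
      proof -
        have "u \<in> U" "v \<in> U" "L s u = 0" "L s v = 0" using that by (simp_all add: U0_def)
        moreover from this have "L s (u \<oplus>\<^bsub>V\<^esub> v) = L s u + L s v" using insert.prems(2) by (intro add sS) blast+
        ultimately show ?thesis using insert.prems(3) by (simp add: U0_def)
      qed
      show "c \<odot>\<^bsub>V\<^esub> v \<in> U0" if "v \<in> U0" for c v
      proof -
        have "v \<in> U" "L s v = 0" using that by (simp_all add: U0_def)
        moreover from this have "L s (c \<odot>\<^bsub>V\<^esub> v) = c * L s v" using insert.prems(2) by (intro smult sS) blast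
        ultimately show ?thesis using insert.prems(4) by (simp add: U0_def)
      qed
      show "v = \<zero>\<^bsub>V\<^esub>" if "v \<in> U0" "\<And>t. t \<in> T \<Longrightarrow> L t v = 0" for v
      proof (rule insert.prems(5))
        show "v \<in> U" using that(1) by (simp add: U0_def)
        show "L t v = 0" if "t \<in> insert s T" for t
          using that \<open>v \<in> U0\<close> \<open>\<And>t. t \<in> T \<Longrightarrow> L t v = 0\<close> by (auto simp: U0_def)
      qed
    qed
    then obtain G where G: "G \<subseteq> U0" "finite G" "card G \<le> card T" "U0 \<subseteq> V.span G" by blast
    have U0U: "U0 \<subseteq> U" by (auto simp: U0_def)
    show ?case
    proof (cases "U0 = U")
      case True
      have "card G \<le> card (insert s T)" using G(3) insert.hyps by simp
      then show ?thesis using G unfolding True by blast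
    next
      case False
      \<comment> \<open>One vector outside the kernel of \<open>L s\<close> completes a spanning set
        of the kernel: subtracting \<open>L s v / L s u\<close> times \<open>u\<close> moves any
        \<open>v\<close> into it.\<close>
      then obtain u where u: "u \<in> U" "L s u \<noteq> 0" using U0U by (auto simp: U0_def)
      have GC: "insert u G \<subseteq> carrier V" using u(1) G(1) U0U insert.prems(2) by blast
      note sub = V.span_is_submodule[OF GC]
      have "v \<in> V.span (insert u G)" if v: "v \<in> U" for v
      proof -
        let ?a = "L s v / L s u"
        have uv: "u \<in> carrier V" "v \<in> carrier V" using u(1) v insert.prems(2) by blast+
        have "v \<oplus>\<^bsub>V\<^esub> (- ?a) \<odot>\<^bsub>V\<^esub> u \<in> U" by (intro insert.prems(3,4) u v)
        moreover have "L s (v \<oplus>\<^bsub>V\<^esub> (- ?a) \<odot>\<^bsub>V\<^esub> u) = L s v + (- ?a) * L s u"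
          using add[OF sS uv(2) V.smult_closed[OF c uv(1)]] smult[OF sS uv(1)] by simp
        ultimately have "v \<oplus>\<^bsub>V\<^esub> (- ?a) \<odot>\<^bsub>V\<^esub> u \<in> U0" using u(2) by (simp add: U0_def)
        then have "v \<oplus>\<^bsub>V\<^esub> (- ?a) \<odot>\<^bsub>V\<^esub> u \<in> V.span (insert u G)"
          using G(4) V.span_is_monotone[of G "insert u G"] by blast
        moreover have "?a \<odot>\<^bsub>V\<^esub> u \<in> V.span (insert u G)"
          using submodule.smult_closed[OF sub c] V.in_own_span[OF GC] by blast
        ultimately have "v \<oplus>\<^bsub>V\<^esub> (- ?a) \<odot>\<^bsub>V\<^esub> u \<oplus>\<^bsub>V\<^esub> ?a \<odot>\<^bsub>V\<^esub> u \<in> V.span (insert u G)"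
          by (rule submodule.m_closed[OF sub])
        also have "v \<oplus>\<^bsub>V\<^esub> (- ?a) \<odot>\<^bsub>V\<^esub> u \<oplus>\<^bsub>V\<^esub> ?a \<odot>\<^bsub>V\<^esub> u = v \<oplus>\<^bsub>V\<^esub> ((- ?a) \<odot>\<^bsub>V\<^esub> u \<oplus>\<^bsub>V\<^esub> ?a \<odot>\<^bsub>V\<^esub> u)"
          by (rule V.a_assoc) (intro uv V.smult_closed c)+
        also have "(- ?a) \<odot>\<^bsub>V\<^esub> u \<oplus>\<^bsub>V\<^esub> ?a \<odot>\<^bsub>V\<^esub> u = (- ?a + ?a) \<odot>\<^bsub>V\<^esub> u"
          using V.smult_l_distr[OF c c uv(1), of "- ?a" ?a] by (simp only: class_ring_simps)
        also have "\<dots> = \<zero>\<^bsub>V\<^esub>"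
          using V.smult_l_null[OF uv(1)] by (simp only: class_ring_simps left_minus)
        also have "v \<oplus>\<^bsub>V\<^esub> \<zero>\<^bsub>V\<^esub> = v" by (rule V.r_zero[OF uv(2)])
        finally show ?thesis .
      qed
      then have "U \<subseteq> V.span (insert u G)" by (intro subsetI)
      moreover have "card (insert u G) \<le> card (insert s T)"
        using G(2,3) insert.hyps by (simp add: card_insert_if)
      moreover have "insert u G \<subseteq> U" using u(1) G(1) U0U by blast
      ultimately show ?thesis using G(2) by (meson finite.insertI)
    qed
  qed
  from this[OF S order_refl order_refl V.a_closed V.smult_closed[OF c] inj]
  obtain G where G: "G \<subseteq> carrier V" "finite G" "card G \<le> card S" "carrier V \<subseteq> V.span G" by blast
  have gen: "V.span G = carrier V" using G(4) V.span_is_submodule[OF G(1)] by (intro equalityI submodule.subset)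
  have "V.fin_dim" unfolding V.fin_dim_def using G(1,2) gen by blast
  moreover have "V.dim \<le> card S" using V.gen_ge_dim[OF G(2,1) gen] G(3) by simp
  ultimately show ?thesis ..
qed

context valued_symbol_model
begin

text \<open>The coordinates at the leading monomials of \<open>V\<close> separate its elements,
  because a nonzero element has a nonzero coordinate at its own leading monomial. So the dimension
  is at most the number of leading monomials.\<close>

theorem dimension_bound:
  assumes m: "m \<ge> 1" and V: "VectorSpace.subspace class_ring V TA"
    and zero: "\<And>v i. v \<in> V \<Longrightarrow> 1 \<le> i \<Longrightarrow> i < p \<Longrightarrow> char_coeff d TA i v = 0"
  shows "vectorspace.fin_dim class_ring (TA\<lparr>carrier := V\<rparr>) \<and>
    vectorspace.dim class_ring (TA\<lparr>carrier := V\<rparr>) \<le> (p ^ (2 * m) - 1) div (p - 1)"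
proof -
  have sub: "submodule class_ring V TA" using V by (simp add: subspace_def)
  note closed = submodule.subset[OF sub] submodule.m_closed[OF sub] submodule.zero_closed[OF sub] submodule.smult_closed[OF sub]
  define W where "W = {C. from_coords C \<in> V}"
  define S where "S = {x. \<exists>C g. C \<in> W \<and> is_lead C x g}"
  have W_add: "(\<lambda>x. C x + C' x) \<in> W" if "C \<in> W" "C' \<in> W" for C C'
    using closed(2) that unfolding W_def mem_Collect_eq from_coords_add .
  have W_zero: "(\<lambda>_. 0) \<in> W" using closed(3) unfolding W_def mem_Collect_eq from_coords_zero .
  have traces: "mat_trace (comb_mat (\<lambda>x. to_ac (C x)) ^\<^sub>m k) = 0" if C: "C \<in> W" and k: "0 < k" "k < p" for C k
  proof (rule power_trace_zero)
    show "char_coeff d TA i (from_coords C) = 0" if "1 \<le> i" "i < p" for i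
      using zero that C by (simp add: W_def)
    show "mat_trace (comb_mat (\<lambda>x. to_ac (C x)) ^\<^sub>m k) \<in> range to_ac" for k
      unfolding comb_mat_power_trace tr(1)[symmetric] to_ac_prod[symmetric] to_ac_mult[symmetric] to_ac_sum[symmetric]
      by (rule rangeI)
    show "m \<ge> 1" "1 \<le> k" "k < p" using m k by simp_all
  qed (rule small)
  have "\<forall>x\<in>S. \<exists>cg. fst cg \<in> W \<and> is_lead (fst cg) x (snd cg)" by (auto simp: S_def)
  from bchoice[OF this] obtain cg where cg: "\<And>x. x \<in> S \<Longrightarrow> fst (cg x) \<in> W" "\<And>x. x \<in> S \<Longrightarrow> is_lead (fst (cg x)) x (snd (cg x))"
    by blast
  have SI: "S \<subseteq> Idx" by (auto simp: S_def is_lead_def)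
  have card: "card S \<le> (p ^ (2 * m) - 1) div (p - 1)"
  proof (rule card_leads_le[OF SI _ m])
    fix l k
    assume l: "\<And>s. s < k \<Longrightarrow> l s \<in> S" and k: "0 < k" "k < p" and h: "hits (map l [0..<k])"
      and comm: "CHAR('f) = p \<or> (\<exists>a b. l = (\<lambda>s. if s = 0 then b else a))"
    show False
      by (rule leads_no_hit[where W = W and Cs = "\<lambda>s. fst (cg (l s))" and g = "\<lambda>s. snd (cg (l s))", OF W_add W_zero traces _ _ _ _ h comm])
        (rule k cg l | assumption)+
  qed
  \<comment> \<open>A choice of coordinates, determined on \<open>Idx\<close> by injectivity.
    Linearity can thus be asserted at the points of \<open>S\<close>, which lie in
    \<open>Idx\<close>.\<close>
  define coords where "coords v = (SOME C. v = from_coords C)" for v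
  have coords: "from_coords (coords v) = v" if "v \<in> carrier TA" for v
    unfolding coords_def using someI_ex[OF from_coords_surj[OF that]] by (rule sym)
  have vs: "vectorspace class_ring (TA\<lparr>carrier := V\<rparr>)"
    by (rule vectorspace.subspace_is_vs[OF TA.vectorspace_class_ring V])
  have "vectorspace.fin_dim class_ring (TA\<lparr>carrier := V\<rparr>) \<and> vectorspace.dim class_ring (TA\<lparr>carrier := V\<rparr>) \<le> card S"
  proof (rule dim_le_card_functionals[OF vs, where L = "\<lambda>s v. coords v s"])
    show "finite S" using SI finite_Idx by (rule finite_subset)
    show "coords (u \<oplus>\<^bsub>TA\<lparr>carrier := V\<rparr>\<^esub> v) s = coords u s + coords v s"
      if s: "s \<in> S" and "u \<in> carrier (TA\<lparr>carrier := V\<rparr>)" "v \<in> carrier (TA\<lparr>carrier := V\<rparr>)" for s u v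
    proof -
      have uv: "u \<in> carrier TA" "v \<in> carrier TA" "u \<oplus>\<^bsub>TA\<^esub> v \<in> carrier TA" using that closed(1,2) by auto
      have "from_coords (coords (u \<oplus>\<^bsub>TA\<^esub> v)) = from_coords (\<lambda>x. coords u x + coords v x)"
        unfolding from_coords_add by (simp only: coords uv)
      from from_coords_inj[OF this subsetD[OF SI s]] show ?thesis by simp
    qed
    show "coords (c \<odot>\<^bsub>TA\<lparr>carrier := V\<rparr>\<^esub> v) s = c * coords v s"
      if s: "s \<in> S" and "v \<in> carrier (TA\<lparr>carrier := V\<rparr>)" for s c v
    proof -
      have v: "v \<in> carrier TA" using that closed(1) by auto
      then have cv: "c \<odot>\<^bsub>TA\<^esub> v \<in> carrier TA" by (rule TA.smult_closed)
      have "from_coords (coords (c \<odot>\<^bsub>TA\<^esub> v)) = from_coords (\<lambda>x. c * coords v x)"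
        unfolding from_coords_smult by (simp only: coords v cv)
      from from_coords_inj[OF this subsetD[OF SI s]] show ?thesis by simp
    qed
    show "v = \<zero>\<^bsub>TA\<lparr>carrier := V\<rparr>\<^esub>"
      if "v \<in> carrier (TA\<lparr>carrier := V\<rparr>)" and z: "\<And>s. s \<in> S \<Longrightarrow> coords v s = 0" for v
    proof -
      have vV: "v \<in> V" using that(1) by simp
      then have v: "v \<in> carrier TA" using closed(1) by (rule subsetD[rotated])
      have cW: "coords v \<in> W" unfolding W_def mem_Collect_eq coords[OF v] by (rule vV)
      have null: "coords v x = 0" if x: "x \<in> Idx" for x
      proof (rule ccontr)
        assume "coords v x \<noteq> 0"
        with x obtain y g where y: "is_lead (coords v) y g" "coords v y \<noteq> 0" by (rule lead_exists)
        then have "y \<in> S" using cW unfolding S_def by blast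
        from z[OF this] y(2) show False by simp
      qed
      have "v = from_coords (coords v)" by (simp only: coords v)
      also have "\<dots> = from_coords (\<lambda>_. 0)"
        unfolding from_coords_def by (rule TA.finsum_cong') (simp_all add: null)
      also have "\<dots> = \<zero>\<^bsub>TA\<^esub>" by (rule from_coords_zero)
      finally show ?thesis by simp
    qed
  qed
  then show ?thesis using card by linarith
qed

end

text \<open>The eigenvalues are \<open>\<rho>^j\<close> times a fixed \<open>p\<close>-th root of
  \<open>\<alpha> i\<close>, distinct because \<open>\<rho>\<close> is primitive.\<close>

lemma kummer_symbol_model:
  fixes \<rho> :: "'f::field"
  assumes p: "p \<ge> 2" and \<rho>: "primitive_root_of_unity p \<rho>"
    and nz: "\<And>i. i < m \<Longrightarrow> \<alpha> i \<noteq> 0" "\<And>i. i < m \<Longrightarrow> \<beta> i \<noteq> 0"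
  obtains \<xi> \<eta> where "symbol_model p m 0 \<rho> \<alpha> \<beta> \<xi> \<eta>"
proof -
  have root: "\<exists>y. y ^ p = x" for x :: "'f alg_closure" using nth_root_exists[of p x] p by simp
  from choice[OF allI, of "\<lambda>i y. y ^ p = to_ac (\<alpha> i)"] root
  obtain a where a: "\<And>i. a i ^ p = to_ac (\<alpha> i)" by blast
  from choice[OF allI, of "\<lambda>i y. y ^ p = to_ac (\<beta> i)"] root
  obtain \<eta> where \<eta>: "\<And>i. \<eta> i ^ p = to_ac (\<beta> i)" by blast
  have rp: "\<rho> ^ p = 1" using \<rho> by (simp add: primitive_root_of_unity_def)
  have r0: "\<rho> \<noteq> 0"
  proof
    assume "\<rho> = 0"
    then show False using rp p by (simp add: power_0_left split: if_splits)
  qed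
  have less: "\<rho> ^ j \<noteq> \<rho> ^ k" if "j < k" "k < p" for j k
  proof
    assume "\<rho> ^ j = \<rho> ^ k"
    also have "k = j + (k - j)" using that by simp
    finally have "\<rho> ^ (k - j) = 1" using r0 by (simp add: power_add)
    moreover have "k - j \<in> {1..<p}" unfolding atLeastLessThan_iff using that by linarith
    ultimately show False using \<rho> unfolding primitive_root_of_unity_def by blast
  qed
  let ?\<xi> = "\<lambda>i j. to_ac (\<rho> ^ j) * a i"
  have "symbol_model p m 0 \<rho> \<alpha> \<beta> ?\<xi> \<eta>"
  proof
    show "p \<ge> 2" by (rule p)
    fix i assume i: "i < m"
    have a0: "a i \<noteq> 0"
    proof
      assume "a i = 0"
      then show False using a[of i] p nz(1)[OF i] by (simp add: power_0_left)
    qed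
    show "?\<xi> i (j + p) = ?\<xi> i j" for j by (simp add: power_add rp del: to_ac_power)
    show "?\<xi> i j ^ p = to_ac 0 * ?\<xi> i j + to_ac (\<alpha> i)" for j
    proof -
      have "(\<rho> ^ j) ^ p = 1" by (metis mult.commute power_mult power_one rp)
      then show ?thesis by (simp add: power_mult_distrib a flip: to_ac_power)
    qed
    show "?\<xi> i (Suc j) = to_ac \<rho> * ?\<xi> i j + to_ac 0" for j by simp
    show "inj_on (?\<xi> i) {..<p}"
    proof (rule linorder_inj_onI')
      fix j k assume "j \<in> {..<p}" "k \<in> {..<p}" "j < k"
      then have "\<rho> ^ j \<noteq> \<rho> ^ k" using less by simp
      then show "?\<xi> i j \<noteq> ?\<xi> i k" using a0 by (simp del: to_ac_power)
    qed
    show "\<eta> i ^ p = to_ac (\<beta> i)" by (rule \<eta>)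
    show "\<eta> i \<noteq> 0"
    proof
      assume "\<eta> i = 0"
      then show False using \<eta>[of i] p nz(2)[OF i] by (simp add: power_0_left)
    qed
  qed
  then show thesis by (rule that)
qed

text \<open>The eigenvalues are \<open>t + j\<close> with \<open>t^p = t + \<alpha>\<close>. The
  Frobenius map and Fermat's theorem show that translating by an integer preserves this
  equation.\<close>

lemma artin_schreier_symbol_model:
  fixes \<alpha> \<beta> :: "nat \<Rightarrow> 'f::field"
  assumes p: "Factorial_Ring.prime p" "CHAR('f) = p" and nz: "\<And>i. i < m \<Longrightarrow> \<beta> i \<noteq> 0"
  obtains \<xi> \<eta> where "symbol_model p m 1 1 \<alpha> \<beta> \<xi> \<eta>"
proof -
  have p2: "p \<ge> 2" using p(1) by (rule prime_ge_2_nat)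
  have root: "\<exists>y. y ^ p = x" for x :: "'f alg_closure" using nth_root_exists[of p x] p2 by simp
  from choice[OF allI, of "\<lambda>i y. y ^ p = to_ac (\<beta> i)"] root
  obtain \<eta> where \<eta>: "\<And>i. \<eta> i ^ p = to_ac (\<beta> i)" by blast
  have "\<exists>y. y ^ p = y + x" for x :: "'f alg_closure"
  proof -
    \<comment> \<open>The Artin-Schreier polynomial \<open>X^p - X - x\<close>, whose root is the
      required \<open>y\<close>.\<close>
    let ?q = "monom 1 p + [:- x, - 1:] :: 'f alg_closure poly"
    have "degree ?q = p" using p2 by (subst degree_add_eq_left) (auto simp: degree_monom_eq)
    then obtain y where "poly ?q y = 0" using alg_closed_imp_poly_has_root[of ?q] p2 by auto
    then show ?thesis by (intro exI[of _ y]) (simp add: poly_monom algebra_simps)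
  qed
  from choice[OF allI, of "\<lambda>i y. y ^ p = y + to_ac (\<alpha> i)"] this
  obtain t where t: "\<And>i. t i ^ p = t i + to_ac (\<alpha> i)" by blast
  have ch: "CHAR('f alg_closure) = p" using p(2) by simp
  have pz: "of_nat p = (0 :: 'f alg_closure)" using of_nat_CHAR[where 'a = "'f alg_closure"] unfolding ch .
  have dream: "(x + y) ^ p = x ^ p + y ^ p" for x y :: "'f alg_closure"
    by (rule freshmans_dream) (simp_all add: p)
  have fermat: "of_nat j ^ p = (of_nat j :: 'f alg_closure)" for j
    by (induction j) (use p2 dream in \<open>simp_all add: power_0_left\<close>)
  let ?\<xi> = "\<lambda>i j. t i + of_nat j"
  have "symbol_model p m 1 1 \<alpha> \<beta> ?\<xi> \<eta>"
  proof
    show "p \<ge> 2" by (rule p2)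
    fix i assume i: "i < m"
    show "?\<xi> i (j + p) = ?\<xi> i j" for j by (simp add: pz)
    show "?\<xi> i j ^ p = to_ac 1 * ?\<xi> i j + to_ac (\<alpha> i)" for j by (simp add: dream fermat t)
    show "?\<xi> i (Suc j) = to_ac 1 * ?\<xi> i j + to_ac 1" for j by simp
    show "inj_on (?\<xi> i) {..<p}"
    proof (rule linorder_inj_onI')
      fix j k assume jk: "j \<in> {..<p}" "k \<in> {..<p}" "j < k"
      have "of_nat k = of_nat j + (of_nat (k - j) :: 'f alg_closure)" using jk(3) by (simp flip: of_nat_add)
      moreover have "of_nat (k - j) \<noteq> (0 :: 'f alg_closure)"
        using jk unfolding of_nat_eq_0_iff_char_dvd ch by (auto dest: dvd_imp_le)
      ultimately show "?\<xi> i j \<noteq> ?\<xi> i k" by simp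
    qed
    show "\<eta> i ^ p = to_ac (\<beta> i)" by (rule \<eta>)
    show "\<eta> i \<noteq> 0"
    proof
      assume "\<eta> i = 0"
      then show False using \<eta>[of i] p2 nz[OF i] by (simp add: power_0_left)
    qed
  qed
  then show thesis by (rule that)
qed

theorem corollary5p3:
  fixes p m :: nat
    and F0 :: "'f::field set"
    and \<rho> :: 'f
    and \<alpha> \<beta> :: "nat \<Rightarrow> 'f"
    and V :: "((nat \<Rightarrow> (symbol_gen list \<Rightarrow>\<^sub>0 'f) set) \<Rightarrow>\<^sub>0 'f) set set"
  assumes "Factorial_Ring.prime p"
    and "m \<ge> 1"
    and "subfield F0 (class_ring :: 'f ring)"
    and "CHAR('f) = 0 \<or> CHAR('f) \<ge> p"
    and "CHAR('f) \<noteq> p \<Longrightarrow> \<rho> \<in> F0 \<and> primitive_root_of_unity p \<rho>"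
    and "rational_function_field F0 m \<alpha> \<beta> \<or> iterated_laurent_field F0 m \<alpha> \<beta>"
    and "VectorSpace.subspace class_ring V (symbol_tensor p \<rho> m \<alpha> \<beta>)"
    and "\<And>v i. v \<in> V \<Longrightarrow> i \<in> {1..p - 1} \<Longrightarrow> char_coeff (p ^ m) (symbol_tensor p \<rho> m \<alpha> \<beta>) i v = 0"
  shows "vectorspace.fin_dim class_ring ((symbol_tensor p \<rho> m \<alpha> \<beta>)\<lparr>carrier := V\<rparr>) \<and>
         vectorspace.dim class_ring ((symbol_tensor p \<rho> m \<alpha> \<beta>)\<lparr>carrier := V\<rparr>)
           \<le> (p ^ (2 * m) - 1) div (p - 1)"
proof -
  have p2: "p \<ge> 2" using assms(1) by (rule prime_ge_2_nat)
  obtain w where w: "degree_valuation (UNIV :: 'f set) w" "\<And>x. x \<in> F0 \<Longrightarrow> x \<noteq> 0 \<Longrightarrow> w x = 0"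
    "\<And>i. i < m \<Longrightarrow> \<alpha> i \<noteq> 0 \<and> \<beta> i \<noteq> 0 \<and> w (\<alpha> i) = monom 1 (2 * i) \<and> w (\<beta> i) = monom 1 (2 * i + 1)"
  proof (cases "rational_function_field F0 m \<alpha> \<beta>")
    case True
    then show ?thesis using that by (rule rational_function_valuation[OF assms(3)]) assumption+
  next
    case False
    then have "iterated_laurent_field F0 m \<alpha> \<beta>" using assms(6) by blast
    then show ?thesis using that by (rule iterated_laurent_valuation[OF assms(3)]) assumption+
  qed
  note F0 = subfield_class_ring_closed[OF assms(3)]
  have nat: "of_nat n \<in> F0" for n by (induction n) (simp_all add: F0)
  \<comment> \<open>A positive characteristic dividing \<open>k\<close> would be at most
    \<open>k < p\<close>, against the hypothesis that it is \<open>0\<close> or at least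
    \<open>p\<close>.\<close>
  have small: "of_nat k \<noteq> (0 :: 'f)" if "1 \<le> k" "k < p" for k
    using that assms(4) unfolding of_nat_eq_0_iff_char_dvd by (auto dest: dvd_imp_le)
  \<comment> \<open>The common end of both cases. The parameter \<open>\<rho>'\<close> is
    \<open>1\<close> in characteristic \<open>p\<close> and \<open>\<rho>\<close> otherwise; lying
    in \<open>F0\<close>, it has degree zero.\<close>
  have bound: ?thesis
    if M: "symbol_model p m \<epsilon> \<rho>' \<alpha> \<beta> \<xi> \<eta>" and r: "\<rho>' \<in> F0" "\<rho>' \<noteq> 0"
      and kinds: "CHAR('f) = p \<and> \<epsilon> = 1 \<and> \<rho>' = 1 \<or> of_nat p \<noteq> (0 :: 'f) \<and> \<epsilon> = 0 \<and> primitive_root_of_unity p \<rho>'"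
      and eq: "symbol_tensor p \<rho> m \<alpha> \<beta> = symbol_model.TA p m \<epsilon> \<rho>' \<alpha> \<beta>" for \<epsilon> \<rho>' \<xi> \<eta>
  proof -
    have "valued_symbol_model p m \<epsilon> \<rho>' \<alpha> \<beta> \<xi> \<eta> w"
    proof (rule valued_symbol_model.intro[OF M], rule valued_symbol_model_axioms.intro)
      show "w (x * y) = w x + w y" if "x \<noteq> 0" "y \<noteq> 0" for x y
        using w(1) that by (simp add: degree_valuation_def)
      show "w (x + y) \<le> max (w x) (w y)" if "x \<noteq> 0" "y \<noteq> 0" "x + y \<noteq> 0" for x y
        using w(1) that by (simp add: degree_valuation_def)
    qed (use assms(1) w(2,3) nat r small kinds in simp_all)
    then interpret M: valued_symbol_model p m \<epsilon> \<rho>' \<alpha> \<beta> \<xi> \<eta> w .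
    show ?thesis unfolding eq
    proof (rule M.dimension_bound[OF assms(2)])
      show "VectorSpace.subspace class_ring V M.TA" using assms(7) unfolding eq .
      show "char_coeff (p ^ m) M.TA i v = 0" if "v \<in> V" "1 \<le> i" "i < p" for v i
        using assms(8)[OF that(1), of i] that(2,3) unfolding eq by simp
    qed
  qed
  show ?thesis
  proof (cases "CHAR('f) = p")
    case True
    obtain \<xi> \<eta> where M: "symbol_model p m 1 1 \<alpha> \<beta> \<xi> \<eta>"
      by (rule artin_schreier_symbol_model[where m = m and \<alpha> = \<alpha> and \<beta> = \<beta>, OF assms(1) True]) (use w(3) in auto)
    then interpret M: symbol_model p m 1 1 \<alpha> \<beta> \<xi> \<eta> .
    show ?thesis
      by (rule bound[OF M]) (simp_all add: F0 True M.TA_def symbol_tensor_def symbol_algebra_presentation M.factor_def[abs_def])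
  next
    case False
    then have \<rho>: "\<rho> \<in> F0" "primitive_root_of_unity p \<rho>" using assms(5) by blast+
    have "\<rho> \<noteq> 0"
    proof
      assume "\<rho> = 0"
      then show False using \<rho>(2) p2 by (simp add: primitive_root_of_unity_def power_0_left)
    qed
    \<comment> \<open>Outside characteristic \<open>p\<close> the characteristic is \<open>0\<close>
      or larger than \<open>p\<close>, so \<open>p\<close> is invertible.\<close>
    moreover have "of_nat p \<noteq> (0 :: 'f)"
      unfolding of_nat_eq_0_iff_char_dvd using assms(4) False p2 by (auto dest: dvd_imp_le)
    moreover obtain \<xi> \<eta> where M: "symbol_model p m 0 \<rho> \<alpha> \<beta> \<xi> \<eta>"
      by (rule kummer_symbol_model[where m = m and \<alpha> = \<alpha> and \<beta> = \<beta>, OF p2 \<rho>(2)]) (use w(3) in auto)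
    then interpret M: symbol_model p m 0 \<rho> \<alpha> \<beta> \<xi> \<eta> .
    show ?thesis
      by (rule bound[OF M \<rho>(1)])
        (simp_all add: calculation \<rho>(2) False M.TA_def symbol_tensor_def symbol_algebra_presentation M.factor_def[abs_def])
  qed
qed

end
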